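(* Let $p\in[1,\infty)$, let $(\rho_k)_{k\in\mathbb N}$, $(w_k)_{k\in\mathbb N}$, $w$ and $\mu$ be as in the standing assumptions of the context, assume $w>0$ on $\mathbb R^{2N}$, and let $R>0$. Assume that $(\rho_k)_{k\in\mathbb N}$ is a strongly $p$-compact family. Then the following hold. (i) If $(u_k)_{k\in\mathbb N}\subset L^p_R(\mathbb R^N)$ is such that $\sup_{k\in\mathbb N}\big(\|u_k\|_{L^p}+\mathscr F^{w_k}_{k,p}(u_k)\big)<\infty$, then $(u_k)_{k\in\mathbb N}$ is compact in $L^p(\mathbb R^N)$ and any of its (subsequential) $L^p(\mathbb R^N)$ limits is in $\mathcal S^p(\mathbb R^N)$. (ii) If $(u_k)_{k\in\mathbb N}\subset L^p_R(\mathbb R^N)$ is such that $u_k\to u$ in $L^p(\mathbb R^N)$ as $k\to\infty$ for some $u\in L^p(\mathbb R^N)$, then $\liminf_{k\to\infty}\mathscr F^{w_k}_{k,p}(u_k)\ge\mathscr D^\mu_{p,w}(u)$, where $\mathscr D^\mu_{p,w}(u)=+\infty$ if $u\notin\mathcal S^p(\mathbb R^N)$. (iii) If $u\in\mathcal S^p(\mathbb R^N)$, then $\limsup_{k\to\infty}\mathscr F^{w_k}_{k,p}(u)\le\mathscr D^\mu_{p,w}(u)$.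
   Context: Standing assumptions. $p\in[1,\infty)$. Kernels: $(\rho_k)_{k\in\mathbb N}\subset L^1_{\rm loc}(\mathbb R^N)$, $\rho_k\ge0$, with $$\sup_{R>0}\limsup_{k\to\infty}R^p\int_{\mathbb R^N}\frac{\rho_k(z)}{R^p+|z|^p}\,dz<\infty,$$ and, for some $\alpha\ge0$, the measures $\rho_k\mathscr L^N$ converge weakly-* to $\alpha\delta_0$ in $\mathscr M_{\rm loc}(\mathbb R^N)$ (tested against $C_c(\mathbb R^N)$). Measure $\mu$: for $\delta>0$ and $k\in\mathbb N$ let $\mu_k^\delta$ be the measure on the unit sphere $\mathbb S^{N-1}$ given by $\mu_k^\delta(E)=\int_E\big(\int_0^\delta\rho_k(\sigma r)\,r^{N-1}\,dr\big)\,d\mathscr H^{N-1}(\sigma)$. It is assumed (possibly after passing to a subsequence of $(\rho_k)$ once and for all) that for all small $\delta>0$ the measures $\mu_k^\delta$ converge weakly-* on $\mathbb S^{N-1}$ as $k\to\infty$, and $\mu$ is the weak-* limit of these limits as $\delta\to0^+$, a finite non-negative Radon measure on $\mathbb S^{N-1}$. Weights: $(w_k)_{k\in\mathbb N}\subset L^\infty(\mathbb R^{2N})$, $w_k\ge0$, $w_k\to w$ in $L^\infty(\mathbb R^{2N})$, where $w\in C_b(\mathbb R^{2N})$, $w\ge0$, and $|w(x,y)-w(x',y')|\le\omega(|x-x'|+|y-y'|)$ for all $x,x',y,y'\in\mathbb R^N$, with $\omega\colon[0,\infty)\to[0,\infty)$ non-decreasing and $\lim_{t\to0^+}\omega(t)=\omega(0)=0$.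 Functionals: for a non-negative weight $v\in L^\infty(\mathbb R^{2N})$ and $u\in L^p(\mathbb R^N)$, $$\mathscr F^{v}_{k,p}(u)=\int_{\mathbb R^N}\int_{\mathbb R^N}\frac{|u(x)-u(y)|^p}{|x-y|^p}\,\rho_k(x-y)\,v(x,y)\,dx\,dy\in[0,\infty];$$ $\mathscr F^1_{k,p}$ is the case $v\equiv1$. Spaces: $\mathcal S^p(\mathbb R^N)=W^{1,p}(\mathbb R^N)$ if $p>1$ and $\mathcal S^1(\mathbb R^N)=BV(\mathbb R^N)$; $L^p_R(\mathbb R^N)=\{u\in L^p(\mathbb R^N):\operatorname{supp}u\subset\overline{B}_R\}$. Limit energy: with $w^0(x)=w(x,x)$, for $u\in\mathcal S^p(\mathbb R^N)$, $\mathscr D^\mu_{p,w}(u)=\int_{\mathbb S^{N-1}}\|\sigma\cdot Du\|^p_{L^p(w^0)}\,d\mu(\sigma)$, where $\|\sigma\cdot Du\|_{L^p(w^0)}^p=\int_{\mathbb R^N}w^0|\sigma\cdot Du|^p\,dx$ if $p>1$ and $=\int_{\mathbb R^N}w^0\,d|\sigma\cdot Du|$ (total variation measure) if $p=1$. A sequence $(u_k)\subset L^p(\mathbb R^N)$ is $p$-energy bounded if $\sup_{k}\big(\|u_k\|_{L^p}+\mathscr F^1_{k,p}(u_k)\big)<\infty$. The family $(\rho_k)$ is $p$-compact if any $p$-energy bounded sequence in $L^p(\mathbb R^N)$ is compact in $L^p(E)$ for every compact $E\subset\mathbb R^N$. It is strongly $p$-compact if it is $p$-compact and any $L^p_{\rm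 loc}(\mathbb R^N)$ limit of (a subsequence of) a $p$-energy bounded sequence is in $\mathcal S^p(\mathbb R^N)$. "Compact" for a sequence means relatively compact (every subsequence has a convergent further subsequence). *)

theory Defs
  imports "HOL-Probability.Probability"
begin

section \<open>Lebesgue spaces\<close>

text \<open>Classes of functions modulo null sets are represented by Borel representatives.\<close>

definition Lp :: "'a measure \<Rightarrow> real \<Rightarrow> ('a \<Rightarrow> real) set" where
  "Lp M p = {u. u \<in> borel_measurable M \<and> integrable M (\<lambda>x. \<bar>u x\<bar> powr p)}"

definition Lp_norm :: "'a measure \<Rightarrow> real \<Rightarrow> ('a \<Rightarrow> real) \<Rightarrow> real" where
  "Lp_norm M p u = (LINT x|M. \<bar>u x\<bar> powr p) powr (1 / p)"

definition Lp_conv :: "'a measure \<Rightarrow> real \<Rightarrow> (nat \<Rightarrow> 'a \<Rightarrow> real) \<Rightarrow> ('a \<Rightarrow> real) \<Rightarrow> bool" where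
  "Lp_conv M p u v \<longleftrightarrow> (\<forall>k. u k \<in> Lp M p) \<and> v \<in> Lp M p
     \<and> (\<lambda>k. Lp_norm M p (\<lambda>x. u k x - v x)) \<longlonglongrightarrow> 0"

definition Lp_loc_conv ::
  "real \<Rightarrow> (nat \<Rightarrow> 'a::euclidean_space \<Rightarrow> real) \<Rightarrow> ('a \<Rightarrow> real) \<Rightarrow> bool" where
  "Lp_loc_conv p u v \<longleftrightarrow> (\<forall>E. compact E \<longrightarrow> Lp_conv (restrict_space lborel E) p u v)"

definition Lp_relatively_compact :: "'a measure \<Rightarrow> real \<Rightarrow> (nat \<Rightarrow> 'a \<Rightarrow> real) \<Rightarrow> bool" where
  "Lp_relatively_compact M p u \<longleftrightarrow>
     (\<forall>r. strict_mono r \<longrightarrow> (\<exists>s v. strict_mono (s :: nat \<Rightarrow> nat) \<and> Lp_conv M p (u \<circ> r \<circ> s) v))"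

definition Linf_norm :: "'a measure \<Rightarrow> ('a \<Rightarrow> real) \<Rightarrow> ereal" where
  "Linf_norm M v = esssup M (\<lambda>x. ereal \<bar>v x\<bar>)"

definition ess_supp :: "('a::euclidean_space \<Rightarrow> real) \<Rightarrow> 'a set" where
  "ess_supp u = - \<Union>{U. open U \<and> (AE x in lborel. x \<in> U \<longrightarrow> u x = 0)}"

definition Lp_ball :: "real \<Rightarrow> real \<Rightarrow> ('a::euclidean_space \<Rightarrow> real) set" where
  "Lp_ball p R = {u \<in> Lp lborel p. ess_supp u \<subseteq> cball 0 R}"

section \<open>Sobolev functions and functions of bounded variation\<close>

definition C_c :: "('a::euclidean_space \<Rightarrow> real) set" where
  "C_c = {\<phi>. continuous_on UNIV \<phi> \<and> compact (closure {x. \<phi> x \<noteq> 0})}"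

definition partial_deriv :: "'a::euclidean_space \<Rightarrow> ('a \<Rightarrow> real) \<Rightarrow> 'a \<Rightarrow> real" where
  "partial_deriv i \<phi> x = frechet_derivative \<phi> (at x) i"

text \<open>Distributional derivatives are tested against \<open>C\<^sub>c\<^sup>1\<close> functions, as in Evans and Gariepy.\<close>

definition C1_c :: "('a::euclidean_space \<Rightarrow> real) set" where
  "C1_c = {\<phi> \<in> C_c. (\<forall>x. \<phi> differentiable at x)
     \<and> (\<forall>i\<in>Basis. continuous_on UNIV (partial_deriv i \<phi>))}"

definition is_weak_gradient :: "('a::euclidean_space \<Rightarrow> real) \<Rightarrow> ('a \<Rightarrow> 'a) \<Rightarrow> bool" where
  "is_weak_gradient u g \<longleftrightarrow> g \<in> borel_measurable borel
     \<and> (\<forall>K. compact K \<longrightarrow> set_integrable lborel K g)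
     \<and> (\<forall>\<phi>\<in>C1_c. \<forall>i\<in>Basis.
          (LINT x|lborel. u x * partial_deriv i \<phi> x) = - (LINT x|lborel. (g x \<bullet> i) * \<phi> x))"

definition weak_gradient :: "('a::euclidean_space \<Rightarrow> real) \<Rightarrow> 'a \<Rightarrow> 'a" where
  "weak_gradient u = (SOME g. is_weak_gradient u g)"

definition W1p :: "real \<Rightarrow> ('a::euclidean_space \<Rightarrow> real) set" where
  "W1p p = {u \<in> Lp lborel p. \<exists>g. is_weak_gradient u g \<and> (\<lambda>x. norm (g x)) \<in> Lp lborel p}"

text \<open>Vector-valued Borel measures are set functions on the Borel sets. Every finite vector
  measure has an integrable density with respect to some finite non-negative measure (for
  instance its total variation), and this is how integrals against it are expressed.\<close>

definition is_gradient_measure :: "('a::euclidean_space \<Rightarrow> real) \<Rightarrow> ('a set \<Rightarrow> 'a) \<Rightarrow> bool" where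
  "is_gradient_measure u D \<longleftrightarrow>
     (\<exists>m \<tau>. finite_measure m \<and> sets m = sets borel \<and> integrable m \<tau>
        \<and> (\<forall>A\<in>sets borel. D A = (LINT x:A|m. \<tau> x))
        \<and> (\<forall>\<phi>\<in>C1_c. \<forall>i\<in>Basis.
             (LINT x|lborel. u x * partial_deriv i \<phi> x) = - (LINT x|m. \<phi> x * (\<tau> x \<bullet> i))))"

text \<open>The gradient measure is unique as a set function on the Borel sets.\<close>

definition gradient_measure :: "('a::euclidean_space \<Rightarrow> real) \<Rightarrow> 'a set \<Rightarrow> 'a" where
  "gradient_measure u = (SOME D. is_gradient_measure u D)"

definition BV :: "('a::euclidean_space \<Rightarrow> real) set" where
  "BV = {u \<in> Lp lborel 1. \<exists>D. is_gradient_measure u D}"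

definition variation_measure :: "('a::topological_space set \<Rightarrow> real) \<Rightarrow> 'a measure" where
  "variation_measure \<nu> = measure_of UNIV (sets borel)
     (\<lambda>A. SUP P \<in> {P. finite P \<and> disjoint P \<and> P \<subseteq> sets borel \<and> \<Union>P = A}.
            \<Sum>E\<in>P. ennreal \<bar>\<nu> E\<bar>)"

definition S_space :: "real \<Rightarrow> ('a::euclidean_space \<Rightarrow> real) set" where
  "S_space p = (if p = 1 then BV else W1p p)"

section \<open>Hausdorff measure\<close>

text \<open>Normalised so that the \<open>m\<close>-dimensional Hausdorff measure agrees with Lebesgue
  measure in dimension \<open>m\<close>. For \<open>m = 0\<close> every non-empty set of a cover counts 1
  (as \<open>0 ^ 0 = 1\<close>), so the empty set, which pads finite covers, is treated separately.\<close>

definition hausdorff_gauge :: "nat \<Rightarrow> 'a::metric_space set \<Rightarrow> ennreal" where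
  "hausdorff_gauge m C =
     (if C = {} then 0 else ennreal (unit_ball_vol (real m) * (diameter C / 2) ^ m))"

definition hausdorff_premeasure :: "nat \<Rightarrow> real \<Rightarrow> 'a::metric_space set \<Rightarrow> ennreal" where
  "hausdorff_premeasure m \<delta> A =
     (INF C \<in> {C :: nat \<Rightarrow> 'a set. A \<subseteq> (\<Union>i. C i) \<and> (\<forall>i. bounded (C i) \<and> diameter (C i) \<le> \<delta>)}.
        \<Sum>i. hausdorff_gauge m (C i))"

definition hausdorff_measure :: "nat \<Rightarrow> 'a::metric_space measure" where
  "hausdorff_measure m = measure_of UNIV (sets borel)
     (\<lambda>A. SUP \<delta>\<in>{0<..}. hausdorff_premeasure m \<delta> A)"

definition sphere_measure :: "'a::euclidean_space measure" where
  "sphere_measure = restrict_space (hausdorff_measure (DIM('a) - 1)) (sphere 0 1)"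

section \<open>Kernels, weights and energies\<close>

definition admissible_kernels :: "real \<Rightarrow> (nat \<Rightarrow> 'a::euclidean_space \<Rightarrow> real) \<Rightarrow> bool" where
  "admissible_kernels p \<rho> \<longleftrightarrow>
     (\<forall>k. \<rho> k \<in> borel_measurable borel
        \<and> (\<forall>K. compact K \<longrightarrow> set_integrable lborel K (\<rho> k))
        \<and> (AE z in lborel. 0 \<le> \<rho> k z))
     \<and> (SUP R\<in>{0<..}. limsup (\<lambda>k. ennreal (R powr p)
          * (\<integral>\<^sup>+ z. ennreal (\<rho> k z / (R powr p + norm z powr p)) \<partial>lborel))) < \<infinity>
     \<and> (\<exists>\<alpha>\<ge>0. \<forall>\<phi>\<in>C_c. (\<lambda>k. LINT z|lborel. \<phi> z * \<rho> k z) \<longlonglongrightarrow> \<alpha> * \<phi> 0)"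

definition directional_measure :: "('a::euclidean_space \<Rightarrow> real) \<Rightarrow> real \<Rightarrow> 'a measure" where
  "directional_measure \<rho> \<delta> = density sphere_measure
     (\<lambda>\<sigma>. \<integral>\<^sup>+ r \<in> {0<..<\<delta>}. ennreal (\<rho> (r *\<^sub>R \<sigma>) * r ^ (DIM('a) - 1)) \<partial>lborel)"

definition finite_sphere_measure :: "'a::euclidean_space measure \<Rightarrow> bool" where
  "finite_sphere_measure \<mu> \<longleftrightarrow>
     finite_measure \<mu> \<and> sets \<mu> = sets (restrict_space borel (sphere 0 1))"

definition limit_directional_measure ::
  "(nat \<Rightarrow> 'a::euclidean_space \<Rightarrow> real) \<Rightarrow> 'a measure \<Rightarrow> bool" where
  "limit_directional_measure \<rho> \<mu> \<longleftrightarrow> finite_sphere_measure \<mu> \<and>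
     (\<exists>\<delta>0>0. \<exists>\<nu> :: real \<Rightarrow> 'a measure.
        (\<forall>\<delta>. 0 < \<delta> \<and> \<delta> < \<delta>0 \<longrightarrow> finite_sphere_measure (\<nu> \<delta>)
           \<and> (\<forall>\<phi>. continuous_on (sphere 0 1) \<phi> \<longrightarrow>
                (\<lambda>k. LINT \<sigma>|directional_measure (\<rho> k) \<delta>. (\<phi> \<sigma> :: real))
                  \<longlonglongrightarrow> (LINT \<sigma>|\<nu> \<delta>. \<phi> \<sigma>)))
      \<and> (\<forall>\<phi>. continuous_on (sphere 0 1) \<phi> \<longrightarrow>
           ((\<lambda>\<delta>. LINT \<sigma>|\<nu> \<delta>. (\<phi> \<sigma> :: real)) \<longlongrightarrow> (LINT \<sigma>|\<mu>. \<phi> \<sigma>)) (at_right 0)))"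

definition admissible_weights ::
  "(nat \<Rightarrow> 'a::euclidean_space \<times> 'a \<Rightarrow> real) \<Rightarrow> ('a \<times> 'a \<Rightarrow> real) \<Rightarrow> bool" where
  "admissible_weights ws w \<longleftrightarrow>
     (\<forall>k. ws k \<in> borel_measurable borel \<and> Linf_norm lborel (ws k) < \<infinity>
        \<and> (AE z in lborel. 0 \<le> ws k z))
     \<and> (\<lambda>k. Linf_norm lborel (\<lambda>z. ws k z - w z)) \<longlonglongrightarrow> 0
     \<and> continuous_on UNIV w \<and> bounded (range w) \<and> (\<forall>z. 0 \<le> w z)
     \<and> (\<exists>\<omega> :: real \<Rightarrow> real. (\<forall>t\<ge>0. 0 \<le> \<omega> t) \<and> mono_on {0..} \<omega>
          \<and> \<omega> 0 = 0 \<and> (\<omega> \<longlongrightarrow> 0) (at_right 0)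
          \<and> (\<forall>x x' y y'. \<bar>w (x, y) - w (x', y')\<bar> \<le> \<omega> (norm (x - x') + norm (y - y'))))"

text \<open>\<open>energy p \<rho> v u\<close> is the functional with kernel \<open>\<rho>\<close> and weight \<open>v\<close>; on the (null)
  diagonal the integrand is 0.\<close>

definition energy ::
  "real \<Rightarrow> ('a::euclidean_space \<Rightarrow> real) \<Rightarrow> ('a \<times> 'a \<Rightarrow> real) \<Rightarrow> ('a \<Rightarrow> real) \<Rightarrow> ennreal" where
  "energy p \<rho> v u =
     (\<integral>\<^sup>+ x. \<integral>\<^sup>+ y. ennreal (\<bar>u x - u y\<bar> powr p / norm (x - y) powr p * \<rho> (x - y) * v (x, y))
        \<partial>lborel \<partial>lborel)"

text \<open>The \<open>p\<close>-th power of the norm of \<open>\<sigma> \<bullet> Du\<close> in \<open>L\<^sup>p\<close> with weight \<open>w0\<close>.\<close>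

definition directional_seminorm_pow ::
  "real \<Rightarrow> ('a::euclidean_space \<Rightarrow> real) \<Rightarrow> ('a \<Rightarrow> real) \<Rightarrow> 'a \<Rightarrow> ennreal" where
  "directional_seminorm_pow p w0 u \<sigma> =
     (if p = 1
      then \<integral>\<^sup>+ x. ennreal (w0 x) \<partial>variation_measure (\<lambda>A. \<sigma> \<bullet> gradient_measure u A)
      else \<integral>\<^sup>+ x. ennreal (w0 x * \<bar>\<sigma> \<bullet> weak_gradient u x\<bar> powr p) \<partial>lborel)"

definition limit_energy ::
  "real \<Rightarrow> 'a::euclidean_space measure \<Rightarrow> ('a \<times> 'a \<Rightarrow> real) \<Rightarrow> ('a \<Rightarrow> real) \<Rightarrow> ennreal" where
  "limit_energy p \<mu> w u =
     (if u \<in> S_space p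
      then \<integral>\<^sup>+ \<sigma>. directional_seminorm_pow p (\<lambda>x. w (x, x)) u \<sigma> \<partial>\<mu>
      else \<infinity>)"

section \<open>Compact families of kernels\<close>

definition energy_bounded ::
  "real \<Rightarrow> (nat \<Rightarrow> 'a::euclidean_space \<Rightarrow> real) \<Rightarrow> (nat \<Rightarrow> 'a \<times> 'a \<Rightarrow> real)
     \<Rightarrow> (nat \<Rightarrow> 'a \<Rightarrow> real) \<Rightarrow> bool" where
  "energy_bounded p \<rho> ws u \<longleftrightarrow>
     (SUP k. ennreal (Lp_norm lborel p (u k)) + energy p (\<rho> k) (ws k) (u k)) < \<infinity>"

definition p_compact :: "real \<Rightarrow> (nat \<Rightarrow> 'a::euclidean_space \<Rightarrow> real) \<Rightarrow> bool" where
  "p_compact p \<rho> \<longleftrightarrow>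
     (\<forall>u. (\<forall>k. u k \<in> Lp lborel p) \<and> energy_bounded p \<rho> (\<lambda>_ _. 1) u \<longrightarrow>
        (\<forall>E. compact E \<longrightarrow> Lp_relatively_compact (restrict_space lborel E) p u))"

definition strongly_p_compact :: "real \<Rightarrow> (nat \<Rightarrow> 'a::euclidean_space \<Rightarrow> real) \<Rightarrow> bool" where
  "strongly_p_compact p \<rho> \<longleftrightarrow> p_compact p \<rho> \<and>
     (\<forall>u. (\<forall>k. u k \<in> Lp lborel p) \<and> energy_bounded p \<rho> (\<lambda>_ _. 1) u \<longrightarrow>
        (\<forall>r v. strict_mono r \<and> Lp_loc_conv p (u \<circ> r) v \<longrightarrow> v \<in> S_space p))"

end

theory Submission
  imports Defs
begin

text \<open>
  In polar coordinates, where \<open>\<H>\<^sup>N\<^sup>-\<^sup>1\<close> on the sphere is the cone measure, the directional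
  measures become integrals of \<open>\<rho>\<^sub>k(z) \<phi>(z / |z|)\<close> over small balls. For fixed \<open>z\<close> the
  inner integral of the energy is compared with the directional seminorm of \<open>u\<close>: from above by
  integrating the derivative of mollifications along the segment from \<open>x - z\<close> to \<open>x\<close>, and from below by Jensen's
  inequality, which shows that mollification essentially decreases the energy, together with a second order
  Taylor bound for the mollified functions. Since the latter depends on \<open>u\<^sub>k\<close> only through
  its local \<open>L\<^sup>1\<close> norm, it is uniform in \<open>k\<close>. Lower semicontinuity of the directional seminorms
  then removes the mollification. Contributions of \<open>|z| \<ge> \<delta>\<close> are negligible because the kernels concentrate at the
  origin, and for compactly supported functions the same fact together with the lower bound of \<open>w\<close> on
  compact sets reduces weighted energies to unweighted ones.\<close>

section \<open>Hausdorff premeasures\<close>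

text \<open>Two obstacles shape the development. The covers in \<open>hausdorff_measure\<close> are
  weighted by the volume of a ball of the same diameter. Identifying it with the cone measure
  therefore needs an isodiametric inequality in one direction, obtained by Steiner symmetrization
  and carried to spherical sets by gnomonic projection, and a Vitali exhaustion by disjoint caps in
  the other. Second, membership of the limit in \<open>S_space\<close> is not read off from the
  energies: it comes from strong compactness, which speaks of the unweighted energies of a whole
  sequence, whereas a small limit inferior gives weighted bounds for infinitely many members only.
  Hence the passage to unweighted energies, and the replacement of the other members by zero. The
  unweighted bound also pays for the errors in the weights, which are small in the supremum norm. To
  treat \<open>BV\<close> and Sobolev functions together, a gradient is a pair of a measure and a
  density; the two cases part only where Jensen's inequality or convergence of the mollified
  densities fails for a general measure.\<close>

lemma hausdorff_premeasure_le:
  assumes "A \<subseteq> (\<Union>i. C i)" "\<And>i. bounded (C i)" "\<And>i. diameter (C i) \<le> \<delta>"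
  shows "hausdorff_premeasure m \<delta> A \<le> (\<Sum>i. hausdorff_gauge m (C i))"
  unfolding hausdorff_premeasure_def using assms by (intro INF_lower) auto

lemma hausdorff_premeasure_mono:
  "A \<subseteq> B \<Longrightarrow> hausdorff_premeasure m \<delta> A \<le> hausdorff_premeasure m \<delta> B"
  unfolding hausdorff_premeasure_def by (intro INF_superset_mono) auto

lemma hausdorff_premeasure_antimono:
  "\<delta> \<le> \<delta>' \<Longrightarrow> hausdorff_premeasure m \<delta>' A \<le> hausdorff_premeasure m \<delta> A"
  unfolding hausdorff_premeasure_def by (intro INF_superset_mono) (auto intro: order_trans)

lemma hausdorff_premeasure_empty: "0 \<le> \<delta> \<Longrightarrow> hausdorff_premeasure m \<delta> {} = 0"
  using hausdorff_premeasure_le[of "{}" "\<lambda>_. {}" \<delta> m] by (auto simp: hausdorff_gauge_def)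

lemma ennreal_suminf_geometric_half: "(\<Sum>i. ennreal (e * (1/2) ^ Suc i)) = ennreal e" if "0 \<le> e"
proof (rule suminf_ennreal_eq)
  show "(\<lambda>i. e * (1/2) ^ Suc i) sums e"
    using sums_mult[OF power_half_series, of e] by simp
qed (use that in auto)

lemma hausdorff_premeasure_near_cover:
  assumes "hausdorff_premeasure m \<delta> A < \<infinity>" "0 < e"
  obtains C where "A \<subseteq> (\<Union>i. C i)" "\<And>i. bounded (C i)" "\<And>i. diameter (C i) \<le> \<delta>"
    "(\<Sum>i::nat. hausdorff_gauge m (C i)) \<le> hausdorff_premeasure m \<delta> A + ennreal e"
proof -
  have "hausdorff_premeasure m \<delta> A < hausdorff_premeasure m \<delta> A + ennreal e"
    using assms by (cases "hausdorff_premeasure m \<delta> A") (auto simp: ennreal_plus[symmetric] ennreal_less_iff simp del: ennreal_plus)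
  then obtain C where "A \<subseteq> (\<Union>i. C i)" "\<forall>i. bounded (C i) \<and> diameter (C i) \<le> \<delta>"
    "(\<Sum>i::nat. hausdorff_gauge m (C i)) < hausdorff_premeasure m \<delta> A + ennreal e"
    by (subst (asm) (1) hausdorff_premeasure_def) (auto simp: INF_less_iff)
  then show ?thesis by (intro that[of C]) auto
qed

lemma hausdorff_premeasure_countably_subadditive:
  "hausdorff_premeasure m \<delta> (\<Union>i::nat. A i) \<le> (\<Sum>i. hausdorff_premeasure m \<delta> (A i))"
proof (cases "\<exists>i. hausdorff_premeasure m \<delta> (A i) = \<infinity>")
  case True
  then obtain i where "hausdorff_premeasure m \<delta> (A i) = \<infinity>" by auto
  then have "(\<Sum>i. hausdorff_premeasure m \<delta> (A i)) = \<infinity>"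
    using sum_le_suminf[of "\<lambda>i. hausdorff_premeasure m \<delta> (A i)" "{i}"] by (auto simp: top_unique)
  then show ?thesis by simp
next
  case False
  show ?thesis
  proof (rule ennreal_le_epsilon)
    fix e :: real assume e: "0 < e"
    have "\<exists>C. A i \<subseteq> (\<Union>j. C j) \<and> (\<forall>j. bounded (C j)) \<and> (\<forall>j. diameter (C j) \<le> \<delta>)
      \<and> (\<Sum>j::nat. hausdorff_gauge m (C j)) \<le> hausdorff_premeasure m \<delta> (A i) + ennreal (e * (1/2)^Suc i)" for i
    proof -
      have "hausdorff_premeasure m \<delta> (A i) < \<infinity>" using False by (auto simp: less_top)
      from hausdorff_premeasure_near_cover[OF this, of "e * (1/2)^Suc i"] e
      show ?thesis by (metis half_gt_zero_iff zero_less_divide_1_iff zero_less_mult_iff zero_less_numeral zero_less_power)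
    qed
    then obtain C where C: "\<And>i. A i \<subseteq> (\<Union>j. C i j)" "\<And>i j. bounded (C i j)" "\<And>i j. diameter (C i j) \<le> \<delta>"
      "\<And>i. (\<Sum>j::nat. hausdorff_gauge m (C i j)) \<le> hausdorff_premeasure m \<delta> (A i) + ennreal (e * (1/2)^Suc i)"
      by metis
    define D where "D n = case_prod C (prod_decode n)" for n
    have "hausdorff_premeasure m \<delta> (\<Union>i. A i) \<le> (\<Sum>n. hausdorff_gauge m (D n))"
    proof (rule hausdorff_premeasure_le)
      show "(\<Union>i. A i) \<subseteq> (\<Union>n. D n)"
      proof
        fix x assume "x \<in> (\<Union>i. A i)"
        then obtain i j where "x \<in> C i j" using C(1) by blast
        then have "x \<in> D (prod_encode (i,j))" by (simp add: D_def)
        then show "x \<in> (\<Union>n. D n)" by blast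
      qed
    qed (use C in \<open>auto simp: D_def split: prod.split\<close>)
    also have "\<dots> = (\<Sum>i. \<Sum>j. hausdorff_gauge m (C i j))"
      using suminf_ennreal_2dimen[of "\<lambda>i. \<Sum>j. hausdorff_gauge m (C i j)" "\<lambda>(i,j). hausdorff_gauge m (C i j)"]
      by (simp add: D_def case_prod_beta)
    also have "\<dots> \<le> (\<Sum>i. hausdorff_premeasure m \<delta> (A i) + ennreal (e * (1/2)^Suc i))"
      by (intro suminf_le C) auto
    also have "\<dots> = (\<Sum>i. hausdorff_premeasure m \<delta> (A i)) + (\<Sum>i. ennreal (e * (1/2)^Suc i))"
      by (rule suminf_add[symmetric]) auto
    also have "(\<Sum>i. ennreal (e * (1/2)^Suc i)) = ennreal e"
      using e by (intro ennreal_suminf_geometric_half) auto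
    finally show "hausdorff_premeasure m \<delta> (\<Union>i. A i) \<le> (\<Sum>i. hausdorff_premeasure m \<delta> (A i)) + ennreal e" .
  qed
qed

section \<open>Hausdorff outer measure and Caratheodory's criterion\<close>

definition hausdorff_outer :: "nat \<Rightarrow> 'a::metric_space set \<Rightarrow> ennreal" where
  "hausdorff_outer m A = (SUP \<delta>\<in>{0<..}. hausdorff_premeasure m \<delta> A)"

lemma hausdorff_premeasure_le_outer:
  "0 < \<delta> \<Longrightarrow> hausdorff_premeasure m \<delta> A \<le> hausdorff_outer m A"
  unfolding hausdorff_outer_def by (rule SUP_upper) auto

lemma hausdorff_outer_mono: "A \<subseteq> B \<Longrightarrow> hausdorff_outer m A \<le> hausdorff_outer m B"
  unfolding hausdorff_outer_def by (intro SUP_mono) (auto intro: hausdorff_premeasure_mono)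

lemma hausdorff_outer_empty: "hausdorff_outer m {} = 0"
  unfolding hausdorff_outer_def by (rule antisym, rule SUP_least) (auto simp: hausdorff_premeasure_empty)

lemma hausdorff_outer_countably_subadditive:
  "hausdorff_outer m (\<Union>i::nat. A i) \<le> (\<Sum>i. hausdorff_outer m (A i))"
  unfolding hausdorff_outer_def[of m "\<Union>i. A i"]
proof (rule SUP_least)
  fix \<delta> :: real assume "\<delta> \<in> {0<..}"
  then show "hausdorff_premeasure m \<delta> (\<Union>i. A i) \<le> (\<Sum>i. hausdorff_outer m (A i))"
    by (intro order_trans[OF hausdorff_premeasure_countably_subadditive] suminf_le)
       (auto intro: hausdorff_premeasure_le_outer)
qed

lemma hausdorff_outer_space: "outer_measure_space UNIV' (hausdorff_outer m)" if "UNIV' = UNIV"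
  unfolding outer_measure_space_def that positive_def increasing_def countably_subadditive_def
  by (auto simp: hausdorff_outer_empty hausdorff_outer_mono hausdorff_outer_countably_subadditive)

lemma hausdorff_outer_Un_le: "hausdorff_outer m (A \<union> B) \<le> hausdorff_outer m A + hausdorff_outer m B"
proof -
  let ?A = "\<lambda>i::nat. if i = 0 then A else if i = 1 then B else {}"
  have "hausdorff_outer m (\<Union>i. ?A i) \<le> (\<Sum>i. hausdorff_outer m (?A i))"
    by (rule hausdorff_outer_countably_subadditive)
  also have "(\<Sum>i. hausdorff_outer m (?A i)) = (\<Sum>i\<in>{0,1}. hausdorff_outer m (?A i))"
    by (rule suminf_finite) (auto simp: hausdorff_outer_empty)
  also have "(\<Union>i. ?A i) = A \<union> B" by (auto split: if_splits) 
  finally show ?thesis by simp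
qed

text \<open>Once \<delta> < d, no set of diameter at most \<delta> meets both A and B. A cover of
  the union therefore splits into a cover of A and a cover of B that share no nonempty
  member.\<close>

lemma hausdorff_outer_additive_separated:
  assumes d: "0 < d" "\<And>x y. x \<in> A \<Longrightarrow> y \<in> B \<Longrightarrow> d \<le> dist x y"
  shows "hausdorff_outer m A + hausdorff_outer m B \<le> hausdorff_outer m (A \<union> B)"
proof (cases "hausdorff_outer m (A \<union> B) = \<infinity>")
  case False
  have *: "hausdorff_premeasure m \<delta> A + hausdorff_premeasure m \<delta> B \<le> hausdorff_outer m (A \<union> B)"
    if \<delta>: "0 < \<delta>" "\<delta> < d" for \<delta>
  proof (rule ennreal_le_epsilon)
    fix e :: real assume e: "0 < e"
    have "hausdorff_premeasure m \<delta> (A \<union> B) < \<infinity>"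
      using hausdorff_premeasure_le_outer[OF \<delta>(1), of m "A \<union> B"] False by (auto simp: less_top top_unique)
    then obtain C where C: "A \<union> B \<subseteq> (\<Union>i. C i)" "\<And>i. bounded (C i)" "\<And>i. diameter (C i) \<le> \<delta>"
      "(\<Sum>i::nat. hausdorff_gauge m (C i)) \<le> hausdorff_premeasure m \<delta> (A \<union> B) + ennreal e"
      using hausdorff_premeasure_near_cover[OF _ e] by metis
    define CA where "CA i = (if C i \<inter> A = {} then {} else C i)" for i
    define CB where "CB i = (if C i \<inter> B = {} then {} else C i)" for i
    have disj: "C i \<inter> A = {} \<or> C i \<inter> B = {}" for i
    proof (rule ccontr)
      assume "\<not> ?thesis"
      then obtain x y where "x \<in> C i" "x \<in> A" "y \<in> C i" "y \<in> B" by auto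
      then show False using d(2)[of x y] diameter_bounded_bound[OF C(2), of x i y] C(3)[of i] \<delta> by force
    qed
    have "hausdorff_premeasure m \<delta> A + hausdorff_premeasure m \<delta> B \<le>
        (\<Sum>i. hausdorff_gauge m (CA i)) + (\<Sum>i. hausdorff_gauge m (CB i))"
    proof (intro add_mono hausdorff_premeasure_le)
      show "A \<subseteq> (\<Union>i. CA i)" "B \<subseteq> (\<Union>i. CB i)"
        using C(1) unfolding CA_def CB_def by (force split: if_splits)+
    qed (use C \<delta> in \<open>auto simp: CA_def CB_def\<close>)
    also have "\<dots> = (\<Sum>i. hausdorff_gauge m (CA i) + hausdorff_gauge m (CB i))"
      by (rule suminf_add) auto
    also have "\<dots> \<le> (\<Sum>i. hausdorff_gauge m (C i))"
    proof (rule suminf_le)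
      show "hausdorff_gauge m (CA i) + hausdorff_gauge m (CB i) \<le> hausdorff_gauge m (C i)" for i
        using disj[of i] by (auto simp: CA_def CB_def hausdorff_gauge_def)
    qed auto
    also have "\<dots> \<le> hausdorff_outer m (A \<union> B) + ennreal e"
      using C(4) hausdorff_premeasure_le_outer[OF \<delta>(1), of m "A \<union> B"]
      by (meson add_right_mono order_trans)
    finally show "hausdorff_premeasure m \<delta> A + hausdorff_premeasure m \<delta> B \<le> hausdorff_outer m (A \<union> B) + ennreal e" .
  qed
  \<comment> \<open>Premeasures grow as \<delta> shrinks, so the two suprema may be taken over a
    common \<delta>, which may moreover be assumed to be at most d/2.\<close>
  have "hausdorff_outer m A + hausdorff_outer m B =
      (SUP \<delta>\<in>{0<..}. hausdorff_premeasure m \<delta> A + hausdorff_premeasure m \<delta> B)"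
    unfolding hausdorff_outer_def
  proof (rule SUP_add_directed_ennreal[symmetric])
    fix i j :: real assume "i \<in> {0<..}" "j \<in> {0<..}"
    then show "\<exists>k\<in>{0<..}. hausdorff_premeasure m i A + hausdorff_premeasure m j B
      \<le> hausdorff_premeasure m k A + hausdorff_premeasure m k B"
      by (intro bexI[of _ "min i j"] add_mono hausdorff_premeasure_antimono) auto
  qed
  also have "\<dots> \<le> hausdorff_outer m (A \<union> B)"
  proof (rule SUP_least)
    fix \<delta> :: real assume "\<delta> \<in> {0<..}"
    then have "hausdorff_premeasure m \<delta> A + hausdorff_premeasure m \<delta> B \<le>
      hausdorff_premeasure m (min \<delta> (d/2)) A + hausdorff_premeasure m (min \<delta> (d/2)) B"
      by (intro add_mono hausdorff_premeasure_antimono) auto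
    also have "\<dots> \<le> hausdorff_outer m (A \<union> B)" using \<open>\<delta> \<in> _\<close> d by (intro *) auto
    finally show "hausdorff_premeasure m \<delta> A + hausdorff_premeasure m \<delta> B \<le> hausdorff_outer m (A \<union> B)" .
  qed
  finally show ?thesis .
qed simp

lemma hausdorff_outer_separated_sum:
  fixes D :: "nat \<Rightarrow> 'a::metric_space set"
  assumes "\<And>i j. i < j \<Longrightarrow> \<exists>d>0. \<forall>x\<in>D i. \<forall>y\<in>D j. d \<le> dist x y"
  shows "(\<Sum>i<n. hausdorff_outer m (D i)) \<le> hausdorff_outer m (\<Union>i<n. D i)"
proof (induction n)
  case (Suc n)
  have "\<exists>d>0. \<forall>i<n. \<forall>x\<in>D i. \<forall>y\<in>D n. d \<le> dist x y"
  proof -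
    obtain f where f: "\<And>i. i < n \<Longrightarrow> f i > 0 \<and> (\<forall>x\<in>D i. \<forall>y\<in>D n. f i \<le> dist x y)"
      using assms[of _ n] by metis
    show ?thesis
      by (rule exI[of _ "Min (insert 1 (f ` {..<n}))"])
         (use f in \<open>auto simp: Min_le_iff intro!: Min.coboundedI\<close>)
  qed
  then obtain d where "d > 0" "\<And>i x y. i < n \<Longrightarrow> x \<in> D i \<Longrightarrow> y \<in> D n \<Longrightarrow> d \<le> dist x y" by metis
  then have "hausdorff_outer m (\<Union>i<n. D i) + hausdorff_outer m (D n) \<le> hausdorff_outer m ((\<Union>i<n. D i) \<union> D n)"
    by (intro hausdorff_outer_additive_separated[of d]) auto
  moreover have "(\<Union>i<n. D i) \<union> D n = (\<Union>i<Suc n. D i)" by (auto simp: lessThan_Suc)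
  ultimately show ?case
    using order_trans[OF add_right_mono[OF Suc]] by simp
qed (simp add: hausdorff_outer_empty)

text \<open>Caratheodory's argument for metric outer measures. T - F is cut into shells
  \<open>R k\<close> according to the distance to F. Shells whose indices differ by at least two are
  separated, so the even and the odd ones have total measure at most that of T each. The tails of
  this convergent series vanish, while the rest, \<open>G n\<close>, has positive distance to
  F.\<close>

lemma hausdorff_outer_closed_lambda:
  assumes "closed F"
  shows "F \<in> lambda_system UNIV UNIV (hausdorff_outer m)"
proof (cases "F = {}")
  case True then show ?thesis by (simp add: lambda_system_def hausdorff_outer_empty)
next
  case F: False
  have "hausdorff_outer m (F \<inter> T) + hausdorff_outer m (T - F) \<le> hausdorff_outer m T" for T
  proof (cases "hausdorff_outer m T = \<infinity>")
    case False
    define R where "R k = {x\<in>T. 1 / real (k+2) \<le> infdist x F \<and> infdist x F < 1 / real (k+1)}" for k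
    define G where "G n = {x\<in>T. 1 / real (n+1) \<le> infdist x F}" for n
    have lip: "infdist x F - infdist y F \<le> dist x y" for x y
      using infdist_triangle[of x F y] by (simp add: dist_commute)
    have sep: "\<exists>d>0. \<forall>x\<in>R i. \<forall>y\<in>R j. d \<le> dist x y" if "i + 2 \<le> j" for i j
    proof (intro exI[of _ "1 / real (i+2) - 1 / real (j+1)"] conjI ballI)
      show "0 < 1 / real (i+2) - 1 / real (j+1)" using that by (simp add: frac_less2)
      fix x y assume "x \<in> R i" "y \<in> R j"
      then show "1 / real (i+2) - 1 / real (j+1) \<le> dist x y" using lip[of x y] by (auto simp: R_def)
    qed
    have fin: "(\<Sum>i. hausdorff_outer m (R (2*i+c))) \<le> hausdorff_outer m T" for c
    proof (rule suminf_le_const)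
      fix n
      have "(\<Sum>i<n. hausdorff_outer m (R (2*i+c))) \<le> hausdorff_outer m (\<Union>i<n. R (2*i+c))"
        by (rule hausdorff_outer_separated_sum) (auto intro!: sep)
      also have "\<dots> \<le> hausdorff_outer m T" by (rule hausdorff_outer_mono) (auto simp: R_def)
      finally show "(\<Sum>i<n. hausdorff_outer m (R (2*i+c))) \<le> hausdorff_outer m T" .
    qed auto
    define h where "h i = hausdorff_outer m (R i)" for i
    have sumh: "(\<Sum>i. h i) \<le> hausdorff_outer m T + hausdorff_outer m T"
    proof (rule suminf_le_const)
      fix n
      have "(\<Sum>i<n. h i) \<le> (\<Sum>i<2*n. h i)" by (rule sum_mono2) auto
      also have "(\<Sum>i<2*n. h i) = (\<Sum>i<n. h (2*i) + h (2*i+1))"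
        by (induction n) (auto simp: algebra_simps)
      also have "\<dots> = (\<Sum>i<n. h (2*i)) + (\<Sum>i<n. h (2*i+1))" by (rule sum.distrib)
      also have "\<dots> \<le> (\<Sum>i. h (2*i)) + (\<Sum>i. h (2*i+1))"
        by (intro add_mono sum_le_suminf) auto
      also have "\<dots> \<le> hausdorff_outer m T + hausdorff_outer m T"
        using fin[of 0] fin[of 1] by (auto simp: h_def intro: add_mono)
      finally show "(\<Sum>i<n. h i) \<le> hausdorff_outer m T + hausdorff_outer m T" .
    qed auto
    have le: "hausdorff_outer m (F \<inter> T) + hausdorff_outer m (T - F) \<le> hausdorff_outer m T + (\<Sum>k. h (k + n))" for n
    proof -
      have "T - F \<subseteq> G n \<union> (\<Union>k. R (k + n))"
      proof
        fix x assume x: "x \<in> T - F"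
        then have pos: "0 < infdist x F"
          using assms F in_closed_iff_infdist_zero[of F x] infdist_nonneg[of x F] by auto
        show "x \<in> G n \<union> (\<Union>k. R (k + n))"
        proof (cases "x \<in> G n")
          case False
          then have lt: "infdist x F < 1 / real (n+1)" using x by (auto simp: G_def)
          \<comment> \<open>The shell containing x has the least index k with \<open>P k\<close>.
            Its upper bound is the failure of P at the preceding index or, for k = 0, the fact that
            x is not in \<open>G n\<close>.\<close>
          define P where "P k \<longleftrightarrow> 1 / real (k + n + 2) \<le> infdist x F" for k
          obtain k where "P k"
          proof -
            obtain q where "1 / real (Suc q) < infdist x F" using reals_Archimedean[OF pos] by (auto simp: inverse_eq_divide)
            moreover have "1 / real (q + n + 2) \<le> 1 / real (Suc q)" by (rule divide_left_mono) auto
            ultimately show ?thesis using that[of q] by (auto simp: P_def)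
          qed
          then have L: "P (LEAST k. P k)" by (rule LeastI)
          define k where "k = (LEAST k. P k)"
          have "infdist x F < 1 / real (k + n + 1)"
          proof (cases k)
            case 0 then show ?thesis using lt by simp
          next
            case (Suc j)
            then have "\<not> P j" unfolding k_def using not_less_Least[of j P] by simp
            then show ?thesis using Suc by (simp add: P_def)
          qed
          then have "x \<in> R (k + n)" using L x by (auto simp: R_def P_def k_def)
          then show ?thesis by blast
        qed auto
      qed
      then have "hausdorff_outer m (T - F) \<le> hausdorff_outer m (G n) + (\<Sum>k. h (k + n))"
        unfolding h_def
        by (rule order_trans[OF hausdorff_outer_mono order_trans[OF hausdorff_outer_Un_le
            add_left_mono[OF hausdorff_outer_countably_subadditive]]])
      then have "hausdorff_outer m (F \<inter> T) + hausdorff_outer m (T - F) \<le>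
          (hausdorff_outer m (F \<inter> T) + hausdorff_outer m (G n)) + (\<Sum>k. h (k + n))"
        by (simp add: add.assoc add_left_mono)
      also have "hausdorff_outer m (F \<inter> T) + hausdorff_outer m (G n) \<le> hausdorff_outer m (F \<inter> T \<union> G n)"
      proof (rule hausdorff_outer_additive_separated[of "1 / real (n+1)"])
        fix x y assume "x \<in> F \<inter> T" "y \<in> G n"
        then show "1 / real (n+1) \<le> dist x y"
          using infdist_le[of x F y] by (auto simp: G_def dist_commute)
      qed simp
      also have "\<dots> \<le> hausdorff_outer m T" by (rule hausdorff_outer_mono) (auto simp: G_def)
      finally show ?thesis by (simp add: add_right_mono)
    qed
    have hfin: "(\<Sum>i. h i) < \<infinity>"
      using False by (intro le_less_trans[OF sumh]) (simp add: less_top[symmetric])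
    have "(\<lambda>n. \<Sum>k. h (k + n)) \<longlonglongrightarrow> 0"
    proof -
      have hf: "h i < \<infinity>" for i
        using hfin sum_le_suminf[of h "{i}"] by (auto simp: less_top top_unique)
      define g where "g i = enn2real (h i)" for i
      have hg: "h i = ennreal (g i)" for i using hf[of i] by (simp add: g_def less_top)
      have g0: "0 \<le> g i" for i by (simp add: g_def)
      have sg: "summable g" using hfin g0 by (intro summable_suminf_not_top) (auto simp: hg)
      have "(\<Sum>k. h (k + n)) = ennreal (\<Sum>k. g (k + n))" for n
        unfolding hg using g0 sg by (intro suminf_ennreal2) (auto simp: summable_iff_shift)
      moreover have "(\<lambda>n. \<Sum>k. g (k + n)) \<longlonglongrightarrow> 0" using sg by (rule suminf_exist_split2)
      ultimately show ?thesis by (simp add: tendsto_ennrealI[where x=0, simplified])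
    qed
    then have "(\<lambda>n. hausdorff_outer m T + (\<Sum>k. h (k + n))) \<longlonglongrightarrow> hausdorff_outer m T + 0"
      by (intro tendsto_add tendsto_const)
    then show ?thesis using le by (intro LIMSEQ_le_const) auto
  qed simp
  moreover have "hausdorff_outer m T \<le> hausdorff_outer m (F \<inter> T) + hausdorff_outer m (T - F)" for T
    using hausdorff_outer_Un_le[of m "F \<inter> T" "T - F"] Int_Diff_Un[of T F] by (simp add: Int_commute)
  ultimately show ?thesis
    by (auto simp: lambda_system_def Compl_eq_Diff_UNIV[symmetric] Diff_eq Int_commute intro: antisym)
qed

text \<open>\<open>measure_of\<close> gives the zero measure unless the set function is countably
  additive on the Borel sets. This is supplied by Caratheodory's theorem: the measurable sets of the
  outer measure form a sigma-algebra that contains the closed sets.\<close>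

lemma emeasure_hausdorff_measure:
  assumes "A \<in> sets borel"
  shows "emeasure (hausdorff_measure m) A = hausdorff_outer m A"
proof -
  interpret sigma_algebra UNIV "UNIV :: 'a set set" using sigma_algebra_Pow[of UNIV] by simp
  have ms: "measure_space UNIV (lambda_system UNIV UNIV (hausdorff_outer m :: 'a set \<Rightarrow> _)) (hausdorff_outer m)"
    by (rule caratheodory_lemma) (rule hausdorff_outer_space, simp)
  then interpret L: sigma_algebra UNIV "lambda_system UNIV UNIV (hausdorff_outer m :: 'a set \<Rightarrow> _)"
    by (simp add: measure_space_def)
  have "sets borel \<subseteq> lambda_system UNIV UNIV (hausdorff_outer m :: 'a set \<Rightarrow> _)"
    unfolding borel_eq_closed
    by (simp, intro L.sigma_sets_subset subsetI hausdorff_outer_closed_lambda) auto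
  with ms have "measure_space UNIV (sets borel) (hausdorff_outer m :: 'a set \<Rightarrow> _)"
    by (intro measure_down[OF ms]) (auto intro: sets.sigma_algebra_axioms[of borel, simplified])
  then show ?thesis
    unfolding hausdorff_measure_def hausdorff_outer_def[abs_def]
    using assms sets.sigma_algebra_axioms[of "borel :: 'a measure"] sets.sigma_sets_eq[of "borel :: 'a measure"]
    by (intro emeasure_measure_of) (auto simp: measure_space_def)
qed

lemma sets_hausdorff_measure [measurable_cong, simp]: "sets (hausdorff_measure m) = sets borel"
  unfolding hausdorff_measure_def using sets.sigma_sets_eq[of borel] by (simp add: sets_measure_of_conv)

section \<open>Lebesgue integrals under translations, dilations and orthogonal maps\<close>

lemma nn_integral_lborel_shift:
  fixes f :: "'a::euclidean_space \<Rightarrow> ennreal"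
  assumes [measurable]: "f \<in> borel_measurable borel"
  shows "(\<integral>\<^sup>+x. f (x + c) \<partial>lborel) = (\<integral>\<^sup>+x. f x \<partial>lborel)"
  by (subst (2) lborel_distr_plus[of c, symmetric]) (simp add: nn_integral_distr add.commute)

lemma nn_integral_lborel_scale:
  fixes f :: "'a::euclidean_space \<Rightarrow> ennreal"
  assumes [measurable]: "f \<in> borel_measurable borel" and c: "c \<noteq> 0"
  shows "(\<integral>\<^sup>+x. f x \<partial>lborel) = ennreal (\<bar>c\<bar> ^ DIM('a)) * (\<integral>\<^sup>+x. f (c *\<^sub>R x) \<partial>lborel)"
  by (subst lborel_affine[OF c, of 0]) (simp add: nn_integral_density nn_integral_distr nn_integral_cmult)

lemma nn_integral_lborel_reflect:
  fixes f :: "'a::euclidean_space \<Rightarrow> ennreal"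
  assumes [measurable]: "f \<in> borel_measurable borel"
  shows "(\<integral>\<^sup>+x. f (c - x) \<partial>lborel) = (\<integral>\<^sup>+x. f x \<partial>lborel)"
  using nn_integral_lborel_scale[of "\<lambda>x. f (x + c)" "-1"] nn_integral_lborel_shift[of f c]
  by (simp add: add.commute)

text \<open>Integrating the indicator of \<open>f -` A\<close> against that of the unit ball in two ways
  determines the measure of \<open>f -` A\<close>, because the unit ball is invariant under \<open>f\<close>.\<close>

lemma distr_lborel_orthogonal:
  fixes f :: "'a::euclidean_space \<Rightarrow> 'a"
  assumes f: "orthogonal_transformation f"
  shows "distr lborel borel f = lborel"
proof (rule measure_eqI)
  fix A assume "A \<in> sets (distr lborel borel f)"
  then have A[measurable]: "A \<in> sets borel" by simp
  have lin: "linear f" using f by (rule orthogonal_transformation_linear)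
  then have cont: "continuous_on UNIV f" by (rule linear_continuous_on[OF linear_conv_bounded_linear[THEN iffD1]])
  then have [measurable]: "f \<in> borel_measurable borel" by (rule borel_measurable_continuous_onI)
  obtain g where g: "orthogonal_transformation g" "\<And>x. f (g x) = x"
    using orthogonal_transformation_inv[OF f] orthogonal_transformation_surj[OF f] by (metis surj_f_inv_f)
  have "linear g" using g(1) by (rule orthogonal_transformation_linear)
  then have "continuous_on UNIV g" by (rule linear_continuous_on[OF linear_conv_bounded_linear[THEN iffD1]])
  then have [measurable]: "g \<in> borel_measurable borel" by (rule borel_measurable_continuous_onI)
  define B where "B = (ball 0 1 :: 'a set)"
  have [measurable]: "B \<in> sets borel" by (simp add: B_def)
  have "emeasure lborel (f -` A) * emeasure lborel B =
      (\<integral>\<^sup>+y. (\<integral>\<^sup>+x. indicator A (f x) * indicator B y \<partial>lborel) \<partial>lborel)"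
  proof -
    have "emeasure lborel (f -` A) = (\<integral>\<^sup>+x. indicator A (f x) \<partial>lborel)"
      using measurable_sets[of f borel borel A]
      by (simp add: nn_integral_indicator[symmetric] indicator_vimage[symmetric] o_def del: nn_integral_indicator)
    then show ?thesis by (simp add: nn_integral_multc nn_integral_cmult)
  qed
  also have "\<dots> = (\<integral>\<^sup>+y. (\<integral>\<^sup>+x. indicator A (f x + y) * indicator B y \<partial>lborel) \<partial>lborel)"
  proof (rule nn_integral_cong)
    fix y :: 'a
    have "f (x + g y) = f x + y" for x using lin g(2) by (simp add: linear_add)
    then show "(\<integral>\<^sup>+x. indicator A (f x) * indicator B y \<partial>lborel) = (\<integral>\<^sup>+x. indicator A (f x + y) * indicator B y \<partial>lborel)"
      using nn_integral_lborel_shift[of "\<lambda>x. indicator A (f x) * indicator B y" "g y"] by simp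
  qed
  also have "\<dots> = (\<integral>\<^sup>+x. (\<integral>\<^sup>+y. indicator A (f x + y) * indicator B y \<partial>lborel) \<partial>lborel)"
    by (rule lborel_pair.Fubini') simp
  also have "\<dots> = (\<integral>\<^sup>+x. (\<integral>\<^sup>+y. indicator A y * indicator B (y - f x) \<partial>lborel) \<partial>lborel)"
  proof (rule nn_integral_cong)
    fix x :: 'a show "(\<integral>\<^sup>+y. indicator A (f x + y) * indicator B y \<partial>lborel) = (\<integral>\<^sup>+y. indicator A y * indicator B (y - f x) \<partial>lborel)"
      using nn_integral_lborel_shift[of "\<lambda>y. indicator A y * indicator B (y - f x)" "f x"] by (simp add: add.commute)
  qed
  also have "\<dots> = (\<integral>\<^sup>+y. (\<integral>\<^sup>+x. indicator A y * indicator B (y - f x) \<partial>lborel) \<partial>lborel)"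
    by (rule lborel_pair.Fubini'[symmetric]) simp
  also have "\<dots> = (\<integral>\<^sup>+y. (\<integral>\<^sup>+x. indicator A y * indicator B (g y - x) \<partial>lborel) \<partial>lborel)"
  proof -
    have "(indicator B (y - f x) :: ennreal) = indicator B (g y - x)" for x y
    proof -
      have "norm (y - f x) = norm (f (g y - x))" using lin g(2) by (simp add: linear_diff)
      also have "\<dots> = norm (g y - x)" using f by (simp add: orthogonal_transformation_norm)
      finally show ?thesis by (simp add: B_def indicator_def)
    qed
    then show ?thesis by simp
  qed
  also have "\<dots> = (\<integral>\<^sup>+y. indicator A y * emeasure lborel B \<partial>lborel)"
    by (intro nn_integral_cong) (simp add: nn_integral_cmult nn_integral_lborel_reflect[of "indicator B"])
  also have "\<dots> = emeasure lborel A * emeasure lborel B" by (simp add: nn_integral_multc)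
  finally have "emeasure lborel (f -` A) * emeasure lborel B = emeasure lborel A * emeasure lborel B" .
  moreover have "emeasure lborel B \<noteq> 0" "emeasure lborel B \<noteq> \<top>"
    using emeasure_ball[of 1 "0::'a"] unit_ball_vol_pos[of "real DIM('a)"]
    by (auto simp: B_def simp del: unit_ball_vol_pos)
  ultimately have "emeasure lborel (f -` A) = emeasure lborel A"
    by (metis mult.commute ennreal_mult_cancel_left)
  then show "emeasure (distr lborel borel f) A = emeasure lborel A"
    by (simp add: emeasure_distr)
qed simp

text \<open>The reflection in the hyperplane orthogonal to v = a - b exchanges a and b, because 2 (a
  \<bullet> v) = v \<bullet> v for unit vectors.\<close>

lemma exists_orthogonal_transformation_unit:
  fixes a b :: "'a::euclidean_space"
  assumes "norm a = 1" "norm b = 1"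
  obtains f where "orthogonal_transformation f" "f a = b"
proof (cases "a = b")
  case True
  then show ?thesis using that[of "\<lambda>x. x"] by simp
next
  case False
  define v where "v = a - b"
  have v0: "v \<bullet> v \<noteq> 0" using False by (simp add: v_def)
  define f where "f x = x - (2 * (x \<bullet> v) / (v \<bullet> v)) *\<^sub>R v" for x
  have "linear f" unfolding f_def
    by (rule linearI) (simp_all add: algebra_simps inner_add_left add_divide_distrib)
  moreover have "f x \<bullet> f y = x \<bullet> y" for x y
  proof -
    have "f x \<bullet> f y = x \<bullet> y - 2 * (x \<bullet> v) / (v \<bullet> v) * (v \<bullet> y) - 2 * (y \<bullet> v) / (v \<bullet> v) * (x \<bullet> v)
        + (2 * (x \<bullet> v) / (v \<bullet> v)) * (2 * (y \<bullet> v) / (v \<bullet> v)) * (v \<bullet> v)"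
      by (simp add: f_def inner_diff_left inner_diff_right algebra_simps)
    then show ?thesis using v0 by (simp add: field_simps inner_commute)
  qed
  ultimately have "orthogonal_transformation f" by (simp add: orthogonal_transformation_def)
  moreover have "2 * (a \<bullet> v) = v \<bullet> v"
    using assms by (simp add: v_def inner_diff_left inner_diff_right norm_eq_1 inner_commute)
  then have "f a = b" using v0 by (simp add: f_def v_def)
  ultimately show ?thesis by (rule that)
qed

section \<open>Steiner symmetrization and an isodiametric inequality\<close>

text \<open>The parameter t is the coordinate along b and not the offset from x, so for a unit
  vector b all points of a line parallel to b have the same section.\<close>

definition line_section :: "'a::euclidean_space \<Rightarrow> 'a set \<Rightarrow> 'a \<Rightarrow> real set" where
  "line_section b A x = {t. x - (x \<bullet> b) *\<^sub>R b + t *\<^sub>R b \<in> A}"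

text \<open>The strict inequality replaces a section by the open centred interval of the same length
  and deletes null sections, so every point of the symmetrized set has a nonempty section of A
  behind it. A section of infinite length becomes the whole line.\<close>

definition steiner :: "'a::euclidean_space \<Rightarrow> 'a set \<Rightarrow> 'a set" where
  "steiner b A = {x. ennreal (2 * \<bar>x \<bullet> b\<bar>) < emeasure lborel (line_section b A x)}"

lemma sets_line_section [measurable]:
  assumes [measurable]: "A \<in> sets borel"
  shows "line_section b A x \<in> sets borel"
proof -
  have "(\<lambda>t. x - (x \<bullet> b) *\<^sub>R b + t *\<^sub>R b) -` A \<inter> space borel \<in> sets borel" by measurable
  then show ?thesis by (simp add: line_section_def vimage_def)
qed

lemma measurable_emeasure_line_section:
  assumes [measurable]: "A \<in> sets borel"
  shows "(\<lambda>x. emeasure lborel (line_section b A x)) \<in> borel_measurable borel"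
proof -
  have "emeasure lborel (line_section b A x) = (\<integral>\<^sup>+t. indicator A (x - (x \<bullet> b) *\<^sub>R b + t *\<^sub>R b) \<partial>lborel)" for x
    by (simp add: nn_integral_indicator[symmetric] del: nn_integral_indicator)
       (intro nn_integral_cong, simp add: line_section_def indicator_def)
  moreover have "(\<lambda>x. \<integral>\<^sup>+t. indicator A (x - (x \<bullet> b) *\<^sub>R b + t *\<^sub>R b) \<partial>lborel) \<in> borel_measurable borel"
  proof (rule lborel.borel_measurable_nn_integral)
    have 1: "(\<lambda>z. fst z - (fst z \<bullet> b) *\<^sub>R b + snd z *\<^sub>R b) \<in> borel \<Otimes>\<^sub>M (lborel :: real measure) \<rightarrow>\<^sub>M borel"
      by measurable
    have 2: "(indicator A :: 'a \<Rightarrow> ennreal) \<in> borel_measurable borel"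
      by (rule borel_measurable_indicator) fact
    show "(\<lambda>(x, t). indicator A (x - (x \<bullet> b) *\<^sub>R b + t *\<^sub>R b) :: ennreal) \<in> borel_measurable (borel \<Otimes>\<^sub>M lborel)"
      using measurable_compose[OF 1 2] by (simp add: case_prod_beta)
  qed
  ultimately show ?thesis by presburger
qed

lemma sets_steiner [measurable]:
  assumes "A \<in> sets borel"
  shows "steiner b A \<in> sets borel"
proof -
  have "(\<lambda>x. ennreal (2 * \<bar>x \<bullet> b\<bar>)) \<in> borel_measurable borel" by measurable
  from borel_measurable_less[OF this measurable_emeasure_line_section[OF assms, of b]]
  show ?thesis by (simp add: steiner_def)
qed

text \<open>Tonelli with the coordinate along b singled out. Lines as inner integrals serve for
  symmetrization, hyperplanes for slicing cones by height.\<close>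

lemma nn_integral_lborel_split:
  fixes f :: "'a::euclidean_space \<Rightarrow> ennreal"
  assumes [measurable]: "f \<in> borel_measurable borel" and b: "b \<in> Basis"
  defines "\<iota> \<equiv> \<lambda>g. \<Sum>i\<in>Basis - {b}. g i *\<^sub>R i"
  shows "(\<integral>\<^sup>+x. f x \<partial>lborel) = (\<integral>\<^sup>+g. (\<integral>\<^sup>+t. f (\<iota> g + t *\<^sub>R b) \<partial>lborel) \<partial>(\<Pi>\<^sub>M i\<in>Basis - {b}. lborel))"
    and "(\<integral>\<^sup>+x. f x \<partial>lborel) = (\<integral>\<^sup>+t. (\<integral>\<^sup>+g. f (\<iota> g + t *\<^sub>R b) \<partial>(\<Pi>\<^sub>M i\<in>Basis - {b}. lborel)) \<partial>lborel)"
proof -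
  interpret P: product_sigma_finite "\<lambda>_::'a. lborel :: real measure" ..
  interpret Q: finite_product_sigma_finite "\<lambda>_::'a. lborel :: real measure" "Basis - {b}" by standard simp
  interpret pair_sigma_finite "\<Pi>\<^sub>M i\<in>Basis - {b}. lborel :: real measure" "lborel :: real measure" ..
  have B: "insert b (Basis - {b}) = (Basis :: 'a set)" using b by auto
  have [measurable]: "(\<lambda>f. \<Sum>b\<in>Basis. f b *\<^sub>R (b::'a)) \<in> measurable (Pi\<^sub>M Basis (\<lambda>_. lborel)) borel"
    by measurable
  have "(\<integral>\<^sup>+x. f x \<partial>lborel) = (\<integral>\<^sup>+h. f (\<Sum>i\<in>Basis. h i *\<^sub>R i) \<partial>(\<Pi>\<^sub>M i\<in>Basis. lborel))"
    by (subst lborel_eq) (simp add: nn_integral_distr)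
  also have "\<dots> = (\<integral>\<^sup>+g. (\<integral>\<^sup>+t. f (\<Sum>i\<in>Basis. (g(b := t)) i *\<^sub>R i) \<partial>lborel) \<partial>(\<Pi>\<^sub>M i\<in>Basis - {b}. lborel))"
    by (subst B[symmetric], subst P.product_nn_integral_insert) (simp_all add: B)
  also have "(\<lambda>g t. f (\<Sum>i\<in>Basis. (g(b := t)) i *\<^sub>R i)) = (\<lambda>g t. f (\<iota> g + t *\<^sub>R b))"
  proof (intro ext arg_cong[of _ _ f])
    fix g :: "'a \<Rightarrow> real" and t
    have "(\<Sum>i\<in>Basis. (g(b := t)) i *\<^sub>R i) = t *\<^sub>R b + (\<Sum>i\<in>Basis - {b}. (g(b := t)) i *\<^sub>R i)"
      using b by (subst sum.remove[of _ b]) auto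
    also have "(\<Sum>i\<in>Basis - {b}. (g(b := t)) i *\<^sub>R i) = \<iota> g" unfolding \<iota>_def by (rule sum.cong) auto
    finally show "(\<Sum>i\<in>Basis. (g(b := t)) i *\<^sub>R i) = \<iota> g + t *\<^sub>R b" by simp
  qed
  finally show 1: "(\<integral>\<^sup>+x. f x \<partial>lborel) = (\<integral>\<^sup>+g. (\<integral>\<^sup>+t. f (\<iota> g + t *\<^sub>R b) \<partial>lborel) \<partial>(\<Pi>\<^sub>M i\<in>Basis - {b}. lborel))" .
  have [measurable]: "(\<lambda>x. f (\<iota> (fst x) + snd x *\<^sub>R b)) \<in> borel_measurable ((\<Pi>\<^sub>M i\<in>Basis - {b}. lborel) \<Otimes>\<^sub>M lborel)"
    unfolding \<iota>_def by measurable
  show "(\<integral>\<^sup>+x. f x \<partial>lborel) = (\<integral>\<^sup>+t. (\<integral>\<^sup>+g. f (\<iota> g + t *\<^sub>R b) \<partial>(\<Pi>\<^sub>M i\<in>Basis - {b}. lborel)) \<partial>lborel)"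
    unfolding 1 by (rule Fubini'[symmetric]) (simp add: case_prod_beta)
qed

lemma emeasure_lborel_centered_interval:
  "emeasure lborel {t::real. ennreal (2 * \<bar>t\<bar>) < l} = l"
proof (cases l)
  case (real r)
  then have "{t::real. ennreal (2 * \<bar>t\<bar>) < l} = {- r / 2<..<r / 2}"
    by (auto simp: ennreal_less_iff abs_if)
  with real show ?thesis by simp
qed (simp add: less_top[symmetric])

lemma inner_sum_Basis_remove:
  fixes b :: "'a::euclidean_space"
  assumes "b \<in> Basis"
  shows "(\<Sum>i\<in>Basis - {b}. g i *\<^sub>R i) \<bullet> b = 0"
  using assms by (auto simp: inner_sum_left inner_Basis intro!: sum.neutral)

lemma emeasure_steiner:
  fixes b :: "'a::euclidean_space"
  assumes [measurable]: "A \<in> sets borel" and b: "b \<in> Basis"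
  shows "emeasure lborel (steiner b A) = emeasure lborel A"
proof -
  let ?i = "\<lambda>g. \<Sum>i\<in>Basis - {b}. g i *\<^sub>R i"
  have *: "(?i g + t *\<^sub>R b) \<bullet> b = t" for g t
    using b inner_sum_Basis_remove[OF b] by (simp add: inner_add_left)
  have l: "line_section b A (?i g + t *\<^sub>R b) = {s. ?i g + s *\<^sub>R b \<in> A}" for g t
    unfolding line_section_def * by simp
  have [measurable]: "{s. ?i g + s *\<^sub>R b \<in> A} \<in> sets borel" for g :: "'a \<Rightarrow> real" by measurable
  have "emeasure lborel (steiner b A) = (\<integral>\<^sup>+x. indicator (steiner b A) x \<partial>lborel)" by simp
  also have "\<dots> = (\<integral>\<^sup>+g. (\<integral>\<^sup>+t. indicator (steiner b A) (?i g + t *\<^sub>R b) \<partial>lborel) \<partial>(\<Pi>\<^sub>M i\<in>Basis - {b}. lborel))"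
    by (rule nn_integral_lborel_split) (use b in auto)
  also have "\<dots> = (\<integral>\<^sup>+g. (\<integral>\<^sup>+t. indicator A (?i g + t *\<^sub>R b) \<partial>lborel) \<partial>(\<Pi>\<^sub>M i\<in>Basis - {b}. lborel))"
  proof (rule nn_integral_cong)
    fix g :: "'a \<Rightarrow> real"
    have "(\<integral>\<^sup>+t. indicator (steiner b A) (?i g + t *\<^sub>R b) \<partial>lborel) =
      (\<integral>\<^sup>+t. indicator {t. ennreal (2 * \<bar>t\<bar>) < emeasure lborel {s. ?i g + s *\<^sub>R b \<in> A}} t \<partial>lborel)"
      by (intro nn_integral_cong) (simp add: steiner_def l * indicator_def)
    also have "\<dots> = emeasure lborel {s. ?i g + s *\<^sub>R b \<in> A}"
      by (simp add: emeasure_lborel_centered_interval)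
    also have "\<dots> = (\<integral>\<^sup>+t. indicator {s. ?i g + s *\<^sub>R b \<in> A} t \<partial>lborel)" by simp
    also have "\<dots> = (\<integral>\<^sup>+t. indicator A (?i g + t *\<^sub>R b) \<partial>lborel)"
      by (intro nn_integral_cong) (simp add: indicator_def)
    finally show "(\<integral>\<^sup>+t. indicator (steiner b A) (?i g + t *\<^sub>R b) \<partial>lborel) = (\<integral>\<^sup>+t. indicator A (?i g + t *\<^sub>R b) \<partial>lborel)" .
  qed
  also have "\<dots> = (\<integral>\<^sup>+x. indicator A x \<partial>lborel)"
    by (rule nn_integral_lborel_split[symmetric]) (use b in auto)
  finally show ?thesis by simp
qed

text \<open>Let c be the distance of the two b-coordinates. If all points s, t of the two sections
  X, Y were closer than c, then X would lie between sup Y - c and inf Y + c, so the lengths of X and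
  Y would add up to at most 2 c. But they exceed twice the absolute values of the two coordinates,
  whose sum is at least c.\<close>

lemma steiner_points_spread:
  assumes A: "A \<in> sets borel" and x: "x \<in> steiner b A" and y: "y \<in> steiner b A"
  obtains s t where "s \<in> line_section b A x" "t \<in> line_section b A y" "\<bar>x \<bullet> b - y \<bullet> b\<bar> \<le> \<bar>s - t\<bar>"
proof (rule ccontr)
  assume no: "\<not> thesis"
  note spread = that
  define c where "c = \<bar>x \<bullet> b - y \<bullet> b\<bar>"
  let ?X = "line_section b A x" and ?Y = "line_section b A y"
  have lt: "\<bar>s - t\<bar> < c" if "s \<in> ?X" "t \<in> ?Y" for s t using no spread[of s t] that unfolding c_def by force
  have ne: "?X \<noteq> {}" "?Y \<noteq> {}" using x y by (auto simp: steiner_def)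
  then obtain s0 t0 where s0: "s0 \<in> ?X" and t0: "t0 \<in> ?Y" by auto
  have bdd: "bdd_above ?Y" "bdd_below ?Y"
    using lt[OF s0] by (auto intro!: bdd_aboveI[of _ "s0 + c"] bdd_belowI[of _ "s0 - c"] simp: abs_less_iff) 
       (smt (verit))+
  have X: "?X \<subseteq> {Sup ?Y - c .. Inf ?Y + c}"
  proof
    fix s assume s: "s \<in> ?X"
    have "Sup ?Y \<le> s + c" using lt[OF s] ne by (intro cSup_least) (auto simp: abs_less_iff, smt)
    moreover have "s - c \<le> Inf ?Y" using lt[OF s] ne by (intro cInf_greatest) (auto simp: abs_less_iff, smt)
    ultimately show "s \<in> {Sup ?Y - c .. Inf ?Y + c}" by auto
  qed
  have Y: "?Y \<subseteq> {Inf ?Y .. Sup ?Y}" using bdd by (auto intro: cInf_lower cSup_upper)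
  have 1: "emeasure lborel ?X \<le> ennreal (Inf ?Y - Sup ?Y + 2 * c)"
    using emeasure_mono[OF X, of lborel] X s0 by (auto simp: algebra_simps)
  have 2: "emeasure lborel ?Y \<le> ennreal (Sup ?Y - Inf ?Y)"
    using emeasure_mono[OF Y, of lborel] Y t0 by auto
  have "ennreal (2 * \<bar>x \<bullet> b\<bar>) < ennreal (Inf ?Y - Sup ?Y + 2 * c)"
    "ennreal (2 * \<bar>y \<bullet> b\<bar>) < ennreal (Sup ?Y - Inf ?Y)"
    using x y 1 2 by (auto simp: steiner_def)
  then have "2 * \<bar>x \<bullet> b\<bar> < Inf ?Y - Sup ?Y + 2 * c" "2 * \<bar>y \<bullet> b\<bar> < Sup ?Y - Inf ?Y"
    by (auto simp: ennreal_less_iff)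
  then show False unfolding c_def using abs_triangle_ineq4[of "x \<bullet> b" "y \<bullet> b"] by argo
qed

text \<open>Only the heights and the diameters of the horizontal slices are prescribed, the latter
  growing linearly as in a cone. This covers open cones over spherical sets, which are cut off by
  the unit sphere and not at a fixed height, and it survives symmetrization.\<close>

definition conical :: "'a::euclidean_space \<Rightarrow> real \<Rightarrow> 'a set \<Rightarrow> bool" where
  "conical e D A \<longleftrightarrow> (\<forall>x\<in>A. 0 < x \<bullet> e \<and> x \<bullet> e < 1)
     \<and> (\<forall>x\<in>A. \<forall>y\<in>A. x \<bullet> e = y \<bullet> e \<longrightarrow> norm (x - y) \<le> D * (x \<bullet> e))"

text \<open>As b is orthogonal to e, symmetrization acts within the horizontal slices. Two points of
  the new set are compared with two points of A on the same lines whose b-coordinates are at least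
  as far apart; the components orthogonal to b agree, and Pythagoras concludes.\<close>

lemma steiner_conical:
  assumes A: "A \<in> sets borel" and c: "conical e D A" and b: "b \<in> Basis" "b \<bullet> e = 0"
  shows "conical e D (steiner b A)"
  unfolding conical_def
proof (intro conjI ballI impI)
  have ex: "\<exists>t. t \<in> line_section b A x" if "x \<in> steiner b A" for x
    using that by (cases "line_section b A x = {}") (auto simp: steiner_def)
  have e: "(x - (x \<bullet> b) *\<^sub>R b + t *\<^sub>R b) \<bullet> e = x \<bullet> e" for x t
    using b by (simp add: inner_diff_left inner_add_left)
  show "0 < x \<bullet> e" "x \<bullet> e < 1" if "x \<in> steiner b A" for x
    using ex[OF that] c e[of x] unfolding conical_def line_section_def by (metis mem_Collect_eq)+
  fix x y assume xy: "x \<in> steiner b A" "y \<in> steiner b A" "x \<bullet> e = y \<bullet> e"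
  obtain s t where st: "s \<in> line_section b A x" "t \<in> line_section b A y" "\<bar>x \<bullet> b - y \<bullet> b\<bar> \<le> \<bar>s - t\<bar>"
    using steiner_points_spread[OF A xy(1,2)] .
  define x' where "x' = x - (x \<bullet> b) *\<^sub>R b + s *\<^sub>R b"
  define y' where "y' = y - (y \<bullet> b) *\<^sub>R b + t *\<^sub>R b"
  define d where "d = x - (x \<bullet> b) *\<^sub>R b - (y - (y \<bullet> b) *\<^sub>R b)"
  have bb: "b \<bullet> b = 1" using b by simp
  have db: "d \<bullet> b = 0" by (simp add: d_def inner_diff_left bb)
  have pyth: "(norm (d + r *\<^sub>R b))\<^sup>2 = (norm d)\<^sup>2 + r\<^sup>2" for r
    using db bb unfolding power2_norm_eq_inner inner_add_left inner_add_right
    by (simp add: inner_commute[of b d] power2_eq_square)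
  have "norm (x - y) \<le> norm (x' - y')"
  proof (rule power2_le_imp_le)
    have "(norm (x - y))\<^sup>2 = (norm d)\<^sup>2 + (x \<bullet> b - y \<bullet> b)\<^sup>2"
      using pyth[of "x \<bullet> b - y \<bullet> b"] by (simp add: d_def algebra_simps)
    also have "\<dots> \<le> (norm d)\<^sup>2 + (s - t)\<^sup>2" using st(3) by (simp add: abs_le_square_iff)
    also have "\<dots> = (norm (x' - y'))\<^sup>2"
      using pyth[of "s - t"] by (simp add: d_def x'_def y'_def algebra_simps)
    finally show "(norm (x - y))\<^sup>2 \<le> (norm (x' - y'))\<^sup>2" .
  qed simp
  also have "\<dots> \<le> D * (x' \<bullet> e)"
    using c st(1,2) xy(3) e[of x s] e[of y t] unfolding conical_def line_section_def x'_def y'_def mem_Collect_eq by metis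
  also have "x' \<bullet> e = x \<bullet> e" unfolding x'_def by (rule e)
  finally show "norm (x - y) \<le> D * (x \<bullet> e)" .
qed

definition reflect :: "'a::real_inner \<Rightarrow> 'a \<Rightarrow> 'a" where
  "reflect b x = x - (2 * (x \<bullet> b)) *\<^sub>R b"

lemma steiner_reflect_self:
  assumes "b \<in> Basis" "x \<in> steiner b A"
  shows "reflect b x \<in> steiner b A"
proof -
  have "reflect b x \<bullet> b = - (x \<bullet> b)" using assms by (simp add: reflect_def inner_diff_left)
  moreover have "reflect b x - (- (x \<bullet> b)) *\<^sub>R b = x - (x \<bullet> b) *\<^sub>R b"
    unfolding reflect_def mult_2 scaleR_left_distrib by simp
  then have "line_section b A (reflect b x) = line_section b A x"
    unfolding line_section_def \<open>reflect b x \<bullet> b = _\<close> by simp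
  ultimately show ?thesis using assms by (simp add: steiner_def)
qed

text \<open>A reflection in a direction orthogonal to b maps sections along b to sections along b
  with the same parameter, so symmetrizing in b keeps the symmetries obtained before.\<close>

lemma steiner_reflect_other:
  assumes c: "c \<in> Basis" "c \<noteq> b" "b \<in> Basis" and A: "\<And>x. x \<in> A \<Longrightarrow> reflect c x \<in> A" and x: "x \<in> steiner b A"
  shows "reflect c x \<in> steiner b A"
proof -
  have cb: "c \<bullet> b = 0" "b \<bullet> c = 0" using c by (auto simp: inner_Basis)
  have rb: "reflect c x \<bullet> b = x \<bullet> b" using cb by (simp add: reflect_def inner_diff_left)
  have inv: "reflect c (reflect c z) = z" for z
    using c by (simp add: reflect_def inner_diff_left algebra_simps)
  have "reflect c x - (x \<bullet> b) *\<^sub>R b + t *\<^sub>R b = reflect c (x - (x \<bullet> b) *\<^sub>R b + t *\<^sub>R b)" for t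
    using cb by (simp add: reflect_def inner_diff_left inner_add_left algebra_simps)
  then have "line_section b A (reflect c x) = line_section b A x"
    unfolding line_section_def rb using A inv by (auto, metis)
  then show ?thesis using x rb by (simp add: steiner_def)
qed

lemma steiner_iterate:
  fixes e :: "'a::euclidean_space"
  assumes "finite B" "B \<subseteq> Basis - {e}" and e: "e \<in> Basis" and A: "A \<in> sets borel" "conical e D A"
  shows "\<exists>A'. A' \<in> sets borel \<and> conical e D A' \<and> emeasure lborel A' = emeasure lborel A
    \<and> (\<forall>b\<in>B. \<forall>x\<in>A'. reflect b x \<in> A')"
  using assms(1,2)
proof (induction B)
  case empty then show ?case using A by auto
next
  case (insert b B)
  then obtain A' where A': "A' \<in> sets borel" "conical e D A'" "emeasure lborel A' = emeasure lborel A"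
    "\<forall>b\<in>B. \<forall>x\<in>A'. reflect b x \<in> A'" by auto
  have b: "b \<in> Basis" "b \<bullet> e = 0" using insert.prems e by (auto simp: inner_Basis)
  show ?case
  proof (intro exI[of _ "steiner b A'"] conjI ballI)
    show "reflect c x \<in> steiner b A'" if "c \<in> insert b B" "x \<in> steiner b A'" for c x
      using that insert.prems insert.hyps A'(4) b
      by (cases "c = b") (auto intro!: steiner_reflect_self steiner_reflect_other)
  qed (use A' b in \<open>auto intro: steiner_conical simp: emeasure_steiner\<close>)
qed

text \<open>Cavalieri's principle: the slice at height t is a ball of radius s t in one dimension
  less.\<close>

lemma emeasure_flat_cone:
  fixes e :: "'a::euclidean_space"
  assumes e: "e \<in> Basis" and s: "0 < s" and a: "0 \<le> a"
  shows "emeasure lborel {x. 0 < x \<bullet> e \<and> x \<bullet> e < a \<and> norm (x - (x \<bullet> e) *\<^sub>R e) \<le> s * (x \<bullet> e)}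
    = ennreal (unit_ball_vol (real (DIM('a) - 1)) * s ^ (DIM('a) - 1) * a ^ DIM('a) / DIM('a))"
proof -
  let ?A = "{x. 0 < x \<bullet> e \<and> x \<bullet> e < a \<and> norm (x - (x \<bullet> e) *\<^sub>R e) \<le> s * (x \<bullet> e)}"
  let ?m = "DIM('a) - 1"
  let ?i = "\<lambda>g. \<Sum>i\<in>Basis - {e}. g i *\<^sub>R i"
  have card: "card (Basis - {e}) = ?m" using e by simp
  have Suc: "Suc ?m = DIM('a)" by (simp add: DIM_positive)
  have [measurable]: "?A \<in> sets borel" by measurable
  have he: "(?i g + t *\<^sub>R e) \<bullet> e = t" for g t
    using e inner_sum_Basis_remove[OF e] by (simp add: inner_add_left)
  have ni: "norm (?i g) = sqrt (\<Sum>i\<in>Basis - {e}. (g i)\<^sup>2)" for g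
  proof -
    have "(norm (?i g))\<^sup>2 = (\<Sum>i\<in>Basis - {e}. g i * (\<Sum>j\<in>Basis - {e}. g j * (j \<bullet> i)))"
      by (simp add: power2_norm_eq_inner inner_sum_left inner_sum_right)
    also have "\<dots> = (\<Sum>i\<in>Basis - {e}. (g i)\<^sup>2)"
    proof (intro sum.cong refl)
      fix i assume i: "i \<in> Basis - {e}"
      then have "(\<Sum>j\<in>Basis - {e}. g j * (j \<bullet> i)) = (\<Sum>j\<in>Basis - {e}. if j = i then g j else 0)"
        by (intro sum.cong refl) (auto simp: inner_Basis)
      also have "\<dots> = g i" using i by simp
      finally show "g i * (\<Sum>j\<in>Basis - {e}. g j * (j \<bullet> i)) = (g i)\<^sup>2" by (simp add: power2_eq_square)
    qed
    finally show ?thesis by (intro real_sqrt_unique[symmetric]) auto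
  qed
  have "emeasure lborel ?A = (\<integral>\<^sup>+x. indicator ?A x \<partial>lborel)" by simp
  also have "\<dots> = (\<integral>\<^sup>+t. (\<integral>\<^sup>+g. indicator ?A (?i g + t *\<^sub>R e) \<partial>(\<Pi>\<^sub>M i\<in>Basis - {e}. lborel)) \<partial>lborel)"
    by (rule nn_integral_lborel_split) (use e in auto)
  also have "\<dots> = (\<integral>\<^sup>+t. ennreal (unit_ball_vol (real ?m) * (s * t) ^ ?m) * indicator {0<..<a} t \<partial>lborel)"
  proof (intro nn_integral_cong)
    fix t :: real
    let ?P = "\<Pi>\<^sub>M i\<in>Basis - {e}. lborel :: real measure"
    let ?S = "{g. sqrt (\<Sum>i\<in>Basis - {e}. (g i)\<^sup>2) \<le> s * t} \<inter> space ?P"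
    show "(\<integral>\<^sup>+g. indicator ?A (?i g + t *\<^sub>R e) \<partial>?P) = ennreal (unit_ball_vol (real ?m) * (s * t) ^ ?m) * indicator {0<..<a} t"
    proof (cases "t \<in> {0<..<a}")
      case True
      have "?S = {g \<in> space ?P. sqrt (\<Sum>i\<in>Basis - {e}. (g i)\<^sup>2) \<le> s * t}" by auto
      also have "\<dots> \<in> sets ?P" by measurable
      finally have S: "?S \<in> sets ?P" .
      have "(\<integral>\<^sup>+g. indicator ?A (?i g + t *\<^sub>R e) \<partial>?P) = (\<integral>\<^sup>+g. indicator ?S g \<partial>?P)"
      proof (intro nn_integral_cong)
        fix g assume "g \<in> space ?P"
        then show "indicator ?A (?i g + t *\<^sub>R e) = (indicator ?S g :: ennreal)"
          using True he[of g t] ni[of g] by (simp add: indicator_def)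
      qed
      also have "\<dots> = emeasure ?P ?S" using S by simp
      also have "\<dots> = ennreal (unit_ball_vol (real ?m) * (s * t) ^ ?m)"
        using True s card by (subst emeasure_cball_aux) auto
      finally show ?thesis using True by simp
    next
      case False
      then have "(\<integral>\<^sup>+g. indicator ?A (?i g + t *\<^sub>R e) \<partial>?P) = (\<integral>\<^sup>+g. 0 \<partial>?P)"
        using he by (intro nn_integral_cong) (auto simp: indicator_def)
      with False show ?thesis by simp
    qed
  qed
  also have "\<dots> = (\<integral>\<^sup>+t. ennreal (unit_ball_vol (real ?m) * s ^ ?m * t ^ ?m) * indicator {0..a} t \<partial>lborel)"
    by (intro nn_integral_cong_AE AE_I[of _ _ "{0,a}"])
       (auto simp: indicator_def power_mult_distrib mult.assoc emeasure_lborel_countable)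
  also have "\<dots> = ennreal (unit_ball_vol (real ?m) * s ^ ?m * a ^ DIM('a) / DIM('a) - 0)"
  proof -
    have "DERIV (\<lambda>t. unit_ball_vol (real ?m) * s ^ ?m * t ^ DIM('a) / DIM('a)) t :> unit_ball_vol (real ?m) * s ^ ?m * t ^ ?m" for t
      by (auto intro!: derivative_eq_intros)
    moreover have "0 \<le> unit_ball_vol (real ?m) * s ^ ?m * t ^ ?m" if "0 \<le> t" for t
      using that s by (intro mult_nonneg_nonneg) auto
    ultimately show ?thesis
      using a by (subst nn_integral_FTC_Icc[where F = "\<lambda>t. unit_ball_vol (real ?m) * s ^ ?m * t ^ DIM('a) / DIM('a)"])
        (auto simp: zero_power)
  qed
  finally show ?thesis by simp
qed

text \<open>The composed reflections negate all coordinates in B. For B the basis without e this is,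
  in each horizontal slice, the point reflection in the axis.\<close>

lemma sum_reflect:
  assumes "finite B" "B \<subseteq> Basis" "\<forall>b\<in>B. \<forall>x\<in>A. reflect b x \<in> A" "x \<in> A"
  shows "x - 2 *\<^sub>R (\<Sum>b\<in>B. (x \<bullet> b) *\<^sub>R b) \<in> A"
  using assms(1,2,3)
proof (induction B)
  case (insert b B)
  let ?y = "x - 2 *\<^sub>R (\<Sum>b\<in>B. (x \<bullet> b) *\<^sub>R b)"
  have "(\<Sum>c\<in>B. (x \<bullet> c) *\<^sub>R c) \<bullet> b = 0"
    using insert by (auto simp: inner_sum_left inner_Basis intro!: sum.neutral)
  then have "?y \<bullet> b = x \<bullet> b" by (simp add: inner_diff_left)
  then have "reflect b ?y = x - 2 *\<^sub>R (\<Sum>b\<in>insert b B. (x \<bullet> b) *\<^sub>R b)"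
    using insert by (simp add: reflect_def algebra_simps)
  moreover have "?y \<in> A" using insert by auto
  ultimately show ?case using insert by (metis insertI1)
qed (use assms in auto)

text \<open>After symmetrization in all directions orthogonal to e, each slice is centrally
  symmetric about the axis. A point and its mirror image are twice as far apart as the point is from
  the axis, so a slice of diameter at most D h lies in the ball of radius D h / 2.\<close>

lemma isodiametric_conical:
  fixes e :: "'a::euclidean_space"
  assumes e: "e \<in> Basis" and A: "A \<in> sets borel" "conical e D A" and D: "0 < D"
  shows "emeasure lborel A \<le> ennreal (unit_ball_vol (real (DIM('a) - 1)) * (D / 2) ^ (DIM('a) - 1) / DIM('a))"
proof -
  obtain A' where A': "A' \<in> sets borel" "conical e D A'" "emeasure lborel A' = emeasure lborel A"
    "\<forall>b\<in>Basis - {e}. \<forall>x\<in>A'. reflect b x \<in> A'"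
    using steiner_iterate[of "Basis - {e}" e A D] e A by auto
  let ?K = "{x. 0 < x \<bullet> e \<and> x \<bullet> e < 1 \<and> norm (x - (x \<bullet> e) *\<^sub>R e) \<le> D / 2 * (x \<bullet> e)}"
  have "A' \<subseteq> ?K"
  proof
    fix x assume x: "x \<in> A'"
    have "x = (\<Sum>b\<in>Basis. (x \<bullet> b) *\<^sub>R b)" by (simp add: euclidean_representation)
    also have "\<dots> = (x \<bullet> e) *\<^sub>R e + (\<Sum>b\<in>Basis - {e}. (x \<bullet> b) *\<^sub>R b)"
      using e by (subst sum.remove[of _ e]) auto
    finally have S: "(\<Sum>b\<in>Basis - {e}. (x \<bullet> b) *\<^sub>R b) = x - (x \<bullet> e) *\<^sub>R e" by (simp add: algebra_simps)
    let ?y = "x - 2 *\<^sub>R (x - (x \<bullet> e) *\<^sub>R e)"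
    have "?y \<in> A'" using sum_reflect[of "Basis - {e}" A' x] A'(4) x S by auto
    moreover have "?y \<bullet> e = x \<bullet> e" using e by (simp add: inner_diff_left)
    ultimately have "norm (x - ?y) \<le> D * (x \<bullet> e)" using A'(2) x unfolding conical_def by metis
    moreover have "norm (x - ?y) = 2 * norm (x - (x \<bullet> e) *\<^sub>R e)"
    proof -
      have "x - ?y = 2 *\<^sub>R (x - (x \<bullet> e) *\<^sub>R e)" by (simp add: algebra_simps)
      then show ?thesis by simp
    qed
    ultimately show "x \<in> ?K" using A'(2) x unfolding conical_def by auto
  qed
  then have "emeasure lborel A' \<le> emeasure lborel ?K" by (rule emeasure_mono) measurable
  also have "\<dots> = ennreal (unit_ball_vol (real (DIM('a) - 1)) * (D / 2) ^ (DIM('a) - 1) / DIM('a))"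
    using emeasure_flat_cone[OF e, of "D/2" 1] D by simp
  finally show ?thesis using A'(3) by simp
qed

section \<open>The cone measure and the Hausdorff measure on the sphere\<close>

definition open_cone :: "'a::euclidean_space set \<Rightarrow> 'a set" where
  "open_cone A = {x. x \<noteq> 0 \<and> norm x < 1 \<and> sgn x \<in> A}"

text \<open>Surface measure as the dimension N times the volume of the cone; the factor N undoes the
  integral of r^(N-1) over (0, 1). The measure lives on the whole space and is carried by the unit
  sphere, so Borel sets of the space can be used throughout.\<close>

definition cone_measure :: "'a::euclidean_space measure" where
  "cone_measure = distr (density lborel (\<lambda>x. of_nat DIM('a) * indicator (open_cone UNIV) x)) borel sgn"

lemma measurable_sgn_euclidean [measurable]: "(sgn :: 'a::euclidean_space \<Rightarrow> 'a) \<in> borel_measurable borel"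
  unfolding sgn_div_norm[abs_def] by measurable

lemma sets_open_cone [measurable]:
  fixes A :: "'a::euclidean_space set"
  assumes [measurable]: "A \<in> sets borel"
  shows "open_cone A \<in> sets borel"
proof -
  have "open_cone A = (ball 0 1 - {0}) \<inter> (sgn -` A \<inter> space borel)" by (auto simp: open_cone_def)
  also have "\<dots> \<in> sets borel" by measurable
  finally show ?thesis .
qed

lemma sets_cone_measure [simp, measurable_cong]: "sets cone_measure = sets borel"
  by (simp add: cone_measure_def)

lemma space_cone_measure [simp]: "space cone_measure = UNIV"
  by (simp add: cone_measure_def)

lemma emeasure_cone_measure:
  fixes A :: "'a::euclidean_space set"
  assumes A[measurable]: "A \<in> sets borel"
  shows "emeasure cone_measure A = of_nat DIM('a) * emeasure lborel (open_cone A)"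
proof -
  have [measurable]: "open_cone (UNIV :: 'a set) \<in> sets borel" by (rule sets_open_cone) simp
  have "emeasure cone_measure A = (\<integral>\<^sup>+x. of_nat DIM('a) * indicator (open_cone UNIV) x * indicator (sgn -` A) x \<partial>lborel)"
    unfolding cone_measure_def using A measurable_sets[OF measurable_sgn_euclidean A]
    by (subst emeasure_distr) (simp_all add: emeasure_density)
  also have "\<dots> = (\<integral>\<^sup>+x. of_nat DIM('a) * indicator (open_cone A) x \<partial>lborel)"
    by (intro nn_integral_cong) (auto simp: open_cone_def indicator_def)
  finally show ?thesis by (simp add: nn_integral_cmult)
qed

interpretation cone_measure: finite_measure "cone_measure :: 'a::euclidean_space measure"
proof
  have "emeasure lborel (open_cone UNIV :: 'a set) \<le> emeasure lborel (ball 0 1 :: 'a set)"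
    by (rule emeasure_mono) (auto simp: open_cone_def)
  also have "\<dots> < \<infinity>" using emeasure_bounded_finite[of "ball 0 1 :: 'a set"] by simp
  finally show "emeasure (cone_measure :: 'a measure) (space cone_measure) \<noteq> \<infinity>"
    by (simp add: emeasure_cone_measure ennreal_mult_eq_top_iff less_top)
qed

lemma cone_measure_orthogonal:
  fixes f :: "'a::euclidean_space \<Rightarrow> 'a"
  assumes f: "orthogonal_transformation f" and A: "A \<in> sets borel"
  shows "emeasure cone_measure (f -` A) = emeasure cone_measure A" "f -` A \<in> sets borel"
proof -
  have "linear f" using f by (rule orthogonal_transformation_linear)
  then have "continuous_on UNIV f" by (rule linear_continuous_on[OF linear_conv_bounded_linear[THEN iffD1]])
  then have mf: "f \<in> borel_measurable borel" by (rule borel_measurable_continuous_onI)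
  then show B: "f -` A \<in> sets borel" using measurable_sets[OF mf A] by simp
  have nf: "norm (f x) = norm x" for x using f by (simp add: orthogonal_transformation_norm)
  have "sgn (f x) = f (sgn x)" for x
    using nf[of x] \<open>linear f\<close> by (simp add: sgn_div_norm linear_scale)
  moreover have "f x = 0 \<longleftrightarrow> x = 0" for x using nf[of x] by (metis norm_eq_zero)
  ultimately have "open_cone (f -` A) = f -` open_cone A"
    by (auto simp: open_cone_def nf)
  moreover have "emeasure lborel (f -` open_cone A) = emeasure (distr lborel borel f) (open_cone A)"
    using mf A by (simp add: emeasure_distr sets_open_cone)
  ultimately show "emeasure cone_measure (f -` A) = emeasure cone_measure A"
    using A B by (simp add: emeasure_cone_measure distr_lborel_orthogonal[OF f])
qed

lemma obtain_orthogonal_Basis: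
  fixes e :: "'a::euclidean_space"
  assumes "norm e = 1"
  obtains f :: "'a \<Rightarrow> 'a" and b where "orthogonal_transformation f" "b \<in> Basis" "f b = e"
proof -
  obtain b :: 'a where b: "b \<in> Basis" using nonempty_Basis by blast
  from b obtain f :: "'a \<Rightarrow> 'a" where f: "orthogonal_transformation f" "f b = e"
    using exists_orthogonal_transformation_unit[of b e] assms by (metis norm_Basis)
  from that[OF f(1) b f(2)] show ?thesis .
qed

text \<open>The gnomonic projection \<open>x \<mapsto> x / (x \<bullet> e)\<close> maps the set onto the section at height one
  of the cone over it.\<close>

lemma cone_measure_le_gnomonic:
  fixes e :: "'a::euclidean_space"
  assumes e: "norm e = 1" and C: "C \<in> sets borel" "C \<subseteq> sphere 0 1" and D: "0 < D"
    and pos: "\<And>x. x \<in> C \<Longrightarrow> 0 < x \<bullet> e"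
    and dist: "\<And>x y. x \<in> C \<Longrightarrow> y \<in> C \<Longrightarrow> norm (x /\<^sub>R (x \<bullet> e) - y /\<^sub>R (y \<bullet> e)) \<le> D"
  shows "emeasure cone_measure C \<le> ennreal (unit_ball_vol (real (DIM('a) - 1)) * (D / 2) ^ (DIM('a) - 1))"
proof -
  \<comment> \<open>Symmetrization works in coordinate directions, so the axis e is rotated to a
    basis vector.\<close>
  obtain f :: "'a \<Rightarrow> 'a" and b where f: "orthogonal_transformation f" and b: "b \<in> Basis" "f b = e"
    using obtain_orthogonal_Basis[OF e] .
  have lin: "linear f" using f by (rule orthogonal_transformation_linear)
  have nf: "norm (f x) = norm x" for x using f by (simp add: orthogonal_transformation_norm)
  have inn: "f x \<bullet> e = x \<bullet> b" for x using f b by (metis orthogonal_transformation_def)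
  define C' where "C' = f -` C"
  have C': "C' \<in> sets borel" "emeasure cone_measure C' = emeasure cone_measure C"
    using cone_measure_orthogonal[OF f C(1)] by (auto simp: C'_def)
  have pos': "0 < x \<bullet> b" if "x \<in> C'" for x using that pos[of "f x"] inn by (auto simp: C'_def)
  have dist': "norm (x /\<^sub>R (x \<bullet> b) - y /\<^sub>R (y \<bullet> b)) \<le> D" if "x \<in> C'" "y \<in> C'" for x y
  proof -
    have "f (x /\<^sub>R (x \<bullet> b) - y /\<^sub>R (y \<bullet> b)) = f x /\<^sub>R (f x \<bullet> e) - f y /\<^sub>R (f y \<bullet> e)"
      using lin by (simp add: linear_diff linear_scale inn)
    then show ?thesis using dist[of "f x" "f y"] that nf[of "x /\<^sub>R (x \<bullet> b) - y /\<^sub>R (y \<bullet> b)"] by (simp add: C'_def)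
  qed
  have s: "x /\<^sub>R (x \<bullet> b) = sgn x /\<^sub>R (sgn x \<bullet> b)" if "x \<noteq> 0" for x
    using that by (simp add: sgn_div_norm)
  have "conical b D (open_cone C')"
    unfolding conical_def
  proof (intro conjI ballI impI)
    fix x assume x: "x \<in> open_cone C'"
    have "x \<bullet> b = norm x * (sgn x \<bullet> b)" using x by (simp add: sgn_div_norm open_cone_def)
    moreover have "0 < sgn x \<bullet> b" using pos'[of "sgn x"] x by (simp add: open_cone_def)
    ultimately show xb: "0 < x \<bullet> b" using x by (simp add: open_cone_def)
    show "x \<bullet> b < 1" using x norm_cauchy_schwarz[of x b] b by (simp add: open_cone_def)
    fix y assume y: "y \<in> open_cone C'" and xy: "x \<bullet> b = y \<bullet> b"
    have "norm (x /\<^sub>R (x \<bullet> b) - y /\<^sub>R (y \<bullet> b)) \<le> D"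
      using s[of x] s[of y] dist'[of "sgn x" "sgn y"] x y by (simp add: open_cone_def)
    moreover have "x /\<^sub>R (x \<bullet> b) - y /\<^sub>R (y \<bullet> b) = (x - y) /\<^sub>R (x \<bullet> b)"
      by (simp add: xy algebra_simps)
    ultimately have "norm (x - y) / (x \<bullet> b) \<le> D" using xb by (simp add: divide_inverse mult.commute)
    then show "norm (x - y) \<le> D * (x \<bullet> b)" using xb by (simp add: divide_le_eq)
  qed
  from isodiametric_conical[OF b(1) sets_open_cone[OF C'(1)] this D]
  have "of_nat DIM('a) * emeasure lborel (open_cone C') \<le> of_nat DIM('a) *
      ennreal (unit_ball_vol (real (DIM('a) - 1)) * (D / 2) ^ (DIM('a) - 1) / DIM('a))"
    by (rule mult_left_mono) simp
  also have "\<dots> = ennreal (unit_ball_vol (real (DIM('a) - 1)) * (D / 2) ^ (DIM('a) - 1))"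
    by (simp add: ennreal_of_nat_eq_real_of_nat ennreal_mult'[symmetric] D less_imp_le)
  finally show ?thesis using C' by (simp add: emeasure_cone_measure)
qed

text \<open>The projection is onto the tangent plane at a point e of C itself. Within a set of
  diameter d around e it stretches distances by at most the factor 1 + 3 d, which tends to 1 with
  d.\<close>

lemma cone_measure_le_diameter:
  fixes C :: "'a::euclidean_space set"
  assumes C: "C \<in> sets borel" "C \<subseteq> sphere 0 1" and d: "0 < d" "d \<le> 1/2"
    and diam: "\<And>x y. x \<in> C \<Longrightarrow> y \<in> C \<Longrightarrow> norm (x - y) \<le> d"
  shows "emeasure cone_measure C \<le> ennreal (unit_ball_vol (real (DIM('a) - 1)) * (d * (1 + 3 * d) / 2) ^ (DIM('a) - 1))"
proof (cases "C = {}")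
  case False
  then obtain e where e: "e \<in> C" by auto
  have n1: "norm x = 1" if "x \<in> C" for x using that C by auto
  have d2: "d\<^sup>2 \<le> 1/4" using power_mono[OF d(2), of 2] d by (simp add: power2_eq_square)
  \<comment> \<open>A lower bound for x \<bullet> e, from |x - e|^2 = 2 - 2 (x \<bullet> e) for unit
    vectors.\<close>
  define c where "c = 1 - d\<^sup>2 / 2"
  have c: "7/8 \<le> c" "c \<le> 1" using d2 by (auto simp: c_def)
  have ge: "c \<le> x \<bullet> e" if "x \<in> C" for x
  proof -
    have "(norm (x - e))\<^sup>2 = 2 - 2 * (x \<bullet> e)"
      using n1[OF that] n1[OF e] by (simp add: power2_norm_eq_inner inner_diff_left inner_diff_right inner_commute norm_eq_1)
    moreover have "(norm (x - e))\<^sup>2 \<le> d\<^sup>2" using diam[OF that e] by (simp add: power_mono)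
    ultimately show ?thesis by (simp add: c_def)
  qed
  have bound: "norm (x /\<^sub>R (x \<bullet> e) - y /\<^sub>R (y \<bullet> e)) \<le> d * (1 + 3 * d)" if x: "x \<in> C" and y: "y \<in> C" for x y
  proof -
    let ?a = "x \<bullet> e" and ?b = "y \<bullet> e"
    have a: "c \<le> ?a" "c \<le> ?b" using ge x y by auto
    \<comment> \<open>A chord of the sphere is orthogonal to the vector to its midpoint. Subtracting
      this midpoint from e makes the difference of heights quadratic in d, where Cauchy-Schwarz
      applied to (x - y) \<bullet> e would give only the order d.\<close>
    have "(x - y) \<bullet> (x + y) = 0"
      using n1[OF x] n1[OF y] by (simp add: inner_diff_left inner_add_right norm_eq_1 inner_commute[of y x])
    then have "?a - ?b = (x - y) \<bullet> (e - (1/2) *\<^sub>R (x + y))"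
      by (simp add: inner_diff_right inner_diff_left)
    also have "e - (1/2) *\<^sub>R (x + y) = (1/2) *\<^sub>R (e - x) + (1/2) *\<^sub>R (e - y)"
      by (simp add: algebra_simps scaleR_left_distrib[symmetric])
    finally have "\<bar>?a - ?b\<bar> \<le> norm (x - y) * norm ((1/2) *\<^sub>R (e - x) + (1/2) *\<^sub>R (e - y))"
      by (metis Cauchy_Schwarz_ineq2)
    also have "\<dots> \<le> d * d"
    proof (intro mult_mono)
      show "norm ((1/2) *\<^sub>R (e - x) + (1/2) *\<^sub>R (e - y)) \<le> d"
        using norm_triangle_ineq[of "(1/2) *\<^sub>R (e - x)" "(1/2) *\<^sub>R (e - y)"] diam[OF e x] diam[OF e y] by simp
    qed (use diam[OF x y] d in auto)
    finally have ab: "\<bar>?a - ?b\<bar> \<le> d * d" .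
    have "x /\<^sub>R ?a - y /\<^sub>R ?b = (x - y) /\<^sub>R ?a + (inverse ?a - inverse ?b) *\<^sub>R y"
      by (simp add: algebra_simps)
    then have "norm (x /\<^sub>R ?a - y /\<^sub>R ?b) \<le> norm ((x - y) /\<^sub>R ?a) + norm ((inverse ?a - inverse ?b) *\<^sub>R y)"
      by (metis norm_triangle_ineq)
    also have "\<dots> = norm (x - y) / ?a + \<bar>?a - ?b\<bar> / (?a * ?b)"
    proof -
      have p: "0 < ?a" "0 < ?b" using a c by auto
      have "norm ((x - y) /\<^sub>R ?a) = norm (x - y) / ?a"
        using p by (simp add: divide_inverse mult.commute)
      moreover have "\<bar>inverse ?a - inverse ?b\<bar> = \<bar>?a - ?b\<bar> / (?a * ?b)"
      proof -
        have "inverse ?a - inverse ?b = (?b - ?a) / (?a * ?b)"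
          using p by (simp add: inverse_eq_divide diff_divide_distrib)
        then have "\<bar>inverse ?a - inverse ?b\<bar> = \<bar>?b - ?a\<bar> / \<bar>?a * ?b\<bar>" by (simp only: abs_divide)
        also have "\<bar>?a * ?b\<bar> = ?a * ?b" using p by simp
        finally show ?thesis by (simp only: abs_minus_commute)
      qed
      ultimately show ?thesis using n1[OF y] by simp
    qed
    also have "\<dots> \<le> d / c + d * d / (c * c)"
      using a c d diam[OF x y] ab by (intro add_mono frac_le mult_mono) auto
    \<comment> \<open>This and the bound on the second summand add up to d (1 + d) + 2 d^2 = d (1 +
      3 d).\<close>
    also have "d / c \<le> d * (1 + d)"
    proof -
      have "1 \<le> (1 + d) * c"
      proof -
        have "(1 + d) * c - 1 = d * (1 - d / 2 - d\<^sup>2 / 2)" by (simp add: c_def algebra_simps power2_eq_square)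
        also have "\<dots> \<ge> 0" using d d2 by (intro mult_nonneg_nonneg) auto
        finally show ?thesis by simp
      qed
      then have "d * 1 \<le> d * ((1 + d) * c)" using d by (intro mult_left_mono) auto
      then show ?thesis using c by (simp add: field_simps)
    qed
    also have "d * d / (c * c) \<le> d * (2 * d)"
    proof -
      have "(7/8) * (7/8) \<le> c * c" using c by (intro mult_mono) auto
      then have "(d * d) * 1 \<le> (d * d) * (2 * (c * c))" using d by (intro mult_left_mono) auto
      then show ?thesis using c by (simp add: field_simps)
    qed
    finally show ?thesis by (simp add: algebra_simps)
  qed
  show ?thesis
    by (rule cone_measure_le_gnomonic[OF n1[OF e] C _ _ bound])
       (use d c ge in \<open>auto intro!: mult_pos_pos dest!: ge\<close>)
qed simp

text \<open>A flat cone of slope r around the axis, cut at height a, lies in the cone over the cap.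
  With a = 1 / sqrt (1 + r^2) its rim is on the unit sphere.\<close>

lemma cone_measure_cap_ge:
  fixes e :: "'a::euclidean_space"
  assumes e: "norm e = 1" and r: "0 < r"
  shows "ennreal (unit_ball_vol (real (DIM('a) - 1)) * r ^ (DIM('a) - 1) / sqrt (1 + r\<^sup>2) ^ DIM('a))
    \<le> emeasure cone_measure (sphere 0 1 \<inter> cball e r)"
proof -
  obtain f :: "'a \<Rightarrow> 'a" and b where f: "orthogonal_transformation f" and b: "b \<in> Basis" "f b = e"
    using obtain_orthogonal_Basis[OF e] .
  have lin: "linear f" using f by (rule orthogonal_transformation_linear)
  have nf: "norm (f x) = norm x" for x using f by (simp add: orthogonal_transformation_norm)
  have "dist e (f x) = dist b x" for x
    using lin b(2) nf[of "b - x"] by (simp add: dist_norm linear_diff)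
  then have pre: "f -` (sphere 0 1 \<inter> cball e r) = sphere 0 1 \<inter> cball b r" by (auto simp: nf)
  define a where "a = 1 / sqrt (1 + r\<^sup>2)"
  have a: "0 < a" by (simp add: a_def add_pos_nonneg)
  let ?K = "{x. 0 < x \<bullet> b \<and> x \<bullet> b < a \<and> norm (x - (x \<bullet> b) *\<^sub>R b) \<le> r * (x \<bullet> b)}"
  have "?K \<subseteq> open_cone (sphere 0 1 \<inter> cball b r)"
  proof
    fix x assume x: "x \<in> ?K"
    define h where "h = x \<bullet> b"
    define y where "y = x - h *\<^sub>R b"
    have h: "0 < h" "h < a" and y: "norm y \<le> r * h" using x by (auto simp: h_def y_def)
    have yb: "y \<bullet> b = 0" using b by (simp add: y_def inner_diff_left h_def)
    have xe: "x = h *\<^sub>R b + y" by (simp add: y_def)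
    have nx: "(norm x)\<^sup>2 = h\<^sup>2 + (norm y)\<^sup>2"
      using yb b unfolding xe power2_norm_eq_inner inner_add_left inner_add_right
      by (simp add: inner_commute[of b y] power2_eq_square)
    have y2: "(norm y)\<^sup>2 \<le> r\<^sup>2 * h\<^sup>2" using power_mono[OF y, of 2] by (simp add: power_mult_distrib)
    have hx: "h \<le> norm x" by (rule power2_le_imp_le) (use nx in auto)
    have "(norm x)\<^sup>2 \<le> (1 + r\<^sup>2) * h\<^sup>2" using nx y2 by (simp add: algebra_simps)
    also have "\<dots> < (1 + r\<^sup>2) * a\<^sup>2"
      using h by (intro mult_strict_left_mono power_strict_mono) (auto simp: add_pos_nonneg)
    also have "\<dots> = 1" by (simp add: a_def power_divide add_nonneg_eq_0_iff)
    finally have x1: "norm x < 1" by (simp add: abs_square_less_1)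
    have x0: "x \<noteq> 0" using h h_def by auto
    \<comment> \<open>n is the secant of the angle between x and b. The claim that the squared chord
      2 - 2 / n is at most the squared slope n^2 - 1 reduces to (n - 1)^2 (n + 2) \<ge> 0.\<close>
    define n where "n = norm x / h"
    have n: "1 \<le> n" using hx h by (simp add: n_def)
    have n2: "n\<^sup>2 \<le> 1 + r\<^sup>2"
      using nx y2 h by (simp add: n_def power_divide divide_le_eq algebra_simps)
    have "(norm (sgn x - b))\<^sup>2 = 2 - 2 * (sgn x \<bullet> b)"
      using x0 b norm_sgn[of x] by (simp add: power2_norm_eq_inner inner_diff_left inner_diff_right inner_commute norm_eq_1)
    also have "sgn x \<bullet> b = 1 / n" by (simp add: sgn_div_norm n_def h_def field_simps)
    also have "2 - 2 * (1 / n) \<le> n\<^sup>2 - 1"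
    proof -
      have "0 \<le> (n - 1)\<^sup>2 * (n + 2)" using n by simp
      also have "(n - 1)\<^sup>2 * (n + 2) = n * (n\<^sup>2 - 3) + 2" by (simp add: power2_eq_square algebra_simps)
      finally have "0 \<le> n * (n\<^sup>2 - 3) + 2" .
      then have "0 \<le> (n * (n\<^sup>2 - 3) + 2) / n" using n by simp
      also have "\<dots> = n\<^sup>2 - 3 + 2 * (1 / n)" using n by (simp add: add_divide_distrib)
      finally show ?thesis by simp
    qed
    finally have "(norm (sgn x - b))\<^sup>2 \<le> r\<^sup>2" using n2 by simp
    then have "norm (sgn x - b) \<le> r" by (rule power2_le_imp_le) (use r in simp)
    then show "x \<in> open_cone (sphere 0 1 \<inter> cball b r)"
      using x0 x1 by (simp add: open_cone_def norm_sgn dist_norm norm_minus_commute)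
  qed
  then have "emeasure lborel ?K \<le> emeasure lborel (open_cone (sphere 0 1 \<inter> cball b r))"
    by (rule emeasure_mono) auto
  then have "of_nat DIM('a) * emeasure lborel ?K \<le> emeasure cone_measure (sphere 0 1 \<inter> cball b r)"
    by (simp add: emeasure_cone_measure mult_left_mono)
  also have "emeasure cone_measure (sphere 0 1 \<inter> cball b r) = emeasure cone_measure (sphere 0 1 \<inter> cball e r)"
    using cone_measure_orthogonal(1)[OF f, of "sphere 0 1 \<inter> cball e r"] unfolding pre by simp
  also have "emeasure lborel ?K = ennreal (unit_ball_vol (real (DIM('a) - 1)) * r ^ (DIM('a) - 1) * a ^ DIM('a) / DIM('a))"
    using emeasure_flat_cone[OF b(1) r, of a] a by simp
  also have "of_nat DIM('a) * \<dots> = ennreal (real DIM('a) * (unit_ball_vol (real (DIM('a) - 1)) * r ^ (DIM('a) - 1) * a ^ DIM('a) / DIM('a)))"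
    unfolding ennreal_of_nat_eq_real_of_nat by (rule ennreal_mult'[symmetric]) simp
  also have "real DIM('a) * (unit_ball_vol (real (DIM('a) - 1)) * r ^ (DIM('a) - 1) * a ^ DIM('a) / DIM('a)) =
      unit_ball_vol (real (DIM('a) - 1)) * r ^ (DIM('a) - 1) / sqrt (1 + r\<^sup>2) ^ DIM('a)"
    by (simp add: a_def power_divide)
  finally show ?thesis .
qed

section \<open>Hausdorff premeasures on the sphere against the cone measure\<close>

lemma hausdorff_premeasure_single:
  assumes "bounded A" "diameter A \<le> \<delta>" "0 \<le> \<delta>"
  shows "hausdorff_premeasure m \<delta> A \<le> hausdorff_gauge m A"
proof -
  have "hausdorff_premeasure m \<delta> A \<le> (\<Sum>i. hausdorff_gauge m (if i = (0::nat) then A else {}))"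
    by (rule hausdorff_premeasure_le) (use assms in auto)
  also have "\<dots> = (\<Sum>i\<in>{0::nat}. hausdorff_gauge m (if i = (0::nat) then A else {}))"
    by (rule suminf_finite) (auto simp: hausdorff_gauge_def)
  finally show ?thesis by simp
qed

lemma hausdorff_premeasure_UN_le:
  assumes "0 \<le> \<delta>"
  shows "hausdorff_premeasure m \<delta> (\<Union>n\<in>J. A n) \<le> (\<Sum>n::nat. if n \<in> J then hausdorff_premeasure m \<delta> (A n) else 0)"
proof -
  have "hausdorff_premeasure m \<delta> (\<Union>n. if n \<in> J then A n else {}) \<le>
      (\<Sum>n. hausdorff_premeasure m \<delta> (if n \<in> J then A n else {}))"
    by (rule hausdorff_premeasure_countably_subadditive)
  moreover have "(\<Union>n. if n \<in> J then A n else {}) = (\<Union>n\<in>J. A n)" by (auto split: if_splits)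
  ultimately show ?thesis using assms by (simp add: if_distrib hausdorff_premeasure_empty cong: if_cong)
qed

lemma cone_measure_le_gauge:
  fixes C :: "'a::euclidean_space set"
  assumes C: "C \<in> sets borel" "C \<subseteq> sphere 0 1" and \<delta>: "diameter C \<le> \<delta>" "0 < \<delta>" "\<delta> < 1/2"
  shows "emeasure cone_measure C \<le> ennreal ((1 + 3 * \<delta>) ^ (DIM('a) - 1)) * hausdorff_gauge (DIM('a) - 1) C"
proof (cases "C = {}")
  case False
  let ?m = "DIM('a) - 1"
  let ?w = "unit_ball_vol (real ?m)"
  have bC: "bounded C" using C(2) bounded_subset bounded_sphere by blast
  have dn: "norm (x - y) \<le> diameter C" if "x \<in> C" "y \<in> C" for x y
    using diameter_bounded_bound[OF bC that] by (simp add: dist_norm)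
  have d0: "0 \<le> diameter C" using diameter_ge_0[OF bC] .
  \<comment> \<open>The bound for small sets requires a positive size, but a single point has
    diameter 0. Hence t decreases to the diameter from above.\<close>
  have *: "emeasure cone_measure C \<le> ennreal (?w * (t * (1 + 3 * t) / 2) ^ ?m)" if "diameter C < t" "t < 1/2" for t
    proof (rule cone_measure_le_diameter[OF C])
    show "norm (x - y) \<le> t" if "x \<in> C" "y \<in> C" for x y
      using dn[OF that] \<open>diameter C < t\<close> by linarith
  qed (use that d0 in auto)
  have "((\<lambda>t. ennreal (?w * (t * (1 + 3 * t) / 2) ^ ?m)) \<longlongrightarrow>
      ennreal (?w * (diameter C * (1 + 3 * diameter C) / 2) ^ ?m)) (at_right (diameter C))"
    by (intro tendsto_intros) auto
  moreover have "eventually (\<lambda>t. emeasure cone_measure C \<le> ennreal (?w * (t * (1 + 3 * t) / 2) ^ ?m)) (at_right (diameter C))"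
    using * \<delta> by (auto simp: eventually_at_right_field intro!: exI[of _ "1/2"])
  ultimately have "emeasure cone_measure C \<le> ennreal (?w * (diameter C * (1 + 3 * diameter C) / 2) ^ ?m)"
    by (rule tendsto_lowerbound) simp
  also have "\<dots> \<le> ennreal ((1 + 3 * \<delta>) ^ ?m * (?w * (diameter C / 2) ^ ?m))"
  proof (rule ennreal_leI)
    have "(diameter C * (1 + 3 * diameter C) / 2) ^ ?m = (1 + 3 * diameter C) ^ ?m * (diameter C / 2) ^ ?m"
      by (simp add: power_mult_distrib[symmetric] mult.commute)
    also have "\<dots> \<le> (1 + 3 * \<delta>) ^ ?m * (diameter C / 2) ^ ?m"
      using d0 \<delta> by (intro mult_right_mono power_mono) auto
    finally show "?w * (diameter C * (1 + 3 * diameter C) / 2) ^ ?m \<le> (1 + 3 * \<delta>) ^ ?m * (?w * (diameter C / 2) ^ ?m)"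
      by (simp add: mult.left_commute mult_left_mono)
  qed
  also have "\<dots> = ennreal ((1 + 3 * \<delta>) ^ ?m) * hausdorff_gauge ?m C"
    using False \<delta> by (simp add: hausdorff_gauge_def ennreal_mult')
  finally show ?thesis .
qed simp

text \<open>The sets of a cover need not be Borel. Their closures, intersected with the sphere, are,
  and have no larger diameter. The distortion factor (1 + 3 \<delta>)^(N-1) tends to 1.\<close>

lemma cone_measure_le_hausdorff:
  fixes A :: "'a::euclidean_space set"
  assumes A: "A \<in> sets borel" "A \<subseteq> sphere 0 1"
  shows "emeasure cone_measure A \<le> hausdorff_outer (DIM('a) - 1) A"
proof -
  let ?m = "DIM('a) - 1"
  have *: "emeasure cone_measure A \<le> ennreal ((1 + 3 * \<delta>) ^ ?m) * hausdorff_outer ?m A" if \<delta>: "0 < \<delta>" "\<delta> < 1/2" for \<delta>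
  proof -
    have "emeasure cone_measure A \<le> ennreal ((1 + 3 * \<delta>) ^ ?m) * (\<Sum>i. hausdorff_gauge ?m (C i))"
      if C: "A \<subseteq> (\<Union>i. C i)" "\<And>i. bounded (C i)" "\<And>i. diameter (C i) \<le> \<delta>" for C :: "nat \<Rightarrow> 'a set"
    proof -
      define E where "E i = closure (C i) \<inter> sphere 0 1" for i
      have [measurable]: "E i \<in> sets borel" for i by (auto simp: E_def)
      have bE: "bounded (closure (C i))" for i using C(2) by (simp add: bounded_closure)
      have dE: "diameter (E i) \<le> diameter (C i)" for i
        using diameter_subset[OF _ bE[of i], of "E i"] diameter_closure[OF C(2)[of i]] by (auto simp: E_def)
      have "emeasure cone_measure A \<le> emeasure cone_measure (\<Union>i. E i)"
        using C(1) A closure_subset by (intro emeasure_mono) (auto simp: E_def, blast)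
      also have "\<dots> \<le> (\<Sum>i. emeasure cone_measure (E i))"
        by (rule emeasure_subadditive_countably) auto
      also have "\<dots> \<le> (\<Sum>i. ennreal ((1 + 3 * \<delta>) ^ ?m) * hausdorff_gauge ?m (C i))"
      proof (intro suminf_le)
        fix i
        have "emeasure cone_measure (E i) \<le> ennreal ((1 + 3 * \<delta>) ^ ?m) * hausdorff_gauge ?m (E i)"
          using \<delta> dE[of i] C(3)[of i] by (intro cone_measure_le_gauge) (auto simp: E_def)
        also have "hausdorff_gauge ?m (E i) \<le> hausdorff_gauge ?m (C i)"
          using dE[of i] diameter_ge_0[of "E i"] bE[of i]
          by (auto simp: hausdorff_gauge_def E_def bounded_Int intro!: ennreal_leI mult_left_mono power_mono divide_right_mono)
        finally show "emeasure cone_measure (E i) \<le> ennreal ((1 + 3 * \<delta>) ^ ?m) * hausdorff_gauge ?m (C i)"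
          by (simp add: mult_left_mono)
      qed auto
      finally show ?thesis by simp
    qed
    then have "emeasure cone_measure A \<le> ennreal ((1 + 3 * \<delta>) ^ ?m) * hausdorff_premeasure ?m \<delta> A"
    proof (cases "hausdorff_premeasure ?m \<delta> A = \<infinity>")
      case False
      assume cov: "\<And>C :: nat \<Rightarrow> 'a set. A \<subseteq> (\<Union>i. C i) \<Longrightarrow> (\<And>i. bounded (C i)) \<Longrightarrow> (\<And>i. diameter (C i) \<le> \<delta>) \<Longrightarrow>
        emeasure cone_measure A \<le> ennreal ((1 + 3 * \<delta>) ^ ?m) * (\<Sum>i. hausdorff_gauge ?m (C i))"
      show ?thesis
      proof (rule ennreal_le_epsilon)
        fix e :: real assume e: "0 < e"
        define c where "c = (1 + 3 * \<delta>) ^ ?m"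
        have c: "0 < c" using \<delta> by (simp add: c_def)
        have "hausdorff_premeasure ?m \<delta> A < \<infinity>" using False by (simp add: less_top)
        then obtain C where C: "A \<subseteq> (\<Union>i. C i)" "\<And>i. bounded (C i)" "\<And>i. diameter (C i) \<le> \<delta>"
          "(\<Sum>i::nat. hausdorff_gauge ?m (C i)) \<le> hausdorff_premeasure ?m \<delta> A + ennreal (e / c)"
          using hausdorff_premeasure_near_cover[of ?m \<delta> A "e / c"] c e by (metis divide_pos_pos)
        have "emeasure cone_measure A \<le> ennreal c * (hausdorff_premeasure ?m \<delta> A + ennreal (e / c))"
          unfolding c_def by (rule order_trans[OF cov[OF C(1-3)] mult_left_mono[OF C(4)[unfolded c_def]]]) simp
        also have "\<dots> = ennreal c * hausdorff_premeasure ?m \<delta> A + ennreal e"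
          using c e by (simp add: distrib_left ennreal_mult'[symmetric])
        finally show "emeasure cone_measure A \<le> ennreal ((1 + 3 * \<delta>) ^ ?m) * hausdorff_premeasure ?m \<delta> A + ennreal e"
          unfolding c_def .
      qed
    qed (use \<delta> in \<open>simp add: ennreal_mult_top\<close>)
    also have "\<dots> \<le> ennreal ((1 + 3 * \<delta>) ^ ?m) * hausdorff_outer ?m A"
      using \<delta> by (intro mult_left_mono hausdorff_premeasure_le_outer) auto
    finally show ?thesis .
  qed
  show ?thesis
  proof (cases "hausdorff_outer ?m A = \<infinity>")
    case False
    have "((\<lambda>\<delta>. ennreal ((1 + 3 * \<delta>) ^ ?m) * hausdorff_outer ?m A) \<longlongrightarrow> ennreal ((1 + 3 * 0) ^ ?m) * hausdorff_outer ?m A) (at_right 0)"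
      using False by (intro tendsto_mult_ennreal tendsto_intros) auto
    moreover have "eventually (\<lambda>\<delta>. emeasure cone_measure A \<le> ennreal ((1 + 3 * \<delta>) ^ ?m) * hausdorff_outer ?m A) (at_right 0)"
      using * by (auto simp: eventually_at_right_field intro!: exI[of _ "1/2"])
    ultimately have "emeasure cone_measure A \<le> ennreal ((1 + 3 * 0) ^ ?m) * hausdorff_outer ?m A"
      by (rule tendsto_lowerbound) simp
    then show ?thesis by simp
  qed simp
qed

section \<open>Filling open subsets of the sphere with small caps\<close>

abbreviation cap :: "'a::euclidean_space \<Rightarrow> real \<Rightarrow> 'a set" where
  "cap x r \<equiv> sphere 0 1 \<inter> cball x r"

lemma diameter_cap_le: "0 \<le> r \<Longrightarrow> diameter (cap x r :: 'a::euclidean_space set) \<le> 2 * r"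
  using diameter_subset[of "cap x r" "cball x r"] by simp

lemma hausdorff_premeasure_cap_le:
  fixes x :: "'a::euclidean_space"
  assumes "0 \<le> r" "2 * r \<le> \<delta>"
  shows "hausdorff_premeasure m \<delta> (cap x r) \<le> ennreal (unit_ball_vol (real m) * r ^ m)"
proof -
  have b: "bounded (cap x r)" by (simp add: bounded_Int)
  have "hausdorff_premeasure m \<delta> (cap x r) \<le> hausdorff_gauge m (cap x r)"
    using assms diameter_cap_le[of r x] b by (intro hausdorff_premeasure_single) auto
  also have "\<dots> \<le> ennreal (unit_ball_vol (real m) * r ^ m)"
    using diameter_cap_le[OF assms(1), of x] diameter_ge_0[OF b] assms
    by (auto simp: hausdorff_gauge_def intro!: ennreal_leI mult_left_mono power_mono)
  finally show ?thesis .
qed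

text \<open>Up to a factor \<kappa> that absorbs the curvature, a small cap has the measure of a
  flat disc. The first bound is meant for the disjoint caps of a Vitali family, the second for their
  enlargements by the factor 5.\<close>

lemma small_cap_estimates:
  assumes "1 < \<kappa>"
  obtains r0 :: real where "0 < r0"
    "\<And>(x::'a::euclidean_space) r. norm x = 1 \<Longrightarrow> 0 < r \<Longrightarrow> r \<le> r0 \<Longrightarrow>
        unit_ball_vol (real (DIM('a) - 1)) * r ^ (DIM('a) - 1) \<le> \<kappa> * measure cone_measure (cap x r)"
    "\<And>(x::'a) r. norm x = 1 \<Longrightarrow> 0 < r \<Longrightarrow> r \<le> r0 \<Longrightarrow>
        measure cone_measure (cap x (5 * r)) \<le> \<kappa> * (unit_ball_vol (real (DIM('a) - 1)) * (5 * r) ^ (DIM('a) - 1))"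
proof -
  let ?m = "DIM('a) - 1"
  have "((\<lambda>r. sqrt (1 + r\<^sup>2) ^ DIM('a)) \<longlongrightarrow> sqrt (1 + 0\<^sup>2) ^ DIM('a)) (at_right (0::real))"
    by (intro tendsto_intros)
  then have "eventually (\<lambda>r. sqrt (1 + r\<^sup>2) ^ DIM('a) < \<kappa>) (at_right (0::real))"
    by (rule order_tendstoD) (use assms in simp)
  moreover have "((\<lambda>r. (1 + 30 * r) ^ ?m) \<longlongrightarrow> (1 + 30 * 0) ^ ?m) (at_right (0::real))"
    by (intro tendsto_intros)
  then have "eventually (\<lambda>r. (1 + 30 * r) ^ ?m < \<kappa>) (at_right (0::real))"
    by (rule order_tendstoD) (use assms in simp)
  ultimately have "eventually (\<lambda>r. sqrt (1 + r\<^sup>2) ^ DIM('a) < \<kappa> \<and> (1 + 30 * r) ^ ?m < \<kappa>) (at_right (0::real))"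
    by (rule eventually_conj)
  then obtain b where b: "0 < b" "\<And>r. 0 < r \<Longrightarrow> r < b \<Longrightarrow> sqrt (1 + r\<^sup>2) ^ DIM('a) < \<kappa> \<and> (1 + 30 * r) ^ ?m < \<kappa>"
    by (auto simp: eventually_at_right_field)
  show ?thesis
  \<comment> \<open>Two points of \<open>cap x (5 * r)\<close> have distance at most 10 r, which
    must not exceed 1/2; this gives 1/20 and, below, 30 = 3 times 10. The limits are controlled for
    radii strictly below b, hence b/2.\<close>
  proof (rule that[of "min (b/2) (1/20)"])
    fix x :: 'a and r :: real assume x: "norm x = 1" and r: "0 < r" "r \<le> min (b/2) (1/20)"
    have k: "sqrt (1 + r\<^sup>2) ^ DIM('a) < \<kappa>" "(1 + 30 * r) ^ ?m < \<kappa>" using b r by auto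
    have s: "0 < sqrt (1 + r\<^sup>2) ^ DIM('a)" by (simp add: add_pos_nonneg)
    let ?v = "unit_ball_vol (real ?m) * r ^ ?m"
    have "?v / sqrt (1 + r\<^sup>2) ^ DIM('a) \<le> measure cone_measure (cap x r)"
      using cone_measure_cap_ge[OF x r(1)] by (simp add: cone_measure.emeasure_eq_measure)
    then have "?v \<le> sqrt (1 + r\<^sup>2) ^ DIM('a) * measure cone_measure (cap x r)"
      using s by (simp add: divide_le_eq mult.commute)
    also have "\<dots> \<le> \<kappa> * measure cone_measure (cap x r)" using k by (intro mult_right_mono) auto
    finally show "?v \<le> \<kappa> * measure cone_measure (cap x r)" .
    have "norm (y - z) \<le> 10 * r" if "y \<in> cap x (5 * r)" "z \<in> cap x (5 * r)" for y z
      using that dist_triangle2[of y z x] by (simp add: dist_norm[symmetric] dist_commute)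
    then have "emeasure cone_measure (cap x (5 * r)) \<le> ennreal (unit_ball_vol (real ?m) * (10 * r * (1 + 3 * (10 * r)) / 2) ^ ?m)"
      using r by (intro cone_measure_le_diameter) auto
    then have "measure cone_measure (cap x (5 * r)) \<le> unit_ball_vol (real ?m) * (10 * r * (1 + 3 * (10 * r)) / 2) ^ ?m"
      using r by (simp add: cone_measure.emeasure_eq_measure)
    also have "10 * r * (1 + 3 * (10 * r)) / 2 = (1 + 30 * r) * (5 * r)" by (simp add: algebra_simps)
    also have "unit_ball_vol (real ?m) * \<dots> ^ ?m = (1 + 30 * r) ^ ?m * (unit_ball_vol (real ?m) * (5 * r) ^ ?m)"
      by (simp add: power_mult_distrib)
    also have "\<dots> \<le> \<kappa> * (unit_ball_vol (real ?m) * (5 * r) ^ ?m)"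
      using k r by (intro mult_right_mono) auto
    finally show "measure cone_measure (cap x (5 * r)) \<le> \<kappa> * (unit_ball_vol (real ?m) * (5 * r) ^ ?m)" .
  qed (use b in auto)
qed

text \<open>Vitali's covering lemma for balls that are centred on the sphere and contained in V.
  Indexing by a subset J of the naturals lets finite and infinite families be summed as
  series.\<close>

lemma cap_covering:
  fixes V :: "'a::euclidean_space set"
  assumes V: "open V" and \<rho>: "0 < \<rho>"
  obtains J :: "nat set" and x :: "nat \<Rightarrow> 'a" and r where
    "\<And>n. n \<in> J \<Longrightarrow> norm (x n) = 1 \<and> 0 < r n \<and> r n \<le> \<rho> \<and> cball (x n) (r n) \<subseteq> V"
    "disjoint_family_on (\<lambda>n. cball (x n) (r n)) J"
    "sphere 0 1 \<inter> V \<subseteq> (\<Union>n\<in>J. cap (x n) (5 * r n))"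
proof -
  define K where "K = {(x::'a, r). norm x = 1 \<and> 0 < r \<and> r \<le> \<rho> \<and> cball x r \<subseteq> V}"
  have cov: "sphere 0 1 \<inter> V \<subseteq> (\<Union>i\<in>K. cball (fst i) (snd i))"
  proof
    fix y assume y: "y \<in> sphere 0 1 \<inter> V"
    then obtain e where e: "0 < e" "cball y e \<subseteq> V" using V open_contains_cball by blast
    have "(y, min e \<rho>) \<in> K" using y e \<rho> by (auto simp: K_def)
    then show "y \<in> (\<Union>i\<in>K. cball (fst i) (snd i))" using e \<rho> by (force intro!: bexI[of _ "(y, min e \<rho>)"])
  qed
  obtain C where C: "countable C" "C \<subseteq> K"
    "pairwise (\<lambda>i j. disjnt (cball (fst i) (snd i)) (cball (fst j) (snd j))) C"
    "sphere 0 1 \<inter> V \<subseteq> (\<Union>i\<in>C. cball (fst i) (5 * snd i))"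
  proof (rule Vitali_covering_lemma_cballs[OF cov])
    show "0 < snd i \<and> snd i \<le> \<rho>" if "i \<in> K" for i using that by (auto simp: K_def)
  qed
  define J where "J = to_nat_on C ` C"
  define g where "g = from_nat_into C"
  have g: "g (to_nat_on C i) = i" if "i \<in> C" for i using C(1) that by (simp add: g_def)
  have gC: "g n \<in> C" if "n \<in> J" for n using that g by (auto simp: J_def)
  have ginj: "g n = g n' \<Longrightarrow> n = n'" if "n \<in> J" "n' \<in> J" for n n' using that g by (auto simp: J_def)
  show ?thesis
  proof (rule that[of J "\<lambda>n. fst (g n)" "\<lambda>n. snd (g n)"])
    fix n assume "n \<in> J"
    then show "norm (fst (g n)) = 1 \<and> 0 < snd (g n) \<and> snd (g n) \<le> \<rho> \<and> cball (fst (g n)) (snd (g n)) \<subseteq> V"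
      using subsetD[OF C(2) gC] by (simp add: K_def case_prod_beta)
  next
    show "disjoint_family_on (\<lambda>n. cball (fst (g n)) (snd (g n))) J"
      using C(3) gC ginj unfolding disjoint_family_on_def pairwise_def disjnt_def by blast
  next
    show "sphere 0 1 \<inter> V \<subseteq> (\<Union>n\<in>J. cap (fst (g n)) (5 * snd (g n)))"
    proof
      fix y assume y: "y \<in> sphere 0 1 \<inter> V"
      then obtain i where i: "i \<in> C" "y \<in> cball (fst i) (5 * snd i)" using C(4) by blast
      then show "y \<in> (\<Union>n\<in>J. cap (fst (g n)) (5 * snd (g n)))"
        using y g by (auto simp: J_def)
    qed
  qed
qed

lemma cone_measure_caps_le:
  fixes V :: "'a::euclidean_space set"
  assumes V: "open V" and J: "\<And>n. n \<in> J \<Longrightarrow> cball (x n) (r n) \<subseteq> V"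
    "disjoint_family_on (\<lambda>n. cball (x n) (r n)) J"
  shows "(\<Sum>n::nat. if n \<in> J then emeasure cone_measure (cap (x n) (r n)) else 0) \<le> emeasure cone_measure (sphere 0 1 \<inter> V)"
proof -
  let ?A = "\<lambda>n. if n \<in> J then cap (x n) (r n) else {}"
  have "(\<Sum>n. emeasure cone_measure (?A n)) = emeasure cone_measure (\<Union>n. ?A n)"
    using J(2) by (intro suminf_emeasure) (auto simp: disjoint_family_on_def)
  also have "\<dots> \<le> emeasure cone_measure (sphere 0 1 \<inter> V)"
    using J(1) V by (intro emeasure_mono) (auto split: if_splits)
  finally show ?thesis by (simp add: if_distrib cong: if_cong)
qed

text \<open>One step of the exhaustion: finitely many disjoint small caps, whose gauge is almost
  optimal, fill a fixed fraction of a relatively open set, and the weaker bound is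
  applied to the rest.\<close>

lemma hausdorff_premeasure_improve:
  fixes \<kappa> \<theta> q \<delta> :: real
  defines "\<theta> \<equiv> 1 / (2 * \<kappa>\<^sup>2 * 5 ^ (DIM('a::euclidean_space) - 1))"
  assumes \<kappa>: "1 < \<kappa>" and \<delta>: "0 < \<delta>" and q: "0 \<le> q"
    and bound: "\<And>V :: 'a set. open V \<Longrightarrow>
      hausdorff_premeasure (DIM('a) - 1) \<delta> (sphere 0 1 \<inter> V) \<le> ennreal ((\<kappa> + q) * measure cone_measure (sphere 0 1 \<inter> V))"
    and V: "open V"
  shows "hausdorff_premeasure (DIM('a) - 1) \<delta> (sphere 0 1 \<inter> V) \<le>
    ennreal ((\<kappa> + (1 - \<theta>) * q) * measure cone_measure (sphere 0 1 \<inter> (V :: 'a set)))"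
proof -
  let ?m = "DIM('a) - 1"
  let ?w = "unit_ball_vol (real ?m)"
  let ?\<mu> = "measure (cone_measure :: 'a measure)"
  obtain r0 where r0: "0 < r0"
    "\<And>(x::'a) r. norm x = 1 \<Longrightarrow> 0 < r \<Longrightarrow> r \<le> r0 \<Longrightarrow> ?w * r ^ ?m \<le> \<kappa> * ?\<mu> (cap x r)"
    "\<And>(x::'a) r. norm x = 1 \<Longrightarrow> 0 < r \<Longrightarrow> r \<le> r0 \<Longrightarrow> ?\<mu> (cap x (5 * r)) \<le> \<kappa> * (?w * (5 * r) ^ ?m)"
    using small_cap_estimates[OF \<kappa>] by metis
  have pos: "0 < min r0 (\<delta>/2)" using r0 \<delta> by auto
  obtain J :: "nat set" and x :: "nat \<Rightarrow> 'a" and r where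
    J: "\<And>n. n \<in> J \<Longrightarrow> norm (x n) = 1 \<and> 0 < r n \<and> r n \<le> min r0 (\<delta>/2) \<and> cball (x n) (r n) \<subseteq> V"
    and disj: "disjoint_family_on (\<lambda>n. cball (x n) (r n)) J"
    and cov: "sphere 0 1 \<inter> V \<subseteq> (\<Union>n\<in>J. cap (x n) (5 * r n))"
    by (rule cap_covering[OF V pos]) (rule that)
  define c where "c n = (if n \<in> J then ?\<mu> (cap (x n) (r n)) else 0)" for n
  have c0: "0 \<le> c n" for n by (simp add: c_def)
  have "(\<Sum>n. ennreal (c n)) = (\<Sum>n. if n \<in> J then emeasure cone_measure (cap (x n) (r n)) else 0)"
    by (intro suminf_cong) (simp add: c_def cone_measure.emeasure_eq_measure)
  also have "\<dots> \<le> ennreal (?\<mu> (sphere 0 1 \<inter> V))"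
    using cone_measure_caps_le[OF V _ disj] J by (simp add: cone_measure.emeasure_eq_measure)
  finally have cs: "(\<Sum>n. ennreal (c n)) \<le> ennreal (?\<mu> (sphere 0 1 \<inter> V))" .
  then have sc: "summable c"
    using c0 by (intro summable_suminf_not_top) (auto simp: top_unique)
  \<comment> \<open>Enlarging one of these caps by the factor 5 multiplies its measure by at most M.
    The disjoint caps thus fill at least the fraction 1/M of the set, and finitely many of them the
    fraction \<theta> = 1/(2 M).\<close>
  define M where "M = \<kappa>\<^sup>2 * 5 ^ ?m"
  have M: "0 < M" using \<kappa> by (simp add: M_def)
  have five: "?\<mu> (cap (x n) (5 * r n)) \<le> M * c n" if n: "n \<in> J" for n
  proof -
    have "?\<mu> (cap (x n) (5 * r n)) \<le> \<kappa> * (?w * (5 * r n) ^ ?m)" using r0(3) J[OF n] by auto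
    also have "\<dots> = \<kappa> * 5 ^ ?m * (?w * r n ^ ?m)" by (simp add: power_mult_distrib)
    also have "\<dots> \<le> \<kappa> * 5 ^ ?m * (\<kappa> * ?\<mu> (cap (x n) (r n)))"
      using r0(2)[of "x n" "r n"] J[OF n] \<kappa> by (intro mult_left_mono) auto
    finally show ?thesis using n by (simp add: c_def M_def power2_eq_square mult_ac)
  qed
  have "ennreal (?\<mu> (sphere 0 1 \<inter> V)) = emeasure cone_measure (sphere 0 1 \<inter> V)"
    by (simp add: cone_measure.emeasure_eq_measure)
  also have "\<dots> \<le> emeasure cone_measure (\<Union>n. if n \<in> J then cap (x n) (5 * r n) else {})"
  proof (rule emeasure_mono)
    show "sphere 0 1 \<inter> V \<subseteq> (\<Union>n. if n \<in> J then cap (x n) (5 * r n) else {})"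
    proof
      fix y assume "y \<in> sphere 0 1 \<inter> V"
      then obtain n where "n \<in> J" "y \<in> cap (x n) (5 * r n)" using cov by blast
      then show "y \<in> (\<Union>n. if n \<in> J then cap (x n) (5 * r n) else {})" by (intro UN_I[of n]) auto
    qed
  qed auto
  also have "\<dots> \<le> (\<Sum>n. emeasure cone_measure (if n \<in> J then cap (x n) (5 * r n) else {}))"
    by (rule emeasure_subadditive_countably) auto
  also have "\<dots> \<le> (\<Sum>n. ennreal (M * c n))"
  proof (intro suminf_le)
    show "emeasure cone_measure (if n \<in> J then cap (x n) (5 * r n) else {}) \<le> ennreal (M * c n)" for n
      using five[of n] by (auto simp: cone_measure.emeasure_eq_measure intro: ennreal_leI)
  qed auto
  also have "\<dots> = ennreal (\<Sum>n. M * c n)"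
    using sc c0 M by (intro suminf_ennreal2 summable_mult) auto
  finally have "?\<mu> (sphere 0 1 \<inter> V) \<le> (\<Sum>n. M * c n)"
    using c0 M sc by (subst (asm) ennreal_le_iff) (auto intro!: suminf_nonneg summable_mult)
  also have "\<dots> = M * suminf c" using sc by (rule suminf_mult)
  finally have fill: "?\<mu> (sphere 0 1 \<inter> V) / M \<le> suminf c" using M by (simp add: divide_le_eq mult.commute)
  obtain n0 where n0: "?\<mu> (sphere 0 1 \<inter> V) / (2 * M) \<le> sum c {..<n0}"
  proof (cases "?\<mu> (sphere 0 1 \<inter> V) = 0")
    case False
    then have "0 < ?\<mu> (sphere 0 1 \<inter> V)" by (simp add: less_le)
    then have "?\<mu> (sphere 0 1 \<inter> V) / (2 * M) < ?\<mu> (sphere 0 1 \<inter> V) / M"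
      using M by (intro divide_strict_left_mono) auto
    then have "?\<mu> (sphere 0 1 \<inter> V) / (2 * M) < suminf c" using fill by linarith
    moreover have "(\<lambda>n. sum c {..<n}) \<longlonglongrightarrow> suminf c" using sc by (rule summable_LIMSEQ)
    ultimately have "eventually (\<lambda>n. ?\<mu> (sphere 0 1 \<inter> V) / (2 * M) < sum c {..<n}) sequentially"
      by (intro order_tendstoD)
    then obtain n where "?\<mu> (sphere 0 1 \<inter> V) / (2 * M) < sum c {..<n}"
      unfolding eventually_sequentially by blast
    then show ?thesis by (intro that[of n]) simp
  qed (use that[of 0] in simp)
  define F where "F = J \<inter> {..<n0}"
  define s where "s = (\<Sum>n\<in>F. ?\<mu> (cap (x n) (r n)))"
  have s: "?\<mu> (sphere 0 1 \<inter> V) * \<theta> \<le> s"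
  proof -
    have "sum c {..<n0} = s" unfolding s_def F_def c_def
      by (subst sum.inter_restrict[symmetric]) (auto simp: Int_commute)
    then show ?thesis using n0 by (simp add: \<theta>_def M_def mult.assoc)
  qed
  \<comment> \<open>The finiteness of F keeps the remainder W open, so that the assumed bound
    applies to it.\<close>
  define W where "W = V - (\<Union>n\<in>F. cball (x n) (r n))"
  have W: "open W" unfolding W_def using V by (intro open_Diff closed_UN) (auto simp: F_def)
  have capF: "(\<Union>n\<in>F. cap (x n) (r n)) \<subseteq> sphere 0 1 \<inter> V" using J by (auto simp: F_def)
  have split: "?\<mu> (sphere 0 1 \<inter> W) = ?\<mu> (sphere 0 1 \<inter> V) - s"
  proof -
    have "sphere 0 1 \<inter> W = (sphere 0 1 \<inter> V) - (\<Union>n\<in>F. cap (x n) (r n))" by (auto simp: W_def)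
    then have "?\<mu> (sphere 0 1 \<inter> W) = ?\<mu> (sphere 0 1 \<inter> V) - ?\<mu> (\<Union>n\<in>F. cap (x n) (r n))"
      using capF V by (simp add: cone_measure.finite_measure_Diff F_def)
    also have "?\<mu> (\<Union>n\<in>F. cap (x n) (r n)) = s" unfolding s_def
      by (rule cone_measure.finite_measure_finite_Union) (use disj in \<open>auto simp: F_def disjoint_family_on_def\<close>)
    finally show ?thesis .
  qed
  have "hausdorff_premeasure ?m \<delta> (sphere 0 1 \<inter> V) \<le>
      hausdorff_premeasure ?m \<delta> (\<Union>n. if n = 0 then sphere 0 1 \<inter> W else if n - 1 \<in> F then cap (x (n - 1)) (r (n - 1)) else {})"
  proof (rule hausdorff_premeasure_mono, rule subsetI)
    fix y assume y: "y \<in> sphere 0 1 \<inter> V"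
    show "y \<in> (\<Union>n. if n = 0 then sphere 0 1 \<inter> W else if n - 1 \<in> F then cap (x (n - 1)) (r (n - 1)) else {})"
    proof (cases "y \<in> W")
      case True then show ?thesis using y by (intro UN_I[of 0]) auto
    next
      case False
      then obtain n where "n \<in> F" "y \<in> cball (x n) (r n)" using y by (auto simp: W_def)
      then show ?thesis using y by (intro UN_I[of "Suc n"]) auto
    qed
  qed
  also have "\<dots> \<le> (\<Sum>n. hausdorff_premeasure ?m \<delta> (if n = 0 then sphere 0 1 \<inter> W else if n - 1 \<in> F then cap (x (n - 1)) (r (n - 1)) else {}))"
    by (rule hausdorff_premeasure_countably_subadditive)
  also have "\<dots> = hausdorff_premeasure ?m \<delta> (sphere 0 1 \<inter> W) +
      (\<Sum>n. hausdorff_premeasure ?m \<delta> (if n \<in> F then cap (x n) (r n) else {}))"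
    by (subst suminf_offset[where i=1]) (auto intro!: suminf_cong simp: add.commute)
  also have "(\<Sum>n. hausdorff_premeasure ?m \<delta> (if n \<in> F then cap (x n) (r n) else {})) =
      (\<Sum>n\<in>F. hausdorff_premeasure ?m \<delta> (if n \<in> F then cap (x n) (r n) else {}))"
    using \<delta> by (intro suminf_finite) (auto simp: F_def hausdorff_premeasure_empty)
  also have "\<dots> \<le> (\<Sum>n\<in>F. ennreal (\<kappa> * ?\<mu> (cap (x n) (r n))))"
  proof (rule sum_mono)
    fix n assume n: "n \<in> F"
    then have nJ: "n \<in> J" by (simp add: F_def)
    have "hausdorff_premeasure ?m \<delta> (cap (x n) (r n)) \<le> ennreal (?w * r n ^ ?m)"
      using J[OF nJ] by (intro hausdorff_premeasure_cap_le) auto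
    also have "\<dots> \<le> ennreal (\<kappa> * ?\<mu> (cap (x n) (r n)))"
      using J[OF nJ] r0(2) by (intro ennreal_leI) auto
    finally show "hausdorff_premeasure ?m \<delta> (if n \<in> F then cap (x n) (r n) else {}) \<le> ennreal (\<kappa> * ?\<mu> (cap (x n) (r n)))"
      using n by simp
  qed
  also have "\<dots> = ennreal (\<kappa> * s)" using \<kappa> by (simp add: s_def sum_distrib_left)
  also have "hausdorff_premeasure ?m \<delta> (sphere 0 1 \<inter> W) + ennreal (\<kappa> * s) \<le>
      ennreal ((\<kappa> + q) * ?\<mu> (sphere 0 1 \<inter> W)) + ennreal (\<kappa> * s)"
    by (intro add_right_mono bound W)
  also have "\<dots> = ennreal ((\<kappa> + q) * ?\<mu> (sphere 0 1 \<inter> W) + \<kappa> * s)"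
    using \<kappa> q by (intro ennreal_plus[symmetric]) (auto simp: s_def sum_nonneg)
  also have "\<dots> \<le> ennreal ((\<kappa> + (1 - \<theta>) * q) * ?\<mu> (sphere 0 1 \<inter> V))"
  proof (rule ennreal_leI)
    have "(\<kappa> + q) * ?\<mu> (sphere 0 1 \<inter> W) + \<kappa> * s = \<kappa> * ?\<mu> (sphere 0 1 \<inter> V) + q * (?\<mu> (sphere 0 1 \<inter> V) - s)"
      unfolding split by (simp add: algebra_simps)
    also have "\<dots> \<le> \<kappa> * ?\<mu> (sphere 0 1 \<inter> V) + q * (?\<mu> (sphere 0 1 \<inter> V) - ?\<mu> (sphere 0 1 \<inter> V) * \<theta>)"
      using s q by (intro add_left_mono mult_left_mono) auto
    finally show "(\<kappa> + q) * ?\<mu> (sphere 0 1 \<inter> W) + \<kappa> * s \<le> (\<kappa> + (1 - \<theta>) * q) * ?\<mu> (sphere 0 1 \<inter> V)"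
      by (simp add: algebra_simps)
  qed
  finally show ?thesis by (simp add: add_left_mono)
qed

text \<open>The start of the iteration: the enlarged caps cover, while the disjoint original ones
  control their total gauge. An enlarged cap has diameter at most 10 r, hence the radii are bounded
  by \<delta>/10.\<close>

lemma hausdorff_premeasure_crude:
  fixes V :: "'a::euclidean_space set" and \<kappa> :: real
  assumes \<kappa>: "1 < \<kappa>" and \<delta>: "0 < \<delta>" and V: "open V"
  shows "hausdorff_premeasure (DIM('a) - 1) \<delta> (sphere 0 1 \<inter> V) \<le>
    ennreal (\<kappa> * 5 ^ (DIM('a) - 1) * measure cone_measure (sphere 0 1 \<inter> V))"
proof -
  let ?m = "DIM('a) - 1"
  let ?w = "unit_ball_vol (real ?m)"
  let ?\<mu> = "measure (cone_measure :: 'a measure)"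
  obtain r0 where r0: "0 < r0"
    "\<And>(x::'a) r. norm x = 1 \<Longrightarrow> 0 < r \<Longrightarrow> r \<le> r0 \<Longrightarrow> ?w * r ^ ?m \<le> \<kappa> * ?\<mu> (cap x r)"
    using small_cap_estimates[OF \<kappa>] by metis
  have pos: "0 < min r0 (\<delta>/10)" using r0 \<delta> by auto
  obtain J :: "nat set" and x :: "nat \<Rightarrow> 'a" and r where
    J: "\<And>n. n \<in> J \<Longrightarrow> norm (x n) = 1 \<and> 0 < r n \<and> r n \<le> min r0 (\<delta>/10) \<and> cball (x n) (r n) \<subseteq> V"
    and disj: "disjoint_family_on (\<lambda>n. cball (x n) (r n)) J"
    and cov: "sphere 0 1 \<inter> V \<subseteq> (\<Union>n\<in>J. cap (x n) (5 * r n))"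
    by (rule cap_covering[OF V pos]) (rule that)
  have "hausdorff_premeasure ?m \<delta> (sphere 0 1 \<inter> V) \<le> hausdorff_premeasure ?m \<delta> (\<Union>n\<in>J. cap (x n) (5 * r n))"
    by (rule hausdorff_premeasure_mono[OF cov])
  also have "\<dots> \<le> (\<Sum>n. if n \<in> J then hausdorff_premeasure ?m \<delta> (cap (x n) (5 * r n)) else 0)"
    using \<delta> by (intro hausdorff_premeasure_UN_le) simp
  also have "\<dots> \<le> (\<Sum>n. ennreal (\<kappa> * 5 ^ ?m) * (if n \<in> J then emeasure cone_measure (cap (x n) (r n)) else 0))"
  proof (intro suminf_le)
    fix n
    show "(if n \<in> J then hausdorff_premeasure ?m \<delta> (cap (x n) (5 * r n)) else 0) \<le>
      ennreal (\<kappa> * 5 ^ ?m) * (if n \<in> J then emeasure cone_measure (cap (x n) (r n)) else 0)"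
    proof (cases "n \<in> J")
      case True
      have "hausdorff_premeasure ?m \<delta> (cap (x n) (5 * r n)) \<le> ennreal (?w * (5 * r n) ^ ?m)"
        using J[OF True] by (intro hausdorff_premeasure_cap_le) auto
      also have "?w * (5 * r n) ^ ?m = 5 ^ ?m * (?w * r n ^ ?m)" by (simp add: power_mult_distrib)
      also have "ennreal \<dots> \<le> ennreal (5 ^ ?m * (\<kappa> * ?\<mu> (cap (x n) (r n))))"
        using J[OF True] r0(2) by (intro ennreal_leI mult_left_mono) auto
      finally show ?thesis using True \<kappa>
        by (simp add: cone_measure.emeasure_eq_measure ennreal_mult'[symmetric] mult_ac)
    qed simp
  qed auto
  also have "\<dots> = ennreal (\<kappa> * 5 ^ ?m) * (\<Sum>n. if n \<in> J then emeasure cone_measure (cap (x n) (r n)) else 0)"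
    by simp
  also have "\<dots> \<le> ennreal (\<kappa> * 5 ^ ?m) * emeasure cone_measure (sphere 0 1 \<inter> V)"
    using J by (intro mult_left_mono cone_measure_caps_le V disj) auto
  finally show ?thesis using \<kappa> by (simp add: cone_measure.emeasure_eq_measure ennreal_mult'[symmetric])
qed

text \<open>Each improvement multiplies the excess q over \<kappa> by 1 - \<theta>, and \<theta>
  depends only on \<kappa> and the dimension, neither on the set nor on q. So the factor can be
  brought down to \<kappa>, and then \<kappa> tends to 1.\<close>

lemma hausdorff_premeasure_le_cone_measure:
  fixes V :: "'a::euclidean_space set"
  assumes \<delta>: "0 < \<delta>" and V: "open V"
  shows "hausdorff_premeasure (DIM('a) - 1) \<delta> (sphere 0 1 \<inter> V) \<le> emeasure cone_measure (sphere 0 1 \<inter> V)"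
proof -
  let ?m = "DIM('a) - 1"
  let ?\<mu> = "measure (cone_measure :: 'a measure)"
  have *: "hausdorff_premeasure ?m \<delta> (sphere 0 1 \<inter> V) \<le> ennreal (\<kappa> * ?\<mu> (sphere 0 1 \<inter> V))" if \<kappa>: "1 < \<kappa>" for \<kappa>
  proof -
    define \<theta> where "\<theta> = 1 / (2 * \<kappa>\<^sup>2 * 5 ^ ?m)"
    have k2: "1 \<le> \<kappa>\<^sup>2" using \<kappa> by (simp add: one_le_power)
    have "1 * 1 \<le> \<kappa>\<^sup>2 * 5 ^ ?m" using k2 by (intro mult_mono) auto
    then have \<theta>: "0 < \<theta>" "\<theta> < 1" using \<kappa> by (auto simp: \<theta>_def divide_less_eq)
    define q where "q = \<kappa> * 5 ^ ?m"
    have q: "0 \<le> q" using \<kappa> by (simp add: q_def)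
    have n: "hausdorff_premeasure ?m \<delta> (sphere 0 1 \<inter> V) \<le> ennreal ((\<kappa> + (1 - \<theta>) ^ n * q) * ?\<mu> (sphere 0 1 \<inter> V))"
      if "open V" for n and V :: "'a set"
      using that
    proof (induction n arbitrary: V)
      case 0
      have "hausdorff_premeasure ?m \<delta> (sphere 0 1 \<inter> V) \<le> ennreal (q * ?\<mu> (sphere 0 1 \<inter> V))"
        unfolding q_def by (rule hausdorff_premeasure_crude[OF \<kappa> \<delta> 0])
      also have "\<dots> \<le> ennreal ((\<kappa> + (1 - \<theta>) ^ 0 * q) * ?\<mu> (sphere 0 1 \<inter> V))"
        using \<kappa> by (intro ennreal_leI mult_right_mono) auto
      finally show ?case .
    next
      case (Suc n)
      have "0 \<le> (1 - \<theta>) ^ n * q" using \<theta> q by simp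
      from hausdorff_premeasure_improve[OF \<kappa> \<delta> this Suc.IH Suc.prems]
      show ?case by (simp add: \<theta>_def mult.assoc)
    qed
    have "(\<lambda>n. ennreal ((\<kappa> + (1 - \<theta>) ^ n * q) * ?\<mu> (sphere 0 1 \<inter> V))) \<longlonglongrightarrow>
        ennreal ((\<kappa> + 0 * q) * ?\<mu> (sphere 0 1 \<inter> V))"
      using \<theta> by (intro tendsto_intros LIMSEQ_realpow_zero) auto
    then show ?thesis using n[OF V] by (intro LIMSEQ_le_const) auto
  qed
  have "((\<lambda>\<kappa>. ennreal (\<kappa> * ?\<mu> (sphere 0 1 \<inter> V))) \<longlongrightarrow> ennreal (1 * ?\<mu> (sphere 0 1 \<inter> V))) (at_right 1)"
    by (intro tendsto_intros)
  moreover have "eventually (\<lambda>\<kappa>. hausdorff_premeasure ?m \<delta> (sphere 0 1 \<inter> V) \<le> ennreal (\<kappa> * ?\<mu> (sphere 0 1 \<inter> V))) (at_right 1)"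
    using * by (auto simp: eventually_at_right_field intro!: exI[of _ 2])
  ultimately have "hausdorff_premeasure ?m \<delta> (sphere 0 1 \<inter> V) \<le> ennreal (1 * ?\<mu> (sphere 0 1 \<inter> V))"
    by (rule tendsto_lowerbound) simp
  then show ?thesis by (simp add: cone_measure.emeasure_eq_measure)
qed

text \<open>The lower bound holds for all Borel sets. The upper bound is known for relatively open
  sets, uniformly in \<delta>, and outer regularity of the finite cone measure extends it.\<close>

theorem hausdorff_measure_sphere:
  fixes A :: "'a::euclidean_space set"
  assumes A: "A \<in> sets borel" "A \<subseteq> sphere 0 1"
  shows "emeasure (hausdorff_measure (DIM('a) - 1)) A = emeasure cone_measure A"
proof (rule antisym)
  show "emeasure cone_measure A \<le> emeasure (hausdorff_measure (DIM('a) - 1)) A"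
    using cone_measure_le_hausdorff[OF A] A by (simp add: emeasure_hausdorff_measure)
  have "emeasure (hausdorff_measure (DIM('a) - 1)) A \<le> emeasure cone_measure V" if V: "A \<subseteq> V" "open V" for V
  proof -
    have "hausdorff_outer (DIM('a) - 1) A \<le> hausdorff_outer (DIM('a) - 1) (sphere 0 1 \<inter> V)"
      using A V by (intro hausdorff_outer_mono) auto
    also have "\<dots> \<le> emeasure cone_measure (sphere 0 1 \<inter> V)"
      unfolding hausdorff_outer_def using V
      by (intro SUP_least hausdorff_premeasure_le_cone_measure) auto
    also have "\<dots> \<le> emeasure cone_measure V" using V by (intro emeasure_mono) auto
    finally show ?thesis using A by (simp add: emeasure_hausdorff_measure)
  qed
  then show "emeasure (hausdorff_measure (DIM('a) - 1)) A \<le> emeasure cone_measure A"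
    using outer_regular[of cone_measure A] A cone_measure.emeasure_finite[of UNIV]
    by (auto intro!: INF_greatest)
qed

section \<open>Polar coordinates\<close>

text \<open>The image M of Lebesgue measure off the origin under x \<mapsto> (sgn x, norm x) is the
  product of the cone measure and r^(N-1) dr. By uniqueness of product measures it suffices to
  compare rectangles A x B. For fixed A both sides are measures in B, and on rays {..<b} the claim
  is the scaling of truncated cones.\<close>

lemma nn_integral_polar:
  fixes f :: "'a::euclidean_space \<Rightarrow> ennreal"
  assumes f[measurable]: "f \<in> borel_measurable borel"
  shows "(\<integral>\<^sup>+x. f x \<partial>lborel) =
    (\<integral>\<^sup>+\<sigma>. (\<integral>\<^sup>+r\<in>{0<..}. f (r *\<^sub>R \<sigma>) * ennreal (r ^ (DIM('a) - 1)) \<partial>lborel) \<partial>cone_measure)"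
proof -
  let ?m = "DIM('a) - 1"
  define R where "R = density lborel (\<lambda>r::real. ennreal (r ^ ?m) * indicator {0<..} r)"
  define M where "M = distr (density lborel (indicator (- {0}))) (borel \<Otimes>\<^sub>M borel) (\<lambda>x::'a. (sgn x, norm x))"
  have ms[measurable]: "(\<lambda>x::'a. (sgn x, norm x)) \<in> borel \<rightarrow>\<^sub>M borel \<Otimes>\<^sub>M borel" by measurable
  have sR[simp, measurable_cong]: "sets R = sets borel" by (simp add: R_def)
  have eR: "emeasure R {..<b} = ennreal (b ^ DIM('a) / DIM('a))" if "0 < b" for b
  proof -
    have "emeasure R {..<b} = (\<integral>\<^sup>+r. ennreal (r ^ ?m) * indicator {0..b} r \<partial>lborel)"
      unfolding R_def
      by (subst emeasure_density, simp, simp, intro nn_integral_cong_AE AE_I[of _ _ "{0,b}"])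
         (auto simp: indicator_def emeasure_lborel_countable)
    also have "\<dots> = ennreal (b ^ DIM('a) / DIM('a) - 0 ^ DIM('a) / DIM('a))"
      by (rule nn_integral_FTC_Icc[where F = "\<lambda>r. r ^ DIM('a) / DIM('a)"])
         (use that in \<open>auto intro!: derivative_eq_intros\<close>)
    finally show ?thesis by (simp add: zero_power)
  qed
  have eR0: "emeasure R {..<b} = 0" if "b \<le> 0" for b
    unfolding R_def using that by (auto simp: emeasure_density indicator_def intro!: nn_integral_zero' AE_I2)
  have sig: "sigma_finite_measure R"
  proof
    let ?A = "range (\<lambda>n::nat. {..<real n})"
    show "\<exists>A. countable A \<and> A \<subseteq> sets R \<and> \<Union>A = space R \<and> (\<forall>a\<in>A. emeasure R a \<noteq> \<infinity>)"
    proof (intro exI[of _ ?A] conjI ballI)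
      show "\<Union>?A = space R" using reals_Archimedean2 by (auto simp: R_def)
      fix a assume "a \<in> ?A"
      then obtain n :: nat where "a = {..<real n}" by auto
      then show "emeasure R a \<noteq> \<infinity>" using eR[of "real n"] eR0[of "real n"] by (cases "n = 0") auto
    qed auto
  qed
  have MA: "emeasure M (A \<times> B) = emeasure lborel {x. x \<noteq> 0 \<and> sgn x \<in> A \<and> norm x \<in> B}"
    if [measurable]: "A \<in> sets borel" "B \<in> sets borel" for A :: "'a set" and B
  proof -
    have S: "(\<lambda>x::'a. (sgn x, norm x)) -` (A \<times> B) \<in> sets borel"
      using measurable_sets[OF ms, of "A \<times> B"] by simp
    have "emeasure M (A \<times> B) = (\<integral>\<^sup>+x. indicator (- {0}) x * indicator ((\<lambda>x::'a. (sgn x, norm x)) -` (A \<times> B)) x \<partial>lborel)"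
      unfolding M_def using S by (subst emeasure_distr) (auto simp: emeasure_density)
    also have "\<dots> = (\<integral>\<^sup>+x. indicator (- {0} \<inter> ((\<lambda>x::'a. (sgn x, norm x)) -` (A \<times> B))) x \<partial>lborel)"
      by (intro nn_integral_cong) (auto simp: indicator_def)
    also have "\<dots> = emeasure lborel (- {0} \<inter> ((\<lambda>x::'a. (sgn x, norm x)) -` (A \<times> B)))"
      using S by (intro nn_integral_indicator) auto
    also have "- {0} \<inter> ((\<lambda>x::'a. (sgn x, norm x)) -` (A \<times> B)) = {x. x \<noteq> 0 \<and> sgn x \<in> A \<and> norm x \<in> B}" by auto
    finally show ?thesis .
  qed
  have scale: "emeasure lborel {x. x \<noteq> 0 \<and> sgn x \<in> A \<and> norm x < b} = ennreal (b ^ DIM('a)) * emeasure lborel (open_cone A)"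
    if A: "A \<in> sets borel" and b: "0 < b" for A :: "'a set" and b
  proof -
    let ?S = "{x. x \<noteq> 0 \<and> sgn x \<in> A \<and> norm x < b}"
    have "?S = (ball 0 b - {0}) \<inter> (sgn -` A \<inter> space borel)" by auto
    also have "\<dots> \<in> sets borel" using A by (intro sets.Int sets.Diff measurable_sets[OF measurable_sgn_euclidean]) auto
    finally have S: "?S \<in> sets borel" .
    have "emeasure lborel ?S = (\<integral>\<^sup>+x. indicator ?S x \<partial>lborel)" using S by simp
    also have "\<dots> = ennreal (\<bar>b\<bar> ^ DIM('a)) * (\<integral>\<^sup>+x. indicator ?S (b *\<^sub>R x) \<partial>lborel)"
      using S b by (intro nn_integral_lborel_scale) auto
    also have "(\<lambda>x. indicator ?S (b *\<^sub>R x) :: ennreal) = indicator (open_cone A)"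
      using b by (auto simp: open_cone_def indicator_def sgn_scaleR fun_eq_iff)
    finally show ?thesis using A b by (simp add: sets_open_cone)
  qed
  have prod: "emeasure cone_measure A * emeasure R B = emeasure M (A \<times> B)"
    if A[measurable]: "A \<in> sets borel" and B: "B \<in> sets borel" for A :: "'a set" and B
  proof -
    have sgnA: "{x. x \<noteq> 0 \<and> sgn x \<in> A} \<in> sets borel"
    proof -
      have "{x. x \<noteq> 0 \<and> sgn x \<in> A} = - {0} \<inter> (sgn -` A \<inter> space borel)" by auto
      also have "\<dots> \<in> sets borel" by (intro sets.Int measurable_sets[OF measurable_sgn_euclidean]) auto
      finally show ?thesis .
    qed
    define P where "P = density R (\<lambda>_. emeasure cone_measure A)"
    define Q where "Q = distr (restrict_space lborel {x. x \<noteq> 0 \<and> sgn x \<in> A}) borel norm"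
    have nm: "norm \<in> restrict_space lborel {x. x \<noteq> 0 \<and> sgn x \<in> A} \<rightarrow>\<^sub>M borel"
      by (intro measurable_restrict_space1) simp
    have P: "emeasure P B = emeasure cone_measure A * emeasure R B" if "B \<in> sets borel" for B
      using that by (simp add: P_def emeasure_density nn_integral_cmult)
    have Q: "emeasure Q B = emeasure lborel {x. x \<noteq> 0 \<and> sgn x \<in> A \<and> norm x \<in> B}" if "B \<in> sets borel" for B
    proof -
      have "emeasure Q B = emeasure (restrict_space lborel {x. x \<noteq> 0 \<and> sgn x \<in> A}) (norm -` B \<inter> {x. x \<noteq> 0 \<and> sgn x \<in> A})"
        unfolding Q_def using that nm by (subst emeasure_distr) (auto simp: space_restrict_space)
      also have "\<dots> = emeasure lborel (norm -` B \<inter> {x. x \<noteq> 0 \<and> sgn x \<in> A})"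
        using sgnA by (intro emeasure_restrict_space) auto
      also have "norm -` B \<inter> {x. x \<noteq> 0 \<and> sgn x \<in> A} = {x. x \<noteq> 0 \<and> sgn x \<in> A \<and> norm x \<in> B}" by auto
      finally show ?thesis .
    qed
    have lt: "emeasure P {..<b} = emeasure Q {..<b}" for b
    proof (cases "0 < b")
      case True
      have "emeasure P {..<b} = of_nat DIM('a) * emeasure lborel (open_cone A) * ennreal (b ^ DIM('a) / DIM('a))"
        using True by (simp add: P eR emeasure_cone_measure A)
      also have "\<dots> = (ennreal (real DIM('a)) * ennreal (b ^ DIM('a) / DIM('a))) * emeasure lborel (open_cone A)"
        by (simp add: ennreal_of_nat_eq_real_of_nat mult_ac)
      also have "ennreal (real DIM('a)) * ennreal (b ^ DIM('a) / DIM('a)) = ennreal (b ^ DIM('a))"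
        using True by (simp add: ennreal_mult'[symmetric])
      also have "\<dots> * emeasure lborel (open_cone A) = emeasure Q {..<b}"
        using scale[OF A True] by (simp add: Q)
      finally show ?thesis .
    next
      case False
      then have "\<not> norm x < b" for x :: 'a using norm_ge_zero[of x] by linarith
      then show ?thesis using False by (simp add: P Q eR0)
    qed
    have "P = Q"
    proof (rule measure_eqI_generator_eq[where E = "range lessThan" and \<Omega> = UNIV and A = "\<lambda>n. {..<real n}"])
      show "Int_stable (range lessThan :: real set set)"
        proof (rule Int_stableI)
        fix a b :: "real set" assume "a \<in> range lessThan" "b \<in> range lessThan"
        then obtain x y where "a = {..<x}" "b = {..<y}" by auto
        then have "a \<inter> b = {..<min x y}" by auto
        then show "a \<inter> b \<in> range lessThan" by simp
      qed
      show "sets P = sigma_sets UNIV (range lessThan)" "sets Q = sigma_sets UNIV (range lessThan)"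
        by (simp_all add: P_def Q_def borel_Iio)
      show "(\<Union>i. {..<real i}) = UNIV" using reals_Archimedean2 by auto
      show "emeasure P {..<real i} \<noteq> \<infinity>" for i :: nat
        using eR[of "real i"] eR0[of "real i"] by (cases "i = 0") (auto simp: P ennreal_mult_eq_top_iff cone_measure.emeasure_eq_measure)
    qed (use lt in auto)
    then show ?thesis using P[OF B] Q[OF B] MA[OF A B] by simp
  qed
  have "cone_measure \<Otimes>\<^sub>M R = M"
  proof (rule pair_measure_eqI)
    show "sigma_finite_measure (cone_measure :: 'a measure)" by unfold_locales
    show "sets (cone_measure \<Otimes>\<^sub>M R) = sets M" by (simp add: M_def cong: sets_pair_measure_cong)
  qed (use sig prod in auto)
  interpret R: sigma_finite_measure R by fact
  have fm: "(\<lambda>(\<sigma>, r). f (r *\<^sub>R \<sigma>)) \<in> borel_measurable (borel \<Otimes>\<^sub>M borel)" by measurable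
  have "(\<integral>\<^sup>+x. f x \<partial>lborel) = (\<integral>\<^sup>+x. indicator (- {0}) x * f x \<partial>lborel)"
    by (intro nn_integral_cong_AE AE_I[of _ _ "{0}"]) (auto simp: indicator_def)
  also have "\<dots> = (\<integral>\<^sup>+x. indicator (- {0}) x * (case (sgn x, norm x) of (\<sigma>, r) \<Rightarrow> f (r *\<^sub>R \<sigma>)) \<partial>lborel)"
    by (intro nn_integral_cong) (auto simp: indicator_def sgn_div_norm)
  also have "\<dots> = (\<integral>\<^sup>+z. (case z of (\<sigma>, r) \<Rightarrow> f (r *\<^sub>R \<sigma>)) \<partial>M)"
    unfolding M_def using fm by (simp add: nn_integral_distr nn_integral_density)
  also have "\<dots> = (\<integral>\<^sup>+\<sigma>. (\<integral>\<^sup>+r. f (r *\<^sub>R \<sigma>) \<partial>R) \<partial>cone_measure)"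
    unfolding \<open>cone_measure \<Otimes>\<^sub>M R = M\<close>[symmetric]
    using fm by (subst R.nn_integral_fst[symmetric]) (auto cong: measurable_cong_sets sets_pair_measure_cong)
  also have "\<dots> = (\<integral>\<^sup>+\<sigma>. (\<integral>\<^sup>+r\<in>{0<..}. f (r *\<^sub>R \<sigma>) * ennreal (r ^ ?m) \<partial>lborel) \<partial>cone_measure)"
    unfolding R_def by (intro nn_integral_cong, subst nn_integral_density) (auto intro!: nn_integral_cong simp: mult_ac)
  finally show ?thesis .
qed

lemma sphere_measure_eq: "(sphere_measure :: 'a::euclidean_space measure) = restrict_space cone_measure (sphere 0 1)"
proof (rule measure_eqI)
  show s: "sets (sphere_measure :: 'a measure) = sets (restrict_space cone_measure (sphere 0 1))"
    by (simp add: sphere_measure_def sets_restrict_space)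
  fix A assume "A \<in> sets (sphere_measure :: 'a measure)"
  then obtain B where "A = sphere 0 1 \<inter> B" "B \<in> sets (borel :: 'a measure)"
    by (auto simp: sphere_measure_def sets_restrict_space)
  then have A: "A \<in> sets borel" "A \<subseteq> sphere 0 1" by auto
  have "space (hausdorff_measure (DIM('a) - 1) :: 'a measure) = UNIV"
    using sets_eq_imp_space_eq[OF sets_hausdorff_measure] by (metis space_borel)
  then show "emeasure sphere_measure A = emeasure (restrict_space cone_measure (sphere 0 1)) A"
    using A hausdorff_measure_sphere[OF A] by (simp add: sphere_measure_def emeasure_restrict_space)
qed

lemma AE_cone_measure_sphere: "AE \<sigma> in (cone_measure :: 'a::euclidean_space measure). \<sigma> \<in> sphere 0 1"
proof (rule AE_I[of _ _ "- sphere 0 1"])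
  have "open_cone (- sphere 0 1 :: 'a set) = {}" by (auto simp: open_cone_def norm_sgn)
  then show "emeasure (cone_measure :: 'a measure) (- sphere 0 1) = 0" by (simp add: emeasure_cone_measure)
qed auto

section \<open>Directional measures as integrals over balls\<close>

lemma borel_measurable_radial_mass [measurable]:
  fixes \<rho> :: "'a::euclidean_space \<Rightarrow> real"
  assumes [measurable]: "\<rho> \<in> borel_measurable borel"
  shows "(\<lambda>\<sigma>. \<integral>\<^sup>+ r \<in> {0<..<\<delta>}. ennreal (\<rho> (r *\<^sub>R \<sigma>) * r ^ (DIM('a) - 1)) \<partial>lborel) \<in> borel_measurable borel"
  by (rule lborel.borel_measurable_nn_integral) (simp add: case_prod_beta)

lemma nn_integral_directional_measure:
  fixes \<rho> :: "'a::euclidean_space \<Rightarrow> real" and \<phi> :: "'a \<Rightarrow> ennreal"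
  assumes [measurable]: "\<rho> \<in> borel_measurable borel" "\<phi> \<in> borel_measurable borel"
  shows "(\<integral>\<^sup>+\<sigma>. \<phi> \<sigma> \<partial>directional_measure \<rho> \<delta>) =
    (\<integral>\<^sup>+z. ennreal (\<rho> z) * \<phi> (sgn z) * indicator (ball 0 \<delta>) z \<partial>lborel)"
proof -
  have [measurable]: "ball (0::'a) \<delta> \<in> sets borel" by simp
  let ?h = "\<lambda>\<sigma>. \<integral>\<^sup>+ r \<in> {0<..<\<delta>}. ennreal (\<rho> (r *\<^sub>R \<sigma>) * r ^ (DIM('a) - 1)) \<partial>lborel"
  have m: "?h \<in> borel_measurable sphere_measure" "\<phi> \<in> borel_measurable sphere_measure"
    unfolding sphere_measure_eq by (intro measurable_restrict_space1, simp)+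
  have "(\<integral>\<^sup>+\<sigma>. \<phi> \<sigma> \<partial>directional_measure \<rho> \<delta>) = (\<integral>\<^sup>+\<sigma>. ?h \<sigma> * \<phi> \<sigma> \<partial>sphere_measure)"
    unfolding directional_measure_def by (rule nn_integral_density[OF m])
  also have "\<dots> = (\<integral>\<^sup>+\<sigma>. ?h \<sigma> * \<phi> \<sigma> * indicator (sphere 0 1) \<sigma> \<partial>cone_measure)"
    unfolding sphere_measure_eq by (rule nn_integral_restrict_space) simp
  also have "\<dots> = (\<integral>\<^sup>+\<sigma>. (\<integral>\<^sup>+r\<in>{0<..}. (ennreal (\<rho> (r *\<^sub>R \<sigma>)) * \<phi> (sgn (r *\<^sub>R \<sigma>)) * indicator (ball 0 \<delta>) (r *\<^sub>R \<sigma>))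
        * ennreal (r ^ (DIM('a) - 1)) \<partial>lborel) \<partial>cone_measure)"
  proof (rule nn_integral_cong_AE, use AE_cone_measure_sphere in eventually_elim)
    fix \<sigma> :: 'a assume s: "\<sigma> \<in> sphere 0 1"
    have "?h \<sigma> * \<phi> \<sigma> = (\<integral>\<^sup>+ r. ennreal (\<rho> (r *\<^sub>R \<sigma>) * r ^ (DIM('a) - 1)) * indicator {0<..<\<delta>} r * \<phi> \<sigma> \<partial>lborel)"
      by (rule nn_integral_multc[symmetric]) measurable
    also have "\<dots> = (\<integral>\<^sup>+r\<in>{0<..}. (ennreal (\<rho> (r *\<^sub>R \<sigma>)) * \<phi> (sgn (r *\<^sub>R \<sigma>)) * indicator (ball 0 \<delta>) (r *\<^sub>R \<sigma>))
        * ennreal (r ^ (DIM('a) - 1)) \<partial>lborel)"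
      by (intro nn_integral_cong) (use s in \<open>auto simp: indicator_def sgn_scaleR ennreal_mult'' mult_ac sgn_div_norm\<close>)
    finally show "?h \<sigma> * \<phi> \<sigma> * indicator (sphere 0 1) \<sigma> = \<dots>" using s by simp
  qed
  also have "\<dots> = (\<integral>\<^sup>+z. ennreal (\<rho> z) * \<phi> (sgn z) * indicator (ball 0 \<delta>) z \<partial>lborel)"
    by (rule nn_integral_polar[symmetric]) measurable
  finally show ?thesis .
qed

lemma compact_mass_finite:
  fixes \<rho> :: "'a::euclidean_space \<Rightarrow> real"
  assumes "set_integrable lborel K \<rho>" "K \<in> sets borel"
  shows "(\<integral>\<^sup>+z. ennreal (\<rho> z) * indicator K z \<partial>lborel) < \<infinity>"
proof -
  have "(\<integral>\<^sup>+z. ennreal (\<rho> z) * indicator K z \<partial>lborel) \<le> (\<integral>\<^sup>+z. ennreal (norm (indicator K z *\<^sub>R \<rho> z)) \<partial>lborel)"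
    by (intro nn_integral_mono) (auto simp: indicator_def intro!: ennreal_leI)
  also have "\<dots> < \<infinity>" using assms unfolding set_integrable_def by (simp add: integrable_iff_bounded)
  finally show ?thesis .
qed

lemma LINT_directional_measure:
  fixes \<rho> :: "'a::euclidean_space \<Rightarrow> real" and \<phi> :: "'a \<Rightarrow> real"
  assumes \<rho>: "\<rho> \<in> borel_measurable borel" "\<And>K. compact K \<Longrightarrow> set_integrable lborel K \<rho>"
    and \<phi>: "continuous_on UNIV \<phi>" "\<And>x. 0 \<le> \<phi> x"
  shows "ennreal (LINT \<sigma>|directional_measure \<rho> \<delta>. \<phi> \<sigma>) =
    (\<integral>\<^sup>+z. ennreal (\<rho> z) * ennreal (\<phi> (sgn z)) * indicator (ball 0 \<delta>) z \<partial>lborel)"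
proof -
  have [measurable]: "\<phi> \<in> borel_measurable borel" using \<phi>(1) by (rule borel_measurable_continuous_onI)
  \<comment> \<open>The bound is taken on the ball and not merely on the sphere, because
    \<open>sgn 0 = 0\<close>.\<close>
  obtain B where B: "\<And>x. x \<in> cball (0::'a) 1 \<Longrightarrow> \<phi> x \<le> B"
  proof -
    have "compact (\<phi> ` cball 0 1)" using continuous_on_subset[OF \<phi>(1)] by (intro compact_continuous_image) auto
    then have "bdd_above (\<phi> ` cball 0 1)" by (simp add: compact_imp_bounded bounded_imp_bdd_above)
    then obtain M where "\<forall>x\<in>cball 0 1. \<phi> x \<le> M" by (auto simp: bdd_above_def)
    then show ?thesis by (intro that[of M]) blast
  qed
  have eq: "(\<integral>\<^sup>+\<sigma>. ennreal (\<phi> \<sigma>) \<partial>directional_measure \<rho> \<delta>) =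
    (\<integral>\<^sup>+z. ennreal (\<rho> z) * ennreal (\<phi> (sgn z)) * indicator (ball 0 \<delta>) z \<partial>lborel)"
    using \<rho>(1) by (intro nn_integral_directional_measure) auto
  also have "\<dots> \<le> (\<integral>\<^sup>+z. ennreal B * (ennreal (\<rho> z) * indicator (cball 0 \<delta>) z) \<partial>lborel)"
  proof (rule nn_integral_mono)
    fix z :: 'a
    have "\<phi> (sgn z) \<le> B" by (intro B) (auto simp: norm_sgn)
    then have "ennreal (\<phi> (sgn z)) \<le> ennreal B" by (rule ennreal_leI)
    moreover have "indicator (ball 0 \<delta>) z \<le> (indicator (cball 0 \<delta>) z :: ennreal)" by (auto simp: indicator_def)
    ultimately show "ennreal (\<rho> z) * ennreal (\<phi> (sgn z)) * indicator (ball 0 \<delta>) z \<le> ennreal B * (ennreal (\<rho> z) * indicator (cball 0 \<delta>) z)"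
      by (subst mult.assoc, subst mult.left_commute, intro mult_mono) auto
  qed
  also have "\<dots> = ennreal B * (\<integral>\<^sup>+z. ennreal (\<rho> z) * indicator (cball 0 \<delta>) z \<partial>lborel)"
  proof (rule nn_integral_cmult)
    have [measurable]: "\<rho> \<in> borel_measurable borel" "cball (0::'a) \<delta> \<in> sets borel" using \<rho>(1) by auto
    show "(\<lambda>z. ennreal (\<rho> z) * indicator (cball 0 \<delta>) z) \<in> borel_measurable lborel" by measurable
  qed
  also have "\<dots> < \<infinity>" using compact_mass_finite[OF \<rho>(2), of "cball 0 \<delta>"] by (simp add: ennreal_mult_less_top less_top)
  finally have fin: "(\<integral>\<^sup>+\<sigma>. ennreal (\<phi> \<sigma>) \<partial>directional_measure \<rho> \<delta>) < \<infinity>" .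
  have mb: "\<phi> \<in> borel_measurable (directional_measure \<rho> \<delta>)"
    unfolding directional_measure_def sphere_measure_eq measurable_density_eq1 by (intro measurable_restrict_space1) simp
  have "integrable (directional_measure \<rho> \<delta>) \<phi>"
    using mb fin \<phi>(2) by (intro integrableI_nonneg) auto
  then have "(\<integral>\<^sup>+\<sigma>. ennreal (\<phi> \<sigma>) \<partial>directional_measure \<rho> \<delta>) = ennreal (LINT \<sigma>|directional_measure \<rho> \<delta>. \<phi> \<sigma>)"
    using \<phi>(2) by (intro nn_integral_eq_integral) auto
  then show ?thesis using eq by simp
qed

lemma continuous_integrable_finite_sphere:
  fixes \<phi> :: "'a::euclidean_space \<Rightarrow> real"
  assumes \<nu>: "finite_sphere_measure \<nu>" and \<phi>: "continuous_on UNIV \<phi>"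
  shows "integrable \<nu> \<phi>"
proof -
  interpret finite_measure \<nu> using \<nu> by (simp add: finite_sphere_measure_def)
  have s: "sets \<nu> = sets (restrict_space borel (sphere 0 1))" using \<nu> by (simp add: finite_sphere_measure_def)
  then have sp: "space \<nu> = sphere 0 1" by (simp add: sets_eq_imp_space_eq[OF s] space_restrict_space)
  have "compact (\<phi> ` sphere 0 1)" using continuous_on_subset[OF \<phi>] by (intro compact_continuous_image) auto
  then obtain B where "\<And>x. x \<in> sphere 0 1 \<Longrightarrow> norm (\<phi> x) \<le> B" by (meson bounded_iff compact_imp_bounded imageI)
  moreover have "\<phi> \<in> borel_measurable \<nu>"
    unfolding measurable_cong_sets[OF s refl]
    using \<phi> by (intro measurable_restrict_space1 borel_measurable_continuous_onI)
  ultimately show ?thesis using sp by (intro integrable_const_bound[of _ B]) auto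
qed

abbreviation sgn_mass :: "('a::euclidean_space \<Rightarrow> real) \<Rightarrow> real \<Rightarrow> ('a \<Rightarrow> real) \<Rightarrow> ennreal" where
  "sgn_mass \<rho> \<delta> \<phi> \<equiv> \<integral>\<^sup>+z. ennreal (\<rho> z) * ennreal (\<phi> (sgn z)) * indicator (ball 0 \<delta>) z \<partial>lborel"

text \<open>The hypothesis on \<mu> in the form in which it meets the energies: test functions are
  non-negative and defined on the whole space, integrals are over balls, limits are in the extended
  reals. The same \<delta>0 serves every \<phi>.\<close>

lemma directional_measure_tendsto:
  fixes \<rho> :: "nat \<Rightarrow> 'a::euclidean_space \<Rightarrow> real"
  assumes \<rho>: "admissible_kernels p \<rho>" and \<mu>: "limit_directional_measure \<rho> \<mu>"
  obtains \<delta>0 where "0 < \<delta>0"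
    "\<forall>\<phi> :: 'a \<Rightarrow> real. continuous_on UNIV \<phi> \<and> (\<forall>x. 0 \<le> \<phi> x) \<longrightarrow> (\<exists>I :: real \<Rightarrow> ennreal.
      (\<forall>\<delta>. 0 < \<delta> \<and> \<delta> < \<delta>0 \<longrightarrow>
        (\<lambda>k. sgn_mass (\<rho> k) \<delta> \<phi>) \<longlonglongrightarrow> I \<delta>)
      \<and> (I \<longlongrightarrow> (\<integral>\<^sup>+\<sigma>. ennreal (\<phi> \<sigma>) \<partial>\<mu>)) (at_right 0))"
proof -
  obtain \<delta>0 \<nu> where d: "0 < \<delta>0" and
    \<nu>: "\<And>\<delta>. 0 < \<delta> \<Longrightarrow> \<delta> < \<delta>0 \<Longrightarrow> finite_sphere_measure (\<nu> \<delta>)"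
    "\<And>\<delta> \<phi>. 0 < \<delta> \<Longrightarrow> \<delta> < \<delta>0 \<Longrightarrow> continuous_on (sphere 0 1) \<phi> \<Longrightarrow>
      (\<lambda>k. LINT \<sigma>|directional_measure (\<rho> k) \<delta>. (\<phi> \<sigma> :: real)) \<longlonglongrightarrow> (LINT \<sigma>|\<nu> \<delta>. \<phi> \<sigma>)"
    "\<And>\<phi>. continuous_on (sphere 0 1) \<phi> \<Longrightarrow> ((\<lambda>\<delta>. LINT \<sigma>|\<nu> \<delta>. (\<phi> \<sigma> :: real)) \<longlongrightarrow> (LINT \<sigma>|\<mu>. \<phi> \<sigma>)) (at_right 0)"
    using \<mu> unfolding limit_directional_measure_def by metis
  have f\<mu>: "finite_sphere_measure \<mu>" using \<mu> by (simp add: limit_directional_measure_def)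
  show ?thesis
  proof (rule that[OF d], intro allI impI)
    fix \<phi> :: "'a \<Rightarrow> real" assume "continuous_on UNIV \<phi> \<and> (\<forall>x. 0 \<le> \<phi> x)"
    then have \<phi>: "continuous_on UNIV \<phi>" "\<And>x. 0 \<le> \<phi> x" by auto
    have c: "continuous_on (sphere 0 1) \<phi>" using \<phi>(1) continuous_on_subset by blast
    have eq: "ennreal (LINT \<sigma>|directional_measure (\<rho> k) \<delta>. \<phi> \<sigma>) =
      sgn_mass (\<rho> k) \<delta> \<phi>" for k \<delta>
      using \<rho> by (intro LINT_directional_measure \<phi>) (auto simp: admissible_kernels_def)
    have "(\<integral>\<^sup>+\<sigma>. ennreal (\<phi> \<sigma>) \<partial>\<mu>) = ennreal (LINT \<sigma>|\<mu>. \<phi> \<sigma>)"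
      using \<phi>(2) by (intro nn_integral_eq_integral continuous_integrable_finite_sphere[OF f\<mu> \<phi>(1)]) auto
    then show "\<exists>I :: real \<Rightarrow> ennreal.
      (\<forall>\<delta>. 0 < \<delta> \<and> \<delta> < \<delta>0 \<longrightarrow>
        (\<lambda>k. sgn_mass (\<rho> k) \<delta> \<phi>) \<longlonglongrightarrow> I \<delta>)
      \<and> (I \<longlongrightarrow> (\<integral>\<^sup>+\<sigma>. ennreal (\<phi> \<sigma>) \<partial>\<mu>)) (at_right 0)"
      unfolding eq[symmetric]
      by (intro exI[of _ "\<lambda>\<delta>. ennreal (LINT \<sigma>|\<nu> \<delta>. \<phi> \<sigma>)"]) (auto intro!: tendsto_ennrealI \<nu> c)
  qed
qed

abbreviation Lp_mass :: "'a measure \<Rightarrow> real \<Rightarrow> ('a \<Rightarrow> real) \<Rightarrow> ennreal" where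
  "Lp_mass M p u \<equiv> \<integral>\<^sup>+x. ennreal (\<bar>u x\<bar> powr p) \<partial>M"

abbreviation L1_mass :: "'a::euclidean_space set \<Rightarrow> ('a \<Rightarrow> real) \<Rightarrow> ennreal" where
  "L1_mass A u \<equiv> \<integral>\<^sup>+x. ennreal \<bar>u x\<bar> * indicator A x \<partial>lborel"

abbreviation difference_mass :: "real \<Rightarrow> ('a::euclidean_space \<Rightarrow> ennreal) \<Rightarrow> ('a \<Rightarrow> real) \<Rightarrow> 'a \<Rightarrow> ennreal" where
  "difference_mass p f u z \<equiv> \<integral>\<^sup>+x. f x * ennreal (\<bar>u x - u (x - z)\<bar> powr p) \<partial>lborel"

abbreviation directional_mass :: "'b measure \<Rightarrow> real \<Rightarrow> ('b \<Rightarrow> real) \<Rightarrow> ('b \<Rightarrow> 'a::real_inner) \<Rightarrow> 'a \<Rightarrow> ennreal" where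
  "directional_mass M p w \<tau> \<sigma> \<equiv> \<integral>\<^sup>+y. ennreal (w y) * ennreal (\<bar>\<tau> y \<bullet> \<sigma>\<bar> powr p) \<partial>M"

section \<open>Mollifiers\<close>

text \<open>The function \<open>\<gamma>\<close> is the gradient of \<open>\<eta>\<close>; all that is used of it is the Taylor bound.\<close>

definition mollifier :: "real \<Rightarrow> ('a::euclidean_space \<Rightarrow> real) \<Rightarrow> ('a \<Rightarrow> 'a) \<Rightarrow> real \<Rightarrow> bool" where
  "mollifier \<epsilon> \<eta> \<gamma> L \<longleftrightarrow> 0 < \<epsilon> \<and> 0 \<le> L \<and> continuous_on UNIV \<eta> \<and> continuous_on UNIV \<gamma>
     \<and> (\<forall>x. 0 \<le> \<eta> x \<and> \<eta> x \<le> L \<and> norm (\<gamma> x) \<le> L)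
     \<and> (\<forall>x. \<epsilon> \<le> norm x \<longrightarrow> \<eta> x = 0 \<and> \<gamma> x = 0)
     \<and> (\<integral>\<^sup>+x. ennreal (\<eta> x) \<partial>lborel) = 1
     \<and> (\<forall>x h. norm h \<le> \<epsilon> \<longrightarrow> \<bar>\<eta> (x + h) - \<eta> x - \<gamma> x \<bullet> h\<bar> \<le> L * (norm h)\<^sup>2)"

text \<open>The squared positive part has the Lipschitz derivative 2 max 0 t. This is enough
  regularity for a mollifier with quadratic Taylor remainder.\<close>

lemma square_pos_part_Taylor:
  "\<bar>(max 0 s)\<^sup>2 - (max 0 t)\<^sup>2 - 2 * max 0 t * (s - t)\<bar> \<le> (s - t)\<^sup>2" for s t :: real
proof (cases "0 \<le> t"; cases "0 \<le> s")
  assume "0 \<le> t" "0 \<le> s"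
  then have "(max 0 s)\<^sup>2 - (max 0 t)\<^sup>2 - 2 * max 0 t * (s - t) = (s - t)\<^sup>2"
    by (simp add: power2_eq_square algebra_simps)
  then show ?thesis by simp
next
  assume a: "0 \<le> t" "\<not> 0 \<le> s"
  have "\<bar>(max 0 s)\<^sup>2 - (max 0 t)\<^sup>2 - 2 * max 0 t * (s - t)\<bar> = \<bar>t * (t - 2 * s)\<bar>"
    using a by (simp add: power2_eq_square algebra_simps)
  also have "\<dots> = t * t - 2 * (s * t)"
  proof -
    have "0 \<le> t * (t - 2 * s)" using a by (intro mult_nonneg_nonneg) auto
    then show ?thesis by (simp add: algebra_simps)
  qed
  also have "\<dots> \<le> (s - t)\<^sup>2" by (simp add: power2_eq_square algebra_simps)
  finally show ?thesis .
next
  assume a: "\<not> 0 \<le> t" "0 \<le> s"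
  then have "s \<le> s - t" by simp
  then have "s\<^sup>2 \<le> (s - t)\<^sup>2" using a by (intro power_mono) auto
  then show ?thesis using a by simp
qed auto

lemma mollifier_exists:
  assumes \<epsilon>: "0 < \<epsilon>"
  shows "\<exists>(\<eta> :: 'a::euclidean_space \<Rightarrow> real) \<gamma> L. mollifier \<epsilon> \<eta> \<gamma> L"
proof -
  \<comment> \<open>\<eta> is a multiple of T^2, where T is a paraboloid truncated at radius
    \<epsilon>. The square makes it continuously differentiable across the boundary.\<close>
  define T where "T x = max 0 (1 - (norm x)\<^sup>2 / \<epsilon>\<^sup>2)" for x :: 'a
  have T0: "0 \<le> T x" "T x \<le> 1" for x by (auto simp: T_def)
  have Tz: "T x = 0" if "\<epsilon> \<le> norm x" for x
    using that \<epsilon> power_mono[OF that, of 2] by (simp add: T_def field_simps)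
  have contT: "continuous_on UNIV T" unfolding T_def using \<epsilon> by (intro continuous_intros) auto
  have [measurable]: "T \<in> borel_measurable borel" using contT by (rule borel_measurable_continuous_onI)
  define Z where "Z = enn2real (\<integral>\<^sup>+x. ennreal ((T x)\<^sup>2) \<partial>lborel)"
  have fin: "(\<integral>\<^sup>+x. ennreal ((T x)\<^sup>2) \<partial>lborel) < \<infinity>"
  proof -
    have "(\<integral>\<^sup>+x. ennreal ((T x)\<^sup>2) \<partial>lborel) \<le> (\<integral>\<^sup>+x. indicator (cball (0::'a) \<epsilon>) x \<partial>lborel)"
    proof (rule nn_integral_mono)
      fix x :: 'a
      show "ennreal ((T x)\<^sup>2) \<le> indicator (cball 0 \<epsilon>) x"
        using Tz[of x] T0[of x] ennreal_leI[OF power_le_one[OF T0, of x 2]] by (auto simp: indicator_def)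
    qed
    also have "\<dots> < \<infinity>" using emeasure_bounded_finite[of "cball (0::'a) \<epsilon>"] by simp
    finally show ?thesis .
  qed
  have "0 < (\<integral>\<^sup>+x. ennreal ((T x)\<^sup>2) \<partial>lborel)"
  proof -
    have "0 < ennreal (9/16) * emeasure lborel (cball (0::'a) (\<epsilon>/2))"
      using \<epsilon> by (simp add: emeasure_cball ennreal_zero_less_mult_iff)
    also have "\<dots> = (\<integral>\<^sup>+x. ennreal (9/16) * indicator (cball (0::'a) (\<epsilon>/2)) x \<partial>lborel)"
      by (rule nn_integral_cmult_indicator[symmetric]) simp
    also have "\<dots> \<le> (\<integral>\<^sup>+x. ennreal ((T x)\<^sup>2) \<partial>lborel)"
    proof (intro nn_integral_mono)
      fix x :: 'a
      have "3/4 \<le> T x" if "norm x \<le> \<epsilon>/2"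
      proof -
        have "(norm x)\<^sup>2 / \<epsilon>\<^sup>2 \<le> (\<epsilon>/2)\<^sup>2 / \<epsilon>\<^sup>2" using power_mono[OF that, of 2] by (intro divide_right_mono) auto
        also have "\<dots> = 1/4" using \<epsilon> by (simp add: power_divide)
        finally have "(norm x)\<^sup>2 / \<epsilon>\<^sup>2 \<le> 1/4" .
        then show ?thesis unfolding T_def by linarith
      qed
      then have "norm x \<le> \<epsilon>/2 \<Longrightarrow> (3/4)\<^sup>2 \<le> (T x)\<^sup>2" by (intro power_mono) auto
      then show "ennreal (9/16) * indicator (cball 0 (\<epsilon>/2)) x \<le> ennreal ((T x)\<^sup>2)"
        by (auto simp: indicator_def power2_eq_square intro!: ennreal_leI)
    qed
    finally show ?thesis .
  qed
  with fin have Z: "0 < Z" "ennreal Z = (\<integral>\<^sup>+x. ennreal ((T x)\<^sup>2) \<partial>lborel)"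
    by (auto simp: Z_def enn2real_positive_iff)
  define \<eta> where "\<eta> x = (T x)\<^sup>2 / Z" for x
  define \<gamma> where "\<gamma> x = (- 4 * T x / (\<epsilon>\<^sup>2 * Z)) *\<^sub>R x" for x
  have n\<gamma>: "norm (\<gamma> x) \<le> 4 / (\<epsilon> * Z)" for x
  proof (cases "norm x < \<epsilon>")
    case True
    have "norm (\<gamma> x) = 4 * T x * norm x / (\<epsilon>\<^sup>2 * Z)" using Z T0 by (simp add: \<gamma>_def)
    also have "\<dots> \<le> 4 * 1 * \<epsilon> / (\<epsilon>\<^sup>2 * Z)"
      using T0 True Z \<epsilon> by (intro divide_right_mono mult_mono) auto
    also have "\<dots> = 4 / (\<epsilon> * Z)" using \<epsilon> by (simp add: power2_eq_square)
    finally show ?thesis .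
  qed (use Tz Z \<epsilon> in \<open>simp add: \<gamma>_def\<close>)
  \<comment> \<open>For |x| < 2 \<epsilon> the argument of the positive part changes by at most 5
    |h| / \<epsilon>, whose square accounts for 25; the quadratic term in the expansion of |x + h|^2
    accounts for the other 2. For larger |x| all terms vanish.\<close>
  have Taylor: "\<bar>\<eta> (x + h) - \<eta> x - \<gamma> x \<bullet> h\<bar> \<le> 27 / (\<epsilon>\<^sup>2 * Z) * (norm h)\<^sup>2" if h: "norm h \<le> \<epsilon>" for x h
  proof (cases "norm x < 2 * \<epsilon>")
    case True
    define t where "t = 1 - (norm x)\<^sup>2 / \<epsilon>\<^sup>2"
    define s where "s = 1 - (norm (x + h))\<^sup>2 / \<epsilon>\<^sup>2"
    have st: "s - t = - (2 * (x \<bullet> h) + (norm h)\<^sup>2) / \<epsilon>\<^sup>2"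
      using \<epsilon> by (simp add: s_def t_def field_simps power2_norm_eq_inner inner_add_left inner_add_right inner_commute)
    have "\<bar>2 * (x \<bullet> h) + (norm h)\<^sup>2\<bar> \<le> 2 * \<bar>x \<bullet> h\<bar> + (norm h)\<^sup>2"
      by (rule order_trans[OF abs_triangle_ineq]) (simp add: abs_mult)
    also have "\<dots> \<le> 2 * (2 * \<epsilon> * norm h) + \<epsilon> * norm h"
    proof (intro add_mono mult_left_mono)
      show "\<bar>x \<bullet> h\<bar> \<le> 2 * \<epsilon> * norm h"
        using True by (intro order_trans[OF Cauchy_Schwarz_ineq2] mult_right_mono) auto
      show "(norm h)\<^sup>2 \<le> \<epsilon> * norm h" using h by (simp add: power2_eq_square mult_right_mono)
    qed auto
    finally have "\<bar>2 * (x \<bullet> h) + (norm h)\<^sup>2\<bar> \<le> 5 * \<epsilon> * norm h" by simp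
    then have "(2 * (x \<bullet> h) + (norm h)\<^sup>2)\<^sup>2 \<le> (5 * \<epsilon> * norm h)\<^sup>2" by (intro abs_le_square_iff[THEN iffD1]) (use \<epsilon> in auto)
    then have st2: "(s - t)\<^sup>2 \<le> 25 * (norm h)\<^sup>2 / \<epsilon>\<^sup>2"
    proof -
      assume le: "(2 * (x \<bullet> h) + (norm h)\<^sup>2)\<^sup>2 \<le> (5 * \<epsilon> * norm h)\<^sup>2"
      have "(s - t)\<^sup>2 = (2 * (x \<bullet> h) + (norm h)\<^sup>2)\<^sup>2 / (\<epsilon>\<^sup>2)\<^sup>2"
        unfolding st power_divide power2_minus ..
      also have "\<dots> \<le> (5 * \<epsilon> * norm h)\<^sup>2 / (\<epsilon>\<^sup>2)\<^sup>2" using le by (rule divide_right_mono) simp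
      also have "\<dots> = 25 * (norm h)\<^sup>2 / \<epsilon>\<^sup>2" using \<epsilon> by (simp add: power_mult_distrib power2_eq_square)
      finally show ?thesis .
    qed
    have "Z * (\<eta> (x + h) - \<eta> x - \<gamma> x \<bullet> h) = (max 0 s)\<^sup>2 - (max 0 t)\<^sup>2 + 4 * max 0 t * (x \<bullet> h) / \<epsilon>\<^sup>2"
    proof -
      have "Z * \<eta> (x + h) = (max 0 s)\<^sup>2" "Z * \<eta> x = (max 0 t)\<^sup>2"
        using Z(1) by (simp_all add: \<eta>_def T_def s_def t_def)
      moreover have "Z * (\<gamma> x \<bullet> h) = - (4 * max 0 t * (x \<bullet> h) / \<epsilon>\<^sup>2)"
        using Z(1) by (simp add: \<gamma>_def T_def t_def)
      ultimately show ?thesis by (simp add: right_diff_distrib)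
    qed
    also have "\<dots> = ((max 0 s)\<^sup>2 - (max 0 t)\<^sup>2 - 2 * max 0 t * (s - t)) - 2 * max 0 t * ((norm h)\<^sup>2 / \<epsilon>\<^sup>2)"
      unfolding st using \<epsilon> by (simp add: field_simps)
    finally have "\<bar>Z * (\<eta> (x + h) - \<eta> x - \<gamma> x \<bullet> h)\<bar> \<le> \<bar>(max 0 s)\<^sup>2 - (max 0 t)\<^sup>2 - 2 * max 0 t * (s - t)\<bar> + \<bar>2 * max 0 t * ((norm h)\<^sup>2 / \<epsilon>\<^sup>2)\<bar>"
      by (simp only: abs_triangle_ineq4)
    also have "\<dots> \<le> 25 * (norm h)\<^sup>2 / \<epsilon>\<^sup>2 + 2 * ((norm h)\<^sup>2 / \<epsilon>\<^sup>2)"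
    proof (intro add_mono)
      show "\<bar>(max 0 s)\<^sup>2 - (max 0 t)\<^sup>2 - 2 * max 0 t * (s - t)\<bar> \<le> 25 * (norm h)\<^sup>2 / \<epsilon>\<^sup>2"
        using square_pos_part_Taylor[of s t] st2 by linarith
      have "\<bar>2 * max 0 t * ((norm h)\<^sup>2 / \<epsilon>\<^sup>2)\<bar> = 2 * T x * ((norm h)\<^sup>2 / \<epsilon>\<^sup>2)"
        unfolding t_def T_def[symmetric] using T0[of x] by (simp add: abs_mult)
      also have "\<dots> \<le> 2 * 1 * ((norm h)\<^sup>2 / \<epsilon>\<^sup>2)" using T0[of x] by (intro mult_right_mono) auto
      finally show "\<bar>2 * max 0 t * ((norm h)\<^sup>2 / \<epsilon>\<^sup>2)\<bar> \<le> 2 * ((norm h)\<^sup>2 / \<epsilon>\<^sup>2)" by simp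
    qed
    also have "\<dots> = 27 * (norm h)\<^sup>2 / \<epsilon>\<^sup>2" by (simp add: add_divide_distrib[symmetric])
    finally have "Z * \<bar>\<eta> (x + h) - \<eta> x - \<gamma> x \<bullet> h\<bar> \<le> 27 * (norm h)\<^sup>2 / \<epsilon>\<^sup>2"
      using Z(1) by (simp only: abs_mult abs_of_pos)
    then have "\<bar>\<eta> (x + h) - \<eta> x - \<gamma> x \<bullet> h\<bar> \<le> 27 * (norm h)\<^sup>2 / \<epsilon>\<^sup>2 / Z"
      using Z(1) by (simp only: pos_le_divide_eq mult.commute)
    then show ?thesis by simp
  next
    case False
    have "norm x \<le> norm (x + h) + norm h" using norm_triangle_ineq4[of "x + h" h] by simp
    then have "T (x + h) = 0" "T x = 0" using False h \<epsilon> by (auto intro!: Tz)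
    then show ?thesis using Z by (simp add: \<eta>_def \<gamma>_def)
  qed
  define L where "L = 1 / Z + 4 / (\<epsilon> * Z) + 27 / (\<epsilon>\<^sup>2 * Z)"
  have L: "1 / Z \<le> L" "4 / (\<epsilon> * Z) \<le> L" "27 / (\<epsilon>\<^sup>2 * Z) \<le> L" "0 \<le> L"
    using \<epsilon> Z by (auto simp: L_def)
  have "mollifier \<epsilon> \<eta> \<gamma> L"
    unfolding mollifier_def
  proof (intro conjI allI impI)
    show "continuous_on UNIV \<eta>" "continuous_on UNIV \<gamma>"
      unfolding \<eta>_def \<gamma>_def using Z \<epsilon> contT by (auto intro!: continuous_intros)
    show "0 \<le> \<eta> x" for x using Z by (simp add: \<eta>_def)
    show "\<eta> x \<le> L" for x
      using T0[of x] Z L(1) by (intro order_trans[OF _ L(1)]) (auto simp: \<eta>_def divide_right_mono power_le_one)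
    show "norm (\<gamma> x) \<le> L" for x using n\<gamma>[of x] L(2) by simp
    show "(\<integral>\<^sup>+x. ennreal (\<eta> x) \<partial>lborel) = 1"
    proof -
      have "(\<integral>\<^sup>+x. ennreal (\<eta> x) \<partial>lborel) = (\<integral>\<^sup>+x. ennreal (1/Z) * ennreal ((T x)\<^sup>2) \<partial>lborel)"
        using Z by (intro nn_integral_cong) (simp add: \<eta>_def ennreal_mult'[symmetric])
      also have "\<dots> = ennreal (1/Z) * ennreal Z" unfolding Z(2) by (rule nn_integral_cmult) simp
      also have "\<dots> = 1" using Z(1) by (simp add: ennreal_mult'[symmetric])
      finally show ?thesis .
    qed
    show "\<bar>\<eta> (x + h) - \<eta> x - \<gamma> x \<bullet> h\<bar> \<le> L * (norm h)\<^sup>2" if "norm h \<le> \<epsilon>" for x h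
      using order_trans[OF Taylor[OF that] mult_right_mono[OF L(3)]] by simp
  qed (use \<epsilon> L Tz in \<open>auto simp: \<eta>_def \<gamma>_def\<close>)
  then show ?thesis by blast
qed

lemma mollifierD:
  assumes "mollifier \<epsilon> \<eta> \<gamma> L"
  shows "0 < \<epsilon>" "0 \<le> L" "continuous_on UNIV \<eta>" "continuous_on UNIV \<gamma>"
    "0 \<le> \<eta> x" "\<eta> x \<le> L" "norm (\<gamma> x) \<le> L" "\<epsilon> \<le> norm x \<Longrightarrow> \<eta> x = 0" "\<epsilon> \<le> norm x \<Longrightarrow> \<gamma> x = 0"
    "(\<integral>\<^sup>+x. ennreal (\<eta> x) \<partial>lborel) = 1"
    "norm h \<le> \<epsilon> \<Longrightarrow> \<bar>\<eta> (x + h) - \<eta> x - \<gamma> x \<bullet> h\<bar> \<le> L * (norm h)\<^sup>2"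
    "\<eta> \<in> borel_measurable borel" "\<gamma> \<in> borel_measurable borel"
  using assms unfolding mollifier_def by (auto intro: borel_measurable_continuous_onI)

lemma mollifier_has_derivative:
  assumes \<eta>: "mollifier \<epsilon> \<eta> \<gamma> L"
  shows "(\<eta> has_derivative (\<lambda>h. \<gamma> x \<bullet> h)) (at x)"
  unfolding has_derivative_at
proof (intro conjI)
  show "bounded_linear (\<lambda>h. \<gamma> x \<bullet> h)" by (rule bounded_linear_inner_right)
  have "((\<lambda>h::'a. L * norm h) \<longlongrightarrow> L * norm (0::'a)) (at 0)" by (intro tendsto_intros)
  then have lim: "((\<lambda>h::'a. L * norm h) \<longlongrightarrow> 0) (at 0)" by simp
  have "eventually (\<lambda>h. norm h \<le> \<epsilon>) (at (0::'a))"
    using mollifierD(1)[OF \<eta>] by (auto simp: eventually_at dist_norm intro!: exI[of _ \<epsilon>])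
  then have "eventually (\<lambda>h. norm (norm (\<eta> (x + h) - \<eta> x - \<gamma> x \<bullet> h) / norm h) \<le> L * norm h) (at 0)"
  proof eventually_elim
    case (elim h)
    show ?case
      using mollifierD(11)[OF \<eta> elim, of x] by (cases "h = 0") (auto simp: divide_le_eq power2_eq_square mult.assoc)
  qed
  then show "(\<lambda>h. norm (\<eta> (x + h) - \<eta> x - \<gamma> x \<bullet> h) / norm h) \<midarrow>0\<rightarrow> 0"
    by (rule Lim_null_comparison[OF _ lim])
qed

text \<open>Shows that mollification kernels are admissible test functions. The sign from reflecting
  the argument cancels the one in the definition of distributional gradients.\<close>

lemma mollifier_reflected:
  assumes \<eta>: "mollifier \<epsilon> \<eta> \<gamma> L"
  shows "(\<lambda>y. \<eta> (x - y)) \<in> C1_c" "partial_deriv i (\<lambda>y. \<eta> (x - y)) y = - (\<gamma> (x - y) \<bullet> i)"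
proof -
  have d: "((\<lambda>y. \<eta> (x - y)) has_derivative (\<lambda>h. - (\<gamma> (x - y) \<bullet> h))) (at y)" for y
    using has_derivative_compose[OF has_derivative_diff[OF has_derivative_const has_derivative_ident] mollifier_has_derivative[OF \<eta>], of x y UNIV]
    by simp
  then have p: "partial_deriv i (\<lambda>y. \<eta> (x - y)) y = - (\<gamma> (x - y) \<bullet> i)" for i y
    unfolding partial_deriv_def using frechet_derivative_at[OF d, of y] by (metis (no_types))
  then show "partial_deriv i (\<lambda>y. \<eta> (x - y)) y = - (\<gamma> (x - y) \<bullet> i)" .
  have c: "continuous_on UNIV (\<lambda>y. \<eta> (x - y))"
    by (rule continuous_on_compose2[OF mollifierD(3)[OF \<eta>]]) (auto intro!: continuous_intros)
  have "{y. \<eta> (x - y) \<noteq> 0} \<subseteq> cball x \<epsilon>"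
    using mollifierD(8)[OF \<eta>] by (force simp: dist_norm)
  then have "compact (closure {y. \<eta> (x - y) \<noteq> 0})"
    by (metis bounded_cball bounded_subset compact_closure)
  moreover have "continuous_on UNIV (\<lambda>y. - (\<gamma> (x - y) \<bullet> i))" for i
    by (intro continuous_intros continuous_on_compose2[OF mollifierD(4)[OF \<eta>]]) auto
  ultimately show "(\<lambda>y. \<eta> (x - y)) \<in> C1_c"
    using d c unfolding C1_c_def C_c_def by (auto simp: differentiable_def p[abs_def])
qed

section \<open>Locally integrable functions and convolutions\<close>

definition loc_integrable :: "('a::euclidean_space \<Rightarrow> real) \<Rightarrow> bool" where
  "loc_integrable u \<longleftrightarrow> u \<in> borel_measurable borel
     \<and> (\<forall>r. L1_mass (cball 0 r) u < \<infinity>)"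

definition moll :: "('a::euclidean_space \<Rightarrow> real) \<Rightarrow> ('a \<Rightarrow> real) \<Rightarrow> 'a \<Rightarrow> real" where
  "moll \<eta> u x = (LINT y|lborel. \<eta> (x - y) * u y)"

lemma le_one_plus_powr: "\<bar>t\<bar> \<le> 1 + \<bar>t\<bar> powr p" if "1 \<le> p" for t p :: real
proof (cases "\<bar>t\<bar> \<le> 1")
  case True then show ?thesis by (meson add_increasing2 powr_ge_zero order_trans order_refl)
next
  case False
  then have "\<bar>t\<bar> powr 1 \<le> \<bar>t\<bar> powr p" using that by (intro powr_mono) auto
  then show ?thesis using False by simp
qed

text \<open>The inequality t \<le> 1 + t^p takes the place of Hoelder's. The bound is the same for
  all centres c, which later makes the Taylor remainders uniform in the point.\<close>

lemma Lp_local_mass_le: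
  fixes u :: "'a::euclidean_space \<Rightarrow> real"
  assumes p: "1 \<le> p" and u: "u \<in> Lp lborel p"
  shows "L1_mass (cball c r) u
    \<le> emeasure lborel (cball (0::'a) r) + Lp_mass lborel p u"
proof -
  have [measurable]: "u \<in> borel_measurable borel" using u by (simp add: Lp_def)
  have [measurable]: "cball c r \<in> sets borel" by simp
  have "L1_mass (cball c r) u \<le>
    (\<integral>\<^sup>+x. indicator (cball c r) x + ennreal (\<bar>u x\<bar> powr p) \<partial>lborel)"
  proof (rule nn_integral_mono)
    fix x :: 'a
    have "ennreal \<bar>u x\<bar> \<le> 1 + ennreal (\<bar>u x\<bar> powr p)"
      using ennreal_leI[OF le_one_plus_powr[OF p, of "u x"]] by (simp add: ennreal_plus)
    then show "ennreal \<bar>u x\<bar> * indicator (cball c r) x \<le> indicator (cball c r) x + ennreal (\<bar>u x\<bar> powr p)"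
      by (auto simp: indicator_def)
  qed
  also have "\<dots> = emeasure lborel (cball c r) + Lp_mass lborel p u"
    by (subst nn_integral_add) auto
  also have "emeasure lborel (cball c r) = emeasure lborel (cball (0::'a) r)"
  proof (cases "0 \<le> r")
    case True then show ?thesis by (simp add: emeasure_cball)
  qed simp
  finally show ?thesis .
qed

lemma Lp_nn_integral_finite: "u \<in> Lp M p \<Longrightarrow> Lp_mass M p u < \<infinity>"
  unfolding Lp_def using nn_integral_eq_integral[of M "\<lambda>x. \<bar>u x\<bar> powr p"] by auto

lemma Lp_loc_integrable: "loc_integrable u" if "1 \<le> p" "u \<in> Lp lborel p" for u :: "'a::euclidean_space \<Rightarrow> real"
  unfolding loc_integrable_def
proof (intro conjI allI)
  show "u \<in> borel_measurable borel" using that by (simp add: Lp_def)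
  fix r
  have "emeasure lborel (cball (0::'a) r) < \<infinity>" by (rule emeasure_bounded_finite) simp
  with Lp_nn_integral_finite[OF that(2)] show "L1_mass (cball 0 r) u < \<infinity>"
    by (intro le_less_trans[OF Lp_local_mass_le[OF that]]) (simp add: less_top)
qed

lemma loc_integrable_kernel:
  fixes u :: "'a::euclidean_space \<Rightarrow> real" and \<kappa> :: "'a \<Rightarrow> 'b::{banach, second_countable_topology}"
  assumes u: "loc_integrable u" and \<kappa>: "\<kappa> \<in> borel_measurable borel" "\<And>x. norm (\<kappa> x) \<le> L"
    "\<And>x. \<epsilon> \<le> norm x \<Longrightarrow> \<kappa> x = 0"
  shows "integrable lborel (\<lambda>y. u y *\<^sub>R \<kappa> (x - y))"
proof (rule integrableI_bounded)
  have [measurable]: "u \<in> borel_measurable borel" "\<kappa> \<in> borel_measurable borel"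
    using u \<kappa> by (auto simp: loc_integrable_def)
  show "(\<lambda>y. u y *\<^sub>R \<kappa> (x - y)) \<in> borel_measurable lborel" by measurable
  have L: "0 \<le> L" using norm_ge_zero[of "\<kappa> 0"] \<kappa>(2)[of 0] by linarith
  let ?r = "norm x + \<bar>\<epsilon>\<bar>"
  have [measurable]: "cball (0::'a) ?r \<in> sets borel" by simp
  have "(\<integral>\<^sup>+y. ennreal (norm (u y *\<^sub>R \<kappa> (x - y))) \<partial>lborel) \<le> (\<integral>\<^sup>+y. ennreal L * (ennreal \<bar>u y\<bar> * indicator (cball 0 ?r) y) \<partial>lborel)"
  proof (rule nn_integral_mono)
    fix y :: 'a
    show "ennreal (norm (u y *\<^sub>R \<kappa> (x - y))) \<le> ennreal L * (ennreal \<bar>u y\<bar> * indicator (cball 0 ?r) y)"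
    proof (cases "\<epsilon> \<le> norm (x - y)")
      case False
      then have "norm y \<le> ?r" using norm_triangle_ineq2[of y x] by (simp add: norm_minus_commute)
      moreover have "norm (u y *\<^sub>R \<kappa> (x - y)) \<le> L * \<bar>u y\<bar>"
        using mult_right_mono[OF \<kappa>(2)[of "x - y"], of "\<bar>u y\<bar>"] by (simp add: mult.commute)
      ultimately show ?thesis using L by (simp add: ennreal_mult'[symmetric] ennreal_leI)
    qed (use \<kappa>(3) in simp)
  qed
  also have "\<dots> = ennreal L * L1_mass (cball 0 ?r) u"
    by (rule nn_integral_cmult) measurable
  also have "\<dots> < \<infinity>" using u by (auto simp: loc_integrable_def ennreal_mult_less_top)
  finally show "(\<integral>\<^sup>+y. ennreal (norm (u y *\<^sub>R \<kappa> (x - y))) \<partial>lborel) < \<infinity>" .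
qed

lemma moll_integrable:
  assumes "loc_integrable u" "mollifier \<epsilon> \<eta> \<gamma> L"
  shows "integrable lborel (\<lambda>y. \<eta> (x - y) * u y)"
  using loc_integrable_kernel[OF assms(1) mollifierD(12)[OF assms(2)], of L \<epsilon> x] mollifierD(5,6,8)[OF assms(2)]
  by (simp add: mult.commute)

lemma borel_measurable_moll [measurable]:
  fixes u :: "'a::euclidean_space \<Rightarrow> real"
  assumes [measurable]: "u \<in> borel_measurable borel" "\<eta> \<in> borel_measurable borel"
  shows "moll \<eta> u \<in> borel_measurable borel"
  unfolding moll_def[abs_def] by (rule lborel.borel_measurable_lebesgue_integral) measurable

lemma nn_integral_mollifier_shift:
  fixes \<eta> :: "'a::euclidean_space \<Rightarrow> real"
  assumes \<eta>: "mollifier \<epsilon> \<eta> \<gamma> L"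
  shows "(\<integral>\<^sup>+x. ennreal (\<eta> (x - y)) \<partial>lborel) = 1" "(\<integral>\<^sup>+y. ennreal (\<eta> (x - y)) \<partial>lborel) = 1"
proof -
  have [measurable]: "\<eta> \<in> borel_measurable borel" using mollifierD(12)[OF \<eta>] .
  show "(\<integral>\<^sup>+x. ennreal (\<eta> (x - y)) \<partial>lborel) = 1"
    using nn_integral_lborel_shift[of "\<lambda>x. ennreal (\<eta> x)" "- y"] mollifierD(10)[OF \<eta>] by simp
  show "(\<integral>\<^sup>+y. ennreal (\<eta> (x - y)) \<partial>lborel) = 1"
    using nn_integral_lborel_reflect[of "\<lambda>x. ennreal (\<eta> x)" x] mollifierD(10)[OF \<eta>] by simp
qed

lemma integral_mollifier:
  assumes \<eta>: "mollifier \<epsilon> \<eta> \<gamma> L"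
  shows "integrable lborel (\<lambda>y. \<eta> (x - y))" "(LINT y|lborel. \<eta> (x - y)) = 1"
proof -
  have [measurable]: "\<eta> \<in> borel_measurable borel" using mollifierD(12)[OF \<eta>] .
  show "integrable lborel (\<lambda>y. \<eta> (x - y))"
    using nn_integral_mollifier_shift(2)[OF \<eta>, of x] mollifierD(5)[OF \<eta>] by (intro integrableI_nonneg) auto
  then have "ennreal (LINT y|lborel. \<eta> (x - y)) = 1"
    using nn_integral_mollifier_shift(2)[OF \<eta>, of x] mollifierD(5)[OF \<eta>] by (subst nn_integral_eq_integral[symmetric]) auto
  then show "(LINT y|lborel. \<eta> (x - y)) = 1" by simp
qed

lemma ennreal_abs_le_add: "\<bar>a\<bar> \<le> \<bar>b\<bar> + \<bar>c\<bar> \<Longrightarrow> ennreal \<bar>a\<bar> \<le> ennreal \<bar>b\<bar> + ennreal \<bar>c\<bar>"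
  by (metis abs_ge_zero ennreal_leI ennreal_plus)

text \<open>The approximable functions are closed under sums, multiples and limits in mean, so
  indicators suffice. For these, a compact set inside and an open set outside with almost the same
  measure are separated by Urysohn's lemma.\<close>

lemma bounded_continuous_dense_L1:
  fixes f :: "'a::euclidean_space \<Rightarrow> real"
  assumes M: "finite_measure M" "sets M = sets borel" and f: "integrable M f" and e: "0 < e"
  shows "\<exists>\<phi>. continuous_on UNIV \<phi> \<and> bounded (range \<phi>) \<and> (\<integral>\<^sup>+x. ennreal \<bar>f x - \<phi> x\<bar> \<partial>M) < ennreal e"
proof -
  interpret finite_measure M by fact
  note [measurable_cong] = M(2)
  define P where "P f \<longleftrightarrow> (\<forall>e>0. \<exists>\<phi>. continuous_on UNIV \<phi> \<and> bounded (range \<phi>) \<and> (\<integral>\<^sup>+x. ennreal \<bar>f x - \<phi> x\<bar> \<partial>M) < ennreal e)"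
    for f :: "'a \<Rightarrow> real"
  have cm: "\<phi> \<in> borel_measurable M" if "continuous_on UNIV \<phi>" for \<phi> :: "'a \<Rightarrow> real"
    using that borel_measurable_continuous_onI measurable_cong_sets[OF M(2) refl] by blast
  have Padd: "P (\<lambda>x. f x + g x)" if Pfg: "P f" "P g" and m[measurable]: "f \<in> borel_measurable M" "g \<in> borel_measurable M" for f g
    unfolding P_def
  proof (intro allI impI)
    fix e :: real assume e: "0 < e"
    then obtain \<phi> \<psi> where h: "continuous_on UNIV \<phi>" "bounded (range \<phi>)" "(\<integral>\<^sup>+x. ennreal \<bar>f x - \<phi> x\<bar> \<partial>M) < ennreal (e/2)"
      "continuous_on UNIV \<psi>" "bounded (range \<psi>)" "(\<integral>\<^sup>+x. ennreal \<bar>g x - \<psi> x\<bar> \<partial>M) < ennreal (e/2)"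
      using Pfg unfolding P_def by (meson half_gt_zero)
    note [measurable] = cm[OF h(1)] cm[OF h(4)]
    have "(\<integral>\<^sup>+x. ennreal \<bar>f x + g x - (\<phi> x + \<psi> x)\<bar> \<partial>M) \<le> (\<integral>\<^sup>+x. ennreal \<bar>f x - \<phi> x\<bar> + ennreal \<bar>g x - \<psi> x\<bar> \<partial>M)"
      by (intro nn_integral_mono ennreal_abs_le_add) linarith
    also have "\<dots> = (\<integral>\<^sup>+x. ennreal \<bar>f x - \<phi> x\<bar> \<partial>M) + (\<integral>\<^sup>+x. ennreal \<bar>g x - \<psi> x\<bar> \<partial>M)"
      by (rule nn_integral_add) measurable
    also have "\<dots> < ennreal (e/2 + e/2)" using h by (intro add_mono_ennreal) auto
    also have "\<dots> = ennreal e" by simp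
    finally show "\<exists>\<phi>. continuous_on UNIV \<phi> \<and> bounded (range \<phi>) \<and> (\<integral>\<^sup>+x. ennreal \<bar>f x + g x - \<phi> x\<bar> \<partial>M) < ennreal e"
      using h by (intro exI[of _ "\<lambda>x. \<phi> x + \<psi> x"]) (auto intro!: continuous_intros bounded_plus_comp)
  qed
  have Pcmult: "P (\<lambda>x. c * f x)" if Pf: "P f" and m[measurable]: "f \<in> borel_measurable M" for f c
    unfolding P_def
  proof (intro allI impI)
    fix e :: real assume e: "0 < e"
    then have "0 < e / (\<bar>c\<bar> + 1)" by (simp add: add_nonneg_pos)
    then obtain \<phi> where h: "continuous_on UNIV \<phi>" "bounded (range \<phi>)" "(\<integral>\<^sup>+x. ennreal \<bar>f x - \<phi> x\<bar> \<partial>M) < ennreal (e / (\<bar>c\<bar> + 1))"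
      using Pf unfolding P_def by meson
    note [measurable] = cm[OF h(1)]
    have "(\<integral>\<^sup>+x. ennreal \<bar>c * f x - c * \<phi> x\<bar> \<partial>M) = (\<integral>\<^sup>+x. ennreal \<bar>c\<bar> * ennreal \<bar>f x - \<phi> x\<bar> \<partial>M)"
      by (intro nn_integral_cong) (simp add: ennreal_mult'[symmetric] abs_mult[symmetric] right_diff_distrib)
    also have "\<dots> = ennreal \<bar>c\<bar> * (\<integral>\<^sup>+x. ennreal \<bar>f x - \<phi> x\<bar> \<partial>M)" by (rule nn_integral_cmult) measurable
    also have "\<dots> \<le> ennreal \<bar>c\<bar> * ennreal (e / (\<bar>c\<bar> + 1))" using h(3) by (intro mult_left_mono) auto
    also have "\<dots> = ennreal (\<bar>c\<bar> * (e / (\<bar>c\<bar> + 1)))" using e by (simp add: ennreal_mult'[symmetric])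
    also have "\<dots> < ennreal e" using e by (intro ennreal_lessI) (auto simp: field_simps)
    finally show "\<exists>\<phi>. continuous_on UNIV \<phi> \<and> bounded (range \<phi>) \<and> (\<integral>\<^sup>+x. ennreal \<bar>c * f x - \<phi> x\<bar> \<partial>M) < ennreal e"
    proof (intro exI[of _ "\<lambda>x. c * \<phi> x"] conjI)
      obtain B where "\<And>x. norm (\<phi> x) \<le> B" using h(2) by (auto simp: bounded_iff)
      then show "bounded (range (\<lambda>x. c * \<phi> x))"
        unfolding bounded_iff by (intro exI[of _ "\<bar>c\<bar> * B"]) (auto simp: abs_mult intro!: mult_left_mono)
    qed (use h in \<open>auto intro!: continuous_intros\<close>)
  qed
  have Plim: "P f" if s: "\<And>i. P (s i)" and m[measurable]: "f \<in> borel_measurable M" "\<And>i. s i \<in> borel_measurable M"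
    and lim: "(\<lambda>i. \<integral>\<^sup>+x. ennreal \<bar>f x - s i x\<bar> \<partial>M) \<longlonglongrightarrow> 0" for f and s :: "nat \<Rightarrow> 'a \<Rightarrow> real"
    unfolding P_def
  proof (intro allI impI)
    fix e :: real assume e: "0 < e"
    then have "eventually (\<lambda>i. (\<integral>\<^sup>+x. ennreal \<bar>f x - s i x\<bar> \<partial>M) < ennreal (e/2)) sequentially"
      by (intro order_tendstoD[OF lim]) simp
    then obtain i where i: "(\<integral>\<^sup>+x. ennreal \<bar>f x - s i x\<bar> \<partial>M) < ennreal (e/2)" unfolding eventually_sequentially by blast
    obtain \<phi> where h: "continuous_on UNIV \<phi>" "bounded (range \<phi>)" "(\<integral>\<^sup>+x. ennreal \<bar>s i x - \<phi> x\<bar> \<partial>M) < ennreal (e/2)"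
      using s[of i] e unfolding P_def by (meson half_gt_zero)
    note [measurable] = cm[OF h(1)]
    have "(\<integral>\<^sup>+x. ennreal \<bar>f x - \<phi> x\<bar> \<partial>M) \<le> (\<integral>\<^sup>+x. ennreal \<bar>f x - s i x\<bar> + ennreal \<bar>s i x - \<phi> x\<bar> \<partial>M)"
      by (intro nn_integral_mono ennreal_abs_le_add) linarith
    also have "\<dots> = (\<integral>\<^sup>+x. ennreal \<bar>f x - s i x\<bar> \<partial>M) + (\<integral>\<^sup>+x. ennreal \<bar>s i x - \<phi> x\<bar> \<partial>M)"
      by (rule nn_integral_add) measurable
    also have "\<dots> < ennreal (e/2 + e/2)" using h i by (intro add_mono_ennreal) auto
    also have "\<dots> = ennreal e" by simp
    finally show "\<exists>\<phi>. continuous_on UNIV \<phi> \<and> bounded (range \<phi>) \<and> (\<integral>\<^sup>+x. ennreal \<bar>f x - \<phi> x\<bar> \<partial>M) < ennreal e"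
      using h by blast
  qed
  have Pind: "P (indicator A)" if A: "A \<in> sets borel" for A
    unfolding P_def
  proof (intro allI impI)
    fix e :: real assume e: "0 < e"
    have fin: "emeasure M S \<noteq> \<infinity>" for S by simp
    obtain K where K: "K \<subseteq> A" "compact K" "emeasure M A < emeasure M K + ennreal (e/2)"
      using SUP_approx_ennreal[OF _ _ inner_regular[OF M(2) fin A] fin, of "e/2"] e by force
    obtain U where U: "A \<subseteq> U" "open U" "emeasure M U < emeasure M A + ennreal (e/2)"
      using INF_approx_ennreal[OF _ outer_regular[OF M(2) fin A] fin, of "e/2"] e by force
    have m: "K \<in> sets M" "U \<in> sets M" using K U M(2) by (auto simp: borel_compact)
    have "closed K" "closed (- U)" "K \<inter> - U = {}" using K U by (auto simp: compact_imp_closed)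
    then obtain \<phi> :: "'a \<Rightarrow> real" where \<phi>: "continuous_on UNIV \<phi>" "\<And>x. \<phi> x \<in> closed_segment 1 0"
      "\<And>x. x \<in> K \<Longrightarrow> \<phi> x = 1" "\<And>x. x \<in> - U \<Longrightarrow> \<phi> x = 0"
      by (rule Urysohn[where a = 1 and b = 0]) (rule that)
    have \<phi>01: "0 \<le> \<phi> x" "\<phi> x \<le> 1" for x using \<phi>(2)[of x] by (auto simp: closed_segment_eq_real_ivl)
    have "(\<integral>\<^sup>+x. ennreal \<bar>indicator A x - \<phi> x\<bar> \<partial>M) \<le> (\<integral>\<^sup>+x. indicator (U - K) x \<partial>M)"
    proof (rule nn_integral_mono)
      fix x
      show "ennreal \<bar>indicator A x - \<phi> x\<bar> \<le> indicator (U - K) x"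
        using K(1) U(1) \<phi>(3,4)[of x] \<phi>01[of x] by (auto simp: indicator_def subset_iff)
    qed
    also have "\<dots> = ennreal (measure M (U - K))" using m by (simp add: emeasure_eq_measure)
    also have "\<dots> < ennreal e"
    proof -
      have "measure M A < measure M K + e/2" "measure M U < measure M A + e/2"
        using K(3) U(3) e by (auto simp: emeasure_eq_measure ennreal_less_iff ennreal_plus[symmetric] simp del: ennreal_plus)
      moreover have "measure M (U - K) = measure M U - measure M K" using K U m by (intro finite_measure_Diff) auto
      ultimately show ?thesis using e by (intro ennreal_lessI) auto
    qed
    finally show "\<exists>\<phi>. continuous_on UNIV \<phi> \<and> bounded (range \<phi>) \<and> (\<integral>\<^sup>+x. ennreal \<bar>indicator A x - \<phi> x\<bar> \<partial>M) < ennreal e"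
      using \<phi>(1) \<phi>01 by (intro exI[of _ \<phi>]) (auto intro!: boundedI[of _ 1] simp: abs_le_iff)
  qed
  have "P f"
    using f
  proof (induction rule: integrable_induct)
    case (base A c)
    then have "P (\<lambda>x. c * indicator A x)" using M(2) by (intro Pcmult Pind) auto
    then show ?case by (simp add: mult.commute)
  next
    case (add f g)
    then show ?case by (intro Padd) auto
  next
    case (lim f s)
    have ms: "s i \<in> borel_measurable M" for i using lim.hyps(1) by (rule borel_measurable_integrable)
    have mf: "f \<in> borel_measurable M" using lim.hyps(4) by (rule borel_measurable_integrable)
    have "(\<lambda>i. \<integral>\<^sup>+x. ennreal (norm (f x - s i x)) \<partial>M) \<longlonglongrightarrow> 0"
    proof (rule nn_integral_dominated_convergence_norm[where w = "\<lambda>x. 2 * norm (f x)"])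
      have "integrable M (\<lambda>x. 2 * norm (f x))" using lim.hyps(4) by (intro integrable_mult_right integrable_norm)
      from nn_integral_eq_integral[OF this]
      show "(\<integral>\<^sup>+x. ennreal (2 * norm (f x)) \<partial>M) < \<infinity>" by simp
      show "AE x in M. norm (s i x) \<le> 2 * norm (f x)" for i by (rule AE_I2) (rule lim.hyps(3))
      show "AE x in M. (\<lambda>i. s i x) \<longlonglongrightarrow> f x" by (rule AE_I2) (rule lim.hyps(2))
    qed (use ms mf in auto)
    then have "(\<lambda>i. \<integral>\<^sup>+x. ennreal \<bar>f x - s i x\<bar> \<partial>M) \<longlonglongrightarrow> 0" by simp
    then show ?case by (rule Plim[OF lim.IH mf ms])
  qed
  then show ?thesis using e by (simp add: P_def)
qed

text \<open>Convexity of the power function: the tangent at a lies below the graph. It is Young's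
  inequality for t / a and 1; arguments equal to 0 are treated apart because of the conventions for
  \<open>powr\<close>.\<close>

lemma powr_tangent_le:
  fixes t a p :: real
  assumes p: "1 \<le> p" and ta: "0 \<le> t" "0 \<le> a"
  shows "a powr p + p * a powr (p - 1) * (t - a) \<le> t powr p"
proof (cases "a = 0 \<or> t = 0")
  case True
  show ?thesis
  proof (cases "a = 0")
    case False
    then have "a powr (p - 1) * a = a powr p" using ta powr_add[of a "p - 1" 1] by simp
    then have "a powr p + p * a powr (p - 1) * (t - a) = (1 - p) * a powr p" using True False by (simp add: algebra_simps)
    also have "\<dots> \<le> 0" using p by (intro mult_nonpos_nonneg) auto
    finally show ?thesis by (simp add: order_trans)
  qed (use p in auto)
next
  case False
  define y where "y = t / a"
  have y: "0 < y" using False ta by (simp add: y_def)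
  have "(y powr p) powr (1/p) * 1 powr (1 - 1/p) \<le> (1/p) * y powr p + (1 - 1/p) * 1"
    using p y by (intro Youngs_inequality_0) auto
  then have "y \<le> (1/p) * y powr p + (1 - 1/p)" using p y by (simp add: powr_powr)
  then have "p * y \<le> p * ((1/p) * y powr p + (1 - 1/p))" using p by (intro mult_left_mono) auto
  then have "1 + p * (y - 1) \<le> y powr p" using p by (simp add: algebra_simps)
  then have "a powr p * (1 + p * (y - 1)) \<le> a powr p * y powr p" by (intro mult_left_mono) auto
  also have "a powr p * y powr p = t powr p" using False ta y by (simp add: powr_mult[symmetric] y_def)
  also have "a powr p * (1 + p * (y - 1)) = a powr p + p * a powr (p - 1) * (t - a)"
    using False ta by (simp add: y_def powr_diff field_simps)
  finally show ?thesis .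
qed

text \<open>The tangent inequality at a = |\<integral> K f|, applied to |f|, is integrated against
  the probability density K. The linear term is non-negative because a is at most the integral of K
  |f|.\<close>

lemma powr_Jensen:
  fixes K f :: "'a \<Rightarrow> real"
  assumes p: "1 \<le> p" and K: "K \<in> borel_measurable M" "\<And>x. 0 \<le> K x" "(\<integral>\<^sup>+x. ennreal (K x) \<partial>M) = 1"
    and f: "f \<in> borel_measurable M" "integrable M (\<lambda>x. K x * f x)"
  shows "ennreal (\<bar>LINT x|M. K x * f x\<bar> powr p) \<le> (\<integral>\<^sup>+x. ennreal (K x * \<bar>f x\<bar> powr p) \<partial>M)"
proof (cases "(\<integral>\<^sup>+x. ennreal (K x * \<bar>f x\<bar> powr p) \<partial>M) = \<infinity>")
  case False
  note [measurable] = K(1) f(1)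
  have iK: "integrable M K" using K by (intro integrableI_nonneg) auto
  then have K1: "(LINT x|M. K x) = 1" using K by (simp add: integral_eq_nn_integral)
  have ip: "integrable M (\<lambda>x. K x * \<bar>f x\<bar> powr p)"
    using False K by (intro integrableI_nonneg) (auto simp: less_top)
  have ia: "integrable M (\<lambda>x. K x * \<bar>f x\<bar>)"
    using integrable_norm[OF f(2)] K(2) by (simp add: abs_mult)
  define a where "a = \<bar>LINT x|M. K x * f x\<bar>"
  have a0: "0 \<le> a" by (simp add: a_def)
  have "a \<le> (LINT x|M. K x * \<bar>f x\<bar>)"
    unfolding a_def using integral_norm_bound[of M "\<lambda>x. K x * f x"] K(2) by (simp add: abs_mult)
  then have "a powr p * 1 + p * a powr (p - 1) * (a - a * 1) \<le> a powr p * 1 + p * a powr (p - 1) * ((LINT x|M. K x * \<bar>f x\<bar>) - a * 1)"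
    using p by (intro add_left_mono mult_left_mono) auto
  also have "\<dots> = (LINT x|M. a powr p * K x + p * a powr (p - 1) * (K x * \<bar>f x\<bar> - a * K x))"
    using iK ia K1 by simp
  also have "\<dots> \<le> (LINT x|M. K x * \<bar>f x\<bar> powr p)"
  proof (rule integral_mono)
    show "integrable M (\<lambda>x. a powr p * K x + p * a powr (p - 1) * (K x * \<bar>f x\<bar> - a * K x))"
      using iK ia by simp
    fix x
    have "K x * (a powr p + p * a powr (p - 1) * (\<bar>f x\<bar> - a)) \<le> K x * \<bar>f x\<bar> powr p"
      using powr_tangent_le[OF p _ a0, of "\<bar>f x\<bar>"] K(2) by (intro mult_left_mono) auto
    then show "a powr p * K x + p * a powr (p - 1) * (K x * \<bar>f x\<bar> - a * K x) \<le> K x * \<bar>f x\<bar> powr p"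
      by (simp add: algebra_simps)
  qed (rule ip)
  finally have "a powr p \<le> (LINT x|M. K x * \<bar>f x\<bar> powr p)" by simp
  then show ?thesis
    using ip K(2) by (simp add: nn_integral_eq_integral a_def)
qed simp

lemma moll_powr_le:
  assumes p: "1 \<le> p" and u: "loc_integrable u" and \<eta>: "mollifier \<epsilon> \<eta> \<gamma> L"
  shows "ennreal (\<bar>moll \<eta> u x\<bar> powr p) \<le> (\<integral>\<^sup>+y. ennreal (\<eta> (x - y) * \<bar>u y\<bar> powr p) \<partial>lborel)"
  unfolding moll_def
proof (rule powr_Jensen[OF p])
  have [measurable]: "\<eta> \<in> borel_measurable borel" "u \<in> borel_measurable borel"
    using mollifierD(12)[OF \<eta>] u by (auto simp: loc_integrable_def)
  show "(\<lambda>y. \<eta> (x - y)) \<in> borel_measurable lborel" "u \<in> borel_measurable lborel" by measurable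
qed (use mollifierD(5)[OF \<eta>] nn_integral_mollifier_shift(2)[OF \<eta>] moll_integrable[OF u \<eta>] in auto)

lemma moll_diff_le:
  assumes u: "loc_integrable u" and \<eta>: "mollifier \<epsilon> \<eta> \<gamma> L"
  shows "ennreal \<bar>moll \<eta> u x - c\<bar> \<le> (\<integral>\<^sup>+y. ennreal (\<eta> (x - y)) * ennreal \<bar>u y - c\<bar> \<partial>lborel)"
proof -
  have i: "integrable lborel (\<lambda>y. \<eta> (x - y) * u y)" by (rule moll_integrable[OF u \<eta>])
  have j: "integrable lborel (\<lambda>y. \<eta> (x - y) * c)" using integral_mollifier(1)[OF \<eta>] by simp
  have "moll \<eta> u x - c = (LINT y|lborel. \<eta> (x - y) * u y - \<eta> (x - y) * c)"
    using Bochner_Integration.integral_diff[OF i j] integral_mollifier[OF \<eta>, of x] by (simp add: moll_def)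
  then have "ennreal \<bar>moll \<eta> u x - c\<bar> \<le> (\<integral>\<^sup>+y. ennreal (norm (\<eta> (x - y) * u y - \<eta> (x - y) * c)) \<partial>lborel)"
    using integral_norm_bound_ennreal[OF Bochner_Integration.integrable_diff[OF i j]] by simp
  also have "\<dots> = (\<integral>\<^sup>+y. ennreal (\<eta> (x - y)) * ennreal \<bar>u y - c\<bar> \<partial>lborel)"
    using mollifierD(5)[OF \<eta>] by (intro nn_integral_cong) (simp add: ennreal_mult'[symmetric] right_diff_distrib[symmetric] abs_mult)
  finally show ?thesis .
qed

text \<open>f is approximated in mean by a continuous \<phi> on a slightly larger ball, where \<phi>
  is uniformly continuous; mollification does not increase the error f - \<phi>. One d serves all
  mollifiers of smaller radius, whatever their shape.\<close>

lemma moll_L1_loc: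
  fixes f :: "'a::euclidean_space \<Rightarrow> real"
  assumes f: "loc_integrable f" and e: "0 < e"
  shows "\<exists>d>0. \<forall>\<epsilon> \<eta> \<gamma> L. mollifier \<epsilon> \<eta> \<gamma> L \<and> \<epsilon> < d \<longrightarrow>
    L1_mass (cball 0 r) (\<lambda>x. moll \<eta> f x - f x) \<le> ennreal e"
proof -
  have mf[measurable]: "f \<in> borel_measurable borel" using f by (simp add: loc_integrable_def)
  have [measurable]: "cball (0::'a) r \<in> sets borel" for r by simp
  define R where "R = \<bar>r\<bar> + 1"
  define M where "M = density lborel (indicator (cball (0::'a) R))"
  have fM: "finite_measure M"
  proof
    show "emeasure M (space M) \<noteq> \<infinity>"
      using emeasure_bounded_finite[of "cball (0::'a) R"] by (simp add: M_def emeasure_density)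
  qed
  have iM: "integrable M f"
  proof (rule integrableI_bounded)
    have "(\<integral>\<^sup>+x. ennreal (norm (f x)) \<partial>M) = L1_mass (cball 0 R) f"
      unfolding M_def by (subst nn_integral_density) (auto intro!: nn_integral_cong simp: mult.commute)
    then show "(\<integral>\<^sup>+x. ennreal (norm (f x)) \<partial>M) < \<infinity>" using f by (simp add: loc_integrable_def)
  qed (simp add: M_def)
  have "0 < e/3" using e by simp
  then obtain \<phi> where \<phi>: "continuous_on UNIV \<phi>" "(\<integral>\<^sup>+x. ennreal \<bar>f x - \<phi> x\<bar> \<partial>M) < ennreal (e/3)"
    using bounded_continuous_dense_L1[OF fM _ iM, of "e/3"] unfolding M_def by auto
  have [measurable]: "\<phi> \<in> borel_measurable borel" using \<phi>(1) by (rule borel_measurable_continuous_onI)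
  have f\<phi>: "L1_mass (cball 0 R) (\<lambda>x. f x - \<phi> x) \<le> ennreal (e/3)"
    using \<phi>(2) unfolding M_def by (subst (asm) nn_integral_density) (auto simp: mult.commute)
  define V where "V = measure lborel (cball (0::'a) r)"
  have V: "emeasure lborel (cball (0::'a) r) = ennreal V"
    using emeasure_bounded_finite[of "cball (0::'a) r"] by (simp add: V_def emeasure_eq_ennreal_measure less_top)
  have V0: "0 \<le> V" by (simp add: V_def)
  \<comment> \<open>Three errors of size e/3 arise: f - \<phi> itself, its mollification, and the
    oscillation e' of \<phi> integrated over a ball of volume V.\<close>
  define e' where "e' = e / (3 * (V + 1))"
  have e': "0 < e'" using e V0 by (simp add: e'_def add_nonneg_pos)
  have "uniformly_continuous_on (cball 0 R) \<phi>"
    using continuous_on_subset[OF \<phi>(1)] by (intro compact_uniformly_continuous) auto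
  then obtain d where d: "0 < d" "\<And>x y. x \<in> cball 0 R \<Longrightarrow> y \<in> cball 0 R \<Longrightarrow> dist y x < d \<Longrightarrow> dist (\<phi> y) (\<phi> x) < e'"
    unfolding uniformly_continuous_on_def using e' by metis
  show ?thesis
  proof (intro exI[of _ "min d 1"] conjI allI impI)
    fix \<epsilon> and \<eta> :: "'a \<Rightarrow> real" and \<gamma> L
    assume "mollifier \<epsilon> \<eta> \<gamma> L \<and> \<epsilon> < min d 1"
    then have \<eta>: "mollifier \<epsilon> \<eta> \<gamma> L" and \<epsilon>: "\<epsilon> < d" "\<epsilon> < 1" by auto
    have [measurable]: "\<eta> \<in> borel_measurable borel" using mollifierD(12)[OF \<eta>] .
    let ?g = "\<lambda>y. ennreal \<bar>f y - \<phi> y\<bar> * indicator (cball 0 R) y"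
    have pt: "ennreal \<bar>moll \<eta> f x - f x\<bar> * indicator (cball 0 r) x \<le>
      (\<integral>\<^sup>+y. ennreal (\<eta> (x - y)) * ?g y \<partial>lborel) + (?g x + ennreal e' * indicator (cball 0 r) x)" for x
    proof (cases "x \<in> cball 0 r")
      case True
      then have xR: "x \<in> cball 0 R" by (auto simp: R_def)
      have "ennreal \<bar>moll \<eta> f x - f x\<bar> \<le> (\<integral>\<^sup>+y. ennreal (\<eta> (x - y)) * ennreal \<bar>f y - f x\<bar> \<partial>lborel)"
        by (rule moll_diff_le[OF f \<eta>])
      also have "\<dots> \<le> (\<integral>\<^sup>+y. ennreal (\<eta> (x - y)) * ?g y + ennreal (\<eta> (x - y)) * (?g x + ennreal e') \<partial>lborel)"
      proof (rule nn_integral_mono)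
        fix y :: 'a
        show "ennreal (\<eta> (x - y)) * ennreal \<bar>f y - f x\<bar> \<le> ennreal (\<eta> (x - y)) * ?g y + ennreal (\<eta> (x - y)) * (?g x + ennreal e')"
        proof (cases "\<epsilon> \<le> norm (x - y)")
          case False
          have yR: "y \<in> cball 0 R"
            using True False \<epsilon> norm_triangle_ineq2[of y x] by (auto simp: R_def norm_minus_commute)
          have "\<bar>\<phi> y - \<phi> x\<bar> < e'" using d(2)[OF xR yR] False \<epsilon> by (simp add: dist_norm norm_minus_commute dist_real_def)
          then have "\<bar>f y - f x\<bar> \<le> \<bar>f y - \<phi> y\<bar> + (\<bar>f x - \<phi> x\<bar> + e')" by linarith
          then have "ennreal \<bar>f y - f x\<bar> \<le> ?g y + (?g x + ennreal e')"
            using xR yR e' by (simp add: ennreal_plus[symmetric] ennreal_leI del: ennreal_plus)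
          then show ?thesis by (subst distrib_left[symmetric]) (rule mult_left_mono, auto)
        qed (use mollifierD(8)[OF \<eta>] in simp)
      qed
      also have "\<dots> = (\<integral>\<^sup>+y. ennreal (\<eta> (x - y)) * ?g y \<partial>lborel) + (\<integral>\<^sup>+y. ennreal (\<eta> (x - y)) * (?g x + ennreal e') \<partial>lborel)"
        by (rule nn_integral_add) measurable
      also have "(\<integral>\<^sup>+y. ennreal (\<eta> (x - y)) * (?g x + ennreal e') \<partial>lborel) = ?g x + ennreal e'"
        by (subst nn_integral_multc) (simp_all add: nn_integral_mollifier_shift(2)[OF \<eta>])
      finally show ?thesis using True by simp
    qed simp
    have "L1_mass (cball 0 r) (\<lambda>x. moll \<eta> f x - f x) \<le>
      (\<integral>\<^sup>+x. (\<integral>\<^sup>+y. ennreal (\<eta> (x - y)) * ?g y \<partial>lborel) + (?g x + ennreal e' * indicator (cball 0 r) x) \<partial>lborel)"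
      by (intro nn_integral_mono pt)
    also have "\<dots> = (\<integral>\<^sup>+x. (\<integral>\<^sup>+y. ennreal (\<eta> (x - y)) * ?g y \<partial>lborel) \<partial>lborel)
       + ((\<integral>\<^sup>+x. ?g x \<partial>lborel) + ennreal e' * emeasure lborel (cball (0::'a) r))"
      by (subst nn_integral_add, measurable)+ (simp add: nn_integral_cmult_indicator)
    also have "(\<integral>\<^sup>+x. (\<integral>\<^sup>+y. ennreal (\<eta> (x - y)) * ?g y \<partial>lborel) \<partial>lborel) = (\<integral>\<^sup>+y. (\<integral>\<^sup>+x. ennreal (\<eta> (x - y)) * ?g y \<partial>lborel) \<partial>lborel)"
      by (rule lborel_pair.Fubini') measurable
    also have "\<dots> = (\<integral>\<^sup>+y. ?g y \<partial>lborel)"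
      by (intro nn_integral_cong, subst nn_integral_multc) (simp_all add: nn_integral_mollifier_shift(1)[OF \<eta>])
    also have "(\<integral>\<^sup>+y. ?g y \<partial>lborel) + ((\<integral>\<^sup>+x. ?g x \<partial>lborel) + ennreal e' * emeasure lborel (cball (0::'a) r)) \<le>
      ennreal (e/3) + (ennreal (e/3) + ennreal (e/3))"
    proof (intro add_mono f\<phi>)
      have "e' * V \<le> e/3" using e V0 by (simp add: e'_def divide_le_eq mult_left_mono field_simps)
      then show "ennreal e' * emeasure lborel (cball (0::'a) r) \<le> ennreal (e/3)"
        using e' V0 by (simp add: V ennreal_mult'[symmetric] ennreal_leI)
    qed
    also have "\<dots> = ennreal e" using e by (simp add: ennreal_plus[symmetric] del: ennreal_plus)
    finally show "L1_mass (cball 0 r) (\<lambda>x. moll \<eta> f x - f x) \<le> ennreal e" .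
  qed (use d in auto)
qed

definition mollifier_seq :: "(nat \<Rightarrow> 'a::euclidean_space \<Rightarrow> real) \<Rightarrow> (nat \<Rightarrow> 'a \<Rightarrow> 'a) \<Rightarrow> (nat \<Rightarrow> real) \<Rightarrow> bool" where
  "mollifier_seq \<eta> \<gamma> L \<longleftrightarrow> (\<forall>j. mollifier (1 / real (Suc j)) (\<eta> j) (\<gamma> j) (L j))"

lemma mollifier_seq_exists: "\<exists>(\<eta> :: nat \<Rightarrow> 'a::euclidean_space \<Rightarrow> real) \<gamma> L. mollifier_seq \<eta> \<gamma> L"
proof -
  have "\<forall>j::nat. \<exists>(\<eta> :: 'a \<Rightarrow> real) \<gamma> L. mollifier (1 / real (Suc j)) \<eta> \<gamma> L" by (intro allI mollifier_exists) simp
  then show ?thesis unfolding mollifier_seq_def by metis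
qed

lemma ennreal_tendsto_0I:
  fixes X :: "nat \<Rightarrow> ennreal"
  assumes "\<And>e. 0 < e \<Longrightarrow> eventually (\<lambda>n. X n \<le> ennreal e) sequentially"
  shows "X \<longlonglongrightarrow> 0"
proof (rule order_tendstoI)
  fix a :: ennreal assume "0 < a"
  then obtain e where e: "0 < e" "ennreal e < a"
    by (metis dense ennreal_cases ennreal_less_zero_iff less_top top.not_eq_extremum less_trans order_less_irrefl)
  show "eventually (\<lambda>n. X n < a) sequentially"
    using assms[OF e(1)] by eventually_elim (use e in auto)
qed simp

lemma moll_seq_L1_loc:
  assumes f: "loc_integrable f" and \<eta>: "mollifier_seq \<eta> \<gamma> L"
  shows "(\<lambda>j. \<integral>\<^sup>+x. ennreal \<bar>moll (\<eta> j) f x - f x\<bar> * indicator (cball 0 r) x \<partial>lborel) \<longlonglongrightarrow> 0"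
proof (rule ennreal_tendsto_0I)
  fix e :: real assume "0 < e"
  from moll_L1_loc[OF f this] obtain d where d: "0 < d" and
    *: "\<And>\<epsilon> \<eta> \<gamma> L. mollifier \<epsilon> \<eta> \<gamma> L \<Longrightarrow> \<epsilon> < d \<Longrightarrow>
      L1_mass (cball 0 r) (\<lambda>x. moll \<eta> f x - f x) \<le> ennreal e" by blast
  have "eventually (\<lambda>j. 1 / real (Suc j) < d) sequentially"
    using order_tendstoD(2)[OF LIMSEQ_inverse_real_of_nat d] by (simp add: inverse_eq_divide)
  then show "eventually (\<lambda>j. L1_mass (cball 0 r) (\<lambda>x. moll (\<eta> j) f x - f x) \<le> ennreal e) sequentially"
    by eventually_elim (rule *[OF \<eta>[unfolded mollifier_seq_def, rule_format]])
qed

text \<open>On each ball a subsequence realising the limit inferior converges almost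
  everywhere along a further subsequence, so Fatou's lemma applies.\<close>

lemma nn_integral_powr_lsc:
  fixes f :: "'a::euclidean_space \<Rightarrow> real" and h :: "'a \<Rightarrow> ennreal"
  assumes [measurable]: "f \<in> borel_measurable borel" "\<And>j. g j \<in> borel_measurable borel" "h \<in> borel_measurable borel"
    and lim: "\<And>r. (\<lambda>j. \<integral>\<^sup>+x. ennreal \<bar>g j x - f x\<bar> * indicator (cball 0 r) x \<partial>lborel) \<longlonglongrightarrow> 0"
    and p: "0 < p"
  shows "(\<integral>\<^sup>+x. h x * ennreal (\<bar>f x\<bar> powr p) \<partial>lborel) \<le> liminf (\<lambda>j. \<integral>\<^sup>+x. h x * ennreal (\<bar>g j x\<bar> powr p) \<partial>lborel)"
    (is "_ \<le> liminf ?a")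
proof -
  have [measurable]: "cball (0::'a) r \<in> sets borel" for r by simp
  obtain s where s: "strict_mono s" "(?a \<circ> s) \<longlonglongrightarrow> liminf ?a" using liminf_subseq_lim by blast
  have ball: "(\<integral>\<^sup>+x. h x * ennreal (\<bar>f x\<bar> powr p) * indicator (cball 0 r) x \<partial>lborel) \<le> liminf ?a" for r :: real
  proof -
    define b where "b j = L1_mass (cball 0 r) (\<lambda>x. g (s j) x - f x)" for j
    have bl: "b \<longlonglongrightarrow> 0" using LIMSEQ_subseq_LIMSEQ[OF lim s(1), of r] by (simp add: b_def[abs_def] o_def)
    then have "eventually (\<lambda>j. b j < 1) sequentially" by (rule order_tendstoD) simp
    then obtain n0 where n0: "\<And>j. n0 \<le> j \<Longrightarrow> b j < 1" unfolding eventually_sequentially by blast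
    define q where "q j x = (g (s (j + n0)) x - f x) * indicator (cball 0 r) x" for j x
    have [measurable]: "q j \<in> borel_measurable borel" for j unfolding q_def by measurable
    have nq: "(\<integral>\<^sup>+x. ennreal (norm (q j x)) \<partial>lborel) = b (j + n0)" for j
      unfolding q_def b_def by (intro nn_integral_cong) (auto simp: indicator_def)
    have iq: "integrable lborel (q j)" for j
    proof (rule integrableI_bounded)
      show "(\<integral>\<^sup>+x. ennreal (norm (q j x)) \<partial>lborel) < \<infinity>"
        unfolding nq using n0[of "j + n0"] by (auto intro: less_trans[OF _ ennreal_one_less_top])
    qed simp
    have "ennreal (LINT x|lborel. norm (q j x)) = b (j + n0)" for j
      using iq[of j] by (subst nq[symmetric], intro nn_integral_eq_integral[symmetric]) auto
    then have "(\<lambda>j. ennreal (LINT x|lborel. norm (q j x))) \<longlonglongrightarrow> ennreal 0"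
      using LIMSEQ_ignore_initial_segment[OF bl, of n0] by simp
    then have "(\<lambda>j. LINT x|lborel. norm (q j x)) \<longlonglongrightarrow> 0"
      by (subst (asm) tendsto_ennreal_iff) auto
    from tendsto_L1_AE_subseq[OF iq this] obtain t where t: "strict_mono t" "AE x in lborel. (\<lambda>n. q (t n) x) \<longlonglongrightarrow> 0" by blast
    define c where "c j = s (t j + n0)" for j
    have "(\<integral>\<^sup>+x. h x * ennreal (\<bar>f x\<bar> powr p) * indicator (cball 0 r) x \<partial>lborel) \<le>
      (\<integral>\<^sup>+x. liminf (\<lambda>j. h x * ennreal (\<bar>g (c j) x\<bar> powr p) * indicator (cball 0 r) x) \<partial>lborel)"
    proof (rule nn_integral_mono_AE, use t(2) in eventually_elim)
      fix x assume x: "(\<lambda>n. q (t n) x) \<longlonglongrightarrow> 0"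
      show "h x * ennreal (\<bar>f x\<bar> powr p) * indicator (cball 0 r) x \<le> liminf (\<lambda>j. h x * ennreal (\<bar>g (c j) x\<bar> powr p) * indicator (cball 0 r) x)"
      \<comment> \<open>h may be infinite, and multiplication by an infinite factor is not
        continuous at 0; the zeros of f are therefore set aside, where the left-hand side
        vanishes.\<close>
      proof (cases "x \<in> cball 0 r \<and> f x \<noteq> 0")
        case True
        then have "(\<lambda>n. g (c n) x - f x) \<longlonglongrightarrow> 0" using x by (simp add: q_def c_def)
        then have "(\<lambda>n. g (c n) x) \<longlonglongrightarrow> f x" by (simp add: LIM_zero_iff)
        then have "(\<lambda>n. ennreal (\<bar>g (c n) x\<bar> powr p)) \<longlonglongrightarrow> ennreal (\<bar>f x\<bar> powr p)"
          using True by (intro tendsto_ennrealI tendsto_powr tendsto_rabs tendsto_const) auto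
        then have "(\<lambda>n. h x * ennreal (\<bar>g (c n) x\<bar> powr p)) \<longlonglongrightarrow> h x * ennreal (\<bar>f x\<bar> powr p)"
          using True by (intro tendsto_mult_ennreal tendsto_const) auto
        then have "liminf (\<lambda>n. h x * ennreal (\<bar>g (c n) x\<bar> powr p)) = h x * ennreal (\<bar>f x\<bar> powr p)"
          by (intro lim_imp_Liminf) auto
        then show ?thesis using True by simp
      qed (use p in auto)
    qed
    also have "\<dots> \<le> liminf (\<lambda>j. \<integral>\<^sup>+x. h x * ennreal (\<bar>g (c j) x\<bar> powr p) * indicator (cball 0 r) x \<partial>lborel)"
      by (rule nn_integral_liminf) measurable
    also have "\<dots> \<le> liminf (\<lambda>j. ?a (c j))"
      by (intro Liminf_mono always_eventually allI nn_integral_mono) (auto simp: indicator_def)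
    also have "\<dots> = liminf ?a"
    proof (rule lim_imp_Liminf)
      have "strict_mono (\<lambda>j. t j + n0)" using t(1) by (auto simp: strict_mono_def)
      from LIMSEQ_subseq_LIMSEQ[OF s(2) this] show "(\<lambda>j. ?a (c j)) \<longlonglongrightarrow> liminf ?a" by (simp add: o_def c_def)
    qed simp
    finally show ?thesis .
  qed
  have "(\<integral>\<^sup>+x. h x * ennreal (\<bar>f x\<bar> powr p) \<partial>lborel) = (\<integral>\<^sup>+x. (SUP n::nat. h x * ennreal (\<bar>f x\<bar> powr p) * indicator (cball 0 (real n)) x) \<partial>lborel)"
  proof (rule nn_integral_cong)
    fix x :: 'a
    obtain n :: nat where "norm x \<le> real n" using real_arch_simple by blast
    then have "h x * ennreal (\<bar>f x\<bar> powr p) \<le> (SUP n::nat. h x * ennreal (\<bar>f x\<bar> powr p) * indicator (cball 0 (real n)) x)"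
      by (intro SUP_upper2[of n]) auto
    moreover have "(SUP n::nat. h x * ennreal (\<bar>f x\<bar> powr p) * indicator (cball 0 (real n)) x) \<le> h x * ennreal (\<bar>f x\<bar> powr p)"
      by (intro SUP_least) (auto simp: indicator_def)
    ultimately show "h x * ennreal (\<bar>f x\<bar> powr p) = (SUP n::nat. h x * ennreal (\<bar>f x\<bar> powr p) * indicator (cball 0 (real n)) x)"
      by (rule antisym)
  qed
  also have "\<dots> = (SUP n::nat. \<integral>\<^sup>+x. h x * ennreal (\<bar>f x\<bar> powr p) * indicator (cball 0 (real n)) x \<partial>lborel)"
    by (rule nn_integral_monotone_convergence_SUP) (auto simp: incseq_def le_fun_def indicator_def)
  also have "\<dots> \<le> liminf ?a" by (intro SUP_least ball)
  finally show ?thesis .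
qed

text \<open>The fundamental lemma of the calculus of variations: f is a local limit in mean of its
  mollifications.\<close>

lemma AE_eq_0_if_moll_0:
  fixes f :: "'a::euclidean_space \<Rightarrow> real"
  assumes f: "loc_integrable f" and z: "\<And>\<epsilon> \<eta> \<gamma> L x. mollifier \<epsilon> \<eta> \<gamma> L \<Longrightarrow> moll \<eta> f x = 0"
  shows "AE x in lborel. f x = 0"
proof -
  have [measurable]: "f \<in> borel_measurable borel" using f by (simp add: loc_integrable_def)
  obtain \<eta> \<gamma> L where \<eta>: "mollifier_seq (\<eta> :: nat \<Rightarrow> 'a \<Rightarrow> real) \<gamma> L" using mollifier_seq_exists by blast
  then have "mollifier (1 / real (Suc j)) (\<eta> j) (\<gamma> j) (L j)" for j by (simp add: mollifier_seq_def)
  then have z': "moll (\<eta> j) f x = 0" for j x by (rule z)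
  then have "(\<integral>\<^sup>+x. 1 * ennreal (\<bar>f x\<bar> powr 1) \<partial>lborel) \<le> liminf (\<lambda>j. \<integral>\<^sup>+x. 1 * ennreal (\<bar>moll (\<eta> j) f x\<bar> powr 1) \<partial>lborel)"
    using \<eta> by (intro nn_integral_powr_lsc moll_seq_L1_loc[OF f \<eta>] borel_measurable_moll)
      (auto simp: mollifier_seq_def intro: mollifierD(12))
  also have "\<dots> = 0" using z' by (simp add: Liminf_const)
  finally have "(\<integral>\<^sup>+x. ennreal \<bar>f x\<bar> \<partial>lborel) = 0" by simp
  then show ?thesis by (subst (asm) nn_integral_0_iff_AE) auto
qed

section \<open>Representation of the weak gradient\<close>

text \<open>The parts of A where \<theta> \<ge> 0 and where \<theta> < 0 form a partition that
  attains the supremum, since on each of them the absolute value can be taken outside the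
  integral.\<close>

lemma variation_measure_density:
  fixes m :: "'a::euclidean_space measure" and \<theta> :: "'a \<Rightarrow> real"
  assumes m: "sets m = sets borel" and \<theta>: "integrable m \<theta>"
    and \<nu>: "\<And>A. A \<in> sets borel \<Longrightarrow> \<nu> A = (LINT x:A|m. \<theta> x)"
  shows "variation_measure \<nu> = density m (\<lambda>x. ennreal \<bar>\<theta> x\<bar>)"
proof -
  note [measurable_cong] = m
  have sp: "space m = UNIV" using sets_eq_imp_space_eq[OF m] by simp
  have [measurable]: "\<theta> \<in> borel_measurable m" using \<theta> by auto
  define N where "N = density m (\<lambda>x. ennreal \<bar>\<theta> x\<bar>)"
  have sN: "sets N = sets borel" "space N = UNIV" by (simp_all add: N_def m sp)
  have eN: "emeasure N A = (\<integral>\<^sup>+x. ennreal (norm (indicator A x *\<^sub>R \<theta> x)) \<partial>m)" if "A \<in> sets borel" for A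
    using that m unfolding N_def by (subst emeasure_density) (auto intro!: nn_integral_cong simp: indicator_def)
  have iA: "integrable m (\<lambda>x. indicator A x *\<^sub>R \<theta> x)" if "A \<in> sets borel" for A
    using that m \<theta> by (intro integrable_mult_indicator) auto
  have le: "ennreal \<bar>\<nu> A\<bar> \<le> emeasure N A" if "A \<in> sets borel" for A
    using integral_norm_bound_ennreal[OF iA[OF that]] that by (simp add: eN \<nu> set_lebesgue_integral_def)
  have eq: "ennreal \<bar>\<nu> A\<bar> = emeasure N A"
    if "A \<in> sets borel" "(\<forall>x\<in>A. 0 \<le> \<theta> x) \<or> (\<forall>x\<in>A. \<theta> x \<le> 0)" for A
  proof -
    have "emeasure N A = ennreal (LINT x|m. norm (indicator A x *\<^sub>R \<theta> x))"
      using iA[OF that(1)] by (simp add: eN that nn_integral_eq_integral)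
    also have "(LINT x|m. norm (indicator A x *\<^sub>R \<theta> x)) = \<bar>\<nu> A\<bar>"
    proof (cases "\<forall>x\<in>A. 0 \<le> \<theta> x")
      case True
      then have "(\<lambda>x. norm (indicator A x *\<^sub>R \<theta> x)) = (\<lambda>x. indicator A x *\<^sub>R \<theta> x)" by (auto simp: indicator_def fun_eq_iff)
      moreover have "0 \<le> \<nu> A"
        unfolding \<nu>[OF that(1)] set_lebesgue_integral_def using True by (intro Bochner_Integration.integral_nonneg) (auto simp: indicator_def)
      ultimately show ?thesis by (simp add: \<nu>[OF that(1)] set_lebesgue_integral_def)
    next
      case False
      then have le0: "\<forall>x\<in>A. \<theta> x \<le> 0" using that(2) by auto
      then have "(\<lambda>x. norm (indicator A x *\<^sub>R \<theta> x)) = (\<lambda>x. - (indicator A x *\<^sub>R \<theta> x))" by (auto simp: indicator_def fun_eq_iff)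
      then have "(LINT x|m. norm (indicator A x *\<^sub>R \<theta> x)) = - \<nu> A" by (simp add: \<nu>[OF that(1)] set_lebesgue_integral_def)
      moreover have "0 \<le> (LINT x|m. norm (indicator A x *\<^sub>R \<theta> x))" by simp
      ultimately show ?thesis by simp
    qed
    finally show ?thesis ..
  qed
  have sup: "(SUP P \<in> {P. finite P \<and> disjoint P \<and> P \<subseteq> sets borel \<and> \<Union>P = A}. \<Sum>E\<in>P. ennreal \<bar>\<nu> E\<bar>) = emeasure N A"
    if A: "A \<in> sets borel" for A
  proof (rule antisym)
    show "(SUP P \<in> {P. finite P \<and> disjoint P \<and> P \<subseteq> sets borel \<and> \<Union>P = A}. \<Sum>E\<in>P. ennreal \<bar>\<nu> E\<bar>) \<le> emeasure N A"
    proof (rule SUP_least)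
      fix P assume "P \<in> {P. finite P \<and> disjoint P \<and> P \<subseteq> sets borel \<and> \<Union>P = A}"
      then have P: "finite P" "disjoint P" "P \<subseteq> sets borel" "\<Union>P = A" by auto
      have "(\<Sum>E\<in>P. ennreal \<bar>\<nu> E\<bar>) \<le> (\<Sum>E\<in>P. emeasure N E)" using P by (intro sum_mono le) auto
      also have "\<dots> = emeasure N (\<Union>E\<in>P. E)"
        using P sN by (intro sum_emeasure) (auto simp: disjoint_family_on_def disjoint_def)
      finally show "(\<Sum>E\<in>P. ennreal \<bar>\<nu> E\<bar>) \<le> emeasure N A" using P by simp
    qed
    define A1 where "A1 = A \<inter> {x. 0 \<le> \<theta> x}"
    define A2 where "A2 = A \<inter> {x. \<theta> x < 0}"
    have th: "\<theta> \<in> borel_measurable borel" using \<open>\<theta> \<in> borel_measurable m\<close> measurable_cong_sets[OF m refl] by blast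
    note [measurable] = th A
    have A1[measurable]: "A1 \<in> sets borel" and A2[measurable]: "A2 \<in> sets borel" unfolding A1_def A2_def by measurable
    have dis: "A1 \<inter> A2 = {}" "A1 \<union> A2 = A" by (auto simp: A1_def A2_def)
    have "emeasure N A = emeasure N A1 + emeasure N A2"
      using dis A1 A2 sN by (metis plus_emeasure)
    also have "\<dots> = ennreal \<bar>\<nu> A1\<bar> + ennreal \<bar>\<nu> A2\<bar>"
    proof -
      have "ennreal \<bar>\<nu> A1\<bar> = emeasure N A1" by (rule eq[OF A1]) (auto simp: A1_def)
      moreover have "ennreal \<bar>\<nu> A2\<bar> = emeasure N A2" by (rule eq[OF A2]) (auto simp: A2_def)
      ultimately show ?thesis by simp
    qed
    also have "\<dots> = (\<Sum>E\<in>{A1, A2}. ennreal \<bar>\<nu> E\<bar>)"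
    \<comment> \<open>A sum over a set of sets: if the two parts coincide, they are both empty and
      the sum has a single term 0.\<close>
    proof (cases "A1 = A2")
      case True
      then have "A1 = {}" "A2 = {}" using dis by auto
      moreover have "\<nu> {} = 0" by (simp add: \<nu> set_lebesgue_integral_def)
      ultimately show ?thesis by simp
    qed simp
    also have "\<dots> \<le> (SUP P \<in> {P. finite P \<and> disjoint P \<and> P \<subseteq> sets borel \<and> \<Union>P = A}. \<Sum>E\<in>P. ennreal \<bar>\<nu> E\<bar>)"
      using dis A1 A2 by (intro SUP_upper) (auto simp: disjoint_def)
    finally show "emeasure N A \<le> (SUP P \<in> {P. finite P \<and> disjoint P \<and> P \<subseteq> sets borel \<and> \<Union>P = A}. \<Sum>E\<in>P. ennreal \<bar>\<nu> E\<bar>)" .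
  qed
  have "variation_measure \<nu> = measure_of UNIV (sets borel) (emeasure N)"
    unfolding variation_measure_def
    by (rule measure_of_eq) (auto simp: sup sets.sigma_sets_eq[of borel, simplified] simp del: sum_ennreal)
  also have "\<dots> = N" using measure_of_of_measure[of N] by (simp add: sN)
  finally show ?thesis by (simp add: N_def)
qed

text \<open>One encoding for both function spaces. For p = 1 the gradient is the vector measure
  \<tau> m with m finite, for p > 1 it is the function \<tau> and m is Lebesgue measure; in either
  case the limit energy is made of integrals of |\<sigma> \<bullet> \<tau>|^p with respect to
  m.\<close>

definition gradient_rep :: "real \<Rightarrow> ('a::euclidean_space \<Rightarrow> real) \<Rightarrow> 'a measure \<Rightarrow> ('a \<Rightarrow> 'a) \<Rightarrow> bool" where
  "gradient_rep p u m \<tau> \<longleftrightarrow> u \<in> Lp lborel p \<and> sets m = sets borel \<and> \<tau> \<in> borel_measurable borel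
     \<and> (\<integral>\<^sup>+x. ennreal (norm (\<tau> x) powr p) \<partial>m) < \<infinity>
     \<and> (p = 1 \<and> finite_measure m \<or> 1 < p \<and> m = lborel)
     \<and> (\<forall>\<phi>\<in>C1_c. \<forall>i\<in>Basis. (LINT x|lborel. u x * partial_deriv i \<phi> x) = - (LINT x|m. \<phi> x * (\<tau> x \<bullet> i)))"

lemma weak_gradient_loc_integrable:
  fixes g :: "'a::euclidean_space \<Rightarrow> 'a"
  assumes g: "is_weak_gradient u g" and i: "i \<in> Basis"
  shows "loc_integrable (\<lambda>x. g x \<bullet> i)"
  unfolding loc_integrable_def
proof (intro conjI allI)
  have [measurable]: "g \<in> borel_measurable borel" using g by (simp add: is_weak_gradient_def)
  show "(\<lambda>x. g x \<bullet> i) \<in> borel_measurable borel" by measurable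
  fix r
  have "integrable lborel (\<lambda>x. indicator (cball (0::'a) r) x *\<^sub>R g x)"
    using g by (simp add: is_weak_gradient_def set_integrable_def)
  then have "(\<integral>\<^sup>+x. ennreal (norm (indicator (cball 0 r) x *\<^sub>R g x)) \<partial>lborel) < \<infinity>"
    by (simp add: integrable_iff_bounded)
  moreover have "L1_mass (cball 0 r) (\<lambda>x. g x \<bullet> i) \<le>
    (\<integral>\<^sup>+x. ennreal (norm (indicator (cball 0 r) x *\<^sub>R g x)) \<partial>lborel)"
    using Basis_le_norm[OF i] by (intro nn_integral_mono) (auto simp: indicator_def intro!: ennreal_leI)
  ultimately show "L1_mass (cball 0 r) (\<lambda>x. g x \<bullet> i) < \<infinity>"
    by (rule le_less_trans[rotated])
qed

lemma loc_integrable_diff: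
  assumes "loc_integrable f" "loc_integrable g"
  shows "loc_integrable (\<lambda>x. f x - g x)"
  unfolding loc_integrable_def
proof (intro conjI allI)
  have [measurable]: "f \<in> borel_measurable borel" "g \<in> borel_measurable borel"
    using assms by (auto simp: loc_integrable_def)
  show "(\<lambda>x. f x - g x) \<in> borel_measurable borel" by measurable
  fix r
  have [measurable]: "cball (0::'a) r \<in> sets borel" by simp
  have "L1_mass (cball 0 r) (\<lambda>x. f x - g x) \<le>
    (\<integral>\<^sup>+x. ennreal \<bar>f x\<bar> * indicator (cball 0 r) x + ennreal \<bar>g x\<bar> * indicator (cball 0 r) x \<partial>lborel)"
    by (intro nn_integral_mono) (auto simp: indicator_def intro!: ennreal_abs_le_add)
  also have "\<dots> = L1_mass (cball 0 r) f + L1_mass (cball 0 r) g"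
    by (rule nn_integral_add) measurable
  also have "\<dots> < \<infinity>" using assms by (auto simp: loc_integrable_def)
  finally show "L1_mass (cball 0 r) (\<lambda>x. f x - g x) < \<infinity>" .
qed

text \<open>Membership in \<open>W1p\<close> provides some gradient with integrable p-th power,
  while \<open>weak_gradient\<close> is an arbitrary choice; uniqueness transfers the integrability.
  Both gradients have the same mollifications, as these are pairings with test functions.\<close>

lemma weak_gradient_unique:
  fixes g h :: "'a::euclidean_space \<Rightarrow> 'a"
  assumes g: "is_weak_gradient u g" and h: "is_weak_gradient u h"
  shows "AE x in lborel. g x = h x"
proof -
  have "AE x in lborel. g x \<bullet> i - h x \<bullet> i = 0" if i: "i \<in> Basis" for i
  proof (rule AE_eq_0_if_moll_0)
    note lg = weak_gradient_loc_integrable[OF g i] and lh = weak_gradient_loc_integrable[OF h i]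
    show "loc_integrable (\<lambda>x. g x \<bullet> i - h x \<bullet> i)" by (rule loc_integrable_diff[OF lg lh])
    fix \<epsilon> and \<eta> :: "'a \<Rightarrow> real" and \<gamma> L and x :: 'a assume \<eta>: "mollifier \<epsilon> \<eta> \<gamma> L"
    have test: "(LINT y|lborel. u y * partial_deriv i (\<lambda>y. \<eta> (x - y)) y) = - moll \<eta> (\<lambda>x. G x \<bullet> i) x"
      if "is_weak_gradient u G" for G
    proof -
      have "(\<lambda>y. (G y \<bullet> i) * \<eta> (x - y)) = (\<lambda>y. \<eta> (x - y) * (G y \<bullet> i))" by (intro ext mult.commute)
      then show ?thesis
        using that mollifier_reflected(1)[OF \<eta>, of x] i unfolding is_weak_gradient_def moll_def by metis
    qed
    have "moll \<eta> (\<lambda>x. g x \<bullet> i) x = moll \<eta> (\<lambda>x. h x \<bullet> i) x"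
      using test[OF g] test[OF h] by linarith
    moreover have "moll \<eta> (\<lambda>x. g x \<bullet> i - h x \<bullet> i) x = moll \<eta> (\<lambda>x. g x \<bullet> i) x - moll \<eta> (\<lambda>x. h x \<bullet> i) x"
      unfolding moll_def right_diff_distrib
      by (rule Bochner_Integration.integral_diff[OF moll_integrable[OF lg \<eta>] moll_integrable[OF lh \<eta>]])
    ultimately show "moll \<eta> (\<lambda>x. g x \<bullet> i - h x \<bullet> i) x = 0" by simp
  qed
  then have "AE x in lborel. \<forall>i\<in>Basis. g x \<bullet> i - h x \<bullet> i = 0" by (intro AE_finite_allI) auto
  then show ?thesis by eventually_elim (auto intro: euclidean_eqI)
qed

text \<open>For p = 1, any representation \<tau> m of the chosen gradient measure has |\<sigma>
  \<bullet> \<tau>| m as the total variation of its \<sigma>-component. For p > 1, uniqueness makes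
  the chosen weak gradient p-integrable.\<close>

lemma S_space_gradient_rep:
  fixes u :: "'a::euclidean_space \<Rightarrow> real"
  assumes p: "1 \<le> p" and u: "u \<in> S_space p"
  obtains m \<tau> where "gradient_rep p u m \<tau>"
    "\<And>w0 \<sigma>. w0 \<in> borel_measurable borel \<Longrightarrow>
      directional_seminorm_pow p w0 u \<sigma> = (\<integral>\<^sup>+x. ennreal (w0 x * \<bar>\<sigma> \<bullet> \<tau> x\<bar> powr p) \<partial>m)"
proof (cases "p = 1")
  case True
  with u have "u \<in> Lp lborel 1" and ex: "\<exists>D. is_gradient_measure u D" by (auto simp: S_space_def BV_def)
  have "is_gradient_measure u (gradient_measure u)"
    unfolding gradient_measure_def by (rule someI_ex[OF ex])
  then obtain m \<tau> where m: "finite_measure m" "sets m = sets borel" "integrable m \<tau>"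
    "\<forall>A\<in>sets borel. gradient_measure u A = (LINT x:A|m. \<tau> x)"
    "\<forall>\<phi>\<in>C1_c. \<forall>i\<in>Basis. (LINT x|lborel. u x * partial_deriv i \<phi> x) = - (LINT x|m. \<phi> x * (\<tau> x \<bullet> i))"
    unfolding is_gradient_measure_def by auto
  have t: "\<tau> \<in> borel_measurable borel"
    using borel_measurable_integrable[OF m(3)] measurable_cong_sets[OF m(2) refl] by blast
  have rep: "gradient_rep p u m \<tau>"
    unfolding gradient_rep_def using True m t \<open>u \<in> Lp lborel 1\<close> by (simp add: integrable_iff_bounded)
  have var: "variation_measure (\<lambda>A. \<sigma> \<bullet> gradient_measure u A) = density m (\<lambda>x. ennreal \<bar>\<sigma> \<bullet> \<tau> x\<bar>)" for \<sigma>
  proof (rule variation_measure_density[OF m(2)])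
    show "integrable m (\<lambda>x. \<sigma> \<bullet> \<tau> x)" using m(3) by simp
    fix A :: "'a set" assume A: "A \<in> sets borel"
    have "integrable m (\<lambda>x. indicator A x *\<^sub>R \<tau> x)"
      using m A by (intro integrable_mult_indicator) auto
    then show "\<sigma> \<bullet> gradient_measure u A = (LINT x:A|m. \<sigma> \<bullet> \<tau> x)"
      using A m(4) by (simp add: set_lebesgue_integral_def flip: integral_inner_right)
  qed
  show ?thesis
  proof (rule that[OF rep])
    fix w0 :: "'a \<Rightarrow> real" and \<sigma> assume "w0 \<in> borel_measurable borel"
    then have "w0 \<in> borel_measurable m" "\<tau> \<in> borel_measurable m" using t measurable_cong_sets[OF m(2) refl] by blast+
    then show "directional_seminorm_pow p w0 u \<sigma> = (\<integral>\<^sup>+x. ennreal (w0 x * \<bar>\<sigma> \<bullet> \<tau> x\<bar> powr p) \<partial>m)"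
      unfolding directional_seminorm_pow_def var using True
      by (simp add: nn_integral_density ennreal_mult'' mult.commute)
  qed
next
  case False
  with p have p1: "1 < p" by simp
  from False u obtain g where u: "u \<in> Lp lborel p" and g: "is_weak_gradient u g" "(\<lambda>x. norm (g x)) \<in> Lp lborel p"
    by (auto simp: S_space_def W1p_def)
  define \<tau> where "\<tau> = weak_gradient u"
  have \<tau>: "is_weak_gradient u \<tau>" unfolding \<tau>_def weak_gradient_def by (rule someI[where P = "is_weak_gradient u", OF g(1)])
  have [measurable]: "g \<in> borel_measurable borel" "\<tau> \<in> borel_measurable borel"
    using g \<tau> by (simp_all add: is_weak_gradient_def)
  have "AE x in lborel. g x = \<tau> x" by (rule weak_gradient_unique[OF g(1) \<tau>])
  then have "(\<integral>\<^sup>+x. ennreal (norm (\<tau> x) powr p) \<partial>lborel) = (\<integral>\<^sup>+x. ennreal (norm (g x) powr p) \<partial>lborel)"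
    by (intro nn_integral_cong_AE) auto
  also have "\<dots> < \<infinity>" using Lp_nn_integral_finite[OF g(2)] by simp
  finally have "gradient_rep p u lborel \<tau>"
    unfolding gradient_rep_def using u p1 \<tau> by (simp add: is_weak_gradient_def mult.commute)
  then show ?thesis
    using False by (intro that) (auto simp: directional_seminorm_pow_def \<tau>_def)
qed

lemma gradient_repD:
  assumes "gradient_rep p u m \<tau>"
  shows "1 \<le> p" "u \<in> Lp lborel p" "sets m = sets borel" "\<tau> \<in> borel_measurable borel" "sigma_finite_measure m"
    "loc_integrable u" "\<tau> \<in> borel_measurable m"
proof -
  show *: "1 \<le> p" "u \<in> Lp lborel p" "sets m = sets borel" "\<tau> \<in> borel_measurable borel"
    using assms by (auto simp: gradient_rep_def)
  show "loc_integrable u" by (rule Lp_loc_integrable) fact+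
  show "sigma_finite_measure m"
    using assms finite_measure.axioms(1) by (auto simp: gradient_rep_def sigma_finite_lborel)
  show "\<tau> \<in> borel_measurable m" using * measurable_cong_sets[of m borel] by blast
qed

text \<open>The gradient of \<open>moll \<eta> u\<close> with the derivative put on the mollifier.
  In this form it is defined for every locally integrable u, in particular for the members of a
  sequence that need not lie in \<open>S_space\<close>.\<close>

definition mgrad :: "('a::euclidean_space \<Rightarrow> 'a) \<Rightarrow> ('a \<Rightarrow> real) \<Rightarrow> 'a \<Rightarrow> 'a" where
  "mgrad \<gamma> u x = (LINT y|lborel. u y *\<^sub>R \<gamma> (x - y))"

lemma mgrad_integrable:
  "loc_integrable u \<Longrightarrow> mollifier \<epsilon> \<eta> \<gamma> L \<Longrightarrow> integrable lborel (\<lambda>y. u y *\<^sub>R \<gamma> (x - y))"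
  using loc_integrable_kernel[of u \<gamma> L \<epsilon> x] mollifierD(7,9,13)[of \<epsilon> \<eta> \<gamma> L] by blast

lemma borel_measurable_mgrad [measurable]:
  fixes u :: "'a::euclidean_space \<Rightarrow> real"
  assumes [measurable]: "u \<in> borel_measurable borel" "\<gamma> \<in> borel_measurable borel"
  shows "mgrad \<gamma> u \<in> borel_measurable borel"
  unfolding mgrad_def[abs_def] by (rule lborel.borel_measurable_lebesgue_integral) measurable

lemma gradient_rep_integrable:
  fixes u :: "'a::euclidean_space \<Rightarrow> real"
  assumes rep: "gradient_rep p u m \<tau>" and \<eta>: "mollifier \<epsilon> \<eta> \<gamma> L"
  shows "integrable m (\<lambda>y. \<eta> (x - y) *\<^sub>R \<tau> y)"
proof -
  have [measurable]: "\<eta> \<in> borel_measurable borel" using mollifierD(12)[OF \<eta>] .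
  show ?thesis
  proof (cases "p = 1")
    case True
    note D = gradient_repD[OF rep]
    note [measurable_cong] = D(3)
    note [measurable] = D(7)
    have "integrable m (\<lambda>y. L * norm (\<tau> y))"
      using rep True by (intro integrable_mult_right integrableI_bounded integrable_norm) (auto simp: gradient_rep_def D)
    then show ?thesis
    proof (rule Bochner_Integration.integrable_bound)
      show "(\<lambda>y. \<eta> (x - y) *\<^sub>R \<tau> y) \<in> borel_measurable m" by measurable
      show "AE y in m. norm (\<eta> (x - y) *\<^sub>R \<tau> y) \<le> norm (L * norm (\<tau> y))"
        using mollifierD(2,5,6)[OF \<eta>] by (auto intro!: AE_I2 mult_right_mono)
    qed
  next
    case False
    then have p: "1 < p" "m = lborel" using rep by (auto simp: gradient_rep_def)
    have tm[measurable]: "\<tau> \<in> borel_measurable borel" using gradient_repD(4)[OF rep] .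
    have "Lp_mass lborel p (\<lambda>x. norm (\<tau> x)) < \<infinity>" using rep p by (simp add: gradient_rep_def)
    then have "(\<lambda>y. norm (\<tau> y)) \<in> Lp lborel p" unfolding Lp_def by (auto intro!: integrableI_nonneg)
    then have "loc_integrable (\<lambda>y. norm (\<tau> y))" using p by (intro Lp_loc_integrable) auto
    from integrable_norm[OF moll_integrable[OF this \<eta>, of x]]
    have i: "integrable lborel (\<lambda>y. norm (\<eta> (x - y) * norm (\<tau> y)))" .
    show ?thesis unfolding p(2)
      by (rule Bochner_Integration.integrable_bound[OF i]) auto
  qed
qed

text \<open>The distributional gradient is tested with y \<mapsto> \<eta> (x - y): the gradient of
  the mollification is the mollification of the gradient.\<close>

lemma mgrad_inner:
  fixes u :: "'a::euclidean_space \<Rightarrow> real"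
  assumes rep: "gradient_rep p u m \<tau>" and \<eta>: "mollifier \<epsilon> \<eta> \<gamma> L"
  shows "mgrad \<gamma> u x \<bullet> \<sigma> = (LINT y|m. \<eta> (x - y) * (\<tau> y \<bullet> \<sigma>))"
proof -
  have i1: "integrable lborel (\<lambda>y. u y *\<^sub>R \<gamma> (x - y))" by (rule mgrad_integrable[OF gradient_repD(6)[OF rep] \<eta>])
  have i2: "integrable m (\<lambda>y. \<eta> (x - y) *\<^sub>R \<tau> y)" by (rule gradient_rep_integrable[OF rep \<eta>])
  have "mgrad \<gamma> u x = (LINT y|m. \<eta> (x - y) *\<^sub>R \<tau> y)"
  proof (rule euclidean_eqI)
    fix i :: 'a assume i: "i \<in> Basis"
    have "(LINT y|lborel. u y * partial_deriv i (\<lambda>y. \<eta> (x - y)) y) = - (LINT y|m. \<eta> (x - y) * (\<tau> y \<bullet> i))"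
      using rep mollifier_reflected(1)[OF \<eta>, of x] i unfolding gradient_rep_def by blast
    then have "(LINT y|lborel. u y * (\<gamma> (x - y) \<bullet> i)) = (LINT y|m. \<eta> (x - y) * (\<tau> y \<bullet> i))"
      by (simp add: mollifier_reflected(2)[OF \<eta>])
    then show "mgrad \<gamma> u x \<bullet> i = (LINT y|m. \<eta> (x - y) *\<^sub>R \<tau> y) \<bullet> i"
      unfolding mgrad_def integral_inner_left[OF i1, symmetric] integral_inner_left[OF i2, symmetric] by simp
  qed
  then show ?thesis using integral_inner_left[OF i2, symmetric, of \<sigma>] by simp
qed

text \<open>For p > 1 this is Jensen's inequality. For p = 1 the kernel need not have mass 1 with
  respect to m, but then the triangle inequality is enough.\<close>

lemma mgrad_powr_le:
  fixes u :: "'a::euclidean_space \<Rightarrow> real"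
  assumes rep: "gradient_rep p u m \<tau>" and \<eta>: "mollifier \<epsilon> \<eta> \<gamma> L"
  shows "ennreal (\<bar>mgrad \<gamma> u x \<bullet> \<sigma>\<bar> powr p) \<le> (\<integral>\<^sup>+y. ennreal (\<eta> (x - y) * \<bar>\<tau> y \<bullet> \<sigma>\<bar> powr p) \<partial>m)"
proof -
  have i: "integrable m (\<lambda>y. \<eta> (x - y) * (\<tau> y \<bullet> \<sigma>))"
    using integrable_inner_left[OF gradient_rep_integrable[OF rep \<eta>, of x], of \<sigma>] by simp
  show ?thesis
  proof (cases "p = 1")
    case True
    then show ?thesis
      using integral_norm_bound_ennreal[OF i] mollifierD(5)[OF \<eta>] by (simp add: mgrad_inner[OF rep \<eta>] abs_mult)
  next
    case False
    then have p: "1 < p" "m = lborel" using rep by (auto simp: gradient_rep_def)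
    have [measurable]: "\<eta> \<in> borel_measurable borel" using mollifierD(12)[OF \<eta>] .
    show ?thesis
      unfolding mgrad_inner[OF rep \<eta>]
    proof (rule powr_Jensen[OF gradient_repD(1)[OF rep]])
      show "(\<lambda>y. \<tau> y \<bullet> \<sigma>) \<in> borel_measurable m" using gradient_repD(7)[OF rep] by measurable
    qed (use i mollifierD(5)[OF \<eta>] nn_integral_mollifier_shift(2)[OF \<eta>] p in auto)
  qed
qed

text \<open>After Tonelli the kernel is integrated in x with respect to Lebesgue measure, where it
  has mass 1. It vanishes for |x - y| \<ge> \<epsilon>, so the weight v at x may be replaced by w0
  at y.\<close>

lemma mgrad_weighted_le:
  fixes u :: "'a::euclidean_space \<Rightarrow> real" and v w0 :: "'a \<Rightarrow> real"
  assumes rep: "gradient_rep p u m \<tau>" and \<eta>: "mollifier \<epsilon> \<eta> \<gamma> L"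
    and vw[measurable]: "v \<in> borel_measurable borel" "w0 \<in> borel_measurable borel"
    and close: "\<And>x y. norm (x - y) < \<epsilon> \<Longrightarrow> v x \<le> w0 y"
  shows "directional_mass lborel p v (mgrad \<gamma> u) \<sigma> \<le>
    directional_mass m p w0 \<tau> \<sigma>"
proof -
  note D = gradient_repD[OF rep]
  interpret m: sigma_finite_measure m by (rule D(5))
  interpret pair_sigma_finite m "lborel :: 'a measure" ..
  note [measurable_cong] = D(3)
  have [measurable]: "\<tau> \<in> borel_measurable m" "\<eta> \<in> borel_measurable borel"
    using D(7) mollifierD(12)[OF \<eta>] by auto
  have "directional_mass lborel p v (mgrad \<gamma> u) \<sigma> \<le>
    (\<integral>\<^sup>+x. (\<integral>\<^sup>+y. ennreal (v x) * ennreal (\<eta> (x - y) * \<bar>\<tau> y \<bullet> \<sigma>\<bar> powr p) \<partial>m) \<partial>lborel)"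
  proof (rule nn_integral_mono)
    fix x :: 'a
    have "(\<lambda>y. ennreal (\<eta> (x - y) * \<bar>\<tau> y \<bullet> \<sigma>\<bar> powr p)) \<in> borel_measurable m" by measurable
    then have "(\<integral>\<^sup>+y. ennreal (v x) * ennreal (\<eta> (x - y) * \<bar>\<tau> y \<bullet> \<sigma>\<bar> powr p) \<partial>m) =
      ennreal (v x) * (\<integral>\<^sup>+y. ennreal (\<eta> (x - y) * \<bar>\<tau> y \<bullet> \<sigma>\<bar> powr p) \<partial>m)" by (rule nn_integral_cmult)
    then show "ennreal (v x) * ennreal (\<bar>mgrad \<gamma> u x \<bullet> \<sigma>\<bar> powr p) \<le>
      (\<integral>\<^sup>+y. ennreal (v x) * ennreal (\<eta> (x - y) * \<bar>\<tau> y \<bullet> \<sigma>\<bar> powr p) \<partial>m)"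
      using mgrad_powr_le[OF rep \<eta>] by (simp add: mult_left_mono)
  qed
  also have "\<dots> = (\<integral>\<^sup>+y. (\<integral>\<^sup>+x. ennreal (v x) * ennreal (\<eta> (x - y) * \<bar>\<tau> y \<bullet> \<sigma>\<bar> powr p) \<partial>lborel) \<partial>m)"
    by (rule Fubini') measurable
  also have "\<dots> \<le> directional_mass m p w0 \<tau> \<sigma>"
  proof (rule nn_integral_mono)
    fix y :: 'a
    have "(\<integral>\<^sup>+x. ennreal (v x) * ennreal (\<eta> (x - y) * \<bar>\<tau> y \<bullet> \<sigma>\<bar> powr p) \<partial>lborel) \<le>
      (\<integral>\<^sup>+x. ennreal (\<eta> (x - y)) * (ennreal (w0 y) * ennreal (\<bar>\<tau> y \<bullet> \<sigma>\<bar> powr p)) \<partial>lborel)"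
    proof (rule nn_integral_mono)
      fix x :: 'a
      show "ennreal (v x) * ennreal (\<eta> (x - y) * \<bar>\<tau> y \<bullet> \<sigma>\<bar> powr p) \<le> ennreal (\<eta> (x - y)) * (ennreal (w0 y) * ennreal (\<bar>\<tau> y \<bullet> \<sigma>\<bar> powr p))"
      proof (cases "\<epsilon> \<le> norm (x - y)")
        case False
        then have "ennreal (v x) \<le> ennreal (w0 y)" using close by (intro ennreal_leI) auto
        then show ?thesis using mollifierD(5)[OF \<eta>, of "x - y"]
          by (simp add: ennreal_mult mult.left_commute[of "ennreal (v x)"] mult_left_mono mult_right_mono)
      qed (use mollifierD(8)[OF \<eta>] in simp)
    qed
    also have "\<dots> = ennreal (w0 y) * ennreal (\<bar>\<tau> y \<bullet> \<sigma>\<bar> powr p)"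
      by (subst nn_integral_multc) (simp_all add: nn_integral_mollifier_shift(1)[OF \<eta>])
    finally show "(\<integral>\<^sup>+x. ennreal (v x) * ennreal (\<eta> (x - y) * \<bar>\<tau> y \<bullet> \<sigma>\<bar> powr p) \<partial>lborel) \<le>
      ennreal (w0 y) * ennreal (\<bar>\<tau> y \<bullet> \<sigma>\<bar> powr p)" .
  qed
  finally show ?thesis .
qed

lemma mollifier_continuous_tendsto:
  fixes \<kappa> :: "'a::euclidean_space \<Rightarrow> real"
  assumes \<kappa>: "continuous_on UNIV \<kappa>" "\<And>x. \<bar>\<kappa> x\<bar> \<le> B" and \<eta>: "mollifier_seq \<eta> \<gamma> L"
  shows "(\<lambda>j. LINT x|lborel. \<kappa> x * \<eta> j (x - y)) \<longlonglongrightarrow> \<kappa> y"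
    and "\<bar>LINT x|lborel. \<kappa> x * \<eta> j (x - y)\<bar> \<le> B"
    and "integrable lborel (\<lambda>x. \<kappa> x * \<eta> j (x - y))"
proof -
  have [measurable]: "\<kappa> \<in> borel_measurable borel" using \<kappa>(1) by (rule borel_measurable_continuous_onI)
  have m: "mollifier (1 / real (Suc j)) (\<eta> j) (\<gamma> j) (L j)" for j using \<eta> by (simp add: mollifier_seq_def)
  have [measurable]: "\<eta> j \<in> borel_measurable borel" for j using mollifierD(12)[OF m] .
  have i: "integrable lborel (\<lambda>x. \<eta> j (x - y))" for j
    using nn_integral_mollifier_shift(1)[OF m, of _ y] mollifierD(5)[OF m] by (intro integrableI_nonneg) auto
  have one: "(LINT x|lborel. \<eta> j (x - y)) = 1" for j
  proof -
    have "ennreal (LINT x|lborel. \<eta> j (x - y)) = 1"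
      using nn_integral_mollifier_shift(1)[OF m, of _ y] mollifierD(5)[OF m] i by (subst nn_integral_eq_integral[symmetric]) auto
    then show ?thesis by simp
  qed
  have B: "0 \<le> B" using \<kappa>(2)[of 0] by linarith
  have bd: "\<bar>LINT x|lborel. f x * \<eta> j (x - y)\<bar> \<le> c"
    if [measurable]: "f \<in> borel_measurable borel" and f: "\<And>x. norm (x - y) < 1 / real (Suc j) \<Longrightarrow> \<bar>f x\<bar> \<le> c" and c: "0 \<le> c"
    for f j c
  proof -
    have le: "norm (f x * \<eta> j (x - y)) \<le> c * \<eta> j (x - y)" for x
    proof (cases "norm (x - y) < 1 / real (Suc j)")
      case True then show ?thesis using f[OF True] mollifierD(5)[OF m] by (simp add: abs_mult mult_right_mono)
    next
      case False then show ?thesis using mollifierD(8)[OF m, of j "x - y"] by simp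
    qed
    have ci: "integrable lborel (\<lambda>x. c * \<eta> j (x - y))" using i by simp
    have fi: "integrable lborel (\<lambda>x. f x * \<eta> j (x - y))"
      by (rule Bochner_Integration.integrable_bound[OF ci])
        (use le in \<open>auto intro!: AE_I2 intro: order_trans[OF _ abs_ge_self]\<close>)
    have "norm (LINT x|lborel. f x * \<eta> j (x - y)) \<le> (LINT x|lborel. norm (f x * \<eta> j (x - y)))"
      by (rule integral_norm_bound)
    also have "\<dots> \<le> (LINT x|lborel. c * \<eta> j (x - y))"
      by (intro integral_mono integrable_norm fi ci le)
    finally have "norm (LINT x|lborel. f x * \<eta> j (x - y)) \<le> (LINT x|lborel. c * \<eta> j (x - y))" .
    then show ?thesis using one by simp
  qed
  show "\<bar>LINT x|lborel. \<kappa> x * \<eta> j (x - y)\<bar> \<le> B" by (rule bd) (use \<kappa> B in auto)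
  have ci: "integrable lborel (\<lambda>x. B * \<eta> j (x - y))" for j using i by simp
  have ik: "integrable lborel (\<lambda>x. \<kappa> x * \<eta> j (x - y))" for j
    using \<kappa>(2) B mollifierD(5)[OF m] by (intro Bochner_Integration.integrable_bound[OF ci] AE_I2) (auto simp: abs_mult intro!: mult_mono)
  then show "integrable lborel (\<lambda>x. \<kappa> x * \<eta> j (x - y))" .
  show "(\<lambda>j. LINT x|lborel. \<kappa> x * \<eta> j (x - y)) \<longlonglongrightarrow> \<kappa> y"
  proof (rule LIMSEQ_I)
    fix r :: real assume r: "0 < r"
    have "isCont \<kappa> y" using \<kappa>(1) by (simp add: continuous_on_eq_continuous_at)
    then obtain d where d: "0 < d" "\<And>x. norm (x - y) < d \<Longrightarrow> \<bar>\<kappa> x - \<kappa> y\<bar> < r/2"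
      unfolding continuous_at_eps_delta using r by (metis dist_norm half_gt_zero real_norm_def)
    obtain n where n: "1 / real (Suc n) < d" using reals_Archimedean[OF d(1)] by (auto simp: inverse_eq_divide)
    show "\<exists>no. \<forall>j\<ge>no. norm ((LINT x|lborel. \<kappa> x * \<eta> j (x - y)) - \<kappa> y) < r"
    proof (intro exI[of _ n] allI impI)
      fix j assume "n \<le> j"
      then have jd: "1 / real (Suc j) < d" using n by (intro le_less_trans[OF _ n] divide_left_mono) auto
      have "(LINT x|lborel. \<kappa> x * \<eta> j (x - y)) - \<kappa> y = (LINT x|lborel. (\<kappa> x - \<kappa> y) * \<eta> j (x - y))"
        using ik[of j] i[of j] one[of j] by (simp add: left_diff_distrib)
      also have "\<bar>\<dots>\<bar> \<le> r/2"
        using d jd r by (intro bd) (auto intro: less_imp_le)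
      finally show "norm ((LINT x|lborel. \<kappa> x * \<eta> j (x - y)) - \<kappa> y) < r" using r by simp
    qed
  qed
qed

text \<open>The mollified gradients converge weakly to \<tau> m. Fubini moves the kernel from the
  gradient to \<kappa>, whose mollifications converge pointwise under a common bound.\<close>

lemma mgrad_pairing:
  fixes \<kappa> :: "'a::euclidean_space \<Rightarrow> real"
  assumes rep: "gradient_rep 1 u m \<tau>" and \<kappa>: "continuous_on UNIV \<kappa>" "\<And>x. \<bar>\<kappa> x\<bar> \<le> B"
    and \<eta>: "mollifier_seq \<eta> \<gamma> L"
  shows "(\<lambda>j. LINT x|lborel. \<kappa> x * (mgrad (\<gamma> j) u x \<bullet> \<sigma>)) \<longlonglongrightarrow> (LINT y|m. \<kappa> y * (\<tau> y \<bullet> \<sigma>))"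
proof -
  note D = gradient_repD[OF rep]
  interpret m: finite_measure m using rep by (simp add: gradient_rep_def)
  interpret pair_sigma_finite m "lborel :: 'a measure" ..
  note [measurable_cong] = D(3)
  have j: "mollifier (1 / real (Suc j)) (\<eta> j) (\<gamma> j) (L j)" for j using \<eta> by (simp add: mollifier_seq_def)
  have [measurable]: "\<tau> \<in> borel_measurable m" "\<eta> j \<in> borel_measurable borel" "\<kappa> \<in> borel_measurable borel" for j
    using D(7) mollifierD(12)[OF j] \<kappa>(1) by (auto intro: borel_measurable_continuous_onI)
  have B: "0 \<le> B" using \<kappa>(2)[of 0] by linarith
  have it: "integrable m \<tau>" using rep D(7) by (intro integrableI_bounded) (auto simp: gradient_rep_def)
  have isg: "integrable m (\<lambda>y. \<tau> y \<bullet> \<sigma>)" using it by simp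
  have eq: "(LINT x|lborel. \<kappa> x * (mgrad (\<gamma> j) u x \<bullet> \<sigma>)) = (LINT y|m. (LINT x|lborel. \<kappa> x * \<eta> j (x - y)) * (\<tau> y \<bullet> \<sigma>))" for j
  proof -
    define F where "F y x = \<kappa> x * \<eta> j (x - y) * (\<tau> y \<bullet> \<sigma>)" for y x
    have [measurable]: "case_prod F \<in> borel_measurable (m \<Otimes>\<^sub>M lborel)" unfolding F_def by measurable
    have iF: "integrable (m \<Otimes>\<^sub>M lborel) (case_prod F)"
    proof (rule integrableI_bounded)
      have "(\<integral>\<^sup>+z. ennreal (norm (case z of (y, x) \<Rightarrow> F y x)) \<partial>(m \<Otimes>\<^sub>M lborel)) =
        (\<integral>\<^sup>+y. (\<integral>\<^sup>+x. ennreal (norm (F y x)) \<partial>lborel) \<partial>m)"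
        by (subst lborel.nn_integral_fst[symmetric]) auto
      also have "\<dots> \<le> (\<integral>\<^sup>+y. ennreal B * ennreal \<bar>\<tau> y \<bullet> \<sigma>\<bar> \<partial>m)"
      proof (rule nn_integral_mono)
        fix y :: 'a
        have "(\<integral>\<^sup>+x. ennreal (norm (F y x)) \<partial>lborel) \<le> (\<integral>\<^sup>+x. ennreal (\<eta> j (x - y)) * (ennreal B * ennreal \<bar>\<tau> y \<bullet> \<sigma>\<bar>) \<partial>lborel)"
        proof (rule nn_integral_mono)
          fix x :: 'a
          have "norm (F y x) \<le> \<eta> j (x - y) * (B * \<bar>\<tau> y \<bullet> \<sigma>\<bar>)"
            using mult_right_mono[OF \<kappa>(2)[of x], of "\<eta> j (x - y) * \<bar>\<tau> y \<bullet> \<sigma>\<bar>"] mollifierD(5)[OF j, of j "x - y"]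
            by (simp add: F_def abs_mult mult_ac)
          then show "ennreal (norm (F y x)) \<le> ennreal (\<eta> j (x - y)) * (ennreal B * ennreal \<bar>\<tau> y \<bullet> \<sigma>\<bar>)"
            using B mollifierD(5)[OF j, of j "x - y"] by (simp add: ennreal_mult[symmetric] ennreal_leI)
        qed
        also have "\<dots> = ennreal B * ennreal \<bar>\<tau> y \<bullet> \<sigma>\<bar>"
          by (subst nn_integral_multc) (simp_all add: nn_integral_mollifier_shift(1)[OF j])
        finally show "(\<integral>\<^sup>+x. ennreal (norm (F y x)) \<partial>lborel) \<le> ennreal B * ennreal \<bar>\<tau> y \<bullet> \<sigma>\<bar>" .
      qed
      also have "\<dots> = ennreal B * (\<integral>\<^sup>+y. ennreal \<bar>\<tau> y \<bullet> \<sigma>\<bar> \<partial>m)" by (rule nn_integral_cmult) measurable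
      also have "\<dots> < \<infinity>" using isg by (auto simp: integrable_iff_bounded ennreal_mult_less_top)
      finally show "(\<integral>\<^sup>+z. ennreal (norm (case z of (y, x) \<Rightarrow> F y x)) \<partial>(m \<Otimes>\<^sub>M lborel)) < \<infinity>" .
    qed measurable
    have "(LINT x|lborel. \<kappa> x * (mgrad (\<gamma> j) u x \<bullet> \<sigma>)) = (LINT x|lborel. (LINT y|m. F y x))"
      by (simp add: mgrad_inner[OF rep j] F_def mult.assoc)
    also have "\<dots> = (LINT y|m. (LINT x|lborel. F y x))" by (rule Fubini_integral[OF iF])
    finally show ?thesis by (simp add: F_def)
  qed
  show ?thesis
    unfolding eq
  proof (rule integral_dominated_convergence[where w = "\<lambda>y. B * \<bar>\<tau> y \<bullet> \<sigma>\<bar>"])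
    show "integrable m (\<lambda>y. B * \<bar>\<tau> y \<bullet> \<sigma>\<bar>)" using isg by simp
    show "AE y in m. (\<lambda>j. (LINT x|lborel. \<kappa> x * \<eta> j (x - y)) * (\<tau> y \<bullet> \<sigma>)) \<longlonglongrightarrow> \<kappa> y * (\<tau> y \<bullet> \<sigma>)"
      by (intro AE_I2 tendsto_mult mollifier_continuous_tendsto(1)[OF \<kappa> \<eta>] tendsto_const)
    show "AE y in m. norm ((LINT x|lborel. \<kappa> x * \<eta> j (x - y)) * (\<tau> y \<bullet> \<sigma>)) \<le> B * \<bar>\<tau> y \<bullet> \<sigma>\<bar>" for j
      using mollifier_continuous_tendsto(2)[OF \<kappa> \<eta>] by (intro AE_I2) (auto simp: abs_mult intro!: mult_right_mono)
    show "(\<lambda>y. \<kappa> y * (\<tau> y \<bullet> \<sigma>)) \<in> borel_measurable m" by measurable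
    have "(\<lambda>y. LINT x|lborel. \<kappa> x * \<eta> j (x - y)) \<in> borel_measurable borel" for j
      by (rule lborel.borel_measurable_lebesgue_integral) measurable
    then have [measurable]: "(\<lambda>y. LINT x|lborel. \<kappa> x * \<eta> j (x - y)) \<in> borel_measurable m" for j
      using measurable_cong_sets[OF D(3) refl] by blast
    show "(\<lambda>y. (LINT x|lborel. \<kappa> x * \<eta> j (x - y)) * (\<tau> y \<bullet> \<sigma>)) \<in> borel_measurable m" for j by measurable
  qed
qed

text \<open>For \<open>p = 1\<close> the sign of \<open>\<tau> \<bullet> \<sigma>\<close> is approximated by continuous functions, and
  lower semicontinuity follows by duality.\<close>

lemma mgrad_lsc:
  fixes w0 :: "'a::euclidean_space \<Rightarrow> real"
  assumes rep: "gradient_rep p u m \<tau>" and \<eta>: "mollifier_seq \<eta> \<gamma> L"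
    and w0: "continuous_on UNIV w0" "\<And>x. 0 \<le> w0 x" "\<And>x. w0 x \<le> W"
  shows "directional_mass m p w0 \<tau> \<sigma> \<le>
    liminf (\<lambda>j. \<integral>\<^sup>+x. ennreal (w0 x) * ennreal (\<bar>mgrad (\<gamma> j) u x \<bullet> \<sigma>\<bar> powr p) \<partial>lborel)"
proof -
  note D = gradient_repD[OF rep]
  note [measurable_cong] = D(3)
  have j: "mollifier (1 / real (Suc j)) (\<eta> j) (\<gamma> j) (L j)" for j using \<eta> by (simp add: mollifier_seq_def)
  have mu: "u \<in> borel_measurable borel" using D(6) by (simp add: loc_integrable_def)
  have [measurable]: "\<tau> \<in> borel_measurable m" "\<tau> \<in> borel_measurable borel" "\<eta> j \<in> borel_measurable borel"
    "mgrad (\<gamma> j) u \<in> borel_measurable borel" "w0 \<in> borel_measurable borel" for j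
    using D(4,7) mollifierD(12,13)[OF j] w0(1) mu by (auto intro: borel_measurable_continuous_onI borel_measurable_mgrad)
  show ?thesis
  proof (cases "p = 1")
    case False
    then have p: "1 < p" "m = lborel" using rep by (auto simp: gradient_rep_def)
    have li: "loc_integrable (\<lambda>y. \<tau> y \<bullet> \<sigma>)"
    proof (rule Lp_loc_integrable[of p])
      have "Lp_mass lborel p (\<lambda>x. \<tau> x \<bullet> \<sigma>) \<le> (\<integral>\<^sup>+x. ennreal (norm \<sigma> powr p) * ennreal (norm (\<tau> x) powr p) \<partial>lborel)"
      proof (rule nn_integral_mono)
        fix x :: 'a
        have "\<bar>\<tau> x \<bullet> \<sigma>\<bar> powr p \<le> (norm \<sigma> * norm (\<tau> x)) powr p"
          using p Cauchy_Schwarz_ineq2[of "\<tau> x" \<sigma>] by (intro powr_mono2) (auto simp: mult.commute)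
        then show "ennreal (\<bar>\<tau> x \<bullet> \<sigma>\<bar> powr p) \<le> ennreal (norm \<sigma> powr p) * ennreal (norm (\<tau> x) powr p)"
          by (simp add: powr_mult ennreal_mult[symmetric] ennreal_leI)
      qed
      also have "\<dots> = ennreal (norm \<sigma> powr p) * (\<integral>\<^sup>+x. ennreal (norm (\<tau> x) powr p) \<partial>lborel)"
        by (rule nn_integral_cmult) measurable
      also have "\<dots> < \<infinity>" using rep p by (simp add: gradient_rep_def ennreal_mult_less_top)
      finally show "(\<lambda>y. \<tau> y \<bullet> \<sigma>) \<in> Lp lborel p" unfolding Lp_def by (auto intro!: integrableI_nonneg)
    qed (use p in simp)
    have mg: "mgrad (\<gamma> j) u x \<bullet> \<sigma> = moll (\<eta> j) (\<lambda>y. \<tau> y \<bullet> \<sigma>) x" for j x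
      using mgrad_inner[OF rep j] by (simp add: moll_def p)
    show ?thesis
      unfolding mg p(2)
      by (rule nn_integral_powr_lsc) (use p in \<open>auto intro!: moll_seq_L1_loc[OF li \<eta>] borel_measurable_moll\<close>)
  next
    case p: True
    interpret m: finite_measure m using rep p by (simp add: gradient_rep_def)
    define \<theta> where "\<theta> y = \<tau> y \<bullet> \<sigma>" for y
    have [measurable]: "\<theta> \<in> borel_measurable m" "\<theta> \<in> borel_measurable borel" unfolding \<theta>_def by measurable
    have it: "integrable m \<tau>" using rep D(7) p by (intro integrableI_bounded) (auto simp: gradient_rep_def)
    then have i\<theta>: "integrable m \<theta>" unfolding \<theta>_def by simp
    have W: "0 \<le> W" using w0(2,3)[of 0] by linarith
    define M where "M = density m (\<lambda>x. ennreal \<bar>\<theta> x\<bar>)"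
    have M: "finite_measure M" "sets M = sets borel"
    proof -
      have "emeasure M (space M) = (\<integral>\<^sup>+x. ennreal \<bar>\<theta> x\<bar> \<partial>m)"
        unfolding M_def by (subst emeasure_density) (auto intro!: nn_integral_cong)
      also have "\<dots> < \<infinity>" using i\<theta> by (simp add: integrable_iff_bounded)
      finally show "finite_measure M" by (intro finite_measureI) simp
      show "sets M = sets borel" by (simp add: M_def D(3))
    qed
    interpret M: finite_measure M by (rule M(1))
    have isg: "integrable M (\<lambda>x. sgn (\<theta> x))"
      by (rule M.integrable_const_bound[of _ 1]) (auto simp: M_def abs_sgn_eq)
    show ?thesis
    proof (rule ennreal_le_epsilon)
      fix e :: real assume e: "0 < e"
      \<comment> \<open>The error in approximating the sign, measured in |\<theta>| m, gets
        multiplied by the bound W of the weight.\<close>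
      define e' where "e' = e / (W + 1)"
      have e': "0 < e'" using e W by (simp add: e'_def)
      obtain \<phi>0 where \<phi>0: "continuous_on UNIV \<phi>0" "(\<integral>\<^sup>+x. ennreal \<bar>sgn (\<theta> x) - \<phi>0 x\<bar> \<partial>M) < ennreal e'"
        using bounded_continuous_dense_L1[OF M isg e'] by auto
      \<comment> \<open>Clipping to [-1, 1] makes |\<kappa>| \<le> w0, which bounds the pairings by
        the directional masses. It does not enlarge the error, as the sign takes its values in that
        interval.\<close>
      define \<phi> where "\<phi> x = max (- 1) (min 1 (\<phi>0 x))" for x
      have \<phi>: "continuous_on UNIV \<phi>" unfolding \<phi>_def using \<phi>0(1) by (intro continuous_intros)
      have \<phi>1: "\<bar>\<phi> x\<bar> \<le> 1" for x by (auto simp: \<phi>_def)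
      have [measurable]: "\<phi> \<in> borel_measurable borel" "\<phi>0 \<in> borel_measurable borel"
        using \<phi> \<phi>0 by (auto intro: borel_measurable_continuous_onI)
      define \<kappa> where "\<kappa> x = w0 x * \<phi> x" for x
      have \<kappa>: "continuous_on UNIV \<kappa>" unfolding \<kappa>_def using w0(1) \<phi> by (intro continuous_intros)
      have \<kappa>w: "\<bar>\<kappa> x\<bar> \<le> w0 x" for x
        using mult_left_mono[OF \<phi>1[of x] w0(2)[of x]] w0(2)[of x] by (simp add: \<kappa>_def abs_mult)
      have \<kappa>W: "\<bar>\<kappa> x\<bar> \<le> W" for x using \<kappa>w[of x] w0(3)[of x] by linarith
      have [measurable]: "\<kappa> \<in> borel_measurable borel" using \<kappa> by (rule borel_measurable_continuous_onI)
      have i\<kappa>: "integrable m (\<lambda>y. \<kappa> y * \<theta> y)"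
        by (rule Bochner_Integration.integrable_bound[of _ "\<lambda>y. W * \<theta> y"])
          (use i\<theta> W \<kappa>W in \<open>auto simp: abs_mult intro!: AE_I2 mult_right_mono\<close>)
      have "directional_mass m p w0 \<tau> \<sigma> \<le> ennreal (LINT y|m. \<kappa> y * \<theta> y) + ennreal e"
      proof -
        have iw: "integrable m (\<lambda>y. w0 y * \<bar>\<theta> y\<bar>)"
          by (rule Bochner_Integration.integrable_bound[of _ "\<lambda>y. W * \<theta> y"])
            (use i\<theta> W w0 in \<open>auto simp: abs_mult intro!: AE_I2 mult_right_mono\<close>)
        have "(\<integral>\<^sup>+y. ennreal \<bar>sgn (\<theta> y) - \<phi> y\<bar> * ennreal \<bar>\<theta> y\<bar> \<partial>m) = (\<integral>\<^sup>+y. ennreal \<bar>sgn (\<theta> y) - \<phi> y\<bar> \<partial>M)"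
          unfolding M_def by (subst nn_integral_density) (auto simp: mult.commute)
        also have "\<dots> \<le> (\<integral>\<^sup>+x. ennreal \<bar>sgn (\<theta> x) - \<phi>0 x\<bar> \<partial>M)"
          by (intro nn_integral_mono ennreal_leI) (auto simp: \<phi>_def sgn_if)
        also have "\<dots> \<le> ennreal e'" using \<phi>0(2) by simp
        finally have le: "(\<integral>\<^sup>+y. ennreal \<bar>sgn (\<theta> y) - \<phi> y\<bar> * ennreal \<bar>\<theta> y\<bar> \<partial>m) \<le> ennreal e'" .
        have "(LINT y|m. w0 y * \<bar>\<theta> y\<bar> - \<kappa> y * \<theta> y) \<le> e"
        proof -
          have "ennreal (LINT y|m. w0 y * \<bar>\<theta> y\<bar> - \<kappa> y * \<theta> y) \<le> (\<integral>\<^sup>+y. ennreal \<bar>w0 y * \<bar>\<theta> y\<bar> - \<kappa> y * \<theta> y\<bar> \<partial>m)"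
            using integral_norm_bound_ennreal[OF Bochner_Integration.integrable_diff[OF iw i\<kappa>]]
            by (simp del: Bochner_Integration.integral_diff) (meson abs_ge_self ennreal_leI order_trans)
          also have "\<dots> \<le> (\<integral>\<^sup>+y. ennreal W * (ennreal \<bar>sgn (\<theta> y) - \<phi> y\<bar> * ennreal \<bar>\<theta> y\<bar>) \<partial>m)"
          proof (rule nn_integral_mono)
            fix y
            have "w0 y * \<bar>\<theta> y\<bar> - \<kappa> y * \<theta> y = w0 y * ((sgn (\<theta> y) - \<phi> y) * \<theta> y)"
              by (simp add: \<kappa>_def abs_sgn algebra_simps)
            then have "\<bar>w0 y * \<bar>\<theta> y\<bar> - \<kappa> y * \<theta> y\<bar> = w0 y * (\<bar>sgn (\<theta> y) - \<phi> y\<bar> * \<bar>\<theta> y\<bar>)"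
              using w0(2)[of y] by (simp add: abs_mult)
            also have "\<dots> \<le> W * (\<bar>sgn (\<theta> y) - \<phi> y\<bar> * \<bar>\<theta> y\<bar>)" using w0(3)[of y] by (intro mult_right_mono) auto
            finally show "ennreal \<bar>w0 y * \<bar>\<theta> y\<bar> - \<kappa> y * \<theta> y\<bar> \<le> ennreal W * (ennreal \<bar>sgn (\<theta> y) - \<phi> y\<bar> * ennreal \<bar>\<theta> y\<bar>)"
              using W by (simp add: ennreal_mult[symmetric] ennreal_leI)
          qed
          also have "\<dots> = ennreal W * (\<integral>\<^sup>+y. ennreal \<bar>sgn (\<theta> y) - \<phi> y\<bar> * ennreal \<bar>\<theta> y\<bar> \<partial>m)"
            by (rule nn_integral_cmult) measurable
          also have "\<dots> \<le> ennreal W * ennreal e'" using le by (rule mult_left_mono) simp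
          also have "\<dots> = ennreal (W * e')" using W e' by (simp add: ennreal_mult[symmetric])
          also have "\<dots> \<le> ennreal e" using W e by (intro ennreal_leI) (simp add: e'_def divide_le_eq)
          finally show ?thesis using e by (subst (asm) ennreal_le_iff) auto
        qed
        then have a1: "(LINT y|m. w0 y * \<bar>\<theta> y\<bar>) \<le> (LINT y|m. \<kappa> y * \<theta> y) + e" using iw i\<kappa> by simp
        have a2: "directional_mass m p w0 \<tau> \<sigma> = ennreal (LINT y|m. w0 y * \<bar>\<theta> y\<bar>)"
          using w0(2) iw p by (subst nn_integral_eq_integral[symmetric]) (auto simp: \<theta>_def ennreal_mult)
        \<comment> \<open>If the pairing is negative, \<open>ennreal\<close> truncates it to 0 and
          the inequality still holds.\<close>
        have a3: "ennreal ((LINT y|m. \<kappa> y * \<theta> y) + e) \<le> ennreal (LINT y|m. \<kappa> y * \<theta> y) + ennreal e"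
          using e by (cases "0 \<le> (LINT y|m. \<kappa> y * \<theta> y)") (auto simp: ennreal_neg intro!: ennreal_leI)
        show ?thesis unfolding a2 by (rule order_trans[OF ennreal_leI[OF a1] a3])
      qed
      also have "ennreal (LINT y|m. \<kappa> y * \<theta> y) \<le> liminf (\<lambda>j. \<integral>\<^sup>+x. ennreal (w0 x) * ennreal (\<bar>mgrad (\<gamma> j) u x \<bullet> \<sigma>\<bar> powr p) \<partial>lborel)"
      proof -
        have "(\<lambda>j. ennreal (LINT x|lborel. \<kappa> x * (mgrad (\<gamma> j) u x \<bullet> \<sigma>))) \<longlonglongrightarrow> ennreal (LINT y|m. \<kappa> y * \<theta> y)"
          unfolding \<theta>_def using rep p by (intro tendsto_ennrealI mgrad_pairing[OF _ \<kappa> \<kappa>W \<eta>]) simp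
        then have "ennreal (LINT y|m. \<kappa> y * \<theta> y) = liminf (\<lambda>j. ennreal (LINT x|lborel. \<kappa> x * (mgrad (\<gamma> j) u x \<bullet> \<sigma>)))"
          by (intro lim_imp_Liminf[symmetric]) auto
        also have "\<dots> \<le> liminf (\<lambda>j. \<integral>\<^sup>+x. ennreal (w0 x) * ennreal (\<bar>mgrad (\<gamma> j) u x \<bullet> \<sigma>\<bar> powr p) \<partial>lborel)"
        proof (intro Liminf_mono always_eventually allI)
          fix j
          have "ennreal (LINT x|lborel. \<kappa> x * (mgrad (\<gamma> j) u x \<bullet> \<sigma>)) \<le> (\<integral>\<^sup>+x. ennreal (norm (\<kappa> x * (mgrad (\<gamma> j) u x \<bullet> \<sigma>))) \<partial>lborel)"
          proof (cases "integrable lborel (\<lambda>x. \<kappa> x * (mgrad (\<gamma> j) u x \<bullet> \<sigma>))")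
            case True
            show ?thesis by (rule order_trans[OF _ integral_norm_bound_ennreal[OF True]]) (auto intro: ennreal_leI)
          qed (simp add: not_integrable_integral_eq)
          also have "\<dots> \<le> directional_mass lborel p w0 (mgrad (\<gamma> j) u) \<sigma>"
            using \<kappa>w w0(2) p by (intro nn_integral_mono) (auto simp: abs_mult ennreal_mult[symmetric] intro!: ennreal_leI mult_right_mono)
          finally show "ennreal (LINT x|lborel. \<kappa> x * (mgrad (\<gamma> j) u x \<bullet> \<sigma>)) \<le> \<dots>" .
        qed
        finally show ?thesis .
      qed
      finally show "directional_mass m p w0 \<tau> \<sigma> \<le>
        liminf (\<lambda>j. \<integral>\<^sup>+x. ennreal (w0 x) * ennreal (\<bar>mgrad (\<gamma> j) u x \<bullet> \<sigma>\<bar> powr p) \<partial>lborel) + ennreal e"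
        by (simp add: add_right_mono)
    qed
  qed
qed

section \<open>Taylor bounds for mollifications and integration along segments\<close>

lemma integral_kernel_bound:
  fixes f :: "'a::euclidean_space \<Rightarrow> 'b::{banach, second_countable_topology}" and u :: "'a \<Rightarrow> real"
  assumes f: "integrable lborel f" and u[measurable]: "u \<in> borel_measurable borel"
    and le: "\<And>y. norm (f y) \<le> c * (\<bar>u y\<bar> * indicator (cball x r) y)" and c: "0 \<le> c"
    and B: "L1_mass (cball x r) u \<le> ennreal B" "0 \<le> B"
  shows "norm (LINT y|lborel. f y) \<le> c * B"
proof -
  have [measurable]: "cball x r \<in> sets borel" by simp
  have "ennreal (norm (LINT y|lborel. f y)) \<le> (\<integral>\<^sup>+y. ennreal (norm (f y)) \<partial>lborel)"
    by (rule integral_norm_bound_ennreal[OF f])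
  also have "\<dots> \<le> (\<integral>\<^sup>+y. ennreal c * (ennreal \<bar>u y\<bar> * indicator (cball x r) y) \<partial>lborel)"
  proof (rule nn_integral_mono)
    fix y
    show "ennreal (norm (f y)) \<le> ennreal c * (ennreal \<bar>u y\<bar> * indicator (cball x r) y)"
      using ennreal_leI[OF le[of y]] c by (auto simp: indicator_def ennreal_mult)
  qed
  also have "\<dots> = ennreal c * L1_mass (cball x r) u"
    by (rule nn_integral_cmult) measurable
  also have "\<dots> \<le> ennreal c * ennreal B" using B by (intro mult_left_mono) auto
  also have "\<dots> = ennreal (c * B)" using c B by (simp add: ennreal_mult)
  finally show ?thesis using c B by (subst (asm) ennreal_le_iff) auto
qed

lemma mgrad_bound:
  fixes u :: "'a::euclidean_space \<Rightarrow> real"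
  assumes u: "loc_integrable u" and \<eta>: "mollifier \<epsilon> \<eta> \<gamma> L"
    and B: "L1_mass (cball x (2 * \<epsilon>)) u \<le> ennreal B" "0 \<le> B"
  shows "norm (mgrad \<gamma> u x) \<le> L * B"
  unfolding mgrad_def
proof (rule integral_kernel_bound[OF mgrad_integrable[OF u \<eta>] _ _ _ B])
  show "u \<in> borel_measurable borel" using u by (simp add: loc_integrable_def)
  show "norm (u y *\<^sub>R \<gamma> (x - y)) \<le> L * (\<bar>u y\<bar> * indicator (cball x (2 * \<epsilon>)) y)" for y
  proof (cases "\<epsilon> \<le> norm (x - y)")
    case False
    then have "y \<in> cball x (2 * \<epsilon>)" using mollifierD(1)[OF \<eta>] by (auto simp: dist_norm)
    then show ?thesis using mult_right_mono[OF mollifierD(7)[OF \<eta>], of "\<bar>u y\<bar>" "x - y"] by (simp add: mult.commute)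
  next
    case True
    then show ?thesis using mollifierD(9)[OF \<eta> True] mollifierD(2)[OF \<eta>] by simp
  qed
qed (rule mollifierD(2)[OF \<eta>])

text \<open>The Taylor bound for \<eta> is integrated against u. For |h| \<le> \<epsilon> the
  integrand vanishes outside the ball of radius 2 \<epsilon> around x, so u enters the remainder
  only through its mass B on that ball.\<close>

lemma moll_Taylor:
  fixes u :: "'a::euclidean_space \<Rightarrow> real"
  assumes u: "loc_integrable u" and \<eta>: "mollifier \<epsilon> \<eta> \<gamma> L"
    and B: "L1_mass (cball x (2 * \<epsilon>)) u \<le> ennreal B" "0 \<le> B"
    and h: "norm h \<le> \<epsilon>"
  shows "\<bar>moll \<eta> u (x + h) - moll \<eta> u x - mgrad \<gamma> u x \<bullet> h\<bar> \<le> L * B * (norm h)\<^sup>2"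
proof -
  let ?f = "\<lambda>y. \<eta> (x + h - y) * u y - \<eta> (x - y) * u y - (u y *\<^sub>R \<gamma> (x - y)) \<bullet> h"
  note i = moll_integrable[OF u \<eta>] and j = mgrad_integrable[OF u \<eta>]
  have jj: "integrable lborel (\<lambda>y. (u y *\<^sub>R \<gamma> (x - y)) \<bullet> h)" for x using j by (rule integrable_inner_left)
  have "norm (LINT y|lborel. ?f y) \<le> (L * (norm h)\<^sup>2) * B"
  proof (rule integral_kernel_bound[OF _ _ _ _ B])
    show "integrable lborel ?f" by (intro Bochner_Integration.integrable_diff i jj)
    show "u \<in> borel_measurable borel" using u by (simp add: loc_integrable_def)
    show "0 \<le> L * (norm h)\<^sup>2" using mollifierD(2)[OF \<eta>] by simp
    show "norm (?f y) \<le> L * (norm h)\<^sup>2 * (\<bar>u y\<bar> * indicator (cball x (2 * \<epsilon>)) y)" for y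
    proof (cases "y \<in> cball x (2 * \<epsilon>)")
      case True
      have "?f y = u y * (\<eta> ((x - y) + h) - \<eta> (x - y) - \<gamma> (x - y) \<bullet> h)" by (simp add: algebra_simps)
      then have "norm (?f y) = \<bar>u y\<bar> * \<bar>\<eta> ((x - y) + h) - \<eta> (x - y) - \<gamma> (x - y) \<bullet> h\<bar>" by (simp add: abs_mult)
      also have "\<dots> \<le> \<bar>u y\<bar> * (L * (norm h)\<^sup>2)" by (intro mult_left_mono mollifierD(11)[OF \<eta> h]) simp
      finally show ?thesis using True by (simp add: mult.commute)
    next
      case False
      have "norm (x - y) \<le> norm (x + h - y) + norm h" using norm_triangle_ineq4[of "x + h - y" h] by simp
      then have "\<epsilon> \<le> norm (x + h - y)" "\<epsilon> \<le> norm (x - y)"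
        using False h mollifierD(1)[OF \<eta>] by (auto simp: dist_norm)
      then show ?thesis using False mollifierD(8,9)[OF \<eta>] by simp
    qed
  qed
  also have "(LINT y|lborel. ?f y) = moll \<eta> u (x + h) - moll \<eta> u x - mgrad \<gamma> u x \<bullet> h"
    unfolding moll_def mgrad_def integral_inner_left[OF j, symmetric]
      Bochner_Integration.integral_diff[OF Bochner_Integration.integrable_diff[OF i i] jj]
      Bochner_Integration.integral_diff[OF i i] ..
  finally show ?thesis by (simp add: mult_ac)
qed

text \<open>A second order Taylor bound at every point forces the gradient to be Lipschitz.\<close>

lemma Taylor_imp_continuous:
  fixes v :: "'a::euclidean_space \<Rightarrow> real" and G :: "'a \<Rightarrow> 'a"
  assumes T: "\<And>x h. norm h \<le> \<epsilon> \<Longrightarrow> \<bar>v (x + h) - v x - G x \<bullet> h\<bar> \<le> K * (norm h)\<^sup>2" and \<epsilon>: "0 < \<epsilon>" and K: "0 \<le> K"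
  shows "continuous_on UNIV G"
proof -
  have lip: "norm (G (x + h) - G x) \<le> 6 * K * norm h" if h: "norm h \<le> \<epsilon> / 2" for x h
  proof (cases "h = 0 \<or> G (x + h) = G x")
    case False
    define d where "d = G (x + h) - G x"
    \<comment> \<open>k has the length of h and the direction of the change d of G. Expanding v at x
      + h + k from x and from x + h isolates d \<bullet> k; with |h + k| \<le> 2 |h| the three
      remainders add up to (4 + 1 + 1) K |h|^2.\<close>
    define k where "k = norm h *\<^sub>R sgn d"
    have d0: "d \<noteq> 0" using False by (simp add: d_def)
    have nk: "norm k = norm h" using d0 by (simp add: k_def norm_sgn)
    have hk: "norm (h + k) \<le> 2 * norm h" using norm_triangle_ineq[of h k] nk by simp
    have "norm h * norm d = d \<bullet> k"
      using d0 by (simp add: k_def sgn_div_norm power2_norm_eq_inner[symmetric] power2_eq_square)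
    also have "\<dots> = (v (x + (h + k)) - v x - G x \<bullet> (h + k)) - (v (x + h) - v x - G x \<bullet> h)
        - (v (x + h + k) - v (x + h) - G (x + h) \<bullet> k)"
      by (simp add: d_def inner_diff_left inner_add_right add.assoc)
    also have "\<dots> \<le> K * (norm (h + k))\<^sup>2 + K * (norm h)\<^sup>2 + K * (norm k)\<^sup>2"
      using T[of "h + k" x] T[of h x] T[of k "x + h"] hk h nk \<epsilon> by (auto simp: abs_le_iff)
    also have "\<dots> \<le> K * (2 * norm h)\<^sup>2 + K * (norm h)\<^sup>2 + K * (norm h)\<^sup>2"
      using K hk nk by (intro add_mono mult_left_mono power_mono) auto
    also have "\<dots> = norm h * (6 * K * norm h)" by (simp add: power2_eq_square)
    finally show ?thesis using False by (simp add: d_def)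
  qed (use K in auto)
  show ?thesis
    unfolding continuous_on_iff
  proof (intro ballI allI impI)
    fix x :: 'a and e :: real assume e: "0 < e"
    define d where "d = min (\<epsilon> / 2) (e / (6 * K + 1))"
    have d: "0 < d" using \<epsilon> e K by (auto simp: d_def add_nonneg_pos)
    have "dist (G y) (G x) < e" if "dist y x < d" for y
    proof -
      have h: "norm (y - x) < d" using that by (simp add: dist_norm)
      have "norm (G y - G x) \<le> 6 * K * norm (y - x)" using lip[of "y - x" x] h by (simp add: d_def)
      also have "\<dots> \<le> 6 * K * (e / (6 * K + 1))" using h K by (intro mult_left_mono) (auto simp: d_def)
      also have "\<dots> < e" using e K by (simp add: divide_less_eq add_nonneg_pos)
      finally show ?thesis by (simp add: dist_norm)
    qed
    then show "\<exists>d>0. \<forall>x'\<in>UNIV. dist x' x < d \<longrightarrow> dist (G x') (G x) < e" using d by blast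
  qed
qed

text \<open>By the Taylor bound v is continuously differentiable with gradient G. The fundamental
  theorem of calculus therefore applies along the whole segment from x to x - z, however long, and
  Jensen's inequality for the parameter in [0, 1] follows.\<close>

lemma Taylor_difference_powr_le:
  fixes v :: "'a::euclidean_space \<Rightarrow> real" and G :: "'a \<Rightarrow> 'a"
  assumes p: "1 \<le> p"
    and T: "\<And>x h. norm h \<le> \<epsilon> \<Longrightarrow> \<bar>v (x + h) - v x - G x \<bullet> h\<bar> \<le> K * (norm h)\<^sup>2" and \<epsilon>: "0 < \<epsilon>" and K: "0 \<le> K"
  shows "ennreal (\<bar>v x - v (x - z)\<bar> powr p) \<le>
    (\<integral>\<^sup>+t. indicator {0..1} t * ennreal (\<bar>G (x - t *\<^sub>R z) \<bullet> z\<bar> powr p) \<partial>lborel)"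
proof -
  have cG: "continuous_on UNIV G" by (rule Taylor_imp_continuous[OF T \<epsilon> K])
  have dv: "(v has_derivative (\<lambda>h. G y \<bullet> h)) (at y)" for y
    unfolding has_derivative_at
  proof (intro conjI)
    show "bounded_linear (\<lambda>h. G y \<bullet> h)" by (rule bounded_linear_inner_right)
    have "((\<lambda>h::'a. K * norm h) \<longlongrightarrow> K * norm (0::'a)) (at 0)" by (intro tendsto_intros)
    then have lim: "((\<lambda>h::'a. K * norm h) \<longlongrightarrow> 0) (at 0)" by simp
    have "eventually (\<lambda>h. norm h \<le> \<epsilon>) (at (0::'a))"
      using \<epsilon> by (auto simp: eventually_at dist_norm intro!: exI[of _ \<epsilon>])
    then have "eventually (\<lambda>h. norm (norm (v (y + h) - v y - G y \<bullet> h) / norm h) \<le> K * norm h) (at 0)"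
    proof eventually_elim
      case (elim h)
      show ?case using T[OF elim, of y] by (cases "h = 0") (auto simp: divide_le_eq power2_eq_square mult.assoc)
    qed
    then show "(\<lambda>h. norm (v (y + h) - v y - G y \<bullet> h) / norm h) \<midarrow>0\<rightarrow> 0"
      by (rule Lim_null_comparison[OF _ lim])
  qed
  have D: "DERIV (\<lambda>t. v (x - t *\<^sub>R z)) t :> - (G (x - t *\<^sub>R z) \<bullet> z)" for t
  proof -
    have "((\<lambda>t. x - t *\<^sub>R z) has_derivative (\<lambda>s. - (s *\<^sub>R z))) (at t)"
      by (auto intro!: derivative_eq_intros)
    from has_derivative_compose[OF this dv] have "((\<lambda>t. v (x - t *\<^sub>R z)) has_derivative (\<lambda>s. G (x - t *\<^sub>R z) \<bullet> (- (s *\<^sub>R z)))) (at t)" .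
    then show ?thesis by (rule has_derivative_imp_has_field_derivative) (simp add: mult.commute)
  qed
  define g where "g t = G (x - t *\<^sub>R z) \<bullet> z" for t
  have cg: "continuous_on UNIV g"
    unfolding g_def by (intro continuous_intros continuous_on_compose2[OF cG]) auto
  then have ig: "isCont g t" for t by (simp add: continuous_on_eq_continuous_at)
  have [measurable]: "g \<in> borel_measurable borel" using cg by (rule borel_measurable_continuous_onI)
  have FTC: "(LINT t|lborel. - g t * indicator {0..1} t) = v (x - 1 *\<^sub>R z) - v (x - 0 *\<^sub>R z)"
    by (rule integral_FTC_Icc_real) (use D ig in \<open>auto simp: g_def[abs_def] intro!: isCont_minus\<close>)
  have int: "integrable lborel (\<lambda>t. indicator {0..1} t * g t)"
    using borel_integrable_atLeastAtMost'[OF continuous_on_subset[OF cg], of 0 1]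
    by (simp add: set_integrable_def)
  have "v x - v (x - z) = (LINT t|lborel. indicator {0..1} t * g t)"
    using FTC by (simp add: mult.commute)
  moreover have "ennreal (\<bar>LINT t|lborel. indicator {0..1} t * g t\<bar> powr p) \<le>
      (\<integral>\<^sup>+t. ennreal (indicator {0..1} t * \<bar>g t\<bar> powr p) \<partial>lborel)"
  proof (rule powr_Jensen[OF p _ _ _ _ int])
    have "(\<integral>\<^sup>+t. ennreal (indicator {0..1::real} t) \<partial>lborel) = emeasure lborel {0..1::real}"
      by (simp add: ennreal_indicator)
    then show "(\<integral>\<^sup>+t. ennreal (indicator {0..1::real} t) \<partial>lborel) = 1" by simp
  qed auto
  moreover have "(\<integral>\<^sup>+t. ennreal (indicator {0..1} t * \<bar>g t\<bar> powr p) \<partial>lborel) =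
      (\<integral>\<^sup>+t. indicator {0..1} t * ennreal (\<bar>g t\<bar> powr p) \<partial>lborel)"
    by (intro nn_integral_cong) (auto simp: indicator_def)
  ultimately show ?thesis by (simp add: g_def)
qed

lemma Lp_local_bound:
  assumes p: "1 \<le> p" and u: "u \<in> Lp lborel p"
  obtains B where "0 \<le> B" "\<And>x::'a::euclidean_space. L1_mass (cball x r) u \<le> ennreal B"
proof -
  let ?c = "emeasure lborel (cball (0::'a) r) + Lp_mass lborel p u"
  have "?c < \<infinity>"
    using emeasure_bounded_finite[of "cball (0::'a) r"] Lp_nn_integral_finite[OF u] by simp
  then have "?c = ennreal (enn2real ?c)" by (simp add: less_top)
  then show ?thesis using Lp_local_mass_le[OF p u, of _ r] by (intro that[of "enn2real ?c"]) auto
qed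

text \<open>The fundamental theorem of calculus applies to mollifications, and lower semicontinuity
  removes them.\<close>

lemma difference_integral_le:
  fixes u :: "'a::euclidean_space \<Rightarrow> real" and a w1 w2 :: "'a \<Rightarrow> real"
  assumes rep: "gradient_rep p u m \<tau>"
    and [measurable]: "a \<in> borel_measurable borel" "w1 \<in> borel_measurable borel" "w2 \<in> borel_measurable borel"
    and w1: "\<And>x. 0 \<le> w1 x" and aw: "\<And>x t. 0 \<le> t \<Longrightarrow> t \<le> 1 \<Longrightarrow> a x \<le> w1 (x - t *\<^sub>R z)"
    and d: "0 < d" and ww: "\<And>x y. norm (x - y) < d \<Longrightarrow> w1 x \<le> w2 y"
  shows "difference_mass p (\<lambda>x. ennreal (a x)) u z \<le>
    directional_mass m p w2 \<tau> z" (is "_ \<le> ?R")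
proof -
  note D = gradient_repD[OF rep]
  have [measurable]: "u \<in> borel_measurable borel" using D(6) by (simp add: loc_integrable_def)
  obtain \<eta> \<gamma> L where \<eta>: "mollifier_seq (\<eta> :: nat \<Rightarrow> 'a \<Rightarrow> real) \<gamma> L" using mollifier_seq_exists by blast
  have j: "mollifier (1 / real (Suc j)) (\<eta> j) (\<gamma> j) (L j)" for j using \<eta> by (simp add: mollifier_seq_def)
  have [measurable]: "\<eta> j \<in> borel_measurable borel" "\<gamma> j \<in> borel_measurable borel" for j
    using mollifierD(12,13)[OF j] by auto
  \<comment> \<open>The weight is relaxed twice: w1 dominates a along the segment, and w2 dominates
    w1 at the scale of the mollifier.\<close>
  have smooth: "difference_mass p (\<lambda>x. ennreal (a x)) (moll (\<eta> j) u) z \<le> ?R"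
    if jd: "1 / real (Suc j) < d" for j
  proof -
    define G where "G = mgrad (\<gamma> j) u"
    have [measurable]: "G \<in> borel_measurable borel" unfolding G_def by measurable
    obtain B where B: "0 \<le> B" "\<And>x. (\<integral>\<^sup>+y. ennreal \<bar>u y\<bar> * indicator (cball x (2 * (1 / real (Suc j)))) y \<partial>lborel) \<le> ennreal B"
      using Lp_local_bound[OF D(1,2)] by metis
    have T: "\<bar>moll (\<eta> j) u (x + h) - moll (\<eta> j) u x - G x \<bullet> h\<bar> \<le> L j * B * (norm h)\<^sup>2" if "norm h \<le> 1 / real (Suc j)" for x h
      unfolding G_def by (rule moll_Taylor[OF D(6) j B(2,1) that])
    have "difference_mass p (\<lambda>x. ennreal (a x)) (moll (\<eta> j) u) z \<le>
      (\<integral>\<^sup>+x. (\<integral>\<^sup>+t. indicator {0..1} t * (ennreal (w1 (x - t *\<^sub>R z)) * ennreal (\<bar>G (x - t *\<^sub>R z) \<bullet> z\<bar> powr p)) \<partial>lborel) \<partial>lborel)"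
    proof (rule nn_integral_mono)
      fix x :: 'a
      have "ennreal (a x) * ennreal (\<bar>moll (\<eta> j) u x - moll (\<eta> j) u (x - z)\<bar> powr p) \<le>
        ennreal (a x) * (\<integral>\<^sup>+t. indicator {0..1} t * ennreal (\<bar>G (x - t *\<^sub>R z) \<bullet> z\<bar> powr p) \<partial>lborel)"
        using B(1) mollifierD(1,2)[OF j, of j]
        by (intro mult_left_mono Taylor_difference_powr_le[OF D(1) T]) (auto intro!: mollifierD(1,2)[OF j])
      also have "\<dots> = (\<integral>\<^sup>+t. ennreal (a x) * (indicator {0..1} t * ennreal (\<bar>G (x - t *\<^sub>R z) \<bullet> z\<bar> powr p)) \<partial>lborel)"
        by (rule nn_integral_cmult[symmetric]) measurable
      also have "\<dots> \<le> (\<integral>\<^sup>+t. indicator {0..1} t * (ennreal (w1 (x - t *\<^sub>R z)) * ennreal (\<bar>G (x - t *\<^sub>R z) \<bullet> z\<bar> powr p)) \<partial>lborel)"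
        using aw by (intro nn_integral_mono) (auto simp: indicator_def intro!: mult_right_mono ennreal_leI)
      finally show "ennreal (a x) * ennreal (\<bar>moll (\<eta> j) u x - moll (\<eta> j) u (x - z)\<bar> powr p) \<le> \<dots>" .
    qed
    also have "\<dots> = (\<integral>\<^sup>+t. (\<integral>\<^sup>+x. indicator {0..1} t * (ennreal (w1 (x - t *\<^sub>R z)) * ennreal (\<bar>G (x - t *\<^sub>R z) \<bullet> z\<bar> powr p)) \<partial>lborel) \<partial>lborel)"
      by (rule lborel_pair.Fubini'[symmetric]) measurable
    \<comment> \<open>Translation by t z makes the inner integral independent of t, so the segment
      contributes the single factor 1.\<close>
    also have "\<dots> = (\<integral>\<^sup>+t. indicator {0..1::real} t * directional_mass lborel p w1 G z \<partial>lborel)"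
    proof (rule nn_integral_cong)
      fix t :: real
      have "(\<integral>\<^sup>+x. indicator {0..1} t * (ennreal (w1 (x - t *\<^sub>R z)) * ennreal (\<bar>G (x - t *\<^sub>R z) \<bullet> z\<bar> powr p)) \<partial>lborel) =
        indicator {0..1} t * (\<integral>\<^sup>+x. ennreal (w1 (x - t *\<^sub>R z)) * ennreal (\<bar>G (x - t *\<^sub>R z) \<bullet> z\<bar> powr p) \<partial>lborel)"
        by (rule nn_integral_cmult) measurable
      then show "(\<integral>\<^sup>+x. indicator {0..1} t * (ennreal (w1 (x - t *\<^sub>R z)) * ennreal (\<bar>G (x - t *\<^sub>R z) \<bullet> z\<bar> powr p)) \<partial>lborel) =
        indicator {0..1::real} t * directional_mass lborel p w1 G z"
        using nn_integral_lborel_shift[of "\<lambda>y. ennreal (w1 y) * ennreal (\<bar>G y \<bullet> z\<bar> powr p)" "- (t *\<^sub>R z)"] by simp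
    qed
    also have "\<dots> = directional_mass lborel p w1 G z"
      by (subst nn_integral_multc) auto
    also have "\<dots> \<le> ?R"
      unfolding G_def using jd by (intro mgrad_weighted_le[OF rep j] w1 ww) auto
    finally show ?thesis .
  qed
  have "difference_mass p (\<lambda>x. ennreal (a x)) u z \<le>
    liminf (\<lambda>j. difference_mass p (\<lambda>x. ennreal (a x)) (moll (\<eta> j) u) z)"
  proof (rule nn_integral_powr_lsc)
    fix r :: real
    have [measurable]: "cball (0::'a) s \<in> sets borel" for s by simp
    let ?b = "\<lambda>s j. \<integral>\<^sup>+x. ennreal \<bar>moll (\<eta> j) u x - u x\<bar> * indicator (cball 0 s) x \<partial>lborel"
    have b: "(\<lambda>j. ?b r j + ?b (r + norm z) j) \<longlonglongrightarrow> 0 + 0"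
      by (intro tendsto_add moll_seq_L1_loc[OF D(6) \<eta>])
    show "(\<lambda>j. \<integral>\<^sup>+x. ennreal \<bar>moll (\<eta> j) u x - moll (\<eta> j) u (x - z) - (u x - u (x - z))\<bar> * indicator (cball 0 r) x \<partial>lborel) \<longlonglongrightarrow> 0"
    proof (rule tendsto_sandwich[OF _ _ tendsto_const b[unfolded add_0]])
      show "eventually (\<lambda>j. L1_mass (cball 0 r) (\<lambda>x. moll (\<eta> j) u x - moll (\<eta> j) u (x - z) - (u x - u (x - z)))
        \<le> ?b r j + ?b (r + norm z) j) sequentially"
      proof (intro always_eventually allI)
        fix j
        let ?q = "\<lambda>y. ennreal \<bar>moll (\<eta> j) u y - u y\<bar> * indicator (cball 0 (r + norm z)) y"
        have "L1_mass (cball 0 r) (\<lambda>x. moll (\<eta> j) u x - moll (\<eta> j) u (x - z) - (u x - u (x - z))) \<le>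
          (\<integral>\<^sup>+x. ennreal \<bar>moll (\<eta> j) u x - u x\<bar> * indicator (cball 0 r) x + ?q (x + - z) \<partial>lborel)"
        proof (rule nn_integral_mono)
          fix x :: 'a
          have "norm (x - z) \<le> norm x + norm z" by (rule norm_triangle_ineq4)
          moreover have "ennreal \<bar>moll (\<eta> j) u x - moll (\<eta> j) u (x - z) - (u x - u (x - z))\<bar> \<le>
            ennreal \<bar>moll (\<eta> j) u x - u x\<bar> + ennreal \<bar>moll (\<eta> j) u (x - z) - u (x - z)\<bar>"
            by (rule ennreal_abs_le_add) linarith
          ultimately show "ennreal \<bar>moll (\<eta> j) u x - moll (\<eta> j) u (x - z) - (u x - u (x - z))\<bar> * indicator (cball 0 r) x \<le>
            ennreal \<bar>moll (\<eta> j) u x - u x\<bar> * indicator (cball 0 r) x + ?q (x + - z)"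
            by (auto simp: indicator_def)
        qed
        also have "\<dots> = ?b r j + (\<integral>\<^sup>+x. ?q (x + - z) \<partial>lborel)"
          by (rule nn_integral_add) measurable
        also have "(\<integral>\<^sup>+x. ?q (x + - z) \<partial>lborel) = ?b (r + norm z) j"
          by (rule nn_integral_lborel_shift) measurable
        finally show "L1_mass (cball 0 r) (\<lambda>x. moll (\<eta> j) u x - moll (\<eta> j) u (x - z) - (u x - u (x - z)))
          \<le> ?b r j + ?b (r + norm z) j" .
      qed
    qed auto
  qed (use D(1) in auto)
  also have "\<dots> \<le> liminf (\<lambda>j. ?R)"
  proof (rule Liminf_mono)
    have "eventually (\<lambda>j. 1 / real (Suc j) < d) sequentially"
      using order_tendstoD(2)[OF LIMSEQ_inverse_real_of_nat d] by (simp add: inverse_eq_divide)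
    then show "eventually (\<lambda>j. difference_mass p (\<lambda>x. ennreal (a x)) (moll (\<eta> j) u) z \<le> ?R) sequentially"
      by eventually_elim (rule smooth)
  qed
  also have "\<dots> = ?R" by (simp add: Liminf_const)
  finally show ?thesis .
qed

text \<open>Makes the directional integral a continuous, finite function of \<sigma> on the whole
  space, hence an admissible test function for the weak convergence of the directional
  measures.\<close>

lemma continuous_directional_integral:
  fixes M :: "'b measure" and \<tau> :: "'b \<Rightarrow> 'a::euclidean_space" and w0 :: "'b \<Rightarrow> real"
  assumes [measurable]: "\<tau> \<in> borel_measurable M" "w0 \<in> borel_measurable M"
    and w0: "\<And>y. 0 \<le> w0 y" "\<And>y. w0 y \<le> W" and p: "0 < p"
    and fin: "(\<integral>\<^sup>+y. ennreal (norm (\<tau> y) powr p) \<partial>M) < \<infinity>"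
  shows "continuous_on UNIV (\<lambda>\<sigma>. LINT y|M. w0 y * \<bar>\<tau> y \<bullet> \<sigma>\<bar> powr p)"
    and "ennreal (LINT y|M. w0 y * \<bar>\<tau> y \<bullet> \<sigma>\<bar> powr p) = directional_mass M p w0 \<tau> \<sigma>"
    and "0 \<le> (LINT y|M. w0 y * \<bar>\<tau> y \<bullet> \<sigma>\<bar> powr p)"
proof -
  have int: "integrable M (\<lambda>y. norm (\<tau> y) powr p)" using fin by (intro integrableI_nonneg) auto
  have bd: "w0 y * \<bar>\<tau> y \<bullet> \<sigma>\<bar> powr p \<le> W * (B powr p * norm (\<tau> y) powr p)" if "norm \<sigma> \<le> B" for y \<sigma> B
  proof -
    have "\<bar>\<tau> y \<bullet> \<sigma>\<bar> \<le> B * norm (\<tau> y)"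
      using Cauchy_Schwarz_ineq2[of "\<tau> y" \<sigma>] mult_left_mono[OF that, of "norm (\<tau> y)"] by (simp add: mult.commute)
    then have "\<bar>\<tau> y \<bullet> \<sigma>\<bar> powr p \<le> (B * norm (\<tau> y)) powr p" using p by (intro powr_mono2) auto
    also have "\<dots> = B powr p * norm (\<tau> y) powr p" by (rule powr_mult)
    finally show ?thesis using w0[of y] by (intro mult_mono) auto
  qed
  have i: "integrable M (\<lambda>y. w0 y * \<bar>\<tau> y \<bullet> \<sigma>\<bar> powr p)" for \<sigma>
  proof (rule Bochner_Integration.integrable_bound)
    show "integrable M (\<lambda>y. W * (norm \<sigma> powr p * norm (\<tau> y) powr p))" using int by simp
    show "AE y in M. norm (w0 y * \<bar>\<tau> y \<bullet> \<sigma>\<bar> powr p) \<le> norm (W * (norm \<sigma> powr p * norm (\<tau> y) powr p))"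
    proof (rule AE_I2)
      fix y
      have "0 \<le> w0 y * \<bar>\<tau> y \<bullet> \<sigma>\<bar> powr p" using w0 by simp
      then show "norm (w0 y * \<bar>\<tau> y \<bullet> \<sigma>\<bar> powr p) \<le> norm (W * (norm \<sigma> powr p * norm (\<tau> y) powr p))"
        using bd[of \<sigma> "norm \<sigma>" y] by (metis abs_of_nonneg abs_ge_self order_refl order_trans real_norm_def)
    qed
  qed measurable
  show "ennreal (LINT y|M. w0 y * \<bar>\<tau> y \<bullet> \<sigma>\<bar> powr p) = directional_mass M p w0 \<tau> \<sigma>"
    using i w0 by (subst nn_integral_eq_integral[symmetric]) (auto simp: ennreal_mult)
  show "0 \<le> (LINT y|M. w0 y * \<bar>\<tau> y \<bullet> \<sigma>\<bar> powr p)" using w0 by simp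
  show "continuous_on UNIV (\<lambda>\<sigma>. LINT y|M. w0 y * \<bar>\<tau> y \<bullet> \<sigma>\<bar> powr p)"
    unfolding continuous_on_sequentially
  proof (intro allI ballI impI)
    fix s :: "nat \<Rightarrow> 'a" and \<sigma> assume "(\<forall>n. s n \<in> UNIV) \<and> s \<longlonglongrightarrow> \<sigma>"
    then have s: "s \<longlonglongrightarrow> \<sigma>" by simp
    then have "Bseq s" using convergent_imp_Bseq convergentI by blast
    then obtain B where B: "\<And>n. norm (s n) \<le> B" by (auto simp: Bseq_def)
    have "(\<lambda>n. LINT y|M. w0 y * \<bar>\<tau> y \<bullet> s n\<bar> powr p) \<longlonglongrightarrow> (LINT y|M. w0 y * \<bar>\<tau> y \<bullet> \<sigma>\<bar> powr p)"
    proof (rule integral_dominated_convergence[where w = "\<lambda>y. W * (B powr p * norm (\<tau> y) powr p)"])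
      show "integrable M (\<lambda>y. W * (B powr p * norm (\<tau> y) powr p))" using int by simp
      show "AE y in M. (\<lambda>n. w0 y * \<bar>\<tau> y \<bullet> s n\<bar> powr p) \<longlonglongrightarrow> w0 y * \<bar>\<tau> y \<bullet> \<sigma>\<bar> powr p"
        using p by (intro AE_I2 tendsto_mult tendsto_const tendsto_powr' tendsto_rabs tendsto_inner s) auto
      show "AE y in M. norm (w0 y * \<bar>\<tau> y \<bullet> s n\<bar> powr p) \<le> W * (B powr p * norm (\<tau> y) powr p)" for n
        using bd[OF B] w0 by (intro AE_I2) (simp add: abs_mult)
    qed measurable
    then show "((\<lambda>\<sigma>. LINT y|M. w0 y * \<bar>\<tau> y \<bullet> \<sigma>\<bar> powr p) \<circ> s) \<longlonglongrightarrow> (LINT y|M. w0 y * \<bar>\<tau> y \<bullet> \<sigma>\<bar> powr p)"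
      by (simp add: o_def)
  qed
qed

lemma norm_powr_le_sum:
  fixes x :: "'a::euclidean_space"
  assumes p: "0 < p"
  shows "norm x powr p \<le> real DIM('a) powr p * (\<Sum>i\<in>Basis. \<bar>x \<bullet> i\<bar> powr p)"
proof -
  obtain b :: 'a where b: "b \<in> Basis" "\<And>i. i \<in> Basis \<Longrightarrow> \<bar>x \<bullet> i\<bar> \<le> \<bar>x \<bullet> b\<bar>"
  proof -
    have "Max ((\<lambda>i. \<bar>x \<bullet> i\<bar>) ` Basis) \<in> (\<lambda>i. \<bar>x \<bullet> i\<bar>) ` Basis" by (intro Max_in) auto
    then obtain b where "b \<in> Basis" "Max ((\<lambda>i. \<bar>x \<bullet> i\<bar>) ` Basis) = \<bar>x \<bullet> b\<bar>" by (elim imageE)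
    then have "b \<in> Basis" "\<bar>x \<bullet> b\<bar> = Max ((\<lambda>i. \<bar>x \<bullet> i\<bar>) ` Basis)" by simp_all
    then show ?thesis by (intro that[of b]) auto
  qed
  have "norm x \<le> (\<Sum>i\<in>Basis. \<bar>x \<bullet> i\<bar>)" by (rule norm_le_l1)
  also have "\<dots> \<le> (\<Sum>i\<in>(Basis::'a set). \<bar>x \<bullet> b\<bar>)" by (intro sum_mono b)
  finally have "norm x \<le> real DIM('a) * \<bar>x \<bullet> b\<bar>" by simp
  then have "norm x powr p \<le> (real DIM('a) * \<bar>x \<bullet> b\<bar>) powr p" using p by (intro powr_mono2) auto
  also have "\<dots> = real DIM('a) powr p * \<bar>x \<bullet> b\<bar> powr p" by (rule powr_mult)
  also have "\<dots> \<le> real DIM('a) powr p * (\<Sum>i\<in>Basis. \<bar>x \<bullet> i\<bar> powr p)"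
    using b(1) by (intro mult_left_mono member_le_sum) auto
  finally show ?thesis .
qed

lemma mgrad_powr_finite:
  fixes u :: "'a::euclidean_space \<Rightarrow> real"
  assumes rep: "gradient_rep p u m \<tau>" and \<eta>: "mollifier \<epsilon> \<eta> \<gamma> L"
  shows "(\<integral>\<^sup>+x. ennreal (norm (mgrad \<gamma> u x) powr p) \<partial>lborel) < \<infinity>"
proof -
  note D = gradient_repD[OF rep]
  note [measurable_cong] = D(3)
  have p: "0 < p" using D(1) by simp
  have [measurable]: "u \<in> borel_measurable borel" "\<gamma> \<in> borel_measurable borel" "\<tau> \<in> borel_measurable m"
    using D(6,7) mollifierD(13)[OF \<eta>] by (auto simp: loc_integrable_def)
  have i: "Lp_mass lborel p (\<lambda>x. mgrad \<gamma> u x \<bullet> i) < \<infinity>" if i: "i \<in> Basis" for i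
  proof -
    have "(\<integral>\<^sup>+x. ennreal 1 * ennreal (\<bar>mgrad \<gamma> u x \<bullet> i\<bar> powr p) \<partial>lborel) \<le> (\<integral>\<^sup>+y. ennreal 1 * ennreal (\<bar>\<tau> y \<bullet> i\<bar> powr p) \<partial>m)"
      by (rule mgrad_weighted_le[OF rep \<eta>]) auto
    also have "\<dots> \<le> (\<integral>\<^sup>+y. ennreal (norm (\<tau> y) powr p) \<partial>m)"
      using p Basis_le_norm[OF i] by (intro nn_integral_mono) (auto intro!: ennreal_leI powr_mono2)
    also have "\<dots> < \<infinity>" using rep by (simp add: gradient_rep_def)
    finally show ?thesis by simp
  qed
  have "(\<integral>\<^sup>+x. ennreal (norm (mgrad \<gamma> u x) powr p) \<partial>lborel) \<le>
    (\<integral>\<^sup>+x. ennreal (real DIM('a) powr p) * (\<Sum>i\<in>Basis. ennreal (\<bar>mgrad \<gamma> u x \<bullet> i\<bar> powr p)) \<partial>lborel)"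
    using norm_powr_le_sum[OF p] by (intro nn_integral_mono) (simp add: ennreal_mult[symmetric] ennreal_leI sum_nonneg)
  also have "\<dots> = ennreal (real DIM('a) powr p) * (\<Sum>i\<in>Basis. \<integral>\<^sup>+x. ennreal (\<bar>mgrad \<gamma> u x \<bullet> i\<bar> powr p) \<partial>lborel)"
    by (subst nn_integral_cmult, measurable, subst nn_integral_sum) auto
  also have "\<dots> < \<infinity>" using i by (auto simp: ennreal_mult_less_top)
  finally show ?thesis .
qed

section \<open>Kernels\<close>

lemma admissible_kernelsD:
  assumes "admissible_kernels p \<rho>"
  shows "\<rho> k \<in> borel_measurable borel" "compact K \<Longrightarrow> set_integrable lborel K (\<rho> k)" "AE z in lborel. 0 \<le> \<rho> k z"
  using assms by (auto simp: admissible_kernels_def)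

lemma kernel_tendsto:
  fixes \<rho> :: "nat \<Rightarrow> 'a::euclidean_space \<Rightarrow> real"
  assumes \<rho>: "admissible_kernels p \<rho>"
  obtains \<alpha> where "0 \<le> \<alpha>" "\<And>\<phi>. continuous_on UNIV \<phi> \<Longrightarrow> (\<And>x. 0 \<le> \<phi> x) \<Longrightarrow> (\<And>x. \<phi> x \<le> 1) \<Longrightarrow> (\<And>x. r < norm x \<Longrightarrow> \<phi> x = 0) \<Longrightarrow>
    (\<lambda>k. \<integral>\<^sup>+z. ennreal (\<rho> k z) * ennreal (\<phi> z) \<partial>lborel) \<longlonglongrightarrow> ennreal (\<alpha> * \<phi> 0)"
proof -
  note D = admissible_kernelsD[OF \<rho>]
  from \<rho> obtain \<alpha> where \<alpha>: "0 \<le> \<alpha>" "\<forall>\<phi>\<in>C_c. (\<lambda>k. LINT z|lborel. \<phi> z * \<rho> k z) \<longlonglongrightarrow> \<alpha> * \<phi> 0"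
    by (auto simp: admissible_kernels_def)
  show ?thesis
  proof (rule that[OF \<alpha>(1)])
    fix \<phi> :: "'a \<Rightarrow> real"
    assume \<phi>: "continuous_on UNIV \<phi>" "\<And>x. 0 \<le> \<phi> x" "\<And>x. \<phi> x \<le> 1" "\<And>x. r < norm x \<Longrightarrow> \<phi> x = 0"
    have [measurable]: "\<phi> \<in> borel_measurable borel" using \<phi>(1) by (rule borel_measurable_continuous_onI)
    note [measurable] = D(1)
    have "{x. \<phi> x \<noteq> 0} \<subseteq> cball 0 r" using \<phi>(4) by (force simp: not_less[symmetric])
    then have "compact (closure {x. \<phi> x \<noteq> 0})" by (metis bounded_cball bounded_subset compact_closure)
    then have C: "\<phi> \<in> C_c" using \<phi>(1) by (simp add: C_c_def)
    have "(\<integral>\<^sup>+z. ennreal (\<rho> k z) * ennreal (\<phi> z) \<partial>lborel) = ennreal (LINT z|lborel. \<phi> z * \<rho> k z)" for k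
    proof -
      have "set_integrable lborel (cball 0 r) (\<rho> k)" by (rule D(2)) simp
      then have i: "integrable lborel (\<lambda>z. indicator (cball 0 r) z *\<^sub>R \<rho> k z)" by (simp add: set_integrable_def)
      have "integrable lborel (\<lambda>z. \<phi> z * \<rho> k z)"
      proof (rule Bochner_Integration.integrable_bound[OF i])
        show "AE z in lborel. norm (\<phi> z * \<rho> k z) \<le> norm (indicator (cball 0 r) z *\<^sub>R \<rho> k z)"
        proof (rule AE_I2)
          fix z :: 'a
          show "norm (\<phi> z * \<rho> k z) \<le> norm (indicator (cball 0 r) z *\<^sub>R \<rho> k z)"
            using \<phi>(2,3,4)[of z] mult_right_mono[OF \<phi>(3)[of z], of "\<bar>\<rho> k z\<bar>"]
            by (cases "norm z \<le> r") (auto simp: abs_mult)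
        qed
      qed measurable
      moreover have "AE z in lborel. 0 \<le> \<phi> z * \<rho> k z" using D(3)[of k] by eventually_elim (use \<phi>(2) in auto)
      ultimately have "ennreal (LINT z|lborel. \<phi> z * \<rho> k z) = (\<integral>\<^sup>+z. ennreal (\<phi> z * \<rho> k z) \<partial>lborel)"
        by (intro nn_integral_eq_integral[symmetric])
      also have "\<dots> = (\<integral>\<^sup>+z. ennreal (\<rho> k z) * ennreal (\<phi> z) \<partial>lborel)"
        using \<phi>(2) by (intro nn_integral_cong) (simp add: ennreal_mult' mult.commute)
      finally show ?thesis ..
    qed
    then show "(\<lambda>k. \<integral>\<^sup>+z. ennreal (\<rho> k z) * ennreal (\<phi> z) \<partial>lborel) \<longlonglongrightarrow> ennreal (\<alpha> * \<phi> 0)"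
      using \<alpha>(2) C by (simp add: tendsto_ennrealI)
  qed
qed

lemma kernel_mass_bounded:
  fixes \<rho> :: "nat \<Rightarrow> 'a::euclidean_space \<Rightarrow> real"
  assumes \<rho>: "admissible_kernels p \<rho>"
  obtains C where "0 \<le> C" "eventually (\<lambda>k. (\<integral>\<^sup>+z. ennreal (\<rho> k z) * indicator (ball 0 1) z \<partial>lborel) \<le> ennreal C) sequentially"
proof -
  \<comment> \<open>A continuous cut-off that equals 1 on the unit ball and vanishes beyond radius
    2, so that the weak convergence of the kernels bounds their mass.\<close>
  define \<phi> where "\<phi> z = max 0 (min 1 (2 - norm z))" for z :: 'a
  obtain \<alpha> where \<alpha>: "0 \<le> \<alpha>" "(\<lambda>k. \<integral>\<^sup>+z. ennreal (\<rho> k z) * ennreal (\<phi> z) \<partial>lborel) \<longlonglongrightarrow> ennreal (\<alpha> * \<phi> 0)"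
  proof (rule kernel_tendsto[OF \<rho>, of 2])
    fix \<alpha> assume "0 \<le> \<alpha>" and *: "\<And>\<phi> :: 'a \<Rightarrow> real. continuous_on UNIV \<phi> \<Longrightarrow> (\<And>x. 0 \<le> \<phi> x) \<Longrightarrow> (\<And>x. \<phi> x \<le> 1) \<Longrightarrow> (\<And>x. 2 < norm x \<Longrightarrow> \<phi> x = 0) \<Longrightarrow>
      (\<lambda>k. \<integral>\<^sup>+z. ennreal (\<rho> k z) * ennreal (\<phi> z) \<partial>lborel) \<longlonglongrightarrow> ennreal (\<alpha> * \<phi> 0)"
    have "continuous_on UNIV \<phi>" unfolding \<phi>_def by (intro continuous_intros)
    from *[OF this] have "(\<lambda>k. \<integral>\<^sup>+z. ennreal (\<rho> k z) * ennreal (\<phi> z) \<partial>lborel) \<longlonglongrightarrow> ennreal (\<alpha> * \<phi> 0)"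
      by (auto simp: \<phi>_def)
    with \<open>0 \<le> \<alpha>\<close> show ?thesis by (rule that)
  qed
  have "ennreal (\<alpha> * \<phi> 0) < ennreal (\<alpha> + 1)" using \<alpha>(1) by (intro ennreal_lessI) (auto simp: \<phi>_def)
  then have "eventually (\<lambda>k. (\<integral>\<^sup>+z. ennreal (\<rho> k z) * ennreal (\<phi> z) \<partial>lborel) < ennreal (\<alpha> + 1)) sequentially"
    by (rule order_tendstoD(2)[OF \<alpha>(2)])
  then have "eventually (\<lambda>k. (\<integral>\<^sup>+z. ennreal (\<rho> k z) * indicator (ball 0 1) z \<partial>lborel) \<le> ennreal (\<alpha> + 1)) sequentially"
  proof eventually_elim
    case (elim k)
    have "(\<integral>\<^sup>+z. ennreal (\<rho> k z) * indicator (ball 0 1) z \<partial>lborel) \<le> (\<integral>\<^sup>+z. ennreal (\<rho> k z) * ennreal (\<phi> z) \<partial>lborel)"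
      by (intro nn_integral_mono mult_left_mono) (auto simp: indicator_def \<phi>_def)
    then show ?case using elim by simp
  qed
  then show ?thesis using \<alpha>(1) by (intro that[of "\<alpha> + 1"]) auto
qed

text \<open>Two regimes. Beyond a large radius r, 1 / |z|^p is at most 2 / (r^p + |z|^p), and the
  uniform bound on the kernels leaves a mass of order 1 / r^p. Between \<delta> and r, weak
  convergence to a multiple of the Dirac mass at 0 is tested with a function that vanishes at
  0.\<close>

lemma kernel_tail_small:
  fixes \<rho> :: "nat \<Rightarrow> 'a::euclidean_space \<Rightarrow> real"
  assumes p: "1 \<le> p" and \<rho>: "admissible_kernels p \<rho>" and \<delta>: "0 < \<delta>" and e: "0 < e"
  shows "eventually (\<lambda>k. (\<integral>\<^sup>+z. ennreal (\<rho> k z) * ennreal (1 / norm z powr p) * indicator (- ball 0 \<delta>) z \<partial>lborel) \<le> ennreal e) sequentially"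
proof -
  note D = admissible_kernelsD[OF \<rho>]
  note [measurable] = D(1)
  let ?A = "\<lambda>R k. \<integral>\<^sup>+ z. ennreal (\<rho> k z / (R powr p + norm z powr p)) \<partial>lborel"
  have S: "(SUP R\<in>{0<..}. limsup (\<lambda>k. ennreal (R powr p) * ?A R k)) < \<infinity>"
    using \<rho> by (simp add: admissible_kernels_def)
  then obtain s where s: "(SUP R\<in>{0<..}. limsup (\<lambda>k. ennreal (R powr p) * ?A R k)) = ennreal s" "0 \<le> s"
    by (cases "SUP R\<in>{0<..}. limsup (\<lambda>k. ennreal (R powr p) * ?A R k)") auto
  \<comment> \<open>Chosen so that (s + 1) / r^p \<le> e/4, where s is the uniform bound on the
    kernels; the factor 2 in the comparison then yields e/2.\<close>
  define r where "r = max \<delta> ((4 * (s + 1) / e) powr (1 / p))"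
  have r: "0 < r" "\<delta> \<le> r" using \<delta> by (auto simp: r_def)
  have rp: "4 * (s + 1) / e \<le> r powr p"
  proof -
    have "4 * (s + 1) / e = ((4 * (s + 1) / e) powr (1 / p)) powr p" using s e p by (simp add: powr_powr)
    also have "\<dots> \<le> r powr p" using p by (intro powr_mono2) (auto simp: r_def)
    finally show ?thesis .
  qed
  have rp0: "0 < r powr p" using r by simp
  have "limsup (\<lambda>k. ennreal (r powr p) * ?A r k) \<le> ennreal s"
    unfolding s(1)[symmetric] using r by (intro SUP_upper) auto
  also have "\<dots> < ennreal (s + 1)" using s by (intro ennreal_lessI) auto
  finally have "eventually (\<lambda>k. ennreal (r powr p) * ?A r k < ennreal (s + 1)) sequentially"
    by (rule Limsup_lessD)
  then have far: "eventually (\<lambda>k. ?A r k \<le> ennreal (e / 4)) sequentially"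
  proof eventually_elim
    case (elim k)
    have "?A r k = ennreal (1 / r powr p) * (ennreal (r powr p) * ?A r k)"
      using rp0 by (simp add: mult.assoc[symmetric] ennreal_mult[symmetric])
    also have "\<dots> \<le> ennreal (1 / r powr p) * ennreal (s + 1)" using elim by (intro mult_left_mono) auto
    also have "\<dots> = ennreal ((s + 1) / r powr p)" using s rp0 by (simp add: ennreal_mult[symmetric] del: ennreal_plus)
    also have "\<dots> \<le> ennreal (e / 4)" using rp rp0 e by (intro ennreal_leI) (simp add: field_simps)
    finally show ?case .
  qed
  \<comment> \<open>Equal to 1 for \<delta> \<le> |z| \<le> r, and 0 for |z| \<le> \<delta>/2, in
    particular at the origin.\<close>
  define \<phi> where "\<phi> z = min 1 (max 0 (2 * norm z / \<delta> - 1)) * max 0 (min 1 (r + 1 - norm z))" for z :: 'a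
  have \<phi>: "0 \<le> \<phi> z" "\<phi> z \<le> 1" for z
    unfolding \<phi>_def by (auto intro!: mult_nonneg_nonneg mult_le_one)
  obtain \<alpha> where "0 \<le> \<alpha>" "(\<lambda>k. \<integral>\<^sup>+z. ennreal (\<rho> k z) * ennreal (\<phi> z) \<partial>lborel) \<longlonglongrightarrow> ennreal (\<alpha> * \<phi> 0)"
  proof (rule kernel_tendsto[OF \<rho>, of "r + 1"])
    fix \<alpha> assume "0 \<le> \<alpha>" and *: "\<And>\<phi> :: 'a \<Rightarrow> real. continuous_on UNIV \<phi> \<Longrightarrow> (\<And>x. 0 \<le> \<phi> x) \<Longrightarrow> (\<And>x. \<phi> x \<le> 1) \<Longrightarrow> (\<And>x. r + 1 < norm x \<Longrightarrow> \<phi> x = 0) \<Longrightarrow>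
      (\<lambda>k. \<integral>\<^sup>+z. ennreal (\<rho> k z) * ennreal (\<phi> z) \<partial>lborel) \<longlonglongrightarrow> ennreal (\<alpha> * \<phi> 0)"
    have "continuous_on UNIV \<phi>" unfolding \<phi>_def using \<delta> by (intro continuous_intros) auto
    from *[OF this \<phi>] have "(\<lambda>k. \<integral>\<^sup>+z. ennreal (\<rho> k z) * ennreal (\<phi> z) \<partial>lborel) \<longlonglongrightarrow> ennreal (\<alpha> * \<phi> 0)"
      by (auto simp: \<phi>_def)
    with \<open>0 \<le> \<alpha>\<close> show ?thesis by (rule that)
  qed
  moreover have "\<phi> 0 = 0" by (simp add: \<phi>_def)
  ultimately have lim: "(\<lambda>k. \<integral>\<^sup>+z. ennreal (\<rho> k z) * ennreal (\<phi> z) \<partial>lborel) \<longlonglongrightarrow> 0" by simp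
  have \<delta>p: "0 < \<delta> powr p" using \<delta> by simp
  have "eventually (\<lambda>k. (\<integral>\<^sup>+z. ennreal (\<rho> k z) * ennreal (\<phi> z) \<partial>lborel) < ennreal (e / 2 * \<delta> powr p)) sequentially"
    by (rule order_tendstoD(2)[OF lim]) (use e \<delta>p in simp)
  with far show ?thesis
  proof eventually_elim
    case (elim k)
    have [measurable]: "\<phi> \<in> borel_measurable borel" unfolding \<phi>_def by measurable
    have "(\<integral>\<^sup>+z. ennreal (\<rho> k z) * ennreal (1 / norm z powr p) * indicator (- ball 0 \<delta>) z \<partial>lborel) \<le>
      (\<integral>\<^sup>+z. ennreal (1 / \<delta> powr p) * (ennreal (\<rho> k z) * ennreal (\<phi> z)) + ennreal 2 * ennreal (\<rho> k z / (r powr p + norm z powr p)) \<partial>lborel)"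
    proof (rule nn_integral_mono)
      fix z :: 'a
      show "ennreal (\<rho> k z) * ennreal (1 / norm z powr p) * indicator (- ball 0 \<delta>) z \<le>
        ennreal (1 / \<delta> powr p) * (ennreal (\<rho> k z) * ennreal (\<phi> z)) + ennreal 2 * ennreal (\<rho> k z / (r powr p + norm z powr p))"
      proof (cases "norm z < \<delta>")
        case False
        then have z: "\<delta> \<le> norm z" "0 < norm z powr p" using \<delta> by auto
        show ?thesis
        proof (cases "norm z \<le> r")
          case True
          have "\<phi> z = 1" using True z \<delta> by (simp add: \<phi>_def field_simps)
          moreover have "1 / norm z powr p \<le> 1 / \<delta> powr p"
            using z \<delta>p p \<delta> by (intro divide_left_mono powr_mono2) auto
          ultimately have "ennreal (\<rho> k z) * ennreal (1 / norm z powr p) \<le> ennreal (1 / \<delta> powr p) * (ennreal (\<rho> k z) * ennreal (\<phi> z))"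
            by (simp add: mult.commute mult_left_mono ennreal_leI)
          then show ?thesis using False by (simp add: add_increasing2)
        next
          case far: False
          have "r powr p \<le> norm z powr p" using far r p by (intro powr_mono2) auto
          then have "2 / (2 * norm z powr p) \<le> 2 / (r powr p + norm z powr p)"
            using rp0 z by (intro divide_left_mono mult_pos_pos add_pos_pos) auto
          then have "1 / norm z powr p \<le> 2 / (r powr p + norm z powr p)" by simp
          then have "ennreal (\<rho> k z) * ennreal (1 / norm z powr p) \<le> ennreal (\<rho> k z) * ennreal (2 / (r powr p + norm z powr p))"
            by (intro mult_left_mono ennreal_leI) auto
          also have "\<dots> = ennreal 2 * ennreal (\<rho> k z / (r powr p + norm z powr p))"
          proof -
            have N: "0 \<le> 2 / (r powr p + norm z powr p)" using rp0 z by (intro divide_nonneg_pos add_pos_pos) auto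
            have "ennreal (\<rho> k z) * ennreal (2 / (r powr p + norm z powr p)) = ennreal (\<rho> k z * (2 / (r powr p + norm z powr p)))"
              by (rule ennreal_mult''[OF N, symmetric])
            also have "\<rho> k z * (2 / (r powr p + norm z powr p)) = 2 * (\<rho> k z / (r powr p + norm z powr p))" by simp
            also have "ennreal \<dots> = ennreal 2 * ennreal (\<rho> k z / (r powr p + norm z powr p))"
              by (rule ennreal_mult') simp
            finally show ?thesis .
          qed
          finally show ?thesis using False by (simp add: add_increasing)
        qed
      qed simp
    qed
    also have "\<dots> = ennreal (1 / \<delta> powr p) * (\<integral>\<^sup>+z. ennreal (\<rho> k z) * ennreal (\<phi> z) \<partial>lborel) + ennreal 2 * ?A r k"
      by (subst nn_integral_add, measurable, subst nn_integral_cmult, measurable, subst nn_integral_cmult, measurable)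
    also have "\<dots> \<le> ennreal (1 / \<delta> powr p) * ennreal (e / 2 * \<delta> powr p) + ennreal 2 * ennreal (e / 4)"
      using elim by (intro add_mono mult_left_mono) auto
    also have "\<dots> = ennreal (1 / \<delta> powr p * (e / 2 * \<delta> powr p) + 2 * (e / 4))"
      using e \<delta>p by (simp only: ennreal_mult'[symmetric] ennreal_plus) (simp add: ennreal_mult'[symmetric] ennreal_plus[symmetric] del: ennreal_plus)
    also have "1 / \<delta> powr p * (e / 2 * \<delta> powr p) + 2 * (e / 4) = e" using \<delta>p by simp
    finally show ?case .
  qed
qed

section \<open>Energies\<close>

text \<open>The factors are separate \<open>ennreal\<close> values and the weight is itself
  extended-valued. Weights can then be added, compared and multiplied by indicators without sign
  conditions, and \<rho> is cut off at 0 where it is negative.\<close>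

definition pair_energy :: "real \<Rightarrow> ('a::euclidean_space \<Rightarrow> real) \<Rightarrow> ('a \<Rightarrow> real) \<Rightarrow> ('a \<times> 'a \<Rightarrow> ennreal) \<Rightarrow> ennreal" where
  "pair_energy p \<rho> u V = (\<integral>\<^sup>+q. ennreal (\<bar>u (fst q) - u (snd q)\<bar> powr p / norm (fst q - snd q) powr p)
     * ennreal (\<rho> (fst q - snd q)) * V q \<partial>lborel)"

text \<open>Every x-section of the exceptional set is a reflected translate of a null set.\<close>

lemma AE_kernel_pair:
  fixes \<rho> :: "'a::euclidean_space \<Rightarrow> real"
  assumes [measurable]: "\<rho> \<in> borel_measurable borel" and \<rho>: "AE z in lborel. 0 \<le> \<rho> z"
  shows "AE q in (lborel :: ('a \<times> 'a) measure). 0 \<le> \<rho> (fst q - snd q)"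
proof -
  define N where "N = {z. \<rho> z < 0}"
  have [measurable]: "N \<in> sets borel" unfolding N_def by measurable
  have "(\<integral>\<^sup>+z. indicator N z \<partial>lborel) = 0"
    using \<rho> by (subst nn_integral_0_iff_AE) (auto simp: N_def indicator_def)
  then have x: "(\<integral>\<^sup>+y. indicator N (x - y) \<partial>lborel) = 0" for x
    using nn_integral_lborel_reflect[of "indicator N" x] by simp
  have "(\<integral>\<^sup>+q. indicator N (fst q - snd q) \<partial>(lborel \<Otimes>\<^sub>M lborel)) = (\<integral>\<^sup>+x. (\<integral>\<^sup>+y. indicator N (x - y) \<partial>lborel) \<partial>lborel)"
    by (subst lborel.nn_integral_fst[symmetric]) auto
  then have "(\<integral>\<^sup>+q. indicator N (fst q - snd q) \<partial>(lborel :: ('a \<times> 'a) measure)) = 0"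
    by (simp add: x lborel_prod)
  then have "AE q in (lborel :: ('a \<times> 'a) measure). (indicator N (fst q - snd q) :: ennreal) = 0"
    by (subst (asm) nn_integral_0_iff_AE) (auto simp: borel_prod[symmetric])
  then show ?thesis by eventually_elim (auto simp: N_def indicator_def split: if_splits)
qed

lemma energy_eq_pair_energy:
  fixes \<rho> u :: "'a::euclidean_space \<Rightarrow> real"
  assumes [measurable]: "\<rho> \<in> borel_measurable borel" "u \<in> borel_measurable borel" and v: "v \<in> borel_measurable borel"
    and \<rho>: "AE z in lborel. 0 \<le> \<rho> z" and v0: "AE q in lborel. 0 \<le> v q"
  shows "energy p \<rho> v u = pair_energy p \<rho> u (\<lambda>q. ennreal (v q))"
proof -
  have [measurable]: "v \<in> borel_measurable (borel \<Otimes>\<^sub>M borel)" using v by (simp add: borel_prod)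
  have "energy p \<rho> v u = (\<integral>\<^sup>+q. ennreal (\<bar>u (fst q) - u (snd q)\<bar> powr p / norm (fst q - snd q) powr p * \<rho> (fst q - snd q) * v q) \<partial>(lborel \<Otimes>\<^sub>M lborel))"
    unfolding energy_def by (subst lborel.nn_integral_fst[symmetric]) auto
  also have "\<dots> = pair_energy p \<rho> u (\<lambda>q. ennreal (v q))"
    unfolding pair_energy_def lborel_prod
  proof (rule nn_integral_cong_AE, use AE_kernel_pair[OF assms(1) \<rho>] v0 in eventually_elim)
    case (elim q)
    have *: "ennreal (a * b * c) = ennreal a * ennreal b * ennreal c" if "0 \<le> a" "0 \<le> b" "0 \<le> c" for a b c :: real
      using that by (simp add: ennreal_mult)
    show ?case by (rule *) (use elim in auto)
  qed
  finally show ?thesis .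
qed

text \<open>The substitution y = x - z and an exchange of the integrals. It reduces estimates
  between energies to estimates for each fixed z.\<close>

lemma pair_energy_eq:
  fixes \<rho> u :: "'a::euclidean_space \<Rightarrow> real"
  assumes [measurable]: "\<rho> \<in> borel_measurable borel" "u \<in> borel_measurable borel" and V: "V \<in> borel_measurable borel"
  shows "pair_energy p \<rho> u V = (\<integral>\<^sup>+z. ennreal (\<rho> z) * ennreal (1 / norm z powr p)
    * difference_mass p (\<lambda>x. V (x, x - z)) u z \<partial>lborel)"
proof -
  have [measurable]: "V \<in> borel_measurable (borel \<Otimes>\<^sub>M borel)" using V by (simp add: borel_prod)
  let ?f = "\<lambda>x y. ennreal (\<bar>u x - u y\<bar> powr p / norm (x - y) powr p) * ennreal (\<rho> (x - y)) * V (x, y)"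
  have "pair_energy p \<rho> u V = (\<integral>\<^sup>+x. (\<integral>\<^sup>+y. ?f x y \<partial>lborel) \<partial>lborel)"
    unfolding pair_energy_def lborel_prod[symmetric] by (subst lborel.nn_integral_fst[symmetric]) auto
  also have "\<dots> = (\<integral>\<^sup>+x. (\<integral>\<^sup>+z. ?f x (x - z) \<partial>lborel) \<partial>lborel)"
  proof (rule nn_integral_cong)
    fix x :: 'a
    have "(\<lambda>y. ?f x y) \<in> borel_measurable borel" by measurable
    from nn_integral_lborel_reflect[OF this, of x] show "(\<integral>\<^sup>+y. ?f x y \<partial>lborel) = (\<integral>\<^sup>+z. ?f x (x - z) \<partial>lborel)" ..
  qed
  also have "\<dots> = (\<integral>\<^sup>+z. (\<integral>\<^sup>+x. ?f x (x - z) \<partial>lborel) \<partial>lborel)"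
    by (rule lborel_pair.Fubini'[symmetric]) measurable
  also have "\<dots> = (\<integral>\<^sup>+z. ennreal (\<rho> z) * ennreal (1 / norm z powr p)
    * difference_mass p (\<lambda>x. V (x, x - z)) u z \<partial>lborel)"
  proof (rule nn_integral_cong)
    fix z :: 'a
    have "(\<integral>\<^sup>+x. ?f x (x - z) \<partial>lborel) = (\<integral>\<^sup>+x. ennreal (\<rho> z) * ennreal (1 / norm z powr p) * (V (x, x - z) * ennreal (\<bar>u x - u (x - z)\<bar> powr p)) \<partial>lborel)"
    proof (rule nn_integral_cong)
      fix x :: 'a
      have "ennreal (\<bar>u x - u (x - z)\<bar> powr p / norm z powr p) = ennreal (1 / norm z powr p) * ennreal (\<bar>u x - u (x - z)\<bar> powr p)"
        by (simp add: ennreal_mult[symmetric])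
      then show "?f x (x - z) = ennreal (\<rho> z) * ennreal (1 / norm z powr p) * (V (x, x - z) * ennreal (\<bar>u x - u (x - z)\<bar> powr p))"
        by (simp add: mult_ac)
    qed
    also have "\<dots> = ennreal (\<rho> z) * ennreal (1 / norm z powr p) * difference_mass p (\<lambda>x. V (x, x - z)) u z"
      by (rule nn_integral_cmult) measurable
    finally show "(\<integral>\<^sup>+x. ?f x (x - z) \<partial>lborel) = \<dots>" .
  qed
  finally show ?thesis .
qed

lemma powr_abs_diff_le: "0 < p \<Longrightarrow> \<bar>a - b\<bar> powr p \<le> 2 powr p * (\<bar>a\<bar> powr p + \<bar>b\<bar> powr p)" for a b p :: real
proof -
  assume p: "0 < p"
  let ?m = "max \<bar>a\<bar> \<bar>b\<bar>"
  have "\<bar>a - b\<bar> powr p \<le> (2 * ?m) powr p" using p by (intro powr_mono2) auto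
  also have "\<dots> = 2 powr p * ?m powr p" by (rule powr_mult)
  also have "\<dots> \<le> 2 powr p * (\<bar>a\<bar> powr p + \<bar>b\<bar> powr p)" by (intro mult_left_mono) (auto simp: max_def)
  finally show ?thesis .
qed

lemma shift_difference_powr_le:
  fixes u :: "'a::euclidean_space \<Rightarrow> real"
  assumes [measurable]: "u \<in> borel_measurable borel" and p: "0 < p"
  shows "Lp_mass lborel p (\<lambda>x. u x - u (x - z)) \<le> ennreal (2 * 2 powr p) * Lp_mass lborel p u"
proof -
  let ?N = "\<integral>\<^sup>+x. ennreal (\<bar>u x\<bar> powr p) \<partial>lborel"
  have "Lp_mass lborel p (\<lambda>x. u x - u (x - z)) \<le>
    (\<integral>\<^sup>+x. ennreal (2 powr p) * (ennreal (\<bar>u x\<bar> powr p) + ennreal (\<bar>u (x + - z)\<bar> powr p)) \<partial>lborel)"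
    using powr_abs_diff_le[OF p]
    by (intro nn_integral_mono) (simp add: ennreal_mult'[symmetric] ennreal_plus[symmetric] ennreal_leI del: ennreal_plus)
  also have "\<dots> = ennreal (2 powr p) * (?N + Lp_mass lborel p (\<lambda>x. u (x + - z)))"
    by (subst nn_integral_cmult, measurable, subst nn_integral_add) measurable
  also have "Lp_mass lborel p (\<lambda>x. u (x + - z)) = ?N"
    by (rule nn_integral_lborel_shift) measurable
  also have "ennreal (2 powr p) * (?N + ?N) = ennreal (2 * 2 powr p) * ?N"
    by (simp add: mult_2[symmetric] ennreal_mult mult_ac)
  finally show ?thesis .
qed

lemma sets_far_pairs: "{q :: 'a::euclidean_space \<times> 'a. \<delta> \<le> norm (fst q - snd q)} \<in> sets borel"
  by (intro borel_closed closed_Collect_le continuous_intros)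

lemma sets_near_pairs: "{q :: 'a::euclidean_space \<times> 'a. norm (fst q - snd q) < \<delta>} \<in> sets borel"
  by (intro borel_open open_Collect_less continuous_intros)

text \<open>For every z the difference mass is at most a constant times the mass of u itself. What
  remains is the kernel tail of \<open>kernel_tail_small\<close>.\<close>

lemma pair_energy_far_le:
  fixes \<rho> u :: "'a::euclidean_space \<Rightarrow> real"
  assumes [measurable]: "\<rho> \<in> borel_measurable borel" "u \<in> borel_measurable borel" and p: "0 < p"
  shows "pair_energy p \<rho> u (\<lambda>q. c * indicator {q. \<delta> \<le> norm (fst q - snd q)} q) \<le>
    c * (ennreal (2 * 2 powr p) * Lp_mass lborel p u)
      * (\<integral>\<^sup>+z. ennreal (\<rho> z) * ennreal (1 / norm z powr p) * indicator (- ball 0 \<delta>) z \<partial>lborel)"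
proof -
  have V: "(\<lambda>q :: 'a \<times> 'a. c * indicator {q. \<delta> \<le> norm (fst q - snd q)} q) \<in> borel_measurable borel"
    by (intro borel_measurable_times_ennreal borel_measurable_indicator sets_far_pairs) auto
  have [measurable]: "ball (0::'a) \<delta> \<in> sets borel" by simp
  let ?D = "\<lambda>z. \<integral>\<^sup>+x. ennreal (\<bar>u x - u (x - z)\<bar> powr p) \<partial>lborel"
  have "pair_energy p \<rho> u (\<lambda>q. c * indicator {q. \<delta> \<le> norm (fst q - snd q)} q) =
    (\<integral>\<^sup>+z. ennreal (\<rho> z) * ennreal (1 / norm z powr p) * difference_mass p (\<lambda>x. c * indicator (- ball 0 \<delta>) z) u z \<partial>lborel)"
    unfolding pair_energy_eq[OF assms(1,2) V]
    by (intro nn_integral_cong arg_cong2[where f = times] refl) (auto simp: indicator_def)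
  also have "\<dots> = (\<integral>\<^sup>+z. ennreal (\<rho> z) * ennreal (1 / norm z powr p) * (c * indicator (- ball 0 \<delta>) z * ?D z) \<partial>lborel)"
    by (intro nn_integral_cong arg_cong2[where f = times] refl nn_integral_cmult) measurable
  also have "\<dots> \<le> (\<integral>\<^sup>+z. (ennreal (\<rho> z) * ennreal (1 / norm z powr p) * indicator (- ball 0 \<delta>) z) *
      (c * (ennreal (2 * 2 powr p) * Lp_mass lborel p u)) \<partial>lborel)"
  proof (rule nn_integral_mono)
    fix z :: 'a
    have "c * ?D z \<le> c * (ennreal (2 * 2 powr p) * Lp_mass lborel p u)"
      by (intro mult_left_mono shift_difference_powr_le p) auto
    then have "(ennreal (\<rho> z) * ennreal (1 / norm z powr p) * indicator (- ball 0 \<delta>) z) * (c * ?D z) \<le>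
      (ennreal (\<rho> z) * ennreal (1 / norm z powr p) * indicator (- ball 0 \<delta>) z) * (c * (ennreal (2 * 2 powr p) * Lp_mass lborel p u))"
      by (rule mult_left_mono) simp
    then show "ennreal (\<rho> z) * ennreal (1 / norm z powr p) * (c * indicator (- ball 0 \<delta>) z * ?D z) \<le>
      (ennreal (\<rho> z) * ennreal (1 / norm z powr p) * indicator (- ball 0 \<delta>) z) * (c * (ennreal (2 * 2 powr p) * Lp_mass lborel p u))"
      by (simp only: mult_ac)
  qed
  also have "\<dots> = (\<integral>\<^sup>+z. ennreal (\<rho> z) * ennreal (1 / norm z powr p) * indicator (- ball 0 \<delta>) z \<partial>lborel) *
      (c * (ennreal (2 * 2 powr p) * Lp_mass lborel p u))"
    by (rule nn_integral_multc) measurable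
  finally show ?thesis by (simp only: mult.commute)
qed

lemma nn_integral_mono_nonzero:
  assumes "\<And>z::'a::euclidean_space. z \<noteq> 0 \<Longrightarrow> f z \<le> g z"
  shows "(\<integral>\<^sup>+z. f z \<partial>lborel) \<le> (\<integral>\<^sup>+z. g z \<partial>lborel)"
  by (rule nn_integral_mono_AE, rule AE_I[of _ _ "{0}"]) (use assms in auto)

text \<open>The difference quotient is kept in the hypothesis, so that the weights have to be
  compared only at pairs where u takes different values.\<close>

lemma pair_energy_mono_AE:
  assumes "AE q in lborel. ennreal (\<bar>u (fst q) - u (snd q)\<bar> powr p / norm (fst q - snd q) powr p) * V q
    \<le> ennreal (\<bar>u (fst q) - u (snd q)\<bar> powr p / norm (fst q - snd q) powr p) * V' q"
  shows "pair_energy p \<rho> u V \<le> pair_energy p \<rho> u V'"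
  unfolding pair_energy_def
proof (rule nn_integral_mono_AE, use assms in eventually_elim)
  fix q
  let ?a = "ennreal (\<bar>u (fst q) - u (snd q)\<bar> powr p / norm (fst q - snd q) powr p)"
  assume "?a * V q \<le> ?a * V' q"
  then have "ennreal (\<rho> (fst q - snd q)) * (?a * V q) \<le> ennreal (\<rho> (fst q - snd q)) * (?a * V' q)"
    by (rule mult_left_mono) simp
  then show "?a * ennreal (\<rho> (fst q - snd q)) * V q \<le> ?a * ennreal (\<rho> (fst q - snd q)) * V' q"
    by (simp only: mult_ac)
qed

lemma pair_energy_add:
  fixes \<rho> u :: "'a::euclidean_space \<Rightarrow> real"
  assumes [measurable]: "\<rho> \<in> borel_measurable borel" "u \<in> borel_measurable borel"
    and V: "V \<in> borel_measurable borel" "V' \<in> borel_measurable borel"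
  shows "pair_energy p \<rho> u (\<lambda>q. V q + c * V' q) = pair_energy p \<rho> u V + c * pair_energy p \<rho> u V'"
proof -
  have [measurable]: "V \<in> borel_measurable (borel \<Otimes>\<^sub>M borel)" "V' \<in> borel_measurable (borel \<Otimes>\<^sub>M borel)"
    using V by (simp_all add: borel_prod)
  let ?k = "\<lambda>q. ennreal (\<bar>u (fst q) - u (snd q)\<bar> powr p / norm (fst q - snd q) powr p) * ennreal (\<rho> (fst q - snd q))"
  have "(\<integral>\<^sup>+q. ?k q * (V q + c * V' q) \<partial>(lborel \<Otimes>\<^sub>M lborel)) = (\<integral>\<^sup>+q. ?k q * V q + c * (?k q * V' q) \<partial>(lborel \<Otimes>\<^sub>M lborel))"
    by (intro nn_integral_cong) (simp add: algebra_simps)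
  also have "\<dots> = (\<integral>\<^sup>+q. ?k q * V q \<partial>(lborel \<Otimes>\<^sub>M lborel)) + c * (\<integral>\<^sup>+q. ?k q * V' q \<partial>(lborel \<Otimes>\<^sub>M lborel))"
    by (subst nn_integral_add, measurable, subst nn_integral_cmult) measurable
  finally show ?thesis unfolding pair_energy_def lborel_prod .
qed

lemma admissible_weightsD:
  fixes ws :: "nat \<Rightarrow> 'a::euclidean_space \<times> 'a \<Rightarrow> real"
  assumes w: "admissible_weights ws w"
  shows "ws k \<in> borel_measurable borel" "AE z in lborel. 0 \<le> ws k z" "continuous_on UNIV w" "0 \<le> w z"
    "0 < e \<Longrightarrow> eventually (\<lambda>k. AE z in lborel. \<bar>ws k z - w z\<bar> \<le> e) sequentially"
    "0 < e \<Longrightarrow> \<exists>d>0. \<forall>x x' y y'. norm (x - x') + norm (y - y') < d \<longrightarrow> \<bar>w (x, y) - w (x', y')\<bar> \<le> e"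
    "\<exists>W>0. \<forall>z. w z \<le> W"
proof -
  show D: "ws k \<in> borel_measurable borel" "AE z in lborel. 0 \<le> ws k z" "continuous_on UNIV w" for k
    using w by (auto simp: admissible_weights_def)
  show "0 \<le> w z" using w by (cases z) (auto simp: admissible_weights_def)
  show "eventually (\<lambda>k. AE z in lborel. \<bar>ws k z - w z\<bar> \<le> e) sequentially" if e: "0 < e"
  proof -
    have "(\<lambda>k. Linf_norm lborel (\<lambda>z. ws k z - w z)) \<longlonglongrightarrow> 0" using w by (simp add: admissible_weights_def)
    then have "eventually (\<lambda>k. Linf_norm lborel (\<lambda>z. ws k z - w z) < ereal e) sequentially"
      by (rule order_tendstoD) (use e in simp)
    then show ?thesis
    proof eventually_elim
      case (elim k)
      have [measurable]: "ws k \<in> borel_measurable borel" "w \<in> borel_measurable borel"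
        using D by (auto intro: borel_measurable_continuous_onI)
      have "AE z in lborel. ereal \<bar>ws k z - w z\<bar> \<le> Linf_norm lborel (\<lambda>z. ws k z - w z)"
        unfolding Linf_norm_def by (rule esssup_AE)
      then show ?case
      proof eventually_elim
        case (elim z)
        have "ereal \<bar>ws k z - w z\<bar> \<le> ereal e"
          using order_trans[OF elim less_imp_le[OF \<open>Linf_norm lborel (\<lambda>z. ws k z - w z) < ereal e\<close>]] .
        then show ?case by simp
      qed
    qed
  qed
  show "\<exists>d>0. \<forall>x x' y y'. norm (x - x') + norm (y - y') < d \<longrightarrow> \<bar>w (x, y) - w (x', y')\<bar> \<le> e" if e: "0 < e"
  proof -
    obtain \<omega> :: "real \<Rightarrow> real" where \<omega>: "\<omega> 0 = 0" "(\<omega> \<longlongrightarrow> 0) (at_right 0)"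
      "\<And>x x' y y'. \<bar>w (x, y) - w (x', y')\<bar> \<le> \<omega> (norm (x - x') + norm (y - y'))"
      using w by (auto simp: admissible_weights_def)
    have "eventually (\<lambda>t. \<omega> t < e) (at_right 0)" by (rule order_tendstoD[OF \<omega>(2)]) (use e in simp)
    then obtain d where d: "0 < d" "\<And>t. 0 < t \<Longrightarrow> t < d \<Longrightarrow> \<omega> t < e" by (auto simp: eventually_at_right_field)
    show ?thesis
    proof (intro exI[of _ d] conjI allI impI)
      fix x x' y y' :: 'a assume lt: "norm (x - x') + norm (y - y') < d"
      have "\<omega> (norm (x - x') + norm (y - y')) \<le> e"
      proof (cases "norm (x - x') + norm (y - y') = 0")
        case True then show ?thesis using \<omega>(1) e by (simp only: less_imp_le)
      next
        case False
        then have "0 < norm (x - x') + norm (y - y')" by (simp add: less_le add_nonneg_nonneg)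
        then show ?thesis using d(2)[OF _ lt] by simp
      qed
      then show "\<bar>w (x, y) - w (x', y')\<bar> \<le> e" using \<omega>(3)[of x y x' y'] by linarith
    qed (rule d(1))
  qed
  show "\<exists>W>0. \<forall>z. w z \<le> W"
  proof -
    have "bounded (range w)" using w by (simp add: admissible_weights_def)
    then obtain B where "\<And>z. norm (w z) \<le> B" by (auto simp: bounded_iff)
    then show ?thesis by (intro exI[of _ "\<bar>B\<bar> + 1"]) (auto simp: abs_le_iff intro: order_trans[of _ B])
  qed
qed

lemma measurable_finite_sphere:
  assumes "finite_sphere_measure \<mu>" "continuous_on UNIV \<phi>"
  shows "(\<lambda>\<sigma>. ennreal (\<phi> \<sigma>)) \<in> borel_measurable \<mu>"
  using borel_measurable_integrable[OF continuous_integrable_finite_sphere[OF assms]] by measurable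

lemma directional_integral_scale:
  fixes \<tau> :: "'b \<Rightarrow> 'a::euclidean_space"
  assumes [measurable]: "\<tau> \<in> borel_measurable M" "f \<in> borel_measurable M" and p: "0 < p" and z: "z \<noteq> 0"
  shows "ennreal (1 / norm z powr p) * (\<integral>\<^sup>+y. f y * ennreal (\<bar>\<tau> y \<bullet> z\<bar> powr p) \<partial>M) = (\<integral>\<^sup>+y. f y * ennreal (\<bar>\<tau> y \<bullet> sgn z\<bar> powr p) \<partial>M)"
proof -
  have "ennreal (1 / norm z powr p) * (\<integral>\<^sup>+y. f y * ennreal (\<bar>\<tau> y \<bullet> z\<bar> powr p) \<partial>M) =
    (\<integral>\<^sup>+y. ennreal (1 / norm z powr p) * (f y * ennreal (\<bar>\<tau> y \<bullet> z\<bar> powr p)) \<partial>M)"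
    by (rule nn_integral_cmult[symmetric]) measurable
  also have "\<dots> = (\<integral>\<^sup>+y. f y * ennreal (\<bar>\<tau> y \<bullet> sgn z\<bar> powr p) \<partial>M)"
  proof (rule nn_integral_cong)
    fix y
    have "\<bar>\<tau> y \<bullet> sgn z\<bar> = \<bar>\<tau> y \<bullet> z\<bar> / norm z" using z by (simp add: sgn_div_norm abs_mult divide_inverse mult.commute)
    then have "\<bar>\<tau> y \<bullet> sgn z\<bar> powr p = 1 / norm z powr p * \<bar>\<tau> y \<bullet> z\<bar> powr p" by (simp add: powr_divide)
    then have "ennreal (\<bar>\<tau> y \<bullet> sgn z\<bar> powr p) = ennreal (1 / norm z powr p) * ennreal (\<bar>\<tau> y \<bullet> z\<bar> powr p)"
      by (simp only: ennreal_mult' zero_le_divide_1_iff powr_ge_zero)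
    then show "ennreal (1 / norm z powr p) * (f y * ennreal (\<bar>\<tau> y \<bullet> z\<bar> powr p)) = f y * ennreal (\<bar>\<tau> y \<bullet> sgn z\<bar> powr p)"
      by (simp only: mult_ac)
  qed
  finally show ?thesis .
qed

section \<open>The upper bound\<close>

lemma energy_limsup:
  fixes \<rho> :: "nat \<Rightarrow> 'a::euclidean_space \<Rightarrow> real"
  assumes p: "1 \<le> p" and \<rho>: "admissible_kernels p \<rho>" and \<mu>: "limit_directional_measure \<rho> \<mu>"
    and w: "admissible_weights ws w" and u: "u \<in> S_space p"
  shows "limsup (\<lambda>k. energy p (\<rho> k) (ws k) u) \<le> limit_energy p \<mu> w u"
proof -
  note W = admissible_weightsD[OF w] and K = admissible_kernelsD[OF \<rho>]
  have p0: "0 < p" using p by simp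
  have f\<mu>: "finite_sphere_measure \<mu>" using \<mu> by (simp add: limit_directional_measure_def)
  obtain Wm where Wm: "0 < Wm" "\<And>z. w z \<le> Wm" using W(7) by blast
  have wb: "w \<in> borel_measurable borel" using W(3) by (rule borel_measurable_continuous_onI)
  have [measurable]: "w \<in> borel_measurable (borel \<Otimes>\<^sub>M borel)" using wb by (simp add: borel_prod)
  define w0 where "w0 x = w (x, x)" for x
  have [measurable]: "w0 \<in> borel_measurable borel" unfolding w0_def by measurable
  have w00: "0 \<le> w0 x" "w0 x \<le> Wm" for x using W(4) Wm(2) by (auto simp: w0_def)
  obtain m \<tau> where rep: "gradient_rep p u m \<tau>" and
    dir: "\<And>w0 \<sigma>. w0 \<in> borel_measurable borel \<Longrightarrow> directional_seminorm_pow p w0 u \<sigma> = (\<integral>\<^sup>+x. ennreal (w0 x * \<bar>\<sigma> \<bullet> \<tau> x\<bar> powr p) \<partial>m)"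
    using S_space_gradient_rep[OF p u] by metis
  note D = gradient_repD[OF rep]
  note [measurable_cong] = D(3)
  note [measurable] = K(1) D(7)
  have mu[measurable]: "u \<in> borel_measurable borel" using D(6) by (simp add: loc_integrable_def)
  have fin: "(\<integral>\<^sup>+y. ennreal (norm (\<tau> y) powr p) \<partial>m) < \<infinity>" using rep by (simp add: gradient_rep_def)
  define \<Phi> where "\<Phi> f \<sigma> = directional_mass m p f \<tau> \<sigma>" for f :: "'a \<Rightarrow> real" and \<sigma>
  have real: "\<exists>\<phi>. continuous_on UNIV \<phi> \<and> (\<forall>\<sigma>. 0 \<le> \<phi> \<sigma>) \<and> (\<forall>\<sigma>. ennreal (\<phi> \<sigma>) = \<Phi> f \<sigma>)"
    if [measurable]: "f \<in> borel_measurable borel" and f: "\<And>x. 0 \<le> f x" "\<And>x. f x \<le> B" for f B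
  proof -
    have "f \<in> borel_measurable m" by measurable
    from continuous_directional_integral[OF D(7) this f p0 fin]
    show ?thesis unfolding \<Phi>_def by (intro exI[of _ "\<lambda>\<sigma>. LINT y|m. f y * \<bar>\<tau> y \<bullet> \<sigma>\<bar> powr p"]) auto
  qed
  have lim_eq: "limit_energy p \<mu> w u = (\<integral>\<^sup>+\<sigma>. \<Phi> w0 \<sigma> \<partial>\<mu>)"
  proof -
    have "directional_seminorm_pow p w0 u \<sigma> = \<Phi> w0 \<sigma>" for \<sigma>
      using dir[of w0 \<sigma>] w00 by (simp add: \<Phi>_def ennreal_mult inner_commute)
    then have "directional_seminorm_pow p w0 u = \<Phi> w0" by (intro ext)
    moreover have "(\<lambda>x. w (x, x)) = w0" by (simp add: w0_def fun_eq_iff)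
    ultimately show ?thesis using u unfolding limit_energy_def by simp
  qed
  have fin1: "(\<integral>\<^sup>+\<sigma>. \<Phi> (\<lambda>_. 1) \<sigma> \<partial>\<mu>) < \<infinity>"
  proof -
    obtain \<phi> where \<phi>: "continuous_on UNIV \<phi>" "\<forall>\<sigma>. 0 \<le> \<phi> \<sigma>" "\<forall>\<sigma>. ennreal (\<phi> \<sigma>) = \<Phi> (\<lambda>_. 1) \<sigma>"
      using real[of "\<lambda>_. 1" 1] by auto
    have "(\<integral>\<^sup>+\<sigma>. ennreal (\<phi> \<sigma>) \<partial>\<mu>) = ennreal (LINT \<sigma>|\<mu>. \<phi> \<sigma>)"
      using \<phi>(2) by (intro nn_integral_eq_integral continuous_integrable_finite_sphere[OF f\<mu> \<phi>(1)]) auto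
    then show ?thesis using \<phi>(3) by simp
  qed
  define N where "N = enn2real (\<integral>\<^sup>+\<sigma>. \<Phi> (\<lambda>_. 1) \<sigma> \<partial>\<mu>)"
  have N: "(\<integral>\<^sup>+\<sigma>. \<Phi> (\<lambda>_. 1) \<sigma> \<partial>\<mu>) = ennreal N" "0 \<le> N" using fin1 by (auto simp: N_def less_top)
  define U where "U = enn2real (Lp_mass lborel p u)"
  have U: "Lp_mass lborel p u = ennreal U" "0 \<le> U"
    using Lp_nn_integral_finite[OF D(2)] by (auto simp: U_def less_top)
  obtain \<delta>0 where \<delta>0: "0 < \<delta>0" and dlim:
    "\<forall>\<phi> :: 'a \<Rightarrow> real. continuous_on UNIV \<phi> \<and> (\<forall>x. 0 \<le> \<phi> x) \<longrightarrow> (\<exists>I :: real \<Rightarrow> ennreal.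
      (\<forall>\<delta>. 0 < \<delta> \<and> \<delta> < \<delta>0 \<longrightarrow>
        (\<lambda>k. sgn_mass (\<rho> k) \<delta> \<phi>) \<longlonglongrightarrow> I \<delta>)
      \<and> (I \<longlongrightarrow> (\<integral>\<^sup>+\<sigma>. ennreal (\<phi> \<sigma>) \<partial>\<mu>)) (at_right 0))"
    by (rule directional_measure_tendsto[OF \<rho> \<mu>]) (rule that)
  \<comment> \<open>The three e in the weight stand for the distance of \<open>ws k\<close> to w,
    the oscillation of w between the pair and a point of its segment, and the mollification inside
    \<open>difference_integral_le\<close>. The last e pays for |z| \<ge> \<delta>.\<close>
  have main: "limsup (\<lambda>k. energy p (\<rho> k) (ws k) u) \<le> (\<integral>\<^sup>+\<sigma>. \<Phi> (\<lambda>y. w0 y + 3 * e) \<sigma> \<partial>\<mu>) + ennreal e" if e: "0 < e" for e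
  proof -
    obtain d where d: "0 < d" "\<And>x x' y y'. norm (x - x') + norm (y - y') < d \<Longrightarrow> \<bar>w (x, y) - w (x', y')\<bar> \<le> e"
      using W(6)[OF e] by blast
    obtain \<phi> where \<phi>: "continuous_on UNIV \<phi>" "\<And>\<sigma>. 0 \<le> \<phi> \<sigma>" "\<And>\<sigma>. ennreal (\<phi> \<sigma>) = \<Phi> (\<lambda>y. w0 y + 3 * e) \<sigma>"
      using real[of "\<lambda>y. w0 y + 3 * e" "Wm + 3 * e"] w00 e by (auto simp: add_nonneg_nonneg)
    obtain I where I: "\<And>\<delta>. 0 < \<delta> \<Longrightarrow> \<delta> < \<delta>0 \<Longrightarrow>
        (\<lambda>k. sgn_mass (\<rho> k) \<delta> \<phi>) \<longlonglongrightarrow> I \<delta>"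
      "(I \<longlongrightarrow> (\<integral>\<^sup>+\<sigma>. ennreal (\<phi> \<sigma>) \<partial>\<mu>)) (at_right 0)"
      using dlim \<phi>(1,2) by blast
    have near: "ennreal (1 / norm z powr p) * difference_mass p (\<lambda>x. ennreal (w (x, x - z) + e)) u z \<le> ennreal (\<phi> (sgn z))"
      if z: "norm z < d" "z \<noteq> 0" for z
    proof -
      have "difference_mass p (\<lambda>x. ennreal (w (x, x - z) + e)) u z \<le>
        directional_mass m p (\<lambda>y. w0 y + 3 * e) \<tau> z"
      proof (rule difference_integral_le[OF rep, where ?w1.0 = "\<lambda>y. w0 y + 2 * e" and d = "d / 2"])
        show "w (x, x - z) + e \<le> w0 (x - t *\<^sub>R z) + 2 * e" if "0 \<le> t" "t \<le> 1" for x t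
        proof -
          have "x - z - (x - t *\<^sub>R z) = - ((1 - t) *\<^sub>R z)" by (simp add: algebra_simps)
          then have "norm (x - z - (x - t *\<^sub>R z)) = (1 - t) * norm z" using that by simp
          then have "norm (x - (x - t *\<^sub>R z)) + norm (x - z - (x - t *\<^sub>R z)) = norm z"
            using that by (simp add: left_diff_distrib)
          then have "\<bar>w (x, x - z) - w (x - t *\<^sub>R z, x - t *\<^sub>R z)\<bar> \<le> e" using z by (intro d(2)) simp
          then show ?thesis by (simp add: w0_def)
        qed
        \<comment> \<open>Both arguments of w move by x - y, hence half of d.\<close>
        show "w0 x + 2 * e \<le> w0 y + 3 * e" if "norm (x - y) < d / 2" for x y
          using d(2)[of x y x y] that by (simp add: w0_def)
      qed (use w00 e d in \<open>auto intro: add_nonneg_nonneg\<close>)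
      then have "ennreal (1 / norm z powr p) * difference_mass p (\<lambda>x. ennreal (w (x, x - z) + e)) u z \<le>
        ennreal (1 / norm z powr p) * directional_mass m p (\<lambda>y. w0 y + 3 * e) \<tau> z"
        by (rule mult_left_mono) simp
      also have "\<dots> = ennreal (\<phi> (sgn z))" unfolding \<phi>(3) \<Phi>_def
        by (rule directional_integral_scale) (use p0 z in auto)
      finally show ?thesis .
    qed
    have \<delta>: "limsup (\<lambda>k. energy p (\<rho> k) (ws k) u) \<le> I \<delta> + ennreal e" if \<delta>: "0 < \<delta>" "\<delta> < min \<delta>0 d" for \<delta>
    proof -
      define c where "c = Wm + e"
      \<comment> \<open>T bounds the far energy divided by the kernel tail. For large k the tail is
        at most e / (T + 1), so the far energy is at most e.\<close>
      define T where "T = c * (2 * 2 powr p * U)"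
      have T: "0 \<le> T" using Wm e U by (simp add: T_def c_def)
      have "0 < e / (T + 1)" using T e by simp
      from kernel_tail_small[OF p \<rho> \<delta>(1) this] W(5)[OF e]
      have "eventually (\<lambda>k. energy p (\<rho> k) (ws k) u \<le>
        sgn_mass (\<rho> k) \<delta> \<phi> + ennreal e) sequentially"
      proof eventually_elim
        case (elim k)
        let ?n = "\<lambda>q :: 'a \<times> 'a. ennreal (w q + e) * indicator {q. norm (fst q - snd q) < \<delta>} q"
        let ?f = "\<lambda>q :: 'a \<times> 'a. ennreal c * indicator {q. \<delta> \<le> norm (fst q - snd q)} q"
        have mn: "?n \<in> borel_measurable borel" and mf: "(indicator {q :: 'a \<times> 'a. \<delta> \<le> norm (fst q - snd q)} :: _ \<Rightarrow> ennreal) \<in> borel_measurable borel"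
          using wb by (auto intro!: borel_measurable_times_ennreal borel_measurable_indicator sets_near_pairs sets_far_pairs
            measurable_compose[OF _ measurable_ennreal])
        have [measurable]: "ball (0::'a) \<delta> \<in> sets borel" by simp
        have "energy p (\<rho> k) (ws k) u = pair_energy p (\<rho> k) u (\<lambda>q. ennreal (ws k q))"
          by (rule energy_eq_pair_energy) (use K W mu in auto)
        also have "\<dots> \<le> pair_energy p (\<rho> k) u (\<lambda>q. ?n q + ennreal c * indicator {q. \<delta> \<le> norm (fst q - snd q)} q)"
        proof (rule pair_energy_mono_AE, use elim(2) in eventually_elim)
          fix q :: "'a \<times> 'a" assume "\<bar>ws k q - w q\<bar> \<le> e"
          then have "ennreal (ws k q) \<le> ennreal (w q + e)" "ennreal (ws k q) \<le> ennreal c"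
            using Wm(2)[of q] by (auto simp: c_def intro!: ennreal_leI)
          then have "ennreal (ws k q) \<le> ?n q + ?f q" by (auto simp: indicator_def)
          then show "ennreal (\<bar>u (fst q) - u (snd q)\<bar> powr p / norm (fst q - snd q) powr p) * ennreal (ws k q) \<le>
            ennreal (\<bar>u (fst q) - u (snd q)\<bar> powr p / norm (fst q - snd q) powr p) * (?n q + ?f q)"
            by (rule mult_left_mono) simp
        qed
        also have "\<dots> = pair_energy p (\<rho> k) u ?n + ennreal c * pair_energy p (\<rho> k) u (indicator {q. \<delta> \<le> norm (fst q - snd q)})"
          by (rule pair_energy_add[OF K(1) mu mn mf])
        also have "ennreal c * pair_energy p (\<rho> k) u (indicator {q. \<delta> \<le> norm (fst q - snd q)}) \<le>
          ennreal c * (ennreal (2 * 2 powr p) * ennreal U * ennreal (e / (T + 1)))"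
        proof (rule mult_left_mono)
          have "pair_energy p (\<rho> k) u (\<lambda>q. 1 * indicator {q. \<delta> \<le> norm (fst q - snd q)} q) \<le>
            1 * (ennreal (2 * 2 powr p) * ennreal U) * (\<integral>\<^sup>+z. ennreal (\<rho> k z) * ennreal (1 / norm z powr p) * indicator (- ball 0 \<delta>) z \<partial>lborel)"
            using pair_energy_far_le[OF K(1) mu p0, of k 1 \<delta>] unfolding U(1) .
          also have "\<dots> \<le> 1 * (ennreal (2 * 2 powr p) * ennreal U) * ennreal (e / (T + 1))"
            by (rule mult_left_mono[OF elim(1)]) simp
          finally show "pair_energy p (\<rho> k) u (indicator {q. \<delta> \<le> norm (fst q - snd q)}) \<le> ennreal (2 * 2 powr p) * ennreal U * ennreal (e / (T + 1))"
            by simp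
        qed simp
        also have "ennreal c * (ennreal (2 * 2 powr p) * ennreal U * ennreal (e / (T + 1))) \<le> ennreal e"
        proof -
          have "0 \<le> c" using Wm e by (simp add: c_def)
          then have "ennreal c * (ennreal (2 * 2 powr p) * ennreal U * ennreal (e / (T + 1))) = ennreal (T * (e / (T + 1)))"
            using e U T by (simp add: T_def ennreal_mult[symmetric] mult.assoc del: ennreal_plus)
          also have "\<dots> \<le> ennreal e" using T e by (intro ennreal_leI) (simp add: divide_le_eq algebra_simps)
          finally show ?thesis .
        qed
        also have "pair_energy p (\<rho> k) u ?n \<le> sgn_mass (\<rho> k) \<delta> \<phi>"
          unfolding pair_energy_eq[OF K(1) mu mn]
        proof (rule nn_integral_mono_nonzero)
            fix z :: 'a assume z: "z \<noteq> 0"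
            show "ennreal (\<rho> k z) * ennreal (1 / norm z powr p) * difference_mass p (\<lambda>x. ?n (x, x - z)) u z
              \<le> ennreal (\<rho> k z) * ennreal (\<phi> (sgn z)) * indicator (ball 0 \<delta>) z"
            proof (cases "norm z < \<delta>")
              case True
              then have "difference_mass p (\<lambda>x. ?n (x, x - z)) u z =
                difference_mass p (\<lambda>x. ennreal (w (x, x - z) + e)) u z" by simp
              moreover have "ennreal (\<rho> k z) * (ennreal (1 / norm z powr p) * difference_mass p (\<lambda>x. ennreal (w (x, x - z) + e)) u z)
                \<le> ennreal (\<rho> k z) * ennreal (\<phi> (sgn z))"
                using True \<delta> z by (intro mult_left_mono near) auto
              ultimately show ?thesis using True by (simp add: mult.assoc)
            qed simp
        qed
        finally show ?case by (simp add: add_right_mono add_left_mono ennreal_leI)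
      qed
      then have "limsup (\<lambda>k. energy p (\<rho> k) (ws k) u) \<le>
        limsup (\<lambda>k. sgn_mass (\<rho> k) \<delta> \<phi> + ennreal e)"
        by (rule Limsup_mono)
      also have "\<dots> = I \<delta> + ennreal e"
        using \<delta> by (intro lim_imp_Limsup tendsto_add I tendsto_const) auto
      finally show ?thesis .
    qed
    have "((\<lambda>\<delta>. I \<delta> + ennreal e) \<longlongrightarrow> (\<integral>\<^sup>+\<sigma>. ennreal (\<phi> \<sigma>) \<partial>\<mu>) + ennreal e) (at_right 0)"
      by (intro tendsto_add I tendsto_const)
    moreover have "eventually (\<lambda>\<delta>. limsup (\<lambda>k. energy p (\<rho> k) (ws k) u) \<le> I \<delta> + ennreal e) (at_right 0)"
      using \<delta> \<delta>0 d(1) by (auto simp: eventually_at_right_field intro!: exI[of _ "min \<delta>0 d"])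
    ultimately have "limsup (\<lambda>k. energy p (\<rho> k) (ws k) u) \<le> (\<integral>\<^sup>+\<sigma>. ennreal (\<phi> \<sigma>) \<partial>\<mu>) + ennreal e"
      by (rule tendsto_lowerbound) simp
    then show ?thesis by (simp add: \<phi>(3))
  qed
  show ?thesis
    unfolding lim_eq
  proof (rule ennreal_le_epsilon)
    fix \<epsilon> :: real assume \<epsilon>: "0 < \<epsilon>"
    \<comment> \<open>The total error is three times e N, from the enlarged weight, plus e from the
      far pairs; this choice makes it equal to \<epsilon>.\<close>
    define e where "e = \<epsilon> / (3 * N + 1)"
    have e: "0 < e" using \<epsilon> N by (simp add: e_def add_nonneg_pos)
    obtain \<phi>0 where \<phi>0: "continuous_on UNIV \<phi>0" "\<And>\<sigma>. ennreal (\<phi>0 \<sigma>) = \<Phi> w0 \<sigma>" using real[of w0 Wm] w00 by auto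
    obtain \<phi>1 where \<phi>1: "continuous_on UNIV \<phi>1" "\<And>\<sigma>. ennreal (\<phi>1 \<sigma>) = \<Phi> (\<lambda>_. 1) \<sigma>" using real[of "\<lambda>_. 1" 1] by auto
    have "\<Phi> (\<lambda>y. w0 y + 3 * e) \<sigma> = ennreal (\<phi>0 \<sigma>) + ennreal (3 * e) * ennreal (\<phi>1 \<sigma>)" for \<sigma>
    proof -
      have "\<Phi> (\<lambda>y. w0 y + 3 * e) \<sigma> = (\<integral>\<^sup>+y. ennreal (w0 y) * ennreal (\<bar>\<tau> y \<bullet> \<sigma>\<bar> powr p) + ennreal (3 * e) * (ennreal 1 * ennreal (\<bar>\<tau> y \<bullet> \<sigma>\<bar> powr p)) \<partial>m)"
        unfolding \<Phi>_def using w00 e by (intro nn_integral_cong) (simp add: distrib_right)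
      also have "\<dots> = \<Phi> w0 \<sigma> + ennreal (3 * e) * \<Phi> (\<lambda>_. 1) \<sigma>"
        unfolding \<Phi>_def by (subst nn_integral_add, measurable, subst nn_integral_cmult) measurable
      finally show ?thesis by (simp only: \<phi>0(2) \<phi>1(2))
    qed
    then have "(\<integral>\<^sup>+\<sigma>. \<Phi> (\<lambda>y. w0 y + 3 * e) \<sigma> \<partial>\<mu>) = (\<integral>\<^sup>+\<sigma>. ennreal (\<phi>0 \<sigma>) + ennreal (3 * e) * ennreal (\<phi>1 \<sigma>) \<partial>\<mu>)" by simp
    also have "\<dots> = (\<integral>\<^sup>+\<sigma>. \<Phi> w0 \<sigma> \<partial>\<mu>) + ennreal (3 * e) * ennreal N"
    proof -
      note [measurable] = measurable_finite_sphere[OF f\<mu> \<phi>0(1)] measurable_finite_sphere[OF f\<mu> \<phi>1(1)]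
      have "(\<integral>\<^sup>+\<sigma>. ennreal (\<phi>0 \<sigma>) + ennreal (3 * e) * ennreal (\<phi>1 \<sigma>) \<partial>\<mu>) =
        (\<integral>\<^sup>+\<sigma>. ennreal (\<phi>0 \<sigma>) \<partial>\<mu>) + ennreal (3 * e) * (\<integral>\<^sup>+\<sigma>. ennreal (\<phi>1 \<sigma>) \<partial>\<mu>)"
        by (subst nn_integral_add, measurable, subst nn_integral_cmult) measurable
      then show ?thesis unfolding \<phi>0(2) \<phi>1(2) N(1) .
    qed
    finally have "limsup (\<lambda>k. energy p (\<rho> k) (ws k) u) \<le> (\<integral>\<^sup>+\<sigma>. \<Phi> w0 \<sigma> \<partial>\<mu>) + ennreal (3 * e) * ennreal N + ennreal e"
      using main[OF e] by simp
    also have "\<dots> = (\<integral>\<^sup>+\<sigma>. \<Phi> w0 \<sigma> \<partial>\<mu>) + ennreal (3 * e * N + e)"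
      using e N(2) by (simp add: ennreal_mult[symmetric] add.assoc ennreal_plus[symmetric] del: ennreal_plus)
    also have "3 * e * N + e = e * (3 * N + 1)" by (simp add: algebra_simps)
    also have "e * (3 * N + 1) = \<epsilon>" using N(2) by (simp add: e_def add_nonneg_eq_0_iff)
    finally show "limsup (\<lambda>k. energy p (\<rho> k) (ws k) u) \<le> (\<integral>\<^sup>+\<sigma>. \<Phi> w0 \<sigma> \<partial>\<mu>) + ennreal \<epsilon>" .
  qed
qed

section \<open>Convergence in Lebesgue spaces\<close>

lemma Lp_diff:
  assumes p: "0 < p" and u: "u \<in> Lp M p" and v: "v \<in> Lp M p"
  shows "(\<lambda>x. u x - v x) \<in> Lp M p"
proof -
  have [measurable]: "u \<in> borel_measurable M" "v \<in> borel_measurable M" using u v by (auto simp: Lp_def)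
  have "integrable M (\<lambda>x. 2 powr p * (\<bar>u x\<bar> powr p + \<bar>v x\<bar> powr p))" using u v by (simp add: Lp_def)
  then have "integrable M (\<lambda>x. \<bar>u x - v x\<bar> powr p)"
    by (rule Bochner_Integration.integrable_bound) (use powr_abs_diff_le[OF p] in \<open>auto intro!: AE_I2\<close>)
  then show ?thesis by (simp add: Lp_def)
qed

lemma Lp_conv_nn_integral:
  assumes p: "0 < p"
  shows "Lp_conv M p u v \<longleftrightarrow> (\<forall>k. u k \<in> Lp M p) \<and> v \<in> Lp M p
    \<and> (\<lambda>k. \<integral>\<^sup>+x. ennreal (\<bar>u k x - v x\<bar> powr p) \<partial>M) \<longlonglongrightarrow> 0"
proof -
  have "(\<lambda>k. Lp_norm M p (\<lambda>x. u k x - v x)) \<longlonglongrightarrow> 0 \<longleftrightarrow> (\<lambda>k. \<integral>\<^sup>+x. ennreal (\<bar>u k x - v x\<bar> powr p) \<partial>M) \<longlonglongrightarrow> 0"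
    if uv: "\<And>k. u k \<in> Lp M p" "v \<in> Lp M p"
  proof -
    define I where "I k = (LINT x|M. \<bar>u k x - v x\<bar> powr p)" for k
    have I0: "0 \<le> I k" for k by (simp add: I_def)
    have i: "integrable M (\<lambda>x. \<bar>u k x - v x\<bar> powr p)" for k
      using Lp_diff[OF p uv(1) uv(2)] by (simp add: Lp_def)
    have e: "Lp_mass M p (\<lambda>x. u k x - v x) = ennreal (I k)" for k
      unfolding I_def using i by (intro nn_integral_eq_integral) auto
    have "(\<lambda>k. I k powr (1 / p)) \<longlonglongrightarrow> 0 \<longleftrightarrow> I \<longlonglongrightarrow> 0"
    proof
      assume "(\<lambda>k. I k powr (1 / p)) \<longlonglongrightarrow> 0"
      then have "(\<lambda>k. (I k powr (1 / p)) powr p) \<longlonglongrightarrow> 0 powr p"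
        using p by (intro tendsto_powr') auto
      then show "I \<longlonglongrightarrow> 0" using p I0 by (simp add: powr_powr)
    next
      assume "I \<longlonglongrightarrow> 0"
      then have "(\<lambda>k. I k powr (1 / p)) \<longlonglongrightarrow> 0 powr (1 / p)"
        using p I0 by (intro tendsto_powr') auto
      then show "(\<lambda>k. I k powr (1 / p)) \<longlonglongrightarrow> 0" by simp
    qed
    also have "I \<longlonglongrightarrow> 0 \<longleftrightarrow> (\<lambda>k. ennreal (I k)) \<longlonglongrightarrow> ennreal 0"
      using I0 by (intro tendsto_ennreal_iff[symmetric]) auto
    finally show ?thesis unfolding Lp_norm_def e I_def[symmetric] by simp
  qed
  then show ?thesis unfolding Lp_conv_def by blast
qed

lemma Lp_restrict:
  assumes "u \<in> Lp lborel p" and E: "E \<in> sets borel"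
  shows "u \<in> Lp (restrict_space lborel E) p"
  using assms integrable_mult_indicator[of E lborel "\<lambda>x. \<bar>u x\<bar> powr p"] unfolding Lp_def
  by (auto intro!: measurable_restrict_space1 simp: integrable_restrict_space)

lemma Lp_conv_restrict:
  assumes p: "0 < p" and conv: "Lp_conv lborel p u v" and E: "E \<in> sets borel"
  shows "Lp_conv (restrict_space lborel E) p u v"
proof -
  have c: "\<forall>k. u k \<in> Lp lborel p" "v \<in> Lp lborel p" "(\<lambda>k. \<integral>\<^sup>+x. ennreal (\<bar>u k x - v x\<bar> powr p) \<partial>lborel) \<longlonglongrightarrow> 0"
    using conv by (auto simp: Lp_conv_nn_integral[OF p])
  have "(\<lambda>k. \<integral>\<^sup>+x. ennreal (\<bar>u k x - v x\<bar> powr p) \<partial>restrict_space lborel E) \<longlonglongrightarrow> 0"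
  proof (rule tendsto_sandwich[OF _ _ tendsto_const c(3)])
    show "eventually (\<lambda>k. Lp_mass (restrict_space lborel E) p (\<lambda>x. u k x - v x) \<le> Lp_mass lborel p (\<lambda>x. u k x - v x)) sequentially"
      using E by (intro always_eventually allI) (subst nn_integral_restrict_space, auto intro!: nn_integral_mono simp: indicator_def)
  qed auto
  then show ?thesis using c E by (auto simp: Lp_conv_nn_integral[OF p] intro: Lp_restrict)
qed

lemma Lp_conv_subseq:
  assumes "Lp_conv M p u v" "strict_mono (r :: nat \<Rightarrow> nat)"
  shows "Lp_conv M p (u \<circ> r) v"
  using assms LIMSEQ_subseq_LIMSEQ[of "\<lambda>k. Lp_norm M p (\<lambda>x. u k x - v x)" 0 r]
  by (auto simp: Lp_conv_def o_def)

lemma zero_in_Lp: "0 < p \<Longrightarrow> (\<lambda>_. 0) \<in> Lp M p"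
  by (simp add: Lp_def)

text \<open>Strong compactness requires a bound for all indices, while the energies are controlled
  only for those in A. Outside A the functions are replaced by 0; along the part of the subsequence
  that runs in A nothing has changed, and the limit is the same.\<close>

lemma limit_in_S_space:
  fixes u :: "nat \<Rightarrow> 'a::euclidean_space \<Rightarrow> real"
  assumes p: "1 \<le> p" and sc: "strongly_p_compact p \<rho>" and u: "\<And>k. u k \<in> Lp lborel p"
    and A: "\<And>k. k \<in> A \<Longrightarrow> ennreal (Lp_norm lborel p (u k)) + energy p (\<rho> k) (\<lambda>_. 1) (u k) \<le> ennreal C"
    and conv: "Lp_conv lborel p (u \<circ> r) v" and r: "strict_mono r" and inf: "infinite {j. r j \<in> A}"
  shows "v \<in> S_space p"
proof -
  have p0: "0 < p" using p by simp
  define u' where "u' k = (if k \<in> A then u k else (\<lambda>_. 0))" for k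
  define s where "s = enumerate {j. r j \<in> A}"
  have s: "strict_mono s" "\<And>j. r (s j) \<in> A"
    using strict_mono_enumerate[OF inf] enumerate_in_set[OF inf] by (auto simp: s_def)
  have "u' k \<in> Lp lborel p" for k by (simp add: u'_def u zero_in_Lp[OF p0])
  moreover have "energy_bounded p \<rho> (\<lambda>_ _. 1) u'"
  proof -
    have "(SUP k. ennreal (Lp_norm lborel p (u' k)) + energy p (\<rho> k) (\<lambda>_. 1) (u' k)) \<le> ennreal C"
    proof (rule SUP_least)
      fix k show "ennreal (Lp_norm lborel p (u' k)) + energy p (\<rho> k) (\<lambda>_. 1) (u' k) \<le> ennreal C"
        using A p0 by (cases "k \<in> A") (simp_all add: u'_def Lp_norm_def energy_def)
    qed
    then show ?thesis unfolding energy_bounded_def by (rule le_less_trans) simp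
  qed
  moreover have "Lp_loc_conv p (u' \<circ> (r \<circ> s)) v"
  proof -
    have "u' \<circ> (r \<circ> s) = (u \<circ> r) \<circ> s" using s(2) by (auto simp: u'_def fun_eq_iff)
    then show ?thesis
      unfolding Lp_loc_conv_def using Lp_conv_subseq[OF conv s(1)]
      by (auto intro!: Lp_conv_restrict[OF p0] borel_compact)
  qed
  moreover have "strict_mono (r \<circ> s)" using r s(1) by (rule strict_mono_o)
  moreover have "\<forall>u. (\<forall>k. u k \<in> Lp lborel p) \<and> energy_bounded p \<rho> (\<lambda>_ _. 1) u \<longrightarrow>
      (\<forall>r v. strict_mono r \<and> Lp_loc_conv p (u \<circ> r) v \<longrightarrow> v \<in> S_space p)"
    using sc unfolding strongly_p_compact_def by (rule conjunct2)
  ultimately show ?thesis by (elim allE[of _ u'] impE allE[of _ "r \<circ> s"] allE[of _ v]) auto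
qed

text \<open>The complement of the essential support is a union of possibly uncountably many open
  sets on which u vanishes almost everywhere; by Lindelof's theorem countably many of them
  suffice.\<close>

lemma Lp_ball_support:
  fixes u :: "'a::euclidean_space \<Rightarrow> real"
  assumes "u \<in> Lp_ball p R"
  shows "AE x in lborel. u x \<noteq> 0 \<longrightarrow> x \<in> cball 0 R"
proof -
  let ?F = "{U :: 'a set. open U \<and> (AE x in lborel. x \<in> U \<longrightarrow> u x = 0)}"
  obtain F where F: "F \<subseteq> ?F" "countable F" "\<Union>F = \<Union>?F" using Lindelof[of ?F] by auto
  have ae: "AE x in lborel. \<forall>U\<in>F. x \<in> U \<longrightarrow> u x = 0"
    using F(1) by (subst AE_ball_countable[OF F(2)]) auto
  have cov: "- cball 0 R \<subseteq> \<Union>F" using assms F(3) by (auto simp: Lp_ball_def ess_supp_def)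
  show ?thesis
    using ae
  proof eventually_elim
    case (elim x)
    show ?case
    proof (intro impI, rule ccontr)
      assume "u x \<noteq> 0" "x \<notin> cball 0 R"
      then obtain U where "U \<in> F" "x \<in> U" using cov by blast
      then show False using elim \<open>u x \<noteq> 0\<close> by blast
    qed
  qed
qed

text \<open>On pairs of points in the ball of radius R + 1 the limit weight is at least c0, and so
  \<open>ws k\<close> is at least c0/2 for large k. The other pairs that contribute are at distance
  at least 1 and are handled by the kernel tail. The threshold for k depends only on the kernels and
  weights and serves all u at once.\<close>

lemma unweighted_energy_bound:
  fixes \<rho> :: "nat \<Rightarrow> 'a::euclidean_space \<Rightarrow> real"
  assumes p: "1 \<le> p" and \<rho>: "admissible_kernels p \<rho>" and w: "admissible_weights ws w" and wpos: "\<forall>z. 0 < w z"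
    and R: "0 < R" and B: "0 \<le> B" and c: "0 \<le> c"
  obtains C where "0 \<le> C" "eventually (\<lambda>k. \<forall>u\<in>Lp_ball p R. Lp_mass lborel p u \<le> ennreal B
      \<and> energy p (\<rho> k) (ws k) u \<le> ennreal c \<longrightarrow> energy p (\<rho> k) (\<lambda>_. 1) u \<le> ennreal C) sequentially"
proof -
  note W = admissible_weightsD[OF w] and K = admissible_kernelsD[OF \<rho>]
  have p0: "0 < p" using p by simp
  let ?Q = "cball (0::'a) (R + 1) \<times> cball (0::'a) (R + 1)"
  have "\<exists>q\<in>?Q. \<forall>q'\<in>?Q. w q \<le> w q'"
    using R continuous_on_subset[OF W(3)] by (intro continuous_attains_inf compact_Times) auto
  then obtain q0 where q0: "\<And>q. q \<in> ?Q \<Longrightarrow> w q0 \<le> w q" by blast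
  define c0 where "c0 = w q0"
  have c0: "0 < c0" using wpos[rule_format, of q0] by (simp only: c0_def)
  define C where "C = 2 * 2 powr p * B + 2 / c0 * c"
  have C: "0 \<le> C" using B c c0 by (simp add: C_def)
  have "0 < c0 / 2" using c0 by simp
  have "eventually (\<lambda>k. \<forall>u\<in>Lp_ball p R. Lp_mass lborel p u \<le> ennreal B
      \<and> energy p (\<rho> k) (ws k) u \<le> ennreal c \<longrightarrow> energy p (\<rho> k) (\<lambda>_. 1) u \<le> ennreal C) sequentially"
    using W(5)[OF \<open>0 < c0 / 2\<close>] kernel_tail_small[OF p \<rho> zero_less_one zero_less_one]
  proof eventually_elim
    case (elim k)
    show ?case
    proof (intro ballI impI)
      fix u assume u: "u \<in> Lp_ball p R" and bd: "Lp_mass lborel p u \<le> ennreal B \<and> energy p (\<rho> k) (ws k) u \<le> ennreal c"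
      have mu[measurable]: "u \<in> borel_measurable borel" using u by (simp add: Lp_ball_def Lp_def)
      have [measurable]: "cball (0::'a) R \<in> sets borel" by simp
      have supp: "AE q in (lborel :: ('a \<times> 'a) measure). (u (fst q) \<noteq> 0 \<longrightarrow> fst q \<in> cball 0 R) \<and> (u (snd q) \<noteq> 0 \<longrightarrow> snd q \<in> cball 0 R)"
        unfolding lborel_prod[symmetric]
      proof (rule lborel_pair.AE_pair_measure)
        show "{q \<in> space (lborel \<Otimes>\<^sub>M lborel). (u (fst q) \<noteq> 0 \<longrightarrow> fst q \<in> cball 0 R) \<and> (u (snd q) \<noteq> 0 \<longrightarrow> snd q \<in> cball 0 R)} \<in> sets (lborel \<Otimes>\<^sub>M lborel)"
          by measurable
        show "AE x in lborel. AE y in lborel. (u (fst (x, y)) \<noteq> 0 \<longrightarrow> fst (x, y) \<in> cball 0 R) \<and> (u (snd (x, y)) \<noteq> 0 \<longrightarrow> snd (x, y) \<in> cball 0 R)"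
          using Lp_ball_support[OF u] by eventually_elim (use Lp_ball_support[OF u] in auto)
      qed
      let ?far = "\<lambda>q :: 'a \<times> 'a. 1 * indicator {q. 1 \<le> norm (fst q - snd q)} q :: ennreal"
      have mf: "?far \<in> borel_measurable borel"
        by (intro borel_measurable_times_ennreal borel_measurable_indicator sets_far_pairs) auto
      have mw: "(\<lambda>q. ennreal (ws k q)) \<in> borel_measurable borel" using W(1) by measurable
      have "energy p (\<rho> k) (\<lambda>_. 1) u = pair_energy p (\<rho> k) u (\<lambda>q. ennreal 1)"
        by (rule energy_eq_pair_energy) (use K mu in auto)
      also have "\<dots> \<le> pair_energy p (\<rho> k) u (\<lambda>q. ?far q + ennreal (2 / c0) * ennreal (ws k q))"
      proof (rule pair_energy_mono_AE, use supp elim(1) in eventually_elim)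
        case (elim q)
        let ?a = "ennreal (\<bar>u (fst q) - u (snd q)\<bar> powr p / norm (fst q - snd q) powr p)"
        show "?a * ennreal 1 \<le> ?a * (?far q + ennreal (2 / c0) * ennreal (ws k q))"
        proof (cases "u (fst q) = u (snd q)")
          case False
          have "1 \<le> ?far q + ennreal (2 / c0) * ennreal (ws k q)"
          proof (cases "q \<in> ?Q")
            case True
            have "c0 / 2 \<le> ws k q" using q0[OF True] elim(2) unfolding c0_def[symmetric] by linarith
            then have "1 \<le> 2 / c0 * ws k q" using c0 by (simp add: field_simps)
            then have "1 \<le> ennreal (2 / c0) * ennreal (ws k q)"
              using c0 by (simp add: ennreal_mult'[symmetric] flip: ennreal_1)
            then show ?thesis by (simp add: add_increasing)
          next
            \<comment> \<open>As u takes different values at the two points, one of them lies in the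
              ball of radius R; the other one is then outside the ball of radius R + 1.\<close>
            case far: False
            then have "1 \<le> norm (fst q - snd q)"
              using elim(1) False norm_triangle_ineq2[of "fst q" "snd q"] norm_triangle_ineq3[of "fst q" "snd q"]
              by (cases q) (auto simp: mem_Times_iff)
            then show ?thesis by (simp add: add_increasing2)
          qed
          then show ?thesis by (intro mult_left_mono) auto
        qed (use p0 in simp)
      qed
      also have "\<dots> = pair_energy p (\<rho> k) u ?far + ennreal (2 / c0) * pair_energy p (\<rho> k) u (\<lambda>q. ennreal (ws k q))"
        by (rule pair_energy_add[OF K(1) mu mf mw])
      also have "pair_energy p (\<rho> k) u (\<lambda>q. ennreal (ws k q)) = energy p (\<rho> k) (ws k) u"
        by (rule energy_eq_pair_energy[symmetric]) (use K W mu in auto)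
      also have "pair_energy p (\<rho> k) u ?far + ennreal (2 / c0) * energy p (\<rho> k) (ws k) u \<le>
        1 * (ennreal (2 * 2 powr p) * ennreal B) * ennreal 1 + ennreal (2 / c0) * ennreal c"
      proof (rule add_mono)
        show "pair_energy p (\<rho> k) u ?far \<le> 1 * (ennreal (2 * 2 powr p) * ennreal B) * ennreal 1"
          using bd elim(2) by (intro order_trans[OF pair_energy_far_le[OF K(1) mu p0, of k 1 1]] mult_mono) auto
        show "ennreal (2 / c0) * energy p (\<rho> k) (ws k) u \<le> ennreal (2 / c0) * ennreal c"
          using bd by (intro mult_left_mono) auto
      qed
      also have "\<dots> = ennreal C"
        using B c c0 unfolding C_def by (simp add: ennreal_mult[symmetric] ennreal_plus[symmetric] del: ennreal_plus)
      finally show "energy p (\<rho> k) (\<lambda>_. 1) u \<le> ennreal C" .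
    qed
  qed
  then show ?thesis using that[OF C] by blast
qed

section \<open>The lower bound\<close>

lemma loc_integrable_shift:
  fixes u :: "'a::euclidean_space \<Rightarrow> real"
  assumes u: "loc_integrable u"
  shows "loc_integrable (\<lambda>y. u (y - z))"
  unfolding loc_integrable_def
proof (intro conjI allI)
  have [measurable]: "u \<in> borel_measurable borel" using u by (simp add: loc_integrable_def)
  show "(\<lambda>y. u (y - z)) \<in> borel_measurable borel" by measurable
  fix r
  have [measurable]: "cball (0::'a) s \<in> sets borel" for s by simp
  let ?q = "\<lambda>y. ennreal \<bar>u y\<bar> * indicator (cball 0 (r + norm z)) y"
  have "L1_mass (cball 0 r) (\<lambda>x. u (x - z)) \<le> (\<integral>\<^sup>+x. ?q (x + - z) \<partial>lborel)"
  proof (rule nn_integral_mono)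
    fix x :: 'a
    have "norm (x - z) \<le> norm x + norm z" by (rule norm_triangle_ineq4)
    then show "ennreal \<bar>u (x - z)\<bar> * indicator (cball 0 r) x \<le> ?q (x + - z)" by (auto simp: indicator_def)
  qed
  also have "\<dots> = (\<integral>\<^sup>+x. ?q x \<partial>lborel)" by (rule nn_integral_lborel_shift) measurable
  also have "\<dots> < \<infinity>" using u by (simp add: loc_integrable_def)
  finally show "L1_mass (cball 0 r) (\<lambda>x. u (x - z)) < \<infinity>" .
qed

lemma moll_difference:
  fixes u :: "'a::euclidean_space \<Rightarrow> real"
  assumes u: "loc_integrable u" and \<eta>: "mollifier \<epsilon> \<eta> \<gamma> L"
  shows "moll \<eta> u x - moll \<eta> u (x - z) = moll \<eta> (\<lambda>y. u y - u (y - z)) x"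
proof -
  have [measurable]: "u \<in> borel_measurable borel" "\<eta> \<in> borel_measurable borel"
    using u mollifierD(12)[OF \<eta>] by (auto simp: loc_integrable_def)
  have "moll \<eta> u (x - z) = (LINT y|distr lborel borel ((+) (- z)). \<eta> (x - z - y) * u y)"
    by (simp add: moll_def lborel_distr_plus)
  also have "\<dots> = (LINT y|lborel. \<eta> (x - y) * u (y - z))"
    by (subst integral_distr) (auto intro!: Bochner_Integration.integral_cong simp: algebra_simps)
  finally have s: "moll \<eta> u (x - z) = (LINT y|lborel. \<eta> (x - y) * u (y - z))" .
  show ?thesis
    unfolding s unfolding moll_def right_diff_distrib
    by (rule Bochner_Integration.integral_diff[symmetric])
      (rule moll_integrable[OF u \<eta>], rule moll_integrable[OF loc_integrable_shift[OF u] \<eta>])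
qed

text \<open>For fixed z, the difference of a mollification is the mollification of the difference,
  to which Jensen's inequality applies. The kernel then moves both arguments of w by the same
  vector, which costs e.\<close>

lemma pair_energy_moll_le:
  fixes \<rho> u :: "'a::euclidean_space \<Rightarrow> real" and w :: "'a \<times> 'a \<Rightarrow> real"
  assumes p: "1 \<le> p" and \<rho>: "\<rho> \<in> borel_measurable borel" and u: "loc_integrable u" and \<eta>: "mollifier \<epsilon> \<eta> \<gamma> L"
    and w: "w \<in> borel_measurable borel" and close: "\<And>x y z. norm (x - y) < \<epsilon> \<Longrightarrow> w (x, x - z) \<le> w (y, y - z) + e"
  shows "pair_energy p \<rho> (moll \<eta> u) (\<lambda>q. ennreal (w q)) \<le> pair_energy p \<rho> u (\<lambda>q. ennreal (w q + e))"
proof -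
  have [measurable]: "u \<in> borel_measurable borel" "\<eta> \<in> borel_measurable borel" "w \<in> borel_measurable (borel \<Otimes>\<^sub>M borel)"
    using u w mollifierD(12)[OF \<eta>] by (auto simp: loc_integrable_def borel_prod)
  have mm: "moll \<eta> u \<in> borel_measurable borel" by measurable
  have V: "(\<lambda>q. ennreal (w q)) \<in> borel_measurable borel" "(\<lambda>q. ennreal (w q + e)) \<in> borel_measurable borel"
    using w by measurable
  have mu: "u \<in> borel_measurable borel" by measurable
  show ?thesis
    unfolding pair_energy_eq[OF \<rho> mm V(1)] pair_energy_eq[OF \<rho> mu V(2)]
  proof (rule nn_integral_mono, rule mult_left_mono)
    fix z :: 'a
    define D where "D y = u y - u (y - z)" for y
    have [measurable]: "D \<in> borel_measurable borel" unfolding D_def by measurable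
    have D: "loc_integrable D" unfolding D_def by (intro loc_integrable_diff u loc_integrable_shift)
    have "difference_mass p (\<lambda>x. ennreal (w (x, x - z))) (moll \<eta> u) z \<le>
      (\<integral>\<^sup>+x. (\<integral>\<^sup>+y. ennreal (w (x, x - z)) * ennreal (\<eta> (x - y) * \<bar>D y\<bar> powr p) \<partial>lborel) \<partial>lborel)"
    proof (rule nn_integral_mono)
      fix x :: 'a
      have "(\<integral>\<^sup>+y. ennreal (w (x, x - z)) * ennreal (\<eta> (x - y) * \<bar>D y\<bar> powr p) \<partial>lborel) =
        ennreal (w (x, x - z)) * (\<integral>\<^sup>+y. ennreal (\<eta> (x - y) * \<bar>D y\<bar> powr p) \<partial>lborel)"
        by (rule nn_integral_cmult) measurable
      then show "ennreal (w (x, x - z)) * ennreal (\<bar>moll \<eta> u x - moll \<eta> u (x - z)\<bar> powr p) \<le>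
        (\<integral>\<^sup>+y. ennreal (w (x, x - z)) * ennreal (\<eta> (x - y) * \<bar>D y\<bar> powr p) \<partial>lborel)"
        using moll_powr_le[OF p D \<eta>, of x] by (simp add: moll_difference[OF u \<eta>] D_def[symmetric] mult_left_mono)
    qed
    also have "\<dots> = (\<integral>\<^sup>+y. (\<integral>\<^sup>+x. ennreal (w (x, x - z)) * ennreal (\<eta> (x - y) * \<bar>D y\<bar> powr p) \<partial>lborel) \<partial>lborel)"
      by (rule lborel_pair.Fubini') measurable
    also have "\<dots> \<le> (\<integral>\<^sup>+y. ennreal (w (y, y - z) + e) * ennreal (\<bar>D y\<bar> powr p) \<partial>lborel)"
    proof (rule nn_integral_mono)
      fix y :: 'a
      have "(\<integral>\<^sup>+x. ennreal (w (x, x - z)) * ennreal (\<eta> (x - y) * \<bar>D y\<bar> powr p) \<partial>lborel) \<le>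
        (\<integral>\<^sup>+x. ennreal (\<eta> (x - y)) * (ennreal (w (y, y - z) + e) * ennreal (\<bar>D y\<bar> powr p)) \<partial>lborel)"
      proof (rule nn_integral_mono)
        fix x :: 'a
        show "ennreal (w (x, x - z)) * ennreal (\<eta> (x - y) * \<bar>D y\<bar> powr p) \<le> ennreal (\<eta> (x - y)) * (ennreal (w (y, y - z) + e) * ennreal (\<bar>D y\<bar> powr p))"
        proof (cases "\<epsilon> \<le> norm (x - y)")
          case False
          then have "ennreal (w (x, x - z)) \<le> ennreal (w (y, y - z) + e)" using close by (intro ennreal_leI) auto
          then have "ennreal (\<eta> (x - y)) * (ennreal (w (x, x - z)) * ennreal (\<bar>D y\<bar> powr p)) \<le>
            ennreal (\<eta> (x - y)) * (ennreal (w (y, y - z) + e) * ennreal (\<bar>D y\<bar> powr p))"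
            by (intro mult_left_mono mult_right_mono) auto
          then show ?thesis using mollifierD(5)[OF \<eta>, of "x - y"]
            by (simp add: ennreal_mult mult.left_commute[of "ennreal (w (x, x - z))"])
        qed (use mollifierD(8)[OF \<eta>] in simp)
      qed
      also have "\<dots> = ennreal (w (y, y - z) + e) * ennreal (\<bar>D y\<bar> powr p)"
        by (subst nn_integral_multc) (simp_all add: nn_integral_mollifier_shift(1)[OF \<eta>])
      finally show "(\<integral>\<^sup>+x. ennreal (w (x, x - z)) * ennreal (\<eta> (x - y) * \<bar>D y\<bar> powr p) \<partial>lborel) \<le> \<dots>" .
    qed
    finally show "difference_mass p (\<lambda>x. ennreal (w (x, x - z))) (moll \<eta> u) z \<le>
      difference_mass p (\<lambda>x. ennreal (w (x, x - z) + e)) u z"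
      by (simp add: D_def)
  qed simp
qed

lemma mgrad_zero_outside:
  fixes v :: "'a::euclidean_space \<Rightarrow> real"
  assumes v: "AE x in lborel. v x \<noteq> 0 \<longrightarrow> x \<in> cball 0 R" and \<eta>: "mollifier \<epsilon> \<eta> \<gamma> L" and \<epsilon>: "\<epsilon> \<le> 1" and x: "R + 1 < norm x"
  shows "mgrad \<gamma> v x = 0"
proof -
  have "AE y in lborel. v y *\<^sub>R \<gamma> (x - y) = 0"
    using v
  proof eventually_elim
    case (elim y)
    show ?case
    proof (cases "v y = 0")
      case False
      then have "norm y \<le> R" using elim by simp
      then have "\<epsilon> \<le> norm (x - y)" using x \<epsilon> norm_triangle_ineq2[of x y] by linarith
      then show ?thesis using mollifierD(9)[OF \<eta>] by simp
    qed simp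
  qed
  then show ?thesis unfolding mgrad_def by (rule integral_eq_zero_AE)
qed

text \<open>Only the \<open>L\<^sup>1\<close> distance of \<open>u\<close> and \<open>v\<close> enters the Taylor bound, so \<open>\<delta>\<close> can be chosen
  independently of \<open>u\<close>.\<close>

lemma difference_integral_ge:
  fixes v :: "'a::euclidean_space \<Rightarrow> real" and w :: "'a \<times> 'a \<Rightarrow> real"
  assumes p: "1 \<le> p" and \<eta>: "mollifier \<epsilon> \<eta> \<gamma> L" and \<epsilon>: "\<epsilon> \<le> 1"
    and v: "v \<in> Lp lborel p" and vR: "AE x in lborel. v x \<noteq> 0 \<longrightarrow> x \<in> cball 0 R"
    and w[measurable]: "w \<in> borel_measurable (borel \<Otimes>\<^sub>M borel)" and w0: "\<And>q. 0 \<le> w q" and W: "\<And>q. w q \<le> W"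
    and unif: "\<And>e. 0 < e \<Longrightarrow> \<exists>d>0. \<forall>x x' y y'. norm (x - x') + norm (y - y') < d \<longrightarrow> \<bar>w (x, y) - w (x', y')\<bar> \<le> e"
    and B: "0 \<le> B" and e: "0 < e"
  obtains \<delta> s where "0 < \<delta>" "0 < s"
    "\<And>u z. u \<in> Lp lborel p \<Longrightarrow> Lp_mass lborel p u \<le> ennreal B \<Longrightarrow>
      L1_mass (cball 0 (R + 3)) (\<lambda>x. u x - v x) \<le> ennreal s \<Longrightarrow> norm z < \<delta> \<Longrightarrow> z \<noteq> 0 \<Longrightarrow>
      directional_mass lborel p (\<lambda>x. w (x, x)) (mgrad \<gamma> v) z \<le>
      difference_mass p (\<lambda>x. ennreal (w (x, x - z))) (moll \<eta> u) z + ennreal (e * norm z powr p)"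
proof -
  have p0: "0 < p" using p by simp
  have L: "0 \<le> L" and \<epsilon>0: "0 < \<epsilon>" using mollifierD[OF \<eta>] by auto
  have W0: "0 \<le> W" using w0 W by (meson order_trans)
  define V where "V = measure lborel (cball (0::'a) (R + 1))"
  have V: "emeasure lborel (cball (0::'a) (R + 1)) = ennreal V" "0 \<le> V"
    using emeasure_bounded_finite[of "cball (0::'a) (R + 1)"] by (auto simp: V_def emeasure_eq_ennreal_measure less_top)
  define B1 where "B1 = measure lborel (cball (0::'a) (2 * \<epsilon>)) + B"
  have B1: "emeasure lborel (cball (0::'a) (2 * \<epsilon>)) + ennreal B = ennreal B1" "0 \<le> B1"
    using emeasure_bounded_finite[of "cball (0::'a) (2 * \<epsilon>)"] B by (auto simp: B1_def emeasure_eq_ennreal_measure less_top)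
  obtain B2 where B2: "0 \<le> B2" "\<And>x::'a. L1_mass (cball x (2 * \<epsilon>)) v \<le> ennreal B2"
    using Lp_local_bound[OF p v] by metis
  have lv: "loc_integrable v" by (rule Lp_loc_integrable[OF p v])
  have [measurable]: "v \<in> borel_measurable borel" "\<gamma> \<in> borel_measurable borel" "\<eta> \<in> borel_measurable borel"
    using lv mollifierD(12,13)[OF \<eta>] by (auto simp: loc_integrable_def)
  define M where "M = L * B2 + 1"
  have M: "0 < M" using L B2 by (simp add: M_def add_nonneg_pos)
  \<comment> \<open>T is the admissible pointwise error per |z|^p, to be integrated over a ball of
    volume V. It is shared out as follows: e1 makes the oscillation of w cost at most T/2, while s
    and the last entry of \<delta> limit the error in the gradient and the Taylor remainder to T/4
    each. Q bounds the weight times the derivative of the p-th power on [0, M], and M bounds the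
    mollified gradient of v.\<close>
  define T where "T = e / (V + 1)"
  have T: "0 < T" using e V by (simp add: T_def)
  define e1 where "e1 = T / (2 * (M powr p + 1))"
  have e1: "0 < e1" using T by (simp add: e1_def add_nonneg_pos)
  define Q where "Q = W * p * M powr (p - 1)"
  have Q: "0 \<le> Q" using W0 p by (simp add: Q_def)
  define s where "s = T / (4 * (Q * L + 1))"
  have QL: "0 < Q * L + 1" "0 < Q * L * B1 + 1" using Q L B1 by (auto simp: add_nonneg_pos)
  have s: "0 < s" using T QL by (simp add: s_def)
  obtain d where d: "0 < d" "\<And>x x' y y'. norm (x - x') + norm (y - y') < d \<Longrightarrow> \<bar>w (x, y) - w (x', y')\<bar> \<le> e1"
    using unif[OF e1] by blast
  define \<delta> where "\<delta> = min (min \<epsilon> d) (T / (4 * (Q * L * B1 + 1)))"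
  have \<delta>: "0 < \<delta>" using \<epsilon>0 d T QL by (simp add: \<delta>_def)
  show ?thesis
  proof (rule that[OF \<delta> s])
    fix u :: "'a \<Rightarrow> real" and z :: 'a
    assume u: "u \<in> Lp lborel p" and uB: "Lp_mass lborel p u \<le> ennreal B"
      and uv: "L1_mass (cball 0 (R + 3)) (\<lambda>x. u x - v x) \<le> ennreal s"
      and z: "norm z < \<delta>" "z \<noteq> 0"
    have lu: "loc_integrable u" by (rule Lp_loc_integrable[OF p u])
    have [measurable]: "u \<in> borel_measurable borel" using lu by (auto simp: loc_integrable_def)
    have uloc: "L1_mass (cball x (2 * \<epsilon>)) u \<le> ennreal B1" for x
    proof -
      have "L1_mass (cball x (2 * \<epsilon>)) u \<le>
        emeasure lborel (cball (0::'a) (2 * \<epsilon>)) + Lp_mass lborel p u"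
        by (rule Lp_local_mass_le[OF p u])
      also have "\<dots> \<le> ennreal B1" unfolding B1(1)[symmetric] by (rule add_left_mono[OF uB])
      finally show ?thesis .
    qed
    have nz: "0 < norm z" "norm z \<le> \<epsilon>" using z by (auto simp: \<delta>_def)
    have pt: "w (x, x) * \<bar>mgrad \<gamma> v x \<bullet> z\<bar> powr p \<le> w (x, x - z) * \<bar>moll \<eta> u x - moll \<eta> u (x - z)\<bar> powr p + T * norm z powr p"
      if x: "x \<in> cball 0 (R + 1)" for x
    proof -
      define b where "b = \<bar>mgrad \<gamma> v x \<bullet> z\<bar> / norm z"
      define a where "a = \<bar>moll \<eta> u x - moll \<eta> u (x - z)\<bar> / norm z"
      have a0: "0 \<le> a" and b0: "0 \<le> b" by (auto simp: a_def b_def)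
      have "norm (mgrad \<gamma> v x) \<le> L * B2" by (rule mgrad_bound[OF lv \<eta> B2(2,1)])
      then have "\<bar>mgrad \<gamma> v x \<bullet> z\<bar> \<le> (L * B2) * norm z"
        by (intro order_trans[OF Cauchy_Schwarz_ineq2] mult_right_mono) auto
      also have "\<dots> \<le> M * norm z" by (intro mult_right_mono) (auto simp: M_def)
      finally have bM: "b \<le> M" using nz by (simp add: b_def divide_le_eq)
      have "\<bar>moll \<eta> u (x + - z) - moll \<eta> u x - mgrad \<gamma> u x \<bullet> (- z)\<bar> \<le> L * B1 * (norm (- z))\<^sup>2"
        using nz by (intro moll_Taylor[OF lu \<eta> uloc B1(2)]) auto
      then have Ta: "\<bar>mgrad \<gamma> u x \<bullet> z\<bar> \<le> \<bar>moll \<eta> u x - moll \<eta> u (x - z)\<bar> + L * B1 * (norm z)\<^sup>2" by simp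
      have "norm (mgrad \<gamma> (\<lambda>y. v y - u y) x) \<le> L * s"
      proof (rule mgrad_bound[OF loc_integrable_diff[OF lv lu] \<eta>])
        \<comment> \<open>The points x range over the ball of radius R + 1, beyond which the
          mollified gradient of v vanishes, and 2 \<epsilon> \<le> 2.\<close>
        have "cball x (2 * \<epsilon>) \<subseteq> cball 0 (R + 3)"
        proof
          fix y assume "y \<in> cball x (2 * \<epsilon>)"
          then have "norm (y - x) \<le> 2" using \<epsilon> by (simp add: dist_norm norm_minus_commute)
          moreover have "norm y \<le> norm (y - x) + norm x" using norm_triangle_ineq[of "y - x" x] by simp
          ultimately show "y \<in> cball 0 (R + 3)" using x by simp
        qed
        then have "L1_mass (cball x (2 * \<epsilon>)) (\<lambda>y. v y - u y) \<le>
          L1_mass (cball 0 (R + 3)) (\<lambda>x. u x - v x)"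
          by (intro nn_integral_mono mult_mono) (auto simp: indicator_def abs_minus_commute)
        then show "L1_mass (cball x (2 * \<epsilon>)) (\<lambda>y. v y - u y) \<le> ennreal s"
          using uv by (rule order_trans)
      qed (use s in simp)
      moreover have "mgrad \<gamma> (\<lambda>y. v y - u y) x = mgrad \<gamma> v x - mgrad \<gamma> u x"
        unfolding mgrad_def scaleR_left_diff_distrib
        by (rule Bochner_Integration.integral_diff[OF mgrad_integrable[OF lv \<eta>] mgrad_integrable[OF lu \<eta>]])
      ultimately have "\<bar>(mgrad \<gamma> v x - mgrad \<gamma> u x) \<bullet> z\<bar> \<le> (L * s) * norm z"
        by (intro order_trans[OF Cauchy_Schwarz_ineq2] mult_right_mono) auto
      then have "\<bar>mgrad \<gamma> v x \<bullet> z\<bar> \<le> \<bar>mgrad \<gamma> u x \<bullet> z\<bar> + L * s * norm z" by (simp add: inner_diff_left)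
      with Ta have "\<bar>mgrad \<gamma> v x \<bullet> z\<bar> \<le> \<bar>moll \<eta> u x - moll \<eta> u (x - z)\<bar> + (L * s + L * B1 * norm z) * norm z"
        by (simp add: algebra_simps power2_eq_square)
      then have ba: "b \<le> a + (L * s + L * B1 * norm z)" using nz by (simp add: a_def b_def field_simps)
      have \<kappa>0: "0 \<le> L * s + L * B1 * norm z" using L s B1 by simp
      \<comment> \<open>The tangent is taken at b, for which the bound M has just been established,
        so its slope is controlled independently of u.\<close>
      have "b powr p + p * b powr (p - 1) * (a - b) \<le> a powr p" by (rule powr_tangent_le[OF p a0 b0])
      moreover have "p * b powr (p - 1) * (b - a) \<le> p * M powr (p - 1) * (L * s + L * B1 * norm z)"
      proof -
        have "p * b powr (p - 1) * (b - a) \<le> p * b powr (p - 1) * (L * s + L * B1 * norm z)"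
          using ba p by (intro mult_left_mono) auto
        also have "\<dots> \<le> p * M powr (p - 1) * (L * s + L * B1 * norm z)"
          using \<kappa>0 p b0 bM by (intro mult_right_mono mult_left_mono powr_mono2) auto
        finally show ?thesis .
      qed
      ultimately have "b powr p \<le> a powr p + p * M powr (p - 1) * (L * s + L * B1 * norm z)"
        by (simp add: algebra_simps)
      then have "w (x, x - z) * b powr p \<le> w (x, x - z) * (a powr p + p * M powr (p - 1) * (L * s + L * B1 * norm z))"
        using w0 by (rule mult_left_mono)
      also have "\<dots> \<le> w (x, x - z) * a powr p + Q * (L * s + L * B1 * norm z)"
      proof -
        have "w (x, x - z) * (p * M powr (p - 1) * (L * s + L * B1 * norm z)) \<le> W * (p * M powr (p - 1) * (L * s + L * B1 * norm z))"
          using W \<kappa>0 p by (intro mult_right_mono) auto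
        then show ?thesis by (simp add: Q_def distrib_left mult.assoc)
      qed
      also have "Q * (L * s + L * B1 * norm z) \<le> T / 2"
      proof -
        have "Q * L * s \<le> T / 4"
        proof -
          have "Q * L * T \<le> (Q * L + 1) * T" using T by (intro mult_right_mono) auto
          then show ?thesis using QL by (simp add: s_def divide_le_eq algebra_simps)
        qed
        moreover have "Q * L * B1 * norm z \<le> T / 4"
        proof -
          have "norm z \<le> T / (4 * (Q * L * B1 + 1))" using z by (simp add: \<delta>_def)
          then have "Q * L * B1 * norm z \<le> Q * L * B1 * (T / (4 * (Q * L * B1 + 1)))"
            using Q L B1 by (intro mult_left_mono) auto
          also have "\<dots> \<le> T / 4"
          proof -
            have "Q * L * B1 * T \<le> (Q * L * B1 + 1) * T" using T by (intro mult_right_mono) auto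
            then show ?thesis using QL by (simp add: divide_le_eq algebra_simps)
          qed
          finally show ?thesis .
        qed
        ultimately show ?thesis by (simp add: algebra_simps)
      qed
      finally have m1: "w (x, x - z) * b powr p \<le> w (x, x - z) * a powr p + T / 2" by simp
      have "(w (x, x) - w (x, x - z)) * b powr p \<le> e1 * M powr p"
      proof -
        have "\<bar>w (x, x) - w (x, x - z)\<bar> \<le> e1" using z by (intro d(2)) (simp add: \<delta>_def)
        then have "(w (x, x) - w (x, x - z)) * b powr p \<le> e1 * b powr p" by (intro mult_right_mono) auto
        also have "\<dots> \<le> e1 * M powr p" using e1 b0 bM p0 by (intro mult_left_mono powr_mono2) auto
        finally show ?thesis .
      qed
      also have "\<dots> \<le> T / 2"
      proof -
        have "M powr p * T \<le> (M powr p + 1) * T" using T by (intro mult_right_mono) auto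
        moreover have "0 < M powr p + 1" by (simp add: add_nonneg_pos)
        ultimately show ?thesis by (simp add: e1_def divide_le_eq algebra_simps)
      qed
      finally have "w (x, x) * b powr p \<le> w (x, x - z) * a powr p + T" using m1 by (simp add: algebra_simps)
      then have "(w (x, x) * b powr p) * norm z powr p \<le> (w (x, x - z) * a powr p + T) * norm z powr p"
        by (rule mult_right_mono) simp
      moreover have "b powr p * norm z powr p = \<bar>mgrad \<gamma> v x \<bullet> z\<bar> powr p" "a powr p * norm z powr p = \<bar>moll \<eta> u x - moll \<eta> u (x - z)\<bar> powr p"
        using nz by (simp_all add: a_def b_def powr_divide)
      ultimately show ?thesis by (simp add: distrib_right mult.assoc)
    qed
    let ?I = "\<lambda>x::'a. indicator (cball 0 (R + 1)) x :: ennreal"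
    have [measurable]: "cball (0::'a) (R + 1) \<in> sets borel" by simp
    have "directional_mass lborel p (\<lambda>x. w (x, x)) (mgrad \<gamma> v) z \<le>
      (\<integral>\<^sup>+x. ennreal (w (x, x - z)) * ennreal (\<bar>moll \<eta> u x - moll \<eta> u (x - z)\<bar> powr p) + ennreal (T * norm z powr p) * ?I x \<partial>lborel)"
    proof (rule nn_integral_mono)
      fix x :: 'a
      show "ennreal (w (x, x)) * ennreal (\<bar>mgrad \<gamma> v x \<bullet> z\<bar> powr p) \<le>
        ennreal (w (x, x - z)) * ennreal (\<bar>moll \<eta> u x - moll \<eta> u (x - z)\<bar> powr p) + ennreal (T * norm z powr p) * ?I x"
      proof (cases "x \<in> cball 0 (R + 1)")
        case True
        have "ennreal (w (x, x) * \<bar>mgrad \<gamma> v x \<bullet> z\<bar> powr p) \<le>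
          ennreal (w (x, x - z) * \<bar>moll \<eta> u x - moll \<eta> u (x - z)\<bar> powr p) + ennreal (T * norm z powr p)"
          using ennreal_leI[OF pt[OF True]] w0 T by (subst ennreal_plus[symmetric]) auto
        then show ?thesis using True w0 by (simp add: ennreal_mult)
      next
        case False
        then show ?thesis using mgrad_zero_outside[OF vR \<eta> \<epsilon>, of x] p0 by simp
      qed
    qed
    also have "\<dots> = difference_mass p (\<lambda>x. ennreal (w (x, x - z))) (moll \<eta> u) z + ennreal (T * norm z powr p) * ennreal V"
      by (subst nn_integral_add, measurable, subst nn_integral_cmult_indicator) (auto simp: V(1))
    also have "ennreal (T * norm z powr p) * ennreal V \<le> ennreal (e * norm z powr p)"
    proof -
      have "T * V \<le> e" using e V by (simp add: T_def divide_le_eq algebra_simps)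
      then have "T * norm z powr p * V \<le> e * norm z powr p"
        using mult_right_mono[of "T * V" e "norm z powr p"] by (simp add: mult_ac)
      then show ?thesis using T V by (simp add: ennreal_mult[symmetric] ennreal_leI)
    qed
    finally show "directional_mass lborel p (\<lambda>x. w (x, x)) (mgrad \<gamma> v) z \<le>
      difference_mass p (\<lambda>x. ennreal (w (x, x - z))) (moll \<eta> u) z + ennreal (e * norm z powr p)"
      by (simp add: add_left_mono)
  qed
qed

lemma Lp_norm_le:
  assumes u: "u \<in> Lp M p" and p: "0 < p" and B: "0 \<le> B" "Lp_mass M p u \<le> ennreal B"
  shows "Lp_norm M p u \<le> B powr (1 / p)"
proof -
  have "Lp_mass M p u = ennreal (LINT x|M. \<bar>u x\<bar> powr p)"
    using u by (intro nn_integral_eq_integral) (auto simp: Lp_def)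
  then have "(LINT x|M. \<bar>u x\<bar> powr p) \<le> B" using B by simp
  then show ?thesis unfolding Lp_norm_def using p by (intro powr_mono2) auto
qed

lemma Lp_conv_bounded:
  assumes p: "0 < p" and conv: "Lp_conv M p u v"
  obtains B where "0 \<le> B" "eventually (\<lambda>k. Lp_mass M p (u k) \<le> ennreal B) sequentially"
proof -
  have c: "\<forall>k. u k \<in> Lp M p" "v \<in> Lp M p" "(\<lambda>k. \<integral>\<^sup>+x. ennreal (\<bar>u k x - v x\<bar> powr p) \<partial>M) \<longlonglongrightarrow> 0"
    using conv by (auto simp: Lp_conv_nn_integral[OF p])
  have m: "v \<in> borel_measurable M" "u k \<in> borel_measurable M" for k using c by (auto simp: Lp_def)
  note [measurable] = m
  define V where "V = enn2real (Lp_mass M p v)"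
  have V: "Lp_mass M p v = ennreal V" "0 \<le> V"
    using Lp_nn_integral_finite[OF c(2)] by (auto simp: V_def less_top)
  show ?thesis
  proof (rule that[of "2 powr p * (1 + V)"])
    have "eventually (\<lambda>k. Lp_mass M p (\<lambda>x. u k x - v x) < 1) sequentially"
      using c(3) by (rule order_tendstoD) simp
    then show "eventually (\<lambda>k. Lp_mass M p (u k) \<le> ennreal (2 powr p * (1 + V))) sequentially"
    proof eventually_elim
      case (elim k)
      have "Lp_mass M p (u k) \<le>
        (\<integral>\<^sup>+x. ennreal (2 powr p) * (ennreal (\<bar>u k x - v x\<bar> powr p) + ennreal (\<bar>v x\<bar> powr p)) \<partial>M)"
      proof (rule nn_integral_mono)
        fix x
        show "ennreal (\<bar>u k x\<bar> powr p) \<le> ennreal (2 powr p) * (ennreal (\<bar>u k x - v x\<bar> powr p) + ennreal (\<bar>v x\<bar> powr p))"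
          using powr_abs_diff_le[OF p, of "u k x - v x" "- v x"]
          by (simp add: ennreal_mult'[symmetric] ennreal_plus[symmetric] ennreal_leI del: ennreal_plus)
      qed
      also have "\<dots> = ennreal (2 powr p) * (Lp_mass M p (\<lambda>x. u k x - v x) + ennreal V)"
        unfolding V(1)[symmetric] by (subst nn_integral_cmult, measurable, subst nn_integral_add) measurable
      also have "\<dots> \<le> ennreal (2 powr p) * (1 + ennreal V)"
        using elim by (intro mult_left_mono add_right_mono) auto
      also have "\<dots> = ennreal (2 powr p * (1 + V))"
        using V(2) by (simp add: ennreal_mult' flip: ennreal_1)
      finally show ?case .
    qed
  qed (use V in simp)
qed

text \<open>Splitting at a level t, a \<le> t or a \<le> t^(1-p) a^p: the first alternative costs t
  times the volume of the ball, the second a multiple of the p-th power of the distance. This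
  replaces Hoelder's inequality.\<close>

lemma Lp_conv_local_L1:
  fixes u :: "nat \<Rightarrow> 'a::euclidean_space \<Rightarrow> real"
  assumes p: "1 \<le> p" and conv: "Lp_conv lborel p u v" and s: "0 < s"
  shows "eventually (\<lambda>k. L1_mass (cball 0 r) (\<lambda>x. u k x - v x) \<le> ennreal s) sequentially"
proof -
  have p0: "0 < p" using p by simp
  have c: "\<forall>k. u k \<in> Lp lborel p" "v \<in> Lp lborel p" "(\<lambda>k. \<integral>\<^sup>+x. ennreal (\<bar>u k x - v x\<bar> powr p) \<partial>lborel) \<longlonglongrightarrow> 0"
    using conv by (auto simp: Lp_conv_nn_integral[OF p0])
  have m: "v \<in> borel_measurable borel" "u k \<in> borel_measurable borel" for k using c by (auto simp: Lp_def)
  note [measurable] = m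
  have [measurable]: "cball (0::'a) r \<in> sets borel" by simp
  define V where "V = measure lborel (cball (0::'a) r)"
  have V: "emeasure lborel (cball (0::'a) r) = ennreal V" "0 \<le> V"
    using emeasure_bounded_finite[of "cball (0::'a) r"] by (auto simp: V_def emeasure_eq_ennreal_measure less_top)
  define t where "t = s / (2 * (V + 1))"
  have t: "0 < t" using s V by (simp add: t_def)
  have tV: "t * V \<le> s / 2" using s V by (simp add: t_def field_simps)
  have "eventually (\<lambda>k. Lp_mass lborel p (\<lambda>x. u k x - v x) < ennreal (s / 2 * t powr (p - 1))) sequentially"
    using s t by (intro order_tendstoD[OF c(3)]) simp
  then show ?thesis
  proof eventually_elim
    case (elim k)
    have "L1_mass (cball 0 r) (\<lambda>x. u k x - v x) \<le>
      (\<integral>\<^sup>+x. ennreal t * indicator (cball 0 r) x + ennreal (t powr (1 - p)) * ennreal (\<bar>u k x - v x\<bar> powr p) \<partial>lborel)"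
    proof (rule nn_integral_mono)
      fix x
      show "ennreal \<bar>u k x - v x\<bar> * indicator (cball 0 r) x \<le>
        ennreal t * indicator (cball 0 r) x + ennreal (t powr (1 - p)) * ennreal (\<bar>u k x - v x\<bar> powr p)"
      proof (cases "\<bar>u k x - v x\<bar> \<le> t")
        case True
        then show ?thesis by (intro add_increasing2 mult_right_mono ennreal_leI) auto
      next
        case False
        define a where "a = \<bar>u k x - v x\<bar>"
        have a: "t < a" using False by (simp add: a_def)
        have "t powr (p - 1) \<le> a powr (p - 1)" using a t p by (intro powr_mono2) auto
        then have "t powr (1 - p) * (t powr (p - 1) * a) \<le> t powr (1 - p) * (a powr (p - 1) * a)"
          using a t by (intro mult_left_mono mult_right_mono) auto
        moreover have "t powr (1 - p) * (t powr (p - 1) * a) = a"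
          using t by (simp add: mult.assoc[symmetric] powr_add[symmetric])
        moreover have "a powr (p - 1) * a = a powr p" using a t powr_mult_base[of a "p - 1"] by (simp add: mult.commute)
        ultimately have "a \<le> t powr (1 - p) * a powr p" by simp
        then have "ennreal a \<le> ennreal (t powr (1 - p)) * ennreal (a powr p)"
          by (simp add: ennreal_mult[symmetric] ennreal_leI)
        then show ?thesis unfolding a_def[symmetric] by (auto simp: indicator_def intro: add_increasing)
      qed
    qed
    also have "\<dots> = ennreal t * ennreal V + ennreal (t powr (1 - p)) * Lp_mass lborel p (\<lambda>x. u k x - v x)"
      by (subst nn_integral_add, measurable, subst nn_integral_cmult, measurable, subst nn_integral_cmult_indicator) (auto simp: V(1))
    also have "\<dots> \<le> ennreal t * ennreal V + ennreal (t powr (1 - p)) * ennreal (s / 2 * t powr (p - 1))"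
      using elim by (intro add_left_mono mult_left_mono) auto
    also have "\<dots> = ennreal (t * V + t powr (1 - p) * (s / 2 * t powr (p - 1)))"
      using t V s by (simp add: ennreal_mult[symmetric] ennreal_plus[symmetric] del: ennreal_plus)
    also have "t powr (1 - p) * (s / 2 * t powr (p - 1)) = s / 2"
      using t by (simp add: mult.left_commute[of _ "s / 2"] powr_add[symmetric])
    also have "ennreal (t * V + s / 2) \<le> ennreal s" using tV by (intro ennreal_leI) linarith
    finally show ?case .
  qed
qed

lemma Lp_conv_support:
  fixes u :: "nat \<Rightarrow> 'a::euclidean_space \<Rightarrow> real"
  assumes p: "0 < p" and conv: "Lp_conv lborel p u v" and u: "\<And>k. u k \<in> Lp_ball p R"
  shows "AE x in lborel. v x \<noteq> 0 \<longrightarrow> x \<in> cball 0 R"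
proof -
  have c: "v \<in> Lp lborel p" "(\<lambda>k. \<integral>\<^sup>+x. ennreal (\<bar>u k x - v x\<bar> powr p) \<partial>lborel) \<longlonglongrightarrow> 0"
    using conv by (auto simp: Lp_conv_nn_integral[OF p])
  have [measurable]: "v \<in> borel_measurable borel" using c by (auto simp: Lp_def)
  have [measurable]: "cball (0::'a) R \<in> sets borel" by simp
  let ?f = "\<lambda>x. ennreal (\<bar>v x\<bar> powr p) * indicator (- cball 0 R) x"
  have "(\<integral>\<^sup>+x. ?f x \<partial>lborel) \<le> Lp_mass lborel p (\<lambda>x. u k x - v x)" for k
  proof (rule nn_integral_mono_AE)
    show "AE x in lborel. ?f x \<le> ennreal (\<bar>u k x - v x\<bar> powr p)"
      using Lp_ball_support[OF u, of k] by eventually_elim (auto simp: indicator_def)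
  qed
  then have "(\<integral>\<^sup>+x. ?f x \<partial>lborel) \<le> 0"
    using c(2) by (intro tendsto_lowerbound[OF c(2)]) auto
  then have "AE x in lborel. ?f x = 0" by (subst (asm) le_zero_eq, subst (asm) nn_integral_0_iff_AE) auto
  then show ?thesis by eventually_elim (auto simp: indicator_def split: if_splits)
qed

text \<open>The lower bound at a fixed mollification scale. For fixed z, the directional mass of the
  mollified limit is compared with a difference of the mollified u_k, and unmollifying the energy
  enlarges the weight by e. Replacing w by \<open>ws k\<close> costs another e; the resulting 2 e
  multiplies the unweighted energy, whence 2 e C.\<close>

lemma mollified_energy_le:
  fixes \<rho> :: "nat \<Rightarrow> 'a::euclidean_space \<Rightarrow> real"
  assumes p: "1 \<le> p" and \<rho>: "admissible_kernels p \<rho>" and \<mu>: "limit_directional_measure \<rho> \<mu>"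
    and w: "admissible_weights ws w" and u: "\<And>k. u k \<in> Lp_ball p R" and conv: "Lp_conv lborel p u v"
    and rep: "gradient_rep p v m \<tau>" and \<eta>: "mollifier \<epsilon> \<eta> \<gamma> L" and \<epsilon>: "\<epsilon> \<le> 1" and e: "0 < e"
    and close: "\<And>x y z. norm (x - y) < \<epsilon> \<Longrightarrow> w (x, x - z) \<le> w (y, y - z) + e"
    and freq: "frequently (\<lambda>k. energy p (\<rho> k) (ws k) (u k) \<le> ennreal c \<and> energy p (\<rho> k) (\<lambda>_. 1) (u k) \<le> ennreal C) sequentially"
    and c: "0 \<le> c" and C: "0 \<le> C"
  shows "(\<integral>\<^sup>+\<sigma>. directional_mass lborel p (\<lambda>x. w (x, x)) (mgrad \<gamma> v) \<sigma> \<partial>\<mu>) \<le> ennreal (c + 2 * e * C)"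
proof -
  note W = admissible_weightsD[OF w] and K = admissible_kernelsD[OF \<rho>] and D = gradient_repD[OF rep]
  have p0: "0 < p" using p by simp
  obtain Wm where Wm: "0 < Wm" "\<And>z. w z \<le> Wm" using W(7) by blast
  have wb: "w \<in> borel_measurable borel" using W(3) by (rule borel_measurable_continuous_onI)
  have mw[measurable]: "w \<in> borel_measurable (borel \<Otimes>\<^sub>M borel)" using wb by (simp add: borel_prod)
  have wd[measurable]: "(\<lambda>x. w (x, x)) \<in> borel_measurable borel" by measurable
  have mv[measurable]: "v \<in> borel_measurable borel" "\<gamma> \<in> borel_measurable borel" "\<eta> \<in> borel_measurable borel"
    using D(6) mollifierD(12,13)[OF \<eta>] by (auto simp: loc_integrable_def)
  note [measurable] = K(1)
  have uL: "u k \<in> Lp lborel p" for k using u[of k] by (simp add: Lp_ball_def)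
  have um[measurable]: "u k \<in> borel_measurable borel" for k using uL[of k] by (simp add: Lp_def)
  have mg[measurable]: "mgrad \<gamma> v \<in> borel_measurable borel" by measurable
  define \<phi> where "\<phi> \<sigma> = (LINT x|lborel. w (x, x) * \<bar>mgrad \<gamma> v x \<bullet> \<sigma>\<bar> powr p)" for \<sigma>
  have \<phi>: "continuous_on UNIV \<phi>" "ennreal (\<phi> \<sigma>) = directional_mass lborel p (\<lambda>x. w (x, x)) (mgrad \<gamma> v) \<sigma>" "0 \<le> \<phi> \<sigma>" for \<sigma>
  proof -
    have "mgrad \<gamma> v \<in> borel_measurable lborel" "(\<lambda>x. w (x, x)) \<in> borel_measurable lborel" by simp_all
    from continuous_directional_integral[OF this W(4) Wm(2) p0 mgrad_powr_finite[OF rep \<eta>]]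
    show "continuous_on UNIV \<phi>" "ennreal (\<phi> \<sigma>) = directional_mass lborel p (\<lambda>x. w (x, x)) (mgrad \<gamma> v) \<sigma>" "0 \<le> \<phi> \<sigma>"
      unfolding \<phi>_def by auto
  qed
  obtain \<delta>0 where \<delta>0: "0 < \<delta>0" and dlim:
    "\<forall>\<phi> :: 'a \<Rightarrow> real. continuous_on UNIV \<phi> \<and> (\<forall>x. 0 \<le> \<phi> x) \<longrightarrow> (\<exists>I :: real \<Rightarrow> ennreal.
      (\<forall>\<delta>. 0 < \<delta> \<and> \<delta> < \<delta>0 \<longrightarrow>
        (\<lambda>k. sgn_mass (\<rho> k) \<delta> \<phi>) \<longlonglongrightarrow> I \<delta>)
      \<and> (I \<longlongrightarrow> (\<integral>\<^sup>+\<sigma>. ennreal (\<phi> \<sigma>) \<partial>\<mu>)) (at_right 0))"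
    by (rule directional_measure_tendsto[OF \<rho> \<mu>]) (rule that)
  obtain I where I: "\<And>\<delta>. 0 < \<delta> \<Longrightarrow> \<delta> < \<delta>0 \<Longrightarrow>
      (\<lambda>k. sgn_mass (\<rho> k) \<delta> \<phi>) \<longlonglongrightarrow> I \<delta>"
    "(I \<longlongrightarrow> (\<integral>\<^sup>+\<sigma>. ennreal (\<phi> \<sigma>) \<partial>\<mu>)) (at_right 0)"
    using dlim \<phi>(1,3) by blast
  obtain B where B: "0 \<le> B" "eventually (\<lambda>k. Lp_mass lborel p (u k) \<le> ennreal B) sequentially"
    by (rule Lp_conv_bounded[OF p0 conv])
  obtain C2 where C2: "0 \<le> C2" "eventually (\<lambda>k. (\<integral>\<^sup>+z. ennreal (\<rho> k z) * indicator (ball 0 1) z \<partial>lborel) \<le> ennreal C2) sequentially"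
    by (rule kernel_mass_bounded[OF \<rho>])
  have "(\<integral>\<^sup>+\<sigma>. ennreal (\<phi> \<sigma>) \<partial>\<mu>) \<le> ennreal (c + 2 * e * C)"
  proof (rule ennreal_le_epsilon)
    fix e0 :: real assume e0: "0 < e0"
    \<comment> \<open>The error e' |z|^p is divided by |z|^p and integrated against the kernel on
      the unit ball, whose mass is at most C2 for large k.\<close>
    define e' where "e' = e0 / (C2 + 1)"
    have e': "0 < e'" "e' * C2 \<le> e0" using e0 C2(1) by (simp_all add: e'_def divide_le_eq algebra_simps)
    obtain \<delta>1 s where \<delta>1: "0 < \<delta>1" "0 < s" and diff:
      "\<And>u z. u \<in> Lp lborel p \<Longrightarrow> Lp_mass lborel p u \<le> ennreal B \<Longrightarrow>
        L1_mass (cball 0 (R + 3)) (\<lambda>x. u x - v x) \<le> ennreal s \<Longrightarrow> norm z < \<delta>1 \<Longrightarrow> z \<noteq> 0 \<Longrightarrow>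
        directional_mass lborel p (\<lambda>x. w (x, x)) (mgrad \<gamma> v) z \<le>
        difference_mass p (\<lambda>x. ennreal (w (x, x - z))) (moll \<eta> u) z + ennreal (e' * norm z powr p)"
      by (rule difference_integral_ge[OF p \<eta> \<epsilon> D(2) Lp_conv_support[OF p0 conv u] mw W(4) Wm(2) W(6) B(1) e'(1)]) (assumption | rule that)+
    have bound: "I \<delta> \<le> ennreal (c + 2 * e * C) + ennreal e0" if \<delta>: "0 < \<delta>" "\<delta> < min \<delta>0 (min \<delta>1 1)" for \<delta>
    \<comment> \<open>The energy bounds hold for infinitely many k only, while the other estimates
      hold for all large k. If the claim failed, it would fail for all large k at once and
      contradict one of those infinitely many.\<close>
    proof (rule ccontr)
      assume not: "\<not> I \<delta> \<le> ennreal (c + 2 * e * C) + ennreal e0"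
      have "(\<lambda>k. sgn_mass (\<rho> k) \<delta> \<phi>) \<longlonglongrightarrow> I \<delta>"
        using \<delta> by (intro I) auto
      from order_tendstoD(1)[OF this] not
      have gt: "eventually (\<lambda>k. ennreal (c + 2 * e * C) + ennreal e0 < sgn_mass (\<rho> k) \<delta> \<phi>) sequentially"
        by (simp add: not_le)
      have "eventually (\<lambda>k. \<not> (energy p (\<rho> k) (ws k) (u k) \<le> ennreal c \<and> energy p (\<rho> k) (\<lambda>_. 1) (u k) \<le> ennreal C)) sequentially"
        using gt B(2) C2(2) W(5)[OF e] Lp_conv_local_L1[OF p conv \<delta>1(2), of "R + 3"]
      proof eventually_elim
        case (elim k)
        show ?case
        proof
          assume E: "energy p (\<rho> k) (ws k) (u k) \<le> ennreal c \<and> energy p (\<rho> k) (\<lambda>_. 1) (u k) \<le> ennreal C"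
          have [measurable]: "ball (0::'a) r \<in> sets borel" for r by simp
          have mm[measurable]: "moll \<eta> (u k) \<in> borel_measurable borel" by measurable
          have V: "(\<lambda>q. ennreal (w q)) \<in> borel_measurable borel" "(\<lambda>q. ennreal (ws k q)) \<in> borel_measurable borel"
            using wb W(1) by measurable
          let ?J = "\<lambda>z. ennreal (\<rho> k z) * ennreal (1 / norm z powr p)
            * difference_mass p (\<lambda>x. ennreal (w (x, x - z))) (moll \<eta> (u k)) z"
          let ?m = "\<lambda>z. ennreal e' * (ennreal (\<rho> k z) * indicator (ball 0 1) z)"
          have "sgn_mass (\<rho> k) \<delta> \<phi> \<le> (\<integral>\<^sup>+z. ?J z + ?m z \<partial>lborel)"
          proof (rule nn_integral_mono_nonzero)
              fix z :: 'a assume z: "z \<noteq> 0"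
              show "ennreal (\<rho> k z) * ennreal (\<phi> (sgn z)) * indicator (ball 0 \<delta>) z \<le> ?J z + ?m z"
              proof (cases "norm z < \<delta>")
                case True
                let ?A = "difference_mass p (\<lambda>x. ennreal (w (x, x - z))) (moll \<eta> (u k)) z"
                have "ennreal (\<phi> (sgn z)) = ennreal (1 / norm z powr p) * directional_mass lborel p (\<lambda>x. w (x, x)) (mgrad \<gamma> v) z"
                  unfolding \<phi>(2) by (rule directional_integral_scale[symmetric]) (use p0 z in auto)
                also have "\<dots> \<le> ennreal (1 / norm z powr p) * (?A + ennreal (e' * norm z powr p))"
                  using True \<delta> z elim(2,5) by (intro mult_left_mono diff uL) auto
                also have "\<dots> = ennreal (1 / norm z powr p) * ?A + ennreal e'"
                  using z e'(1) by (simp add: distrib_left ennreal_mult[symmetric])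
                finally have "ennreal (\<rho> k z) * ennreal (\<phi> (sgn z)) \<le> ennreal (\<rho> k z) * (ennreal (1 / norm z powr p) * ?A + ennreal e')"
                  by (rule mult_left_mono) simp
                moreover have "z \<in> ball 0 1" using True \<delta> by simp
                ultimately have "ennreal (\<rho> k z) * ennreal (\<phi> (sgn z)) \<le> ?J z + ?m z"
                  by (simp add: distrib_left mult.assoc mult.commute[of "ennreal e'"])
                then show ?thesis using True by simp
              qed simp
          qed
          also have "\<dots> = pair_energy p (\<rho> k) (moll \<eta> (u k)) (\<lambda>q. ennreal (w q)) + ennreal e' * (\<integral>\<^sup>+z. ennreal (\<rho> k z) * indicator (ball 0 1) z \<partial>lborel)"
            unfolding pair_energy_eq[OF K(1) mm V(1)]
            by (subst nn_integral_add, measurable, subst nn_integral_cmult) measurable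
          also have "\<dots> \<le> ennreal (c + 2 * e * C) + ennreal e0"
          proof (rule add_mono)
            have "ennreal e' * (\<integral>\<^sup>+z. ennreal (\<rho> k z) * indicator (ball 0 1) z \<partial>lborel) \<le> ennreal e' * ennreal C2"
              using elim(3) by (rule mult_left_mono) simp
            also have "\<dots> \<le> ennreal e0" using e' C2(1) by (simp add: ennreal_mult[symmetric] ennreal_leI)
            finally show "ennreal e' * (\<integral>\<^sup>+z. ennreal (\<rho> k z) * indicator (ball 0 1) z \<partial>lborel) \<le> ennreal e0" .
            have "pair_energy p (\<rho> k) (moll \<eta> (u k)) (\<lambda>q. ennreal (w q)) \<le> pair_energy p (\<rho> k) (u k) (\<lambda>q. ennreal (w q + e))"
              by (rule pair_energy_moll_le[OF p K(1) Lp_loc_integrable[OF p uL] \<eta> wb close])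
            also have "\<dots> \<le> pair_energy p (\<rho> k) (u k) (\<lambda>q. ennreal (ws k q) + ennreal (2 * e) * ennreal 1)"
            \<comment> \<open>One e comes from the mollification, the other from |ws k - w| \<le>
              e.\<close>
            proof (rule pair_energy_mono_AE, use elim(4) W(2)[of k] in eventually_elim)
              fix q :: "'a \<times> 'a" assume "\<bar>ws k q - w q\<bar> \<le> e" "0 \<le> ws k q"
              then have "ennreal (w q + e) \<le> ennreal (ws k q + 2 * e)" by (intro ennreal_leI) linarith
              also have "\<dots> = ennreal (ws k q) + ennreal (2 * e) * ennreal 1" using \<open>0 \<le> ws k q\<close> e by simp
              finally show "ennreal (\<bar>u k (fst q) - u k (snd q)\<bar> powr p / norm (fst q - snd q) powr p) * ennreal (w q + e) \<le>
                ennreal (\<bar>u k (fst q) - u k (snd q)\<bar> powr p / norm (fst q - snd q) powr p) * (ennreal (ws k q) + ennreal (2 * e) * ennreal 1)"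
                by (rule mult_left_mono) simp
            qed
            also have "\<dots> = pair_energy p (\<rho> k) (u k) (\<lambda>q. ennreal (ws k q)) + ennreal (2 * e) * pair_energy p (\<rho> k) (u k) (\<lambda>q. ennreal 1)"
              by (rule pair_energy_add[OF K(1) um V(2)]) simp
            also have "pair_energy p (\<rho> k) (u k) (\<lambda>q. ennreal (ws k q)) = energy p (\<rho> k) (ws k) (u k)"
              by (rule energy_eq_pair_energy[symmetric]) (use K W um in auto)
            also have "pair_energy p (\<rho> k) (u k) (\<lambda>q. ennreal 1) = energy p (\<rho> k) (\<lambda>_. 1) (u k)"
              by (rule energy_eq_pair_energy[symmetric]) (use K um in auto)
            also have "energy p (\<rho> k) (ws k) (u k) + ennreal (2 * e) * energy p (\<rho> k) (\<lambda>_. 1) (u k) \<le> ennreal c + ennreal (2 * e) * ennreal C"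
              using E by (intro add_mono mult_left_mono) auto
            also have "\<dots> = ennreal (c + 2 * e * C)"
              using c C e by (simp add: ennreal_mult[symmetric] ennreal_plus[symmetric] del: ennreal_plus)
            finally show "pair_energy p (\<rho> k) (moll \<eta> (u k)) (\<lambda>q. ennreal (w q)) \<le> ennreal (c + 2 * e * C)" .
          qed
          finally show False using elim(1) by (simp add: not_le[symmetric])
        qed
      qed
      then show False using freq by (simp add: frequently_def)
    qed
    have "eventually (\<lambda>\<delta>. I \<delta> \<le> ennreal (c + 2 * e * C) + ennreal e0) (at_right 0)"
      unfolding eventually_at_right_field
      using bound \<delta>0 \<delta>1(1) by (intro exI[of _ "min \<delta>0 (min \<delta>1 1)"]) auto
    then show "(\<integral>\<^sup>+\<sigma>. ennreal (\<phi> \<sigma>) \<partial>\<mu>) \<le> ennreal (c + 2 * e * C) + ennreal e0"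
      by (rule tendsto_upperbound[OF I(2)]) simp
  qed
  then show ?thesis by (simp only: \<phi>(2))
qed

text \<open>By contradiction, with a number c strictly between the two sides. Infinitely many
  weighted energies lie below c, which bounds the unweighted ones by some C and puts v into
  \<open>S_space\<close>. The bound c + 2 e C at fixed scales then passes to the limit, first in the
  mollification by lower semicontinuity and Fatou, then in e.\<close>

lemma energy_liminf:
  fixes \<rho> :: "nat \<Rightarrow> 'a::euclidean_space \<Rightarrow> real"
  assumes p: "1 \<le> p" and \<rho>: "admissible_kernels p \<rho>" and \<mu>: "limit_directional_measure \<rho> \<mu>"
    and w: "admissible_weights ws w" and wpos: "\<forall>z. 0 < w z" and R: "0 < R" and sc: "strongly_p_compact p \<rho>"
    and u: "\<And>k. u k \<in> Lp_ball p R" and conv: "Lp_conv lborel p u v"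
  shows "limit_energy p \<mu> w v \<le> liminf (\<lambda>k. energy p (\<rho> k) (ws k) (u k))"
proof (rule ccontr)
  note W = admissible_weightsD[OF w]
  have p0: "0 < p" using p by simp
  have f\<mu>: "finite_sphere_measure \<mu>" using \<mu> by (simp add: limit_directional_measure_def)
  have uL: "u k \<in> Lp lborel p" for k using u[of k] by (simp add: Lp_ball_def)
  assume "\<not> limit_energy p \<mu> w v \<le> liminf (\<lambda>k. energy p (\<rho> k) (ws k) (u k))"
  then obtain t where t: "liminf (\<lambda>k. energy p (\<rho> k) (ws k) (u k)) < t" "t < limit_energy p \<mu> w v"
    using dense by (auto simp: not_le)
  then obtain c where c: "t = ennreal c" "0 \<le> c" by (cases t) auto
  obtain B where B: "0 \<le> B" "eventually (\<lambda>k. Lp_mass lborel p (u k) \<le> ennreal B) sequentially"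
    by (rule Lp_conv_bounded[OF p0 conv])
  obtain C where C: "0 \<le> C" "eventually (\<lambda>k. \<forall>u\<in>Lp_ball p R. Lp_mass lborel p u \<le> ennreal B
      \<and> energy p (\<rho> k) (ws k) u \<le> ennreal c \<longrightarrow> energy p (\<rho> k) (\<lambda>_. 1) u \<le> ennreal C) sequentially"
    by (rule unweighted_energy_bound[OF p \<rho> w wpos R B(1) c(2)])
  \<comment> \<open>The indices with all bounds available. A cannot be missed by all large k, since
    then the energies would eventually be at least c.\<close>
  define A where "A = {k. Lp_mass lborel p (u k) \<le> ennreal B
    \<and> energy p (\<rho> k) (ws k) (u k) \<le> ennreal c \<and> energy p (\<rho> k) (\<lambda>_. 1) (u k) \<le> ennreal C}"
  have fr: "frequently (\<lambda>k. k \<in> A) sequentially"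
    unfolding frequently_def
  proof
    assume "eventually (\<lambda>k. k \<notin> A) sequentially"
    then have "eventually (\<lambda>k. t \<le> energy p (\<rho> k) (ws k) (u k)) sequentially"
      using B(2) C(2) by eventually_elim (use u c in \<open>auto simp: A_def\<close>)
    then show False using Liminf_bounded t(1) by (metis not_le)
  qed
  have "v \<in> S_space p"
  proof (rule limit_in_S_space[OF p sc uL])
    show "ennreal (Lp_norm lborel p (u k)) + energy p (\<rho> k) (\<lambda>_. 1) (u k) \<le> ennreal (B powr (1 / p) + C)" if "k \<in> A" for k
    proof -
      have "ennreal (Lp_norm lborel p (u k)) + energy p (\<rho> k) (\<lambda>_. 1) (u k) \<le> ennreal (B powr (1 / p)) + ennreal C"
        using that Lp_norm_le[OF uL p0 B(1), of k] by (intro add_mono ennreal_leI) (auto simp: A_def)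
      then show ?thesis using C(1) by simp
    qed
    show "Lp_conv lborel p (u \<circ> id) v" using conv by simp
    show "strict_mono (id :: nat \<Rightarrow> nat)" by (simp add: strict_mono_def)
    show "infinite {j. id j \<in> A}"
      using fr unfolding cofinite_eq_sequentially[symmetric] frequently_cofinite by simp
  qed
  then obtain m \<tau> where rep: "gradient_rep p v m \<tau>" and
    dir: "\<And>w0 \<sigma>. w0 \<in> borel_measurable borel \<Longrightarrow> directional_seminorm_pow p w0 v \<sigma> = (\<integral>\<^sup>+x. ennreal (w0 x * \<bar>\<sigma> \<bullet> \<tau> x\<bar> powr p) \<partial>m)"
    using S_space_gradient_rep[OF p] by metis
  note D = gradient_repD[OF rep]
  obtain \<eta> \<gamma> L where \<eta>: "mollifier_seq (\<eta> :: nat \<Rightarrow> 'a \<Rightarrow> real) \<gamma> L" using mollifier_seq_exists by blast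
  have j: "mollifier (1 / real (Suc j)) (\<eta> j) (\<gamma> j) (L j)" for j using \<eta> by (simp add: mollifier_seq_def)
  obtain Wm where Wm: "0 < Wm" "\<And>z. w z \<le> Wm" using W(7) by blast
  define w0 where "w0 x = w (x, x)" for x
  have cw: "continuous_on UNIV w0"
    unfolding w0_def by (rule continuous_on_compose2[OF W(3)]) (auto intro!: continuous_intros)
  then have mw[measurable]: "w0 \<in> borel_measurable borel" by (rule borel_measurable_continuous_onI)
  have w00: "0 \<le> w0 x" "w0 x \<le> Wm" for x using W(4) Wm(2) by (auto simp: w0_def)
  let ?\<Phi> = "\<lambda>j \<sigma>. \<integral>\<^sup>+x. ennreal (w0 x) * ennreal (\<bar>mgrad (\<gamma> j) v x \<bullet> \<sigma>\<bar> powr p) \<partial>lborel"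
  have m\<Phi>: "?\<Phi> j \<in> borel_measurable \<mu>" for j
  proof -
    have [measurable]: "v \<in> borel_measurable borel" "\<gamma> j \<in> borel_measurable borel"
      using D(6) mollifierD(13)[OF j] by (auto simp: loc_integrable_def)
    have "mgrad (\<gamma> j) v \<in> borel_measurable borel" by measurable
    then have m: "mgrad (\<gamma> j) v \<in> borel_measurable lborel" "w0 \<in> borel_measurable lborel" by simp_all
    note cd = continuous_directional_integral[OF m w00 p0 mgrad_powr_finite[OF rep j]]
    show ?thesis using measurable_finite_sphere[OF f\<mu> cd(1)] unfolding cd(2) .
  qed
  have "directional_seminorm_pow p w0 v \<sigma> \<le> liminf (\<lambda>j. ?\<Phi> j \<sigma>)" for \<sigma>
    using mgrad_lsc[OF rep \<eta> cw w00, of \<sigma>] w00 by (simp add: dir ennreal_mult inner_commute)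
  then have "(\<integral>\<^sup>+\<sigma>. directional_seminorm_pow p w0 v \<sigma> \<partial>\<mu>) \<le> (\<integral>\<^sup>+\<sigma>. liminf (\<lambda>j. ?\<Phi> j \<sigma>) \<partial>\<mu>)"
    by (intro nn_integral_mono)
  also have "\<dots> \<le> liminf (\<lambda>j. \<integral>\<^sup>+\<sigma>. ?\<Phi> j \<sigma> \<partial>\<mu>)" by (rule nn_integral_liminf[OF m\<Phi>])
  also have "\<dots> \<le> ennreal c"
  proof (rule ennreal_le_epsilon)
    fix e0 :: real assume e0: "0 < e0"
    \<comment> \<open>C has been fixed before e, so 2 e C can be made at most e0.\<close>
    define e where "e = e0 / (2 * C + 1)"
    have e: "0 < e" using e0 C(1) by (simp add: e_def)
    have eC: "2 * e * C \<le> e0" using e0 C(1) by (simp add: e_def divide_le_eq algebra_simps)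
    obtain d where d: "0 < d" "\<And>x x' y y'. norm (x - x') + norm (y - y') < d \<Longrightarrow> \<bar>w (x, y) - w (x', y')\<bar> \<le> e"
      using W(6)[OF e] by blast
    \<comment> \<open>d/2 because the mollifier displaces both arguments of w.\<close>
    have "eventually (\<lambda>j. 1 / real (Suc j) < d / 2) sequentially"
      using d(1) by (intro order_tendstoD(2)[OF LIMSEQ_inverse_real_of_nat[unfolded inverse_eq_divide]]) simp
    then have ev: "eventually (\<lambda>j. (\<integral>\<^sup>+\<sigma>. ?\<Phi> j \<sigma> \<partial>\<mu>) \<le> ennreal (c + e0)) sequentially"
    proof eventually_elim
      case (elim j)
      have "(\<integral>\<^sup>+\<sigma>. ?\<Phi> j \<sigma> \<partial>\<mu>) \<le> ennreal (c + 2 * e * C)"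
        unfolding w0_def
      proof (rule mollified_energy_le[OF p \<rho> \<mu> w u conv rep j _ e _ _ c(2) C(1)])
        show "w (x, x - z) \<le> w (y, y - z) + e" if "norm (x - y) < 1 / real (Suc j)" for x y z
          using d(2)[of x y "x - z" "y - z"] that elim by simp
        show "frequently (\<lambda>k. energy p (\<rho> k) (ws k) (u k) \<le> ennreal c \<and> energy p (\<rho> k) (\<lambda>_. 1) (u k) \<le> ennreal C) sequentially"
          using fr by (rule frequently_elim1) (simp add: A_def)
      qed simp
      also have "\<dots> \<le> ennreal (c + e0)" using eC by (intro ennreal_leI) simp
      finally show ?case .
    qed
    have "liminf (\<lambda>j. \<integral>\<^sup>+\<sigma>. ?\<Phi> j \<sigma> \<partial>\<mu>) \<le> liminf (\<lambda>j. ennreal (c + e0))"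
      by (rule Liminf_mono[OF ev])
    also have "\<dots> = ennreal (c + e0)" by (simp add: Liminf_const del: ennreal_plus)
    finally show "liminf (\<lambda>j. \<integral>\<^sup>+\<sigma>. ?\<Phi> j \<sigma> \<partial>\<mu>) \<le> ennreal c + ennreal e0" using c(2) e0 by simp
  qed
  finally have "limit_energy p \<mu> w v \<le> ennreal c"
    using \<open>v \<in> S_space p\<close> unfolding limit_energy_def w0_def by simp
  then show False using t(2) c(1) by simp
qed

section \<open>Compactness\<close>

text \<open>The unweighted bound starts only at some k0, since \<open>ws k\<close> is comparable to
  w and the kernel tail is small only for large k.\<close>

lemma energy_bounded_unweighted:
  fixes \<rho> :: "nat \<Rightarrow> 'a::euclidean_space \<Rightarrow> real"
  assumes p: "1 \<le> p" and \<rho>: "admissible_kernels p \<rho>"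
    and w: "admissible_weights ws w" and wpos: "\<forall>z. 0 < w z" and R: "0 < R"
    and u: "\<And>k. u k \<in> Lp_ball p R" and bd: "energy_bounded p \<rho> ws u"
  obtains C k0 where "0 \<le> C" "\<And>k. k0 \<le> k \<Longrightarrow> ennreal (Lp_norm lborel p (u k)) + energy p (\<rho> k) (\<lambda>_. 1) (u k) \<le> ennreal C"
proof -
  have p0: "0 < p" using p by simp
  let ?S = "\<lambda>k. ennreal (Lp_norm lborel p (u k)) + energy p (\<rho> k) (ws k) (u k)"
  define M where "M = enn2real (SUP k. ?S k)"
  have M: "(SUP k. ?S k) = ennreal M" "0 \<le> M" using bd by (auto simp: M_def energy_bounded_def less_top)
  have le: "?S k \<le> ennreal M" for k unfolding M(1)[symmetric] by (rule SUP_upper) simp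
  have n: "ennreal (Lp_norm lborel p (u k)) \<le> ennreal M" "energy p (\<rho> k) (ws k) (u k) \<le> ennreal M" for k
    by (rule order_trans[OF _ le[of k]], simp)+
  have pow: "Lp_mass lborel p (u k) \<le> ennreal (M powr p)" for k
  proof -
    have i: "integrable lborel (\<lambda>x. \<bar>u k x\<bar> powr p)" using u[of k] by (simp add: Lp_ball_def Lp_def)
    have "Lp_norm lborel p (u k) powr p \<le> M powr p"
      using n(1)[of k] M(2) p0 by (intro powr_mono2) (auto simp: Lp_norm_def)
    then have "(LINT x|lborel. \<bar>u k x\<bar> powr p) \<le> M powr p" using p0 by (simp add: Lp_norm_def powr_powr)
    then show ?thesis using i by (subst nn_integral_eq_integral) (auto intro: ennreal_leI)
  qed
  obtain C where C: "0 \<le> C" "eventually (\<lambda>k. \<forall>u\<in>Lp_ball p R. Lp_mass lborel p u \<le> ennreal (M powr p)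
      \<and> energy p (\<rho> k) (ws k) u \<le> ennreal M \<longrightarrow> energy p (\<rho> k) (\<lambda>_. 1) u \<le> ennreal C) sequentially"
    by (rule unweighted_energy_bound[OF p \<rho> w wpos R powr_ge_zero M(2)])
  then obtain k0 where k0: "\<And>k. k0 \<le> k \<Longrightarrow> energy p (\<rho> k) (\<lambda>_. 1) (u k) \<le> ennreal C"
    using u pow n(2) unfolding eventually_sequentially by blast
  show ?thesis
  proof (rule that)
    show "0 \<le> M + C" using M C by simp
    show "ennreal (Lp_norm lborel p (u k)) + energy p (\<rho> k) (\<lambda>_. 1) (u k) \<le> ennreal (M + C)" if "k0 \<le> k" for k
      unfolding ennreal_plus[OF M(2) C(1)] by (rule add_mono[OF n(1) k0[OF that]])
  qed
qed

text \<open>Compactness is available on compact sets and for sequences bounded from the first index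
  on. So the members before k0 are replaced by 0, the limit is taken on the ball of radius R, and
  extension by zero makes it a limit on the whole space, all functions vanishing outside that
  ball.\<close>

lemma Lp_ball_relatively_compact:
  fixes \<rho> :: "nat \<Rightarrow> 'a::euclidean_space \<Rightarrow> real"
  assumes p: "1 \<le> p" and pc: "p_compact p \<rho>" and u: "\<And>k. u k \<in> Lp_ball p R"
    and bd: "\<And>k. k0 \<le> k \<Longrightarrow> ennreal (Lp_norm lborel p (u k)) + energy p (\<rho> k) (\<lambda>_. 1) (u k) \<le> ennreal C"
  shows "Lp_relatively_compact lborel p u"
proof -
  have p0: "0 < p" using p by simp
  let ?K = "cball (0::'a) R"
  have K[measurable]: "?K \<in> sets borel" by simp
  have uL: "u k \<in> Lp lborel p" for k using u[of k] by (simp add: Lp_ball_def)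
  define u' where "u' k = (if k0 \<le> k then u k else (\<lambda>_. 0))" for k
  have "\<forall>k. u' k \<in> Lp lborel p" by (simp add: u'_def uL zero_in_Lp[OF p0])
  moreover have "energy_bounded p \<rho> (\<lambda>_ _. 1) u'"
  proof -
    have "(SUP k. ennreal (Lp_norm lborel p (u' k)) + energy p (\<rho> k) (\<lambda>_. 1) (u' k)) \<le> ennreal C"
    proof (rule SUP_least)
      fix k show "ennreal (Lp_norm lborel p (u' k)) + energy p (\<rho> k) (\<lambda>_. 1) (u' k) \<le> ennreal C"
        using bd p0 by (cases "k0 \<le> k") (simp_all add: u'_def Lp_norm_def energy_def)
    qed
    then show ?thesis unfolding energy_bounded_def by (rule le_less_trans) simp
  qed
  ultimately have rc: "Lp_relatively_compact (restrict_space lborel ?K) p u'"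
    using pc unfolding p_compact_def by simp
  show ?thesis
    unfolding Lp_relatively_compact_def
  proof (intro allI impI)
    fix r :: "nat \<Rightarrow> nat" assume r: "strict_mono r"
    then obtain s v where s: "strict_mono (s :: nat \<Rightarrow> nat)" and v: "Lp_conv (restrict_space lborel ?K) p (u' \<circ> r \<circ> s) v"
      using rc unfolding Lp_relatively_compact_def by blast
    define v' where "v' x = indicator ?K x * v x" for x
    have vL: "v \<in> Lp (restrict_space lborel ?K) p" and
      lim: "(\<lambda>k. \<integral>\<^sup>+x. ennreal (\<bar>(u' \<circ> r \<circ> s) k x - v x\<bar> powr p) \<partial>restrict_space lborel ?K) \<longlonglongrightarrow> 0"
      using v by (auto simp: Lp_conv_nn_integral[OF p0])
    have "v' \<in> borel_measurable lborel"
      using vL by (simp add: Lp_def v'_def[abs_def] borel_measurable_restrict_space_iff)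
    moreover have "integrable lborel (\<lambda>x. \<bar>v' x\<bar> powr p)"
    proof -
      have "integrable lborel (\<lambda>x. indicator ?K x *\<^sub>R \<bar>v x\<bar> powr p)"
        using vL by (simp add: Lp_def integrable_restrict_space)
      moreover have "(\<lambda>x. indicator ?K x *\<^sub>R \<bar>v x\<bar> powr p) = (\<lambda>x. \<bar>v' x\<bar> powr p)"
        using p0 by (auto simp: v'_def indicator_def fun_eq_iff)
      ultimately show ?thesis by simp
    qed
    ultimately have v'L: "v' \<in> Lp lborel p" by (simp add: Lp_def)
    have "eventually (\<lambda>j. Lp_mass (restrict_space lborel ?K) p (\<lambda>x. (u' \<circ> r \<circ> s) j x - v x)
      = Lp_mass lborel p (\<lambda>x. (u \<circ> r \<circ> s) j x - v' x)) sequentially"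
      using eventually_ge_at_top[of k0]
    proof eventually_elim
      case (elim j)
      have "k0 \<le> r (s j)"
        \<comment> \<open>Strictly increasing index maps dominate the identity, so for j \<ge> k0
          the subsequence avoids the replaced members.\<close>
        using elim strict_mono_imp_increasing[OF r, of "s j"] strict_mono_imp_increasing[OF s, of j] by linarith
      then have eq: "(u' \<circ> r \<circ> s) j = u (r (s j))" by (simp add: u'_def)
      have "Lp_mass (restrict_space lborel ?K) p (\<lambda>x. (u' \<circ> r \<circ> s) j x - v x) =
        (\<integral>\<^sup>+x. ennreal (\<bar>u (r (s j)) x - v x\<bar> powr p) * indicator ?K x \<partial>lborel)"
        unfolding eq by (rule nn_integral_restrict_space) simp
      also have "\<dots> = Lp_mass lborel p (\<lambda>x. u (r (s j)) x - v' x)"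
        using Lp_ball_support[OF u, of "r (s j)"]
        by (intro nn_integral_cong_AE, eventually_elim) (use p0 in \<open>auto simp: v'_def indicator_def\<close>)
      finally show ?case by simp
    qed
    from Lim_transform_eventually[OF lim this]
    have "Lp_conv lborel p (u \<circ> r \<circ> s) v'"
      using v'L uL by (simp add: Lp_conv_nn_integral[OF p0])
    then show "\<exists>s v. strict_mono (s :: nat \<Rightarrow> nat) \<and> Lp_conv lborel p (u \<circ> r \<circ> s) v" using s by blast
  qed
qed

theorem corollary1p5:
  fixes p R :: real
    and \<rho> :: "nat \<Rightarrow> 'a::euclidean_space \<Rightarrow> real"
    and ws :: "nat \<Rightarrow> 'a \<times> 'a \<Rightarrow> real"
    and w :: "'a \<times> 'a \<Rightarrow> real"
    and \<mu> :: "'a measure"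
  assumes "1 \<le> p"
    and "admissible_kernels p \<rho>"
    and "limit_directional_measure \<rho> \<mu>"
    and "admissible_weights ws w"
    and "\<forall>z. 0 < w z"
    and "0 < R"
    and "strongly_p_compact p \<rho>"
  shows "(\<forall>u. (\<forall>k. u k \<in> Lp_ball p R) \<and> energy_bounded p \<rho> ws u \<longrightarrow>
             Lp_relatively_compact lborel p u
             \<and> (\<forall>r v. strict_mono r \<and> Lp_conv lborel p (u \<circ> r) v \<longrightarrow> v \<in> S_space p))
       \<and> (\<forall>u v. (\<forall>k. u k \<in> Lp_ball p R) \<and> Lp_conv lborel p u v \<longrightarrow>
             limit_energy p \<mu> w v \<le> liminf (\<lambda>k. energy p (\<rho> k) (ws k) (u k)))
       \<and> (\<forall>u\<in>S_space p. limsup (\<lambda>k. energy p (\<rho> k) (ws k) u) \<le> limit_energy p \<mu> w u)"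
proof (intro conjI allI impI ballI)
  note A = assms
  show "Lp_relatively_compact lborel p u" if *: "(\<forall>k. u k \<in> Lp_ball p R) \<and> energy_bounded p \<rho> ws u" for u
  proof -
    have u: "u k \<in> Lp_ball p R" for k using * by simp
    obtain C k0 where "0 \<le> C" and C: "\<And>k. k0 \<le> k \<Longrightarrow> ennreal (Lp_norm lborel p (u k)) + energy p (\<rho> k) (\<lambda>_. 1) (u k) \<le> ennreal C"
      by (rule energy_bounded_unweighted[OF A(1,2,4,5,6) u conjunct2[OF *]]) (assumption | rule that)+
    have "p_compact p \<rho>" using A(7) by (simp add: strongly_p_compact_def)
    then show ?thesis by (rule Lp_ball_relatively_compact[OF A(1) _ u C])
  qed
  show "v \<in> S_space p" if *: "(\<forall>k. u k \<in> Lp_ball p R) \<and> energy_bounded p \<rho> ws u"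
    and r: "strict_mono r \<and> Lp_conv lborel p (u \<circ> r) v" for u r v
  proof -
    have u: "u k \<in> Lp_ball p R" for k using * by simp
    obtain C k0 where "0 \<le> C" and C: "\<And>k. k0 \<le> k \<Longrightarrow> ennreal (Lp_norm lborel p (u k)) + energy p (\<rho> k) (\<lambda>_. 1) (u k) \<le> ennreal C"
      by (rule energy_bounded_unweighted[OF A(1,2,4,5,6) u conjunct2[OF *]]) (assumption | rule that)+
    show ?thesis
    proof (rule limit_in_S_space[OF A(1,7) _ _ conjunct2[OF r] conjunct1[OF r]])
      show "u k \<in> Lp lborel p" for k using u[of k] by (simp add: Lp_ball_def)
      show "ennreal (Lp_norm lborel p (u k)) + energy p (\<rho> k) (\<lambda>_. 1) (u k) \<le> ennreal C" if "k \<in> {k0..}" for k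
        using C that by simp
      \<comment> \<open>Again r j \<ge> j, so all but finitely many members of the subsequence
        satisfy the unweighted bound.\<close>
      have "{k0..} \<subseteq> {j. r j \<in> {k0..}}"
        using strict_mono_imp_increasing[OF conjunct1[OF r]] by (auto intro: order_trans)
      then show "infinite {j. r j \<in> {k0..}}" using infinite_Ici finite_subset by blast
    qed
  qed
  show "limit_energy p \<mu> w v \<le> liminf (\<lambda>k. energy p (\<rho> k) (ws k) (u k))"
    if "(\<forall>k. u k \<in> Lp_ball p R) \<and> Lp_conv lborel p u v" for u v
    using that by (intro energy_liminf[OF A(1-7)]) auto
  show "limsup (\<lambda>k. energy p (\<rho> k) (ws k) u) \<le> limit_energy p \<mu> w u" if "u \<in> S_space p" for u
    by (rule energy_limsup[OF A(1-4) that])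
qed

end
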